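(* Let $A,B$ be firm rings and let $M$ be a firm $A$-$B$-bimodule that admits a right adjoint in the bicategory $\mathbf{Firm}$. Then: (i) if the functor $-\otimes_A M:\mathrm{Mod}_A\to\mathrm{Mod}_B$ is comonadic, then the map $\Gamma_M:(\mathbf{I}^r_A(S_M))^{\mathrm{op}}\to\mathrm{End}_{B\text{-cor}}(\mathfrak{C}_M)$ is an isomorphism of monoids; (ii) if the functor $B\otimes_B\mathrm{Mod}_B(M,B)\otimes_A-:{}_A\mathrm{Mod}\to{}_B\mathrm{Mod}$ is comonadic, then the map $\Gamma_{M^{\dagger}}:\mathbf{I}^l_A(S_M)\to\mathrm{End}_{B\text{-cor}}(\mathfrak{C}_M)$ is an isomorphism of monoids; (iii) if ${}_AM_B$ is a separable firm bimodule, then the maps $\Gamma_M$ and $\Gamma_{M^{\dagger}}$ are both isomorphisms of monoids.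
   Context: Rings are associative but need not have a unit. A right module $M$ over a ring $A$ is firm if $M\otimes_A A\to M$, $m\otimes a\mapsto ma$, is an isomorphism; similarly for left modules. A ring $A$ is firm if it is firm as an $A$-module; a bimodule is firm if it is firm on both sides. $\mathrm{Mod}_A$ (resp. ${}_A\mathrm{Mod}$) is the category of firm right (resp. left) $A$-modules. $\mathbf{Firm}$ is the bicategory whose 0-cells are firm rings, whose 1-cells $A\to B$ are firm $A$-$B$-bimodules, and whose 2-cells are bimodule homomorphisms; the horizontal composite of $M:A\to B$ and $N:B\to C$ is $M\otimes_B N$. If $M$ admits a right adjoint in $\mathbf{Firm}$, this right adjoint is $M^{\dagger}=B\otimes_B\mathrm{Mod}_B(M,B)\otimes_A A$, with unit an $A$-bimodule map $\eta:A\to M\otimes_B M^{\dagger}$ and counit a $B$-bimodule map $\varepsilon:M^{\dagger}\otimes_A M\to B$ satisfying the triangle identities. Then $S_M=M\otimes_B M^{\dagger}$ is an $A$-ring (monoid in firm $A$-bimodules) with multiplication $M\otimes_B\varepsilon\otimes_B M^{\dagger}$ and unit $\eta$, and $\mathfrak{C}_M=M^{\dagger}\otimes_A M$ is a $B$-coring (comonoid in firm $B$-bimodules) with comultiplication $M^{\dagger}\otimes_A\eta\otimes_A M$ and counit $\varepsilon$ (canonical isomorphisms suppressed). $\mathrm{End}_{B\text{-cor}}(\mathfrak{C}_M)$ is the monoid, under composition, of $B$-coring endomorphisms of $\mathfrak{C}_M$. $M$ is separable if $\eta$ is a split monomorphism of $A$-bimodules. $\mathbf{I}^r_A(S_M)$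 (resp. $\mathbf{I}^l_A(S_M)$) is the set of firm $A$-subbimodules $I$ of $S_M$ (inclusion $i_I$) such that the multiplication map $I\otimes_A S_M\to S_M$ (resp. $S_M\otimes_A I\to S_M$) is an isomorphism; in the situations of the theorem it is a monoid with product the usual multiplication $IJ$ of subsets of $S_M$. $\Gamma_M$ sends $I\in\mathbf{I}^r_A(S_M)$ to $(\varepsilon\otimes_B M^{\dagger}\otimes_A M)\cdot(M^{\dagger}\otimes_A i_I\otimes_A M)\cdot(M^{\dagger}\otimes_A\xi^{-1})$, where $\xi=(M\otimes_B\varepsilon)\cdot(i_I\otimes_A M):I\otimes_A M\to M$ (invertible). $\Gamma_{M^{\dagger}}$ sends $I\in\mathbf{I}^l_A(S_M)$ to $(M^{\dagger}\otimes_A M\otimes_B\varepsilon)\cdot(M^{\dagger}\otimes_A i_I\otimes_A M)\cdot(\xi^{-1}\otimes_A M)$, where $\xi=(\varepsilon\otimes_B M^{\dagger})\cdot(M^{\dagger}\otimes_A i_I):M^{\dagger}\otimes_A I\to M^{\dagger}$ (invertible). A functor with a right adjoint is comonadic if the comparison functor to the Eilenberg–Moore category of coalgebras over the induced comonad is an equivalence; here $-\otimes_A M$ has right adjoint $-\otimes_B M^{\dagger}$, and $M^{\dagger}\otimes_A-\cong B\otimes_B\mathrm{Mod}_B(M,B)\otimes_A-$ has right adjoint $M\otimes_B-$.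
   Formalization: A firm subbimodule is read as a subobject of S_M among firm A-bimodules, recorded by its image; if the image itself must be firm, (i) and (ii) fail. Firm modules are taken inside any infinite set at least as large as A, B, M and M†. *)

theory Defs
  imports "HOL-Algebra.Module" "HOL-Algebra.Free_Abelian_Groups" "HOL-Algebra.Ideal_Product"
begin

section \<open>Non-unital rings and modules over them\<close>

text \<open>
  Non-unital rings are records of type \<^typ>\<open>'a ring\<close> whose field \<^const>\<open>one\<close> is never used.
  Right, left and two-sided modules share one record type (the fields \<^const>\<open>mult\<close> and
  \<^const>\<open>one\<close> inherited from \<^typ>\<open>'m ring\<close> are unused, as in \<^locale>\<open>module\<close>; the
  multiplication of the \<open>A\<close>-ring \<open>S_M\<close> below is the only exception).  A right module is such a
  record whose left action is ignored, and its left scalars are then given the type \<^typ>\<open>unit\<close>;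
  symmetrically for left modules.
\<close>

record ('a, 'b, 'm) bimod = "('a, 'm) module" +
  rsmult :: "['m, 'b] \<Rightarrow> 'm" (infixl \<open>\<triangleleft>\<index>\<close> 70)

definition nonunital_ring :: "'a ring \<Rightarrow> bool" where
  "nonunital_ring R \<longleftrightarrow> abelian_group R
     \<and> (\<forall>x\<in>carrier R. \<forall>y\<in>carrier R. x \<otimes>\<^bsub>R\<^esub> y \<in> carrier R)
     \<and> (\<forall>x\<in>carrier R. \<forall>y\<in>carrier R. \<forall>z\<in>carrier R.
          (x \<otimes>\<^bsub>R\<^esub> y) \<otimes>\<^bsub>R\<^esub> z = x \<otimes>\<^bsub>R\<^esub> (y \<otimes>\<^bsub>R\<^esub> z)
        \<and> (x \<oplus>\<^bsub>R\<^esub> y) \<otimes>\<^bsub>R\<^esub> z = x \<otimes>\<^bsub>R\<^esub> z \<oplus>\<^bsub>R\<^esub> y \<otimes>\<^bsub>R\<^esub> z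
        \<and> z \<otimes>\<^bsub>R\<^esub> (x \<oplus>\<^bsub>R\<^esub> y) = z \<otimes>\<^bsub>R\<^esub> x \<oplus>\<^bsub>R\<^esub> z \<otimes>\<^bsub>R\<^esub> y)"

definition left_module :: "'a ring \<Rightarrow> ('a, 'b, 'm) bimod \<Rightarrow> bool" where
  "left_module A M \<longleftrightarrow> abelian_group M
     \<and> (\<forall>a\<in>carrier A. \<forall>m\<in>carrier M. a \<odot>\<^bsub>M\<^esub> m \<in> carrier M)
     \<and> (\<forall>a\<in>carrier A. \<forall>m\<in>carrier M. \<forall>m'\<in>carrier M.
          a \<odot>\<^bsub>M\<^esub> (m \<oplus>\<^bsub>M\<^esub> m') = a \<odot>\<^bsub>M\<^esub> m \<oplus>\<^bsub>M\<^esub> a \<odot>\<^bsub>M\<^esub> m')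
     \<and> (\<forall>a\<in>carrier A. \<forall>a'\<in>carrier A. \<forall>m\<in>carrier M.
          (a \<oplus>\<^bsub>A\<^esub> a') \<odot>\<^bsub>M\<^esub> m = a \<odot>\<^bsub>M\<^esub> m \<oplus>\<^bsub>M\<^esub> a' \<odot>\<^bsub>M\<^esub> m
        \<and> (a \<otimes>\<^bsub>A\<^esub> a') \<odot>\<^bsub>M\<^esub> m = a \<odot>\<^bsub>M\<^esub> (a' \<odot>\<^bsub>M\<^esub> m))"

definition right_module :: "'b ring \<Rightarrow> ('a, 'b, 'm) bimod \<Rightarrow> bool" where
  "right_module B M \<longleftrightarrow> abelian_group M
     \<and> (\<forall>m\<in>carrier M. \<forall>b\<in>carrier B. m \<triangleleft>\<^bsub>M\<^esub> b \<in> carrier M)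
     \<and> (\<forall>m\<in>carrier M. \<forall>m'\<in>carrier M. \<forall>b\<in>carrier B.
          (m \<oplus>\<^bsub>M\<^esub> m') \<triangleleft>\<^bsub>M\<^esub> b = m \<triangleleft>\<^bsub>M\<^esub> b \<oplus>\<^bsub>M\<^esub> m' \<triangleleft>\<^bsub>M\<^esub> b)
     \<and> (\<forall>m\<in>carrier M. \<forall>b\<in>carrier B. \<forall>b'\<in>carrier B.
          m \<triangleleft>\<^bsub>M\<^esub> (b \<oplus>\<^bsub>B\<^esub> b') = m \<triangleleft>\<^bsub>M\<^esub> b \<oplus>\<^bsub>M\<^esub> m \<triangleleft>\<^bsub>M\<^esub> b'
        \<and> m \<triangleleft>\<^bsub>M\<^esub> (b \<otimes>\<^bsub>B\<^esub> b') = (m \<triangleleft>\<^bsub>M\<^esub> b) \<triangleleft>\<^bsub>M\<^esub> b')"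

definition bimodule :: "'a ring \<Rightarrow> 'b ring \<Rightarrow> ('a, 'b, 'm) bimod \<Rightarrow> bool" where
  "bimodule A B M \<longleftrightarrow> left_module A M \<and> right_module B M
     \<and> (\<forall>a\<in>carrier A. \<forall>m\<in>carrier M. \<forall>b\<in>carrier B.
          (a \<odot>\<^bsub>M\<^esub> m) \<triangleleft>\<^bsub>M\<^esub> b = a \<odot>\<^bsub>M\<^esub> (m \<triangleleft>\<^bsub>M\<^esub> b))"

definition regular :: "'a ring \<Rightarrow> ('a, 'a, 'a) bimod" where
  "regular A = \<lparr>carrier = carrier A, mult = mult A, one = one A, ring.zero = ring.zero A, add = add A,
     smult = mult A, rsmult = mult A\<rparr>"

text \<open>Homomorphisms are extensional functions on the carrier, so that equality of homomorphisms
  is equality in HOL.\<close>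

definition additive_hom :: "('a, 'b, 'm) bimod \<Rightarrow> ('c, 'd, 'n) bimod \<Rightarrow> ('m \<Rightarrow> 'n) set" where
  "additive_hom M N = {f \<in> carrier M \<rightarrow>\<^sub>E carrier N.
     \<forall>x\<in>carrier M. \<forall>y\<in>carrier M. f (x \<oplus>\<^bsub>M\<^esub> y) = f x \<oplus>\<^bsub>N\<^esub> f y}"

definition left_hom :: "'a ring \<Rightarrow> ('a, 'b, 'm) bimod \<Rightarrow> ('a, 'd, 'n) bimod \<Rightarrow> ('m \<Rightarrow> 'n) set" where
  "left_hom A M N = {f \<in> additive_hom M N.
     \<forall>a\<in>carrier A. \<forall>x\<in>carrier M. f (a \<odot>\<^bsub>M\<^esub> x) = a \<odot>\<^bsub>N\<^esub> f x}"

definition right_hom :: "'b ring \<Rightarrow> ('a, 'b, 'm) bimod \<Rightarrow> ('c, 'b, 'n) bimod \<Rightarrow> ('m \<Rightarrow> 'n) set" where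
  "right_hom B M N = {f \<in> additive_hom M N.
     \<forall>x\<in>carrier M. \<forall>b\<in>carrier B. f (x \<triangleleft>\<^bsub>M\<^esub> b) = f x \<triangleleft>\<^bsub>N\<^esub> b}"

definition bimod_hom ::
    "'a ring \<Rightarrow> 'b ring \<Rightarrow> ('a, 'b, 'm) bimod \<Rightarrow> ('a, 'b, 'n) bimod \<Rightarrow> ('m \<Rightarrow> 'n) set" where
  "bimod_hom A B M N = left_hom A M N \<inter> right_hom B M N"

abbreviation ident :: "('a, 'b, 'm) bimod \<Rightarrow> 'm \<Rightarrow> 'm" where
  "ident M \<equiv> (\<lambda>m\<in>carrier M. m)"


section \<open>Tensor products\<close>

text \<open>\<open>M \<otimes>\<^sub>C N\<close> is the free abelian group on \<open>M \<times> N\<close> modulo the usual relations; its elements are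
  cosets.\<close>

type_synonym ('m, 'n) tens = "('m \<times> 'n \<Rightarrow>\<^sub>0 int) set"

definition tensor_relators ::
    "'c ring \<Rightarrow> ('a, 'c, 'm) bimod \<Rightarrow> ('c, 'b, 'n) bimod \<Rightarrow> ('m \<times> 'n \<Rightarrow>\<^sub>0 int) set" where
  "tensor_relators C M N =
     {frag_of (m \<oplus>\<^bsub>M\<^esub> m', n) - frag_of (m, n) - frag_of (m', n) | m m' n.
        m \<in> carrier M \<and> m' \<in> carrier M \<and> n \<in> carrier N}
   \<union> {frag_of (m, n \<oplus>\<^bsub>N\<^esub> n') - frag_of (m, n) - frag_of (m, n') | m n n'.
        m \<in> carrier M \<and> n \<in> carrier N \<and> n' \<in> carrier N}
   \<union> {frag_of (m \<triangleleft>\<^bsub>M\<^esub> c, n) - frag_of (m, c \<odot>\<^bsub>N\<^esub> n) | m c n.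
        m \<in> carrier M \<and> c \<in> carrier C \<and> n \<in> carrier N}"

definition tensor_free ::
    "('a, 'c, 'm) bimod \<Rightarrow> ('c, 'b, 'n) bimod \<Rightarrow> ('m \<times> 'n \<Rightarrow>\<^sub>0 int) monoid" where
  "tensor_free M N = free_Abelian_group (carrier M \<times> carrier N)"

definition tensor_kernel ::
    "'c ring \<Rightarrow> ('a, 'c, 'm) bimod \<Rightarrow> ('c, 'b, 'n) bimod \<Rightarrow> ('m \<times> 'n \<Rightarrow>\<^sub>0 int) set" where
  "tensor_kernel C M N = generate (tensor_free M N) (tensor_relators C M N)"

definition elem_tensor ::
    "'c ring \<Rightarrow> ('a, 'c, 'm) bimod \<Rightarrow> ('c, 'b, 'n) bimod \<Rightarrow> 'm \<Rightarrow> 'n \<Rightarrow> ('m, 'n) tens" where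
  "elem_tensor C M N m n = tensor_kernel C M N #>\<^bsub>tensor_free M N\<^esub> frag_of (m, n)"

definition tensor_group ::
    "'c ring \<Rightarrow> ('a, 'c, 'm) bimod \<Rightarrow> ('c, 'b, 'n) bimod \<Rightarrow> ('m, 'n) tens ring" where
  "tensor_group C M N = (let Q = tensor_free M N Mod tensor_kernel C M N in
     \<lparr>carrier = carrier Q, mult = mult Q, one = one Q, ring.zero = one Q, add = mult Q\<rparr>)"

text \<open>The additive map \<open>M \<otimes>\<^sub>C N \<rightarrow> P\<close> induced by a balanced biadditive map \<open>\<phi>\<close> (evaluated on an
  arbitrary representative in the free abelian group).\<close>

definition tensor_lift :: "('p, 'x) ring_scheme \<Rightarrow> ('m \<Rightarrow> 'n \<Rightarrow> 'p) \<Rightarrow> ('m, 'n) tens \<Rightarrow> 'p" where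
  "tensor_lift P \<phi> t = (let x = (SOME x. x \<in> t) in
     \<Oplus>\<^bsub>P\<^esub>k\<in>Poly_Mapping.keys x. [Poly_Mapping.lookup x k] \<cdot>\<^bsub>P\<^esub> \<phi> (fst k) (snd k))"

definition tensor ::
    "'c ring \<Rightarrow> ('a, 'c, 'm) bimod \<Rightarrow> ('c, 'b, 'n) bimod \<Rightarrow> ('a, 'b, ('m, 'n) tens) bimod" where
  "tensor C M N = (let T = tensor_group C M N in
     \<lparr>carrier = carrier T, mult = mult T, one = one T, ring.zero = ring.zero T, add = add T,
      smult = (\<lambda>a. tensor_lift T (\<lambda>m n. elem_tensor C M N (a \<odot>\<^bsub>M\<^esub> m) n)),
      rsmult = (\<lambda>t b. tensor_lift T (\<lambda>m n. elem_tensor C M N m (n \<triangleleft>\<^bsub>N\<^esub> b)) t)\<rparr>)"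

text \<open>\<open>f \<otimes>\<^sub>C g : M \<otimes>\<^sub>C N \<rightarrow> M' \<otimes>\<^sub>C N'\<close>\<close>

definition tensor_map ::
    "'c ring \<Rightarrow> ('a, 'c, 'm) bimod \<Rightarrow> ('c, 'b, 'n) bimod \<Rightarrow> ('a', 'c, 'm') bimod \<Rightarrow>
     ('c, 'b', 'n') bimod \<Rightarrow> ('m \<Rightarrow> 'm') \<Rightarrow> ('n \<Rightarrow> 'n') \<Rightarrow> ('m, 'n) tens \<Rightarrow> ('m', 'n') tens" where
  "tensor_map C M N M' N' f g = (\<lambda>t\<in>carrier (tensor C M N).
     tensor_lift (tensor C M' N') (\<lambda>m n. elem_tensor C M' N' (f m) (g n)) t)"

text \<open>Canonical maps \<open>(M \<otimes>\<^sub>C N) \<otimes>\<^sub>D P \<rightarrow> M \<otimes>\<^sub>C (N \<otimes>\<^sub>D P)\<close> and back, \<open>A \<otimes>\<^sub>A M \<rightarrow> M\<close> and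
  \<open>M \<otimes>\<^sub>B B \<rightarrow> M\<close>.\<close>

definition assoc ::
    "'c ring \<Rightarrow> 'd ring \<Rightarrow> ('a, 'c, 'm) bimod \<Rightarrow> ('c, 'd, 'n) bimod \<Rightarrow> ('d, 'b, 'p) bimod \<Rightarrow>
     (('m, 'n) tens, 'p) tens \<Rightarrow> ('m, ('n, 'p) tens) tens" where
  "assoc C D M N P = (\<lambda>t\<in>carrier (tensor D (tensor C M N) P).
     tensor_lift (tensor C M (tensor D N P))
       (\<lambda>u p. tensor_lift (tensor C M (tensor D N P))
          (\<lambda>m n. elem_tensor C M (tensor D N P) m (elem_tensor D N P n p)) u) t)"

definition assoc_inv ::
    "'c ring \<Rightarrow> 'd ring \<Rightarrow> ('a, 'c, 'm) bimod \<Rightarrow> ('c, 'd, 'n) bimod \<Rightarrow> ('d, 'b, 'p) bimod \<Rightarrow>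
     ('m, ('n, 'p) tens) tens \<Rightarrow> (('m, 'n) tens, 'p) tens" where
  "assoc_inv C D M N P = (\<lambda>t\<in>carrier (tensor C M (tensor D N P)).
     tensor_lift (tensor D (tensor C M N) P)
       (\<lambda>m u. tensor_lift (tensor D (tensor C M N) P)
          (\<lambda>n p. elem_tensor D (tensor C M N) P (elem_tensor C M N m n) p) u) t)"

definition lact :: "'a ring \<Rightarrow> ('a, 'b, 'm) bimod \<Rightarrow> ('a, 'm) tens \<Rightarrow> 'm" where
  "lact A M = (\<lambda>t\<in>carrier (tensor A (regular A) M). tensor_lift M (\<lambda>a m. a \<odot>\<^bsub>M\<^esub> m) t)"

definition ract :: "'b ring \<Rightarrow> ('a, 'b, 'm) bimod \<Rightarrow> ('m, 'b) tens \<Rightarrow> 'm" where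
  "ract B M = (\<lambda>t\<in>carrier (tensor B M (regular B)). tensor_lift M (\<lambda>m b. m \<triangleleft>\<^bsub>M\<^esub> b) t)"

definition lact_inv :: "'a ring \<Rightarrow> ('a, 'b, 'm) bimod \<Rightarrow> 'm \<Rightarrow> ('a, 'm) tens" where
  "lact_inv A M = (\<lambda>m\<in>carrier M. inv_into (carrier (tensor A (regular A) M)) (lact A M) m)"

definition ract_inv :: "'b ring \<Rightarrow> ('a, 'b, 'm) bimod \<Rightarrow> 'm \<Rightarrow> ('m, 'b) tens" where
  "ract_inv B M = (\<lambda>m\<in>carrier M. inv_into (carrier (tensor B M (regular B))) (ract B M) m)"


section \<open>Firm rings, modules and bimodules\<close>

definition firm_left :: "'a ring \<Rightarrow> ('a, 'b, 'm) bimod \<Rightarrow> bool" where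
  "firm_left A M \<longleftrightarrow> left_module A M
     \<and> bij_betw (lact A M) (carrier (tensor A (regular A) M)) (carrier M)"

definition firm_right :: "'b ring \<Rightarrow> ('a, 'b, 'm) bimod \<Rightarrow> bool" where
  "firm_right B M \<longleftrightarrow> right_module B M
     \<and> bij_betw (ract B M) (carrier (tensor B M (regular B))) (carrier M)"

text \<open>For the regular module, left and right firmness refer to the same map \<open>A \<otimes>\<^sub>A A \<rightarrow> A\<close>.\<close>

definition firm_ring :: "'a ring \<Rightarrow> bool" where
  "firm_ring A \<longleftrightarrow> nonunital_ring A \<and> firm_right A (regular A)"

definition firm_bimodule :: "'a ring \<Rightarrow> 'b ring \<Rightarrow> ('a, 'b, 'm) bimod \<Rightarrow> bool" where
  "firm_bimodule A B M \<longleftrightarrow> bimodule A B M \<and> firm_left A M \<and> firm_right B M"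


section \<open>Adjunctions in \<open>Firm\<close>\<close>

text \<open>
  Throughout, \<open>M : A \<rightarrow> B\<close> and \<open>N : B \<rightarrow> A\<close> are firm bimodules, \<open>\<eta> : A \<rightarrow> M \<otimes>\<^sub>B N\<close> and
  \<open>\<epsilon> : N \<otimes>\<^sub>A M \<rightarrow> B\<close>.  They induce units and counits for the functors \<open>- \<otimes>\<^sub>A M\<close>, \<open>- \<otimes>\<^sub>B N\<close> on
  right modules (prefix \<open>r\<close>) and \<open>N \<otimes>\<^sub>A -\<close>, \<open>M \<otimes>\<^sub>B -\<close> on left modules (prefix \<open>l\<close>):
  \<open>X \<rightarrow> (X \<otimes>\<^sub>A M) \<otimes>\<^sub>B N\<close>, \<open>(Z \<otimes>\<^sub>B N) \<otimes>\<^sub>A M \<rightarrow> Z\<close>, \<open>X \<rightarrow> M \<otimes>\<^sub>B (N \<otimes>\<^sub>A X)\<close>,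
  \<open>N \<otimes>\<^sub>A (M \<otimes>\<^sub>B Z) \<rightarrow> Z\<close>.
\<close>

definition r_unit ::
    "'a ring \<Rightarrow> 'b ring \<Rightarrow> ('a, 'b, 'm) bimod \<Rightarrow> ('b, 'a, 'n) bimod \<Rightarrow> ('a \<Rightarrow> ('m, 'n) tens) \<Rightarrow>
     ('c, 'a, 'x) bimod \<Rightarrow> 'x \<Rightarrow> (('x, 'm) tens, 'n) tens" where
  "r_unit A B M N \<eta> X = (\<lambda>x\<in>carrier X.
     assoc_inv A B X M N
       (tensor_map A X (regular A) X (tensor B M N) (ident X) \<eta> (ract_inv A X x)))"

definition r_counit ::
    "'a ring \<Rightarrow> 'b ring \<Rightarrow> ('a, 'b, 'm) bimod \<Rightarrow> ('b, 'a, 'n) bimod \<Rightarrow> (('n, 'm) tens \<Rightarrow> 'b) \<Rightarrow>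
     ('c, 'b, 'z) bimod \<Rightarrow> (('z, 'n) tens, 'm) tens \<Rightarrow> 'z" where
  "r_counit A B M N \<epsilon> Z = (\<lambda>t\<in>carrier (tensor A (tensor B Z N) M).
     ract B Z (tensor_map B Z (tensor A N M) Z (regular B) (ident Z) \<epsilon> (assoc B A Z N M t)))"

definition l_unit ::
    "'a ring \<Rightarrow> 'b ring \<Rightarrow> ('a, 'b, 'm) bimod \<Rightarrow> ('b, 'a, 'n) bimod \<Rightarrow> ('a \<Rightarrow> ('m, 'n) tens) \<Rightarrow>
     ('a, 'c, 'x) bimod \<Rightarrow> 'x \<Rightarrow> ('m, ('n, 'x) tens) tens" where
  "l_unit A B M N \<eta> X = (\<lambda>x\<in>carrier X.
     assoc B A M N X
       (tensor_map A (regular A) X (tensor B M N) X \<eta> (ident X) (lact_inv A X x)))"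

definition l_counit ::
    "'a ring \<Rightarrow> 'b ring \<Rightarrow> ('a, 'b, 'm) bimod \<Rightarrow> ('b, 'a, 'n) bimod \<Rightarrow> (('n, 'm) tens \<Rightarrow> 'b) \<Rightarrow>
     ('b, 'c, 'z) bimod \<Rightarrow> ('n, ('m, 'z) tens) tens \<Rightarrow> 'z" where
  "l_counit A B M N \<epsilon> Z = (\<lambda>t\<in>carrier (tensor A N (tensor B M Z)).
     lact B Z (tensor_map B (tensor A N M) Z (regular B) Z \<epsilon> (ident Z) (assoc_inv A B N M Z t)))"

text \<open>\<open>N\<close> is right adjoint to \<open>M\<close> in \<open>Firm\<close> with unit \<open>\<eta>\<close> and counit \<open>\<epsilon>\<close>.  The last two clauses are
  the triangle identities \<open>(M \<otimes> \<epsilon>)(\<eta> \<otimes> M) = M\<close> and \<open>(\<epsilon> \<otimes> N)(N \<otimes> \<eta>) = N\<close>.\<close>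

definition right_adjoint ::
    "'a ring \<Rightarrow> 'b ring \<Rightarrow> ('a, 'b, 'm) bimod \<Rightarrow> ('b, 'a, 'n) bimod \<Rightarrow>
     ('a \<Rightarrow> ('m, 'n) tens) \<Rightarrow> (('n, 'm) tens \<Rightarrow> 'b) \<Rightarrow> bool" where
  "right_adjoint A B M N \<eta> \<epsilon> \<longleftrightarrow>
     firm_bimodule B A N
     \<and> \<eta> \<in> bimod_hom A A (regular A) (tensor B M N)
     \<and> \<epsilon> \<in> bimod_hom B B (tensor A N M) (regular B)
     \<and> (\<forall>m\<in>carrier M.
          r_counit A B M N \<epsilon> M
            (tensor_map A (regular A) M (tensor B M N) M \<eta> (ident M) (lact_inv A M m)) = m)
     \<and> (\<forall>n\<in>carrier N.
          l_counit A B M N \<epsilon> N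
            (tensor_map A N (regular A) N (tensor B M N) (ident N) \<eta> (ract_inv A N n)) = n)"

text \<open>\<open>Mod\<^sub>B(M, B)\<close> as a \<open>B\<close>-\<open>A\<close>-bimodule: \<open>(b f)(m) = b f(m)\<close>, \<open>(f a)(m) = f(a m)\<close>.\<close>

definition dual_module ::
    "'a ring \<Rightarrow> 'b ring \<Rightarrow> ('a, 'b, 'm) bimod \<Rightarrow> ('b, 'a, 'm \<Rightarrow> 'b) bimod" where
  "dual_module A B M =
     \<lparr>carrier = right_hom B M (regular B), mult = undefined, one = undefined,
      ring.zero = (\<lambda>m\<in>carrier M. \<zero>\<^bsub>B\<^esub>), add = (\<lambda>f g. \<lambda>m\<in>carrier M. f m \<oplus>\<^bsub>B\<^esub> g m),
      smult = (\<lambda>b f. \<lambda>m\<in>carrier M. b \<otimes>\<^bsub>B\<^esub> f m),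
      rsmult = (\<lambda>f a. \<lambda>m\<in>carrier M. f (a \<odot>\<^bsub>M\<^esub> m))\<rparr>"

definition dagger ::
    "'a ring \<Rightarrow> 'b ring \<Rightarrow> ('a, 'b, 'm) bimod \<Rightarrow> ('b, 'a, (('b, 'm \<Rightarrow> 'b) tens, 'a) tens) bimod" where
  "dagger A B M = tensor A (tensor B (regular B) (dual_module A B M)) (regular A)"

definition separable ::
    "'a ring \<Rightarrow> 'b ring \<Rightarrow> ('a, 'b, 'm) bimod \<Rightarrow> ('b, 'a, 'n) bimod \<Rightarrow>
     ('a \<Rightarrow> ('m, 'n) tens) \<Rightarrow> bool" where
  "separable A B M N \<eta> \<longleftrightarrow>
     (\<exists>\<pi>\<in>bimod_hom A A (tensor B M N) (regular A). \<forall>a\<in>carrier A. \<pi> (\<eta> a) = a)"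


section \<open>The \<open>A\<close>-ring \<open>S_M\<close> and the \<open>B\<close>-coring \<open>C_M\<close>\<close>

text \<open>\<open>S_M = M \<otimes>\<^sub>B N\<close>, with the multiplication \<open>M \<otimes> \<epsilon> \<otimes> N\<close> stored in the field \<^const>\<open>mult\<close>.  Its
  unit as an \<open>A\<close>-ring is the map \<open>\<eta>\<close>; the field \<^const>\<open>one\<close> is unused.\<close>

definition S_ring ::
    "'a ring \<Rightarrow> 'b ring \<Rightarrow> ('a, 'b, 'm) bimod \<Rightarrow> ('b, 'a, 'n) bimod \<Rightarrow>
     (('n, 'm) tens \<Rightarrow> 'b) \<Rightarrow> ('a, 'a, ('m, 'n) tens) bimod" where
  "S_ring A B M N \<epsilon> = (let S = tensor B M N in
     S\<lparr>mult := (\<lambda>s s'.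
       tensor_map B M (tensor A N S) M N (ident M) (l_counit A B M N \<epsilon> N)
         (assoc B A M N S (elem_tensor A S S s s')))\<rparr>)"

definition C_comult ::
    "'a ring \<Rightarrow> 'b ring \<Rightarrow> ('a, 'b, 'm) bimod \<Rightarrow> ('b, 'a, 'n) bimod \<Rightarrow>
     ('a \<Rightarrow> ('m, 'n) tens) \<Rightarrow> ('n, 'm) tens \<Rightarrow> (('n, 'm) tens, ('n, 'm) tens) tens" where
  "C_comult A B M N \<eta> = (let C = tensor A N M in
     (\<lambda>c\<in>carrier C. assoc_inv A B N M C
       (tensor_map A N M N (tensor B M C) (ident N) (l_unit A B M N \<eta> M) c)))"

definition coring_endo ::
    "'a ring \<Rightarrow> 'b ring \<Rightarrow> ('a, 'b, 'm) bimod \<Rightarrow> ('b, 'a, 'n) bimod \<Rightarrow>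
     ('a \<Rightarrow> ('m, 'n) tens) \<Rightarrow> (('n, 'm) tens \<Rightarrow> 'b) \<Rightarrow> (('n, 'm) tens \<Rightarrow> ('n, 'm) tens) monoid" where
  "coring_endo A B M N \<eta> \<epsilon> = (let C = tensor A N M; \<Delta> = C_comult A B M N \<eta> in
     \<lparr>carrier = {f \<in> bimod_hom B B C C. \<forall>c\<in>carrier C.
        \<epsilon> (f c) = \<epsilon> c \<and> \<Delta> (f c) = tensor_map B C C C C f f (\<Delta> c)},
      mult = compose (carrier C), one = ident C\<rparr>)"


section \<open>Comonadicity\<close>

text \<open>
  Categories of firm (bi)modules are taken relative to a universe \<open>U\<close>: their objects are the
  firm (bi)modules with carrier contained in \<open>U\<close>.

  For right modules, \<open>F = - \<otimes>\<^sub>A M\<close> is left adjoint to \<open>- \<otimes>\<^sub>B N\<close>, the induced comonad is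
  \<open>G Z = (Z \<otimes>\<^sub>B N) \<otimes>\<^sub>A M\<close> with counit \<^const>\<open>r_counit\<close> and comultiplication \<open>F\<close> of the unit at
  \<open>Z \<otimes>\<^sub>B N\<close>, and the comparison functor sends \<open>X\<close> to \<open>F X\<close> with coaction \<open>F\<close> of the unit at \<open>X\<close>.
\<close>

definition r_comonad_map ::
    "'a ring \<Rightarrow> 'b ring \<Rightarrow> ('a, 'b, 'm) bimod \<Rightarrow> ('b, 'a, 'n) bimod \<Rightarrow>
     ('c, 'b, 'z) bimod \<Rightarrow> ('c', 'b, 'z') bimod \<Rightarrow> ('z \<Rightarrow> 'z') \<Rightarrow>
     (('z, 'n) tens, 'm) tens \<Rightarrow> (('z', 'n) tens, 'm) tens" where
  "r_comonad_map A B M N Z Z' f =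
     tensor_map A (tensor B Z N) M (tensor B Z' N) M (tensor_map B Z N Z' N f (ident N)) (ident M)"

definition r_coalgebra ::
    "'a ring \<Rightarrow> 'b ring \<Rightarrow> ('a, 'b, 'm) bimod \<Rightarrow> ('b, 'a, 'n) bimod \<Rightarrow>
     ('a \<Rightarrow> ('m, 'n) tens) \<Rightarrow> (('n, 'm) tens \<Rightarrow> 'b) \<Rightarrow>
     ('c, 'b, 'z) bimod \<Rightarrow> ('z \<Rightarrow> (('z, 'n) tens, 'm) tens) \<Rightarrow> bool" where
  "r_coalgebra A B M N \<eta> \<epsilon> Z \<rho> \<longleftrightarrow> (let UZ = tensor B Z N; GZ = tensor A UZ M in
     firm_right B Z \<and> \<rho> \<in> right_hom B Z GZ
     \<and> (\<forall>z\<in>carrier Z. r_counit A B M N \<epsilon> Z (\<rho> z) = z)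
     \<and> (\<forall>z\<in>carrier Z. r_comonad_map A B M N Z GZ \<rho> (\<rho> z)
          = tensor_map A UZ M (tensor B GZ N) M (r_unit A B M N \<eta> UZ) (ident M) (\<rho> z)))"

definition r_coalgebra_hom ::
    "'a ring \<Rightarrow> 'b ring \<Rightarrow> ('a, 'b, 'm) bimod \<Rightarrow> ('b, 'a, 'n) bimod \<Rightarrow>
     ('c, 'b, 'z) bimod \<Rightarrow> ('z \<Rightarrow> (('z, 'n) tens, 'm) tens) \<Rightarrow>
     ('c', 'b, 'z') bimod \<Rightarrow> ('z' \<Rightarrow> (('z', 'n) tens, 'm) tens) \<Rightarrow> ('z \<Rightarrow> 'z') set" where
  "r_coalgebra_hom A B M N Z \<rho> Z' \<rho>' = {h \<in> right_hom B Z Z'.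
     \<forall>z\<in>carrier Z. \<rho>' (h z) = r_comonad_map A B M N Z Z' h (\<rho> z)}"

definition r_coaction ::
    "'a ring \<Rightarrow> 'b ring \<Rightarrow> ('a, 'b, 'm) bimod \<Rightarrow> ('b, 'a, 'n) bimod \<Rightarrow>
     ('a \<Rightarrow> ('m, 'n) tens) \<Rightarrow> ('c, 'a, 'x) bimod \<Rightarrow>
     ('x, 'm) tens \<Rightarrow> ((('x, 'm) tens, 'n) tens, 'm) tens" where
  "r_coaction A B M N \<eta> X =
     tensor_map A X M (tensor B (tensor A X M) N) M (r_unit A B M N \<eta> X) (ident M)"

text \<open>The comparison functor \<open>Mod\<^sub>A \<rightarrow> Coalg(G)\<close> is an equivalence, i.e. fully faithful and
  essentially surjective.  (\<open>X \<otimes>\<^sub>A M\<close> is not literally contained in \<open>U\<close>, but has isomorphic copies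
  there if \<open>U\<close> is infinite and at least as large as \<open>X\<close> and \<open>M\<close>.)\<close>

definition r_comonadic ::
    "'u set \<Rightarrow> 'a ring \<Rightarrow> 'b ring \<Rightarrow> ('a, 'b, 'm) bimod \<Rightarrow> ('b, 'a, 'n) bimod \<Rightarrow>
     ('a \<Rightarrow> ('m, 'n) tens) \<Rightarrow> (('n, 'm) tens \<Rightarrow> 'b) \<Rightarrow> bool" where
  "r_comonadic U A B M N \<eta> \<epsilon> \<longleftrightarrow>
     (\<forall>(X :: (unit, 'a, 'u) bimod) (Y :: (unit, 'a, 'u) bimod).
        firm_right A X \<and> carrier X \<subseteq> U \<and> firm_right A Y \<and> carrier Y \<subseteq> U \<longrightarrow>
        bij_betw (\<lambda>f. tensor_map A X M Y M f (ident M))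
          (right_hom A X Y)
          (r_coalgebra_hom A B M N (tensor A X M) (r_coaction A B M N \<eta> X)
                                   (tensor A Y M) (r_coaction A B M N \<eta> Y)))
   \<and> (\<forall>(Z :: (unit, 'b, 'u) bimod) \<rho>.
        r_coalgebra A B M N \<eta> \<epsilon> Z \<rho> \<and> carrier Z \<subseteq> U \<longrightarrow>
        (\<exists>(X :: (unit, 'a, 'u) bimod) h. firm_right A X \<and> carrier X \<subseteq> U
           \<and> h \<in> r_coalgebra_hom A B M N (tensor A X M) (r_coaction A B M N \<eta> X) Z \<rho>
           \<and> bij_betw h (carrier (tensor A X M)) (carrier Z)))"

text \<open>The same for \<open>F = N \<otimes>\<^sub>A -\<close> on left modules, with right adjoint \<open>M \<otimes>\<^sub>B -\<close> and
  \<open>G Z = N \<otimes>\<^sub>A (M \<otimes>\<^sub>B Z)\<close>.\<close>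

definition l_comonad_map ::
    "'a ring \<Rightarrow> 'b ring \<Rightarrow> ('a, 'b, 'm) bimod \<Rightarrow> ('b, 'a, 'n) bimod \<Rightarrow>
     ('b, 'c, 'z) bimod \<Rightarrow> ('b, 'c', 'z') bimod \<Rightarrow> ('z \<Rightarrow> 'z') \<Rightarrow>
     ('n, ('m, 'z) tens) tens \<Rightarrow> ('n, ('m, 'z') tens) tens" where
  "l_comonad_map A B M N Z Z' f =
     tensor_map A N (tensor B M Z) N (tensor B M Z') (ident N) (tensor_map B M Z M Z' (ident M) f)"

definition l_coalgebra ::
    "'a ring \<Rightarrow> 'b ring \<Rightarrow> ('a, 'b, 'm) bimod \<Rightarrow> ('b, 'a, 'n) bimod \<Rightarrow>
     ('a \<Rightarrow> ('m, 'n) tens) \<Rightarrow> (('n, 'm) tens \<Rightarrow> 'b) \<Rightarrow>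
     ('b, 'c, 'z) bimod \<Rightarrow> ('z \<Rightarrow> ('n, ('m, 'z) tens) tens) \<Rightarrow> bool" where
  "l_coalgebra A B M N \<eta> \<epsilon> Z \<rho> \<longleftrightarrow> (let UZ = tensor B M Z; GZ = tensor A N UZ in
     firm_left B Z \<and> \<rho> \<in> left_hom B Z GZ
     \<and> (\<forall>z\<in>carrier Z. l_counit A B M N \<epsilon> Z (\<rho> z) = z)
     \<and> (\<forall>z\<in>carrier Z. l_comonad_map A B M N Z GZ \<rho> (\<rho> z)
          = tensor_map A N UZ N (tensor B M GZ) (ident N) (l_unit A B M N \<eta> UZ) (\<rho> z)))"

definition l_coalgebra_hom ::
    "'a ring \<Rightarrow> 'b ring \<Rightarrow> ('a, 'b, 'm) bimod \<Rightarrow> ('b, 'a, 'n) bimod \<Rightarrow>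
     ('b, 'c, 'z) bimod \<Rightarrow> ('z \<Rightarrow> ('n, ('m, 'z) tens) tens) \<Rightarrow>
     ('b, 'c', 'z') bimod \<Rightarrow> ('z' \<Rightarrow> ('n, ('m, 'z') tens) tens) \<Rightarrow> ('z \<Rightarrow> 'z') set" where
  "l_coalgebra_hom A B M N Z \<rho> Z' \<rho>' = {h \<in> left_hom B Z Z'.
     \<forall>z\<in>carrier Z. \<rho>' (h z) = l_comonad_map A B M N Z Z' h (\<rho> z)}"

definition l_coaction ::
    "'a ring \<Rightarrow> 'b ring \<Rightarrow> ('a, 'b, 'm) bimod \<Rightarrow> ('b, 'a, 'n) bimod \<Rightarrow>
     ('a \<Rightarrow> ('m, 'n) tens) \<Rightarrow> ('a, 'c, 'x) bimod \<Rightarrow>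
     ('n, 'x) tens \<Rightarrow> ('n, ('m, ('n, 'x) tens) tens) tens" where
  "l_coaction A B M N \<eta> X =
     tensor_map A N X N (tensor B M (tensor A N X)) (ident N) (l_unit A B M N \<eta> X)"

definition l_comonadic ::
    "'u set \<Rightarrow> 'a ring \<Rightarrow> 'b ring \<Rightarrow> ('a, 'b, 'm) bimod \<Rightarrow> ('b, 'a, 'n) bimod \<Rightarrow>
     ('a \<Rightarrow> ('m, 'n) tens) \<Rightarrow> (('n, 'm) tens \<Rightarrow> 'b) \<Rightarrow> bool" where
  "l_comonadic U A B M N \<eta> \<epsilon> \<longleftrightarrow>
     (\<forall>(X :: ('a, unit, 'u) bimod) (Y :: ('a, unit, 'u) bimod).
        firm_left A X \<and> carrier X \<subseteq> U \<and> firm_left A Y \<and> carrier Y \<subseteq> U \<longrightarrow>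
        bij_betw (\<lambda>f. tensor_map A N X N Y (ident N) f)
          (left_hom A X Y)
          (l_coalgebra_hom A B M N (tensor A N X) (l_coaction A B M N \<eta> X)
                                   (tensor A N Y) (l_coaction A B M N \<eta> Y)))
   \<and> (\<forall>(Z :: ('b, unit, 'u) bimod) \<rho>.
        l_coalgebra A B M N \<eta> \<epsilon> Z \<rho> \<and> carrier Z \<subseteq> U \<longrightarrow>
        (\<exists>(X :: ('a, unit, 'u) bimod) h. firm_left A X \<and> carrier X \<subseteq> U
           \<and> h \<in> l_coalgebra_hom A B M N (tensor A N X) (l_coaction A B M N \<eta> X) Z \<rho>
           \<and> bij_betw h (carrier (tensor A N X)) (carrier Z)))"


section \<open>The monoids of firm subbimodules\<close>

text \<open>
  A firm \<open>A\<close>-subbimodule of \<open>S\<close> is a subobject of \<open>S\<close> in the category of firm \<open>A\<close>-bimodules: a firm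
  \<open>A\<close>-bimodule \<open>I\<close> with a monomorphism \<open>i : I \<rightarrow> S\<close>.  It is recorded by the subset \<open>J = i(I)\<close>, which
  determines \<open>(I, i)\<close> up to isomorphism (\<open>I \<cong> A \<otimes>\<^sub>A J \<otimes>\<^sub>A A\<close>); a subset \<open>J\<close> which is itself firm
  as a bimodule is represented by \<open>J\<close> with its inclusion.  Over non-flat rings monomorphisms of
  firm modules need not be injective, so \<open>J\<close> itself may fail to be firm.  This already happens
  for the unit \<open>\<eta>(A)\<close>: let \<open>k\<close> be a field, \<open>R = k[t]\<close>, \<open>B = k\<langle>s, t\<rangle>/(st = 1)\<close> and
  \<open>A = R \<times> k\<close> with \<open>(r, q)(r', q') = (r r', r(0) q')\<close>, acting on \<open>M = B\<close> through \<open>A \<rightarrow> R\<close>.  Then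
  \<open>- \<otimes>\<^sub>A M\<close> is comonadic, \<open>S_M = B\<close>, and \<open>\<eta>(A) = R\<close> is not a firm right \<open>A\<close>-module.
\<close>

definition firm_mono ::
    "'u set \<Rightarrow> 'a ring \<Rightarrow> ('a, 'a, 'u) bimod \<Rightarrow> ('u \<Rightarrow> 's) \<Rightarrow> bool" where
  "firm_mono U A I i \<longleftrightarrow> (\<forall>(T :: ('a, 'a, 'u) bimod) f g.
     firm_bimodule A A T \<and> carrier T \<subseteq> U \<and> f \<in> bimod_hom A A T I \<and> g \<in> bimod_hom A A T I
     \<and> (\<forall>t\<in>carrier T. i (f t) = i (g t)) \<longrightarrow> f = g)"

definition firm_sub ::
    "'u set \<Rightarrow> 'a ring \<Rightarrow> ('a, 'a, 's) bimod \<Rightarrow> 's set \<Rightarrow>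
     ('a, 'a, 'u) bimod \<Rightarrow> ('u \<Rightarrow> 's) \<Rightarrow> bool" where
  "firm_sub U A S J I i \<longleftrightarrow> firm_bimodule A A I \<and> carrier I \<subseteq> U
     \<and> i \<in> bimod_hom A A I S \<and> firm_mono U A I i \<and> i ` carrier I = J"

text \<open>The subobjects for which \<open>I \<otimes>\<^sub>A S \<rightarrow> S\<close> (resp. \<open>S \<otimes>\<^sub>A I \<rightarrow> S\<close>) is an isomorphism.\<close>

definition r_inv_sub ::
    "'u set \<Rightarrow> 'a ring \<Rightarrow> ('a, 'a, 's) bimod \<Rightarrow> 's set \<Rightarrow>
     ('a, 'a, 'u) bimod \<Rightarrow> ('u \<Rightarrow> 's) \<Rightarrow> bool" where
  "r_inv_sub U A S J I i \<longleftrightarrow> firm_sub U A S J I i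
     \<and> bij_betw (tensor_lift S (\<lambda>x s. i x \<otimes>\<^bsub>S\<^esub> s)) (carrier (tensor A I S)) (carrier S)"

definition l_inv_sub ::
    "'u set \<Rightarrow> 'a ring \<Rightarrow> ('a, 'a, 's) bimod \<Rightarrow> 's set \<Rightarrow>
     ('a, 'a, 'u) bimod \<Rightarrow> ('u \<Rightarrow> 's) \<Rightarrow> bool" where
  "l_inv_sub U A S J I i \<longleftrightarrow> firm_sub U A S J I i
     \<and> bij_betw (tensor_lift S (\<lambda>s x. s \<otimes>\<^bsub>S\<^esub> i x)) (carrier (tensor A S I)) (carrier S)"

text \<open>\<^const>\<open>ideal_prod\<close> is the usual product \<open>J J'\<close> (finite sums of products); it uses only the
  addition and multiplication of its first argument.  The neutral element is \<open>\<eta>(A)\<close>.\<close>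

definition I_r ::
    "'u set \<Rightarrow> 'a ring \<Rightarrow> 'b ring \<Rightarrow> ('a, 'b, 'm) bimod \<Rightarrow> ('b, 'a, 'n) bimod \<Rightarrow>
     ('a \<Rightarrow> ('m, 'n) tens) \<Rightarrow> (('n, 'm) tens \<Rightarrow> 'b) \<Rightarrow> ('m, 'n) tens set monoid" where
  "I_r U A B M N \<eta> \<epsilon> = (let S = S_ring A B M N \<epsilon> in
     \<lparr>carrier = {J. \<exists>I i. r_inv_sub U A S J I i}, mult = ideal_prod S, one = \<eta> ` carrier A\<rparr>)"

definition I_l ::
    "'u set \<Rightarrow> 'a ring \<Rightarrow> 'b ring \<Rightarrow> ('a, 'b, 'm) bimod \<Rightarrow> ('b, 'a, 'n) bimod \<Rightarrow>
     ('a \<Rightarrow> ('m, 'n) tens) \<Rightarrow> (('n, 'm) tens \<Rightarrow> 'b) \<Rightarrow> ('m, 'n) tens set monoid" where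
  "I_l U A B M N \<eta> \<epsilon> = (let S = S_ring A B M N \<epsilon> in
     \<lparr>carrier = {J. \<exists>I i. l_inv_sub U A S J I i}, mult = ideal_prod S, one = \<eta> ` carrier A\<rparr>)"


section \<open>The maps \<open>\<Gamma>\<close>\<close>

definition xi_r ::
    "'a ring \<Rightarrow> 'b ring \<Rightarrow> ('a, 'b, 'm) bimod \<Rightarrow> ('b, 'a, 'n) bimod \<Rightarrow> (('n, 'm) tens \<Rightarrow> 'b) \<Rightarrow>
     ('a, 'a, 'u) bimod \<Rightarrow> ('u \<Rightarrow> ('m, 'n) tens) \<Rightarrow> ('u, 'm) tens \<Rightarrow> 'm" where
  "xi_r A B M N \<epsilon> I i = (\<lambda>t\<in>carrier (tensor A I M).
     r_counit A B M N \<epsilon> M (tensor_map A I M (tensor B M N) M i (ident M) t))"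

definition xi_l ::
    "'a ring \<Rightarrow> 'b ring \<Rightarrow> ('a, 'b, 'm) bimod \<Rightarrow> ('b, 'a, 'n) bimod \<Rightarrow> (('n, 'm) tens \<Rightarrow> 'b) \<Rightarrow>
     ('a, 'a, 'u) bimod \<Rightarrow> ('u \<Rightarrow> ('m, 'n) tens) \<Rightarrow> ('n, 'u) tens \<Rightarrow> 'n" where
  "xi_l A B M N \<epsilon> I i = (\<lambda>t\<in>carrier (tensor A N I).
     l_counit A B M N \<epsilon> N (tensor_map A N I N (tensor B M N) (ident N) i t))"

text \<open>
  \<open>N \<otimes> M \<rightarrow> N \<otimes> (I \<otimes> M) \<rightarrow> N \<otimes> (S \<otimes> M) \<rightarrow> N \<otimes> (M \<otimes> (N \<otimes> M)) \<rightarrow> N \<otimes> M\<close> and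
  \<open>N \<otimes> M \<rightarrow> (N \<otimes> I) \<otimes> M \<rightarrow> (N \<otimes> S) \<otimes> M \<rightarrow> ((N \<otimes> M) \<otimes> N) \<otimes> M \<rightarrow> N \<otimes> M\<close>, the first maps
  being \<open>N \<otimes> \<xi>\<^sup>-\<^sup>1\<close> and \<open>\<xi>\<^sup>-\<^sup>1 \<otimes> M\<close> and the last ones \<open>\<epsilon> \<otimes> N \<otimes> M\<close> and \<open>N \<otimes> M \<otimes> \<epsilon>\<close>.
\<close>

definition gamma_r ::
    "'a ring \<Rightarrow> 'b ring \<Rightarrow> ('a, 'b, 'm) bimod \<Rightarrow> ('b, 'a, 'n) bimod \<Rightarrow> (('n, 'm) tens \<Rightarrow> 'b) \<Rightarrow>
     ('a, 'a, 'u) bimod \<Rightarrow> ('u \<Rightarrow> ('m, 'n) tens) \<Rightarrow> ('n, 'm) tens \<Rightarrow> ('n, 'm) tens" where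
  "gamma_r A B M N \<epsilon> I i =
    (let C = tensor A N M; S = tensor B M N; IM = tensor A I M; SM = tensor A S M;
         \<xi> = xi_r A B M N \<epsilon> I i;
         f1 = tensor_map A N M N IM (ident N) (\<lambda>m\<in>carrier M. inv_into (carrier IM) \<xi> m);
         f2 = tensor_map A N IM N SM (ident N) (tensor_map A I M S M i (ident M));
         f3 = tensor_map A N SM N (tensor B M C) (ident N) (assoc B A M N M);
         f4 = l_counit A B M N \<epsilon> C
     in (\<lambda>c\<in>carrier C. f4 (f3 (f2 (f1 c)))))"

definition gamma_l ::
    "'a ring \<Rightarrow> 'b ring \<Rightarrow> ('a, 'b, 'm) bimod \<Rightarrow> ('b, 'a, 'n) bimod \<Rightarrow> (('n, 'm) tens \<Rightarrow> 'b) \<Rightarrow>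
     ('a, 'a, 'u) bimod \<Rightarrow> ('u \<Rightarrow> ('m, 'n) tens) \<Rightarrow> ('n, 'm) tens \<Rightarrow> ('n, 'm) tens" where
  "gamma_l A B M N \<epsilon> I i =
    (let C = tensor A N M; S = tensor B M N; NI = tensor A N I; NS = tensor A N S;
         \<xi> = xi_l A B M N \<epsilon> I i;
         f1 = tensor_map A N M NI M (\<lambda>n\<in>carrier N. inv_into (carrier NI) \<xi> n) (ident M);
         f2 = tensor_map A NI M NS M (tensor_map A N I N S (ident N) i) (ident M);
         f3 = tensor_map A NS M (tensor B C N) M (assoc_inv A B N M N) (ident M);
         f4 = r_counit A B M N \<epsilon> C
     in (\<lambda>c\<in>carrier C. f4 (f3 (f2 (f1 c)))))"

text \<open>\<open>\<Gamma>\<close> on subsets; the choice of the representing pair \<open>(I, i)\<close> is immaterial.\<close>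

definition Gamma_r ::
    "'u set \<Rightarrow> 'a ring \<Rightarrow> 'b ring \<Rightarrow> ('a, 'b, 'm) bimod \<Rightarrow> ('b, 'a, 'n) bimod \<Rightarrow>
     (('n, 'm) tens \<Rightarrow> 'b) \<Rightarrow> ('m, 'n) tens set \<Rightarrow> ('n, 'm) tens \<Rightarrow> ('n, 'm) tens" where
  "Gamma_r U A B M N \<epsilon> J =
     (let (I, i) = (SOME (I, i). r_inv_sub U A (S_ring A B M N \<epsilon>) J I i)
      in gamma_r A B M N \<epsilon> I i)"

definition Gamma_l ::
    "'u set \<Rightarrow> 'a ring \<Rightarrow> 'b ring \<Rightarrow> ('a, 'b, 'm) bimod \<Rightarrow> ('b, 'a, 'n) bimod \<Rightarrow>
     (('n, 'm) tens \<Rightarrow> 'b) \<Rightarrow> ('m, 'n) tens set \<Rightarrow> ('n, 'm) tens \<Rightarrow> ('n, 'm) tens" where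
  "Gamma_l U A B M N \<epsilon> J =
     (let (I, i) = (SOME (I, i). l_inv_sub U A (S_ring A B M N \<epsilon>) J I i)
      in gamma_l A B M N \<epsilon> I i)"

definition op_monoid :: "'g monoid \<Rightarrow> 'g monoid" where
  "op_monoid G = \<lparr>carrier = carrier G, mult = (\<lambda>x y. y \<otimes>\<^bsub>G\<^esub> x), one = \<one>\<^bsub>G\<^esub>\<rparr>"

definition monoid_iso :: "'g monoid \<Rightarrow> 'h monoid \<Rightarrow> ('g \<Rightarrow> 'h) \<Rightarrow> bool" where
  "monoid_iso G H h \<longleftrightarrow> monoid G \<and> monoid H \<and> h \<in> iso G H \<and> h \<one>\<^bsub>G\<^esub> = \<one>\<^bsub>H\<^esub>"

end

theory Submission
  imports Defs
begin

text \<open>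
  For a firm bimodule \<open>I\<close> and \<open>i : I \<rightarrow> S\<close>, the maps \<open>I \<otimes>\<^sub>A S \<rightarrow> S\<close> and \<open>\<xi> : I \<otimes>\<^sub>A M \<rightarrow> M\<close> are bijective
  simultaneously, and then \<open>\<Gamma>(I, i)\<close> is the only \<open>f\<close> with \<open>f(n \<otimes> i(x) m) = n i(x) \<otimes> m\<close>.  This relation
  makes \<open>\<Gamma>\<close> antimultiplicative, with \<open>I \<otimes>\<^sub>A I'\<close> representing the product; what remains is that every coring
  endomorphism \<open>f\<close> comes from a unique \<open>i(I)\<close>.  Now \<open>\<Phi>\<^sub>f = (M \<otimes> f)(\<eta> \<otimes> M) : M \<rightarrow> S \<otimes>\<^sub>A M\<close> is another coaction
  of the comonad on \<open>M\<close>, and \<open>f = \<Gamma>(I, i)\<close> iff \<open>\<Phi>\<^sub>f(i(x) m) = i(x) \<otimes> m\<close>.  If \<open>- \<otimes>\<^sub>A M\<close> is comonadic, then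
  \<open>(M, \<Phi>\<^sub>f) \<cong> X \<otimes>\<^sub>A M\<close> for a firm module \<open>X\<close>, and \<open>I\<close> is obtained from \<open>X\<close>.  If \<open>\<eta>\<close> has a retraction
  \<open>\<pi>\<close>, then \<open>\<Phi>\<^sub>f\<close> and \<open>\<pi>\<close> give an idempotent endomorphism of the bimodule \<open>S\<close>, and \<open>I\<close> is its image.
  The statements about \<open>\<Gamma>\<close> on \<open>M\<^sup>\<dagger>\<close> are those about \<open>\<Gamma>\<close> on \<open>M\<close> for the opposite rings and the adjunction
  with the roles of \<open>M\<close> and \<open>N\<close> exchanged.
\<close>

section \<open>Additive maps\<close>

definition ahom :: "('p, 'x) ring_scheme \<Rightarrow> ('q, 'y) ring_scheme \<Rightarrow> ('p \<Rightarrow> 'q) set" where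
  "ahom X Y = {f \<in> carrier X \<rightarrow> carrier Y.
     \<forall>x\<in>carrier X. \<forall>y\<in>carrier X. f (x \<oplus>\<^bsub>X\<^esub> y) = f x \<oplus>\<^bsub>Y\<^esub> f y}"

lemma ahomI:
  assumes "\<And>x. x \<in> carrier X \<Longrightarrow> f x \<in> carrier Y"
    and "\<And>x y. x \<in> carrier X \<Longrightarrow> y \<in> carrier X \<Longrightarrow> f (x \<oplus>\<^bsub>X\<^esub> y) = f x \<oplus>\<^bsub>Y\<^esub> f y"
  shows "f \<in> ahom X Y"
  using assms by (auto simp: ahom_def)

lemma ahom_closed: "f \<in> ahom X Y \<Longrightarrow> x \<in> carrier X \<Longrightarrow> f x \<in> carrier Y"
  by (auto simp: ahom_def)

lemma ahom_add:
  "f \<in> ahom X Y \<Longrightarrow> x \<in> carrier X \<Longrightarrow> y \<in> carrier X \<Longrightarrow> f (x \<oplus>\<^bsub>X\<^esub> y) = f x \<oplus>\<^bsub>Y\<^esub> f y"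
  by (auto simp: ahom_def)

lemma ahom_comp: "f \<in> ahom X Y \<Longrightarrow> g \<in> ahom Y Z \<Longrightarrow> (\<lambda>x. g (f x)) \<in> ahom X Z"
  by (auto simp: ahom_def Pi_def)

lemma ahom_ident: "(\<lambda>x. x) \<in> ahom X X"
  by (auto simp: ahom_def)

lemma ahom_iff_hom: "f \<in> ahom X Y \<longleftrightarrow> f \<in> hom (add_monoid X) (add_monoid Y)"
  by (auto simp: ahom_def hom_def)

lemma ahom_add_hom:
  assumes "abelian_group X" "abelian_group Y" "f \<in> ahom X Y"
  shows "abelian_group_hom X Y f"
  using assms
  by (intro abelian_group_homI)
     (auto simp: ahom_iff_hom group_hom_def group_hom_axioms_def intro: abelian_group.a_group)

lemma ahom_zero:
  assumes "abelian_group X" "abelian_group Y" "f \<in> ahom X Y"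
  shows "f \<zero>\<^bsub>X\<^esub> = \<zero>\<^bsub>Y\<^esub>"
  by (rule abelian_group_hom.hom_zero[OF ahom_add_hom[OF assms]])

lemma ahom_neg:
  assumes "abelian_group X" "abelian_group Y" "f \<in> ahom X Y" "x \<in> carrier X"
  shows "f (\<ominus>\<^bsub>X\<^esub> x) = \<ominus>\<^bsub>Y\<^esub> f x"
  by (rule abelian_group_hom.hom_a_inv[OF ahom_add_hom[OF assms(1-3)] assms(4)])

lemma additive_hom_iff: "f \<in> additive_hom M N \<longleftrightarrow> f \<in> ahom M N \<and> f \<in> extensional (carrier M)"
  by (auto simp: additive_hom_def ahom_def PiE_def)

lemma left_hom_iff: "f \<in> left_hom A M N \<longleftrightarrow> f \<in> ahom M N \<and> f \<in> extensional (carrier M)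
    \<and> (\<forall>a\<in>carrier A. \<forall>x\<in>carrier M. f (a \<odot>\<^bsub>M\<^esub> x) = a \<odot>\<^bsub>N\<^esub> f x)"
  by (auto simp: left_hom_def additive_hom_iff)

lemma right_hom_iff: "f \<in> right_hom B M N \<longleftrightarrow> f \<in> ahom M N \<and> f \<in> extensional (carrier M)
    \<and> (\<forall>b\<in>carrier B. \<forall>x\<in>carrier M. f (x \<triangleleft>\<^bsub>M\<^esub> b) = f x \<triangleleft>\<^bsub>N\<^esub> b)"
  by (auto simp: right_hom_def additive_hom_iff)

lemma bimod_hom_iff: "f \<in> bimod_hom A B M N \<longleftrightarrow> f \<in> left_hom A M N \<and> f \<in> right_hom B M N"
  by (auto simp: bimod_hom_def)

lemma left_hom_ahom: "f \<in> left_hom A M N \<Longrightarrow> f \<in> ahom M N"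
  by (simp add: left_hom_iff)

lemma right_hom_ahom: "f \<in> right_hom B M N \<Longrightarrow> f \<in> ahom M N"
  by (simp add: right_hom_iff)

lemma bimod_hom_left: "f \<in> bimod_hom A B M N \<Longrightarrow> f \<in> left_hom A M N"
  and bimod_hom_right: "f \<in> bimod_hom A B M N \<Longrightarrow> f \<in> right_hom B M N"
  by (auto simp: bimod_hom_iff)

lemma bimod_hom_ahom: "f \<in> bimod_hom A B M N \<Longrightarrow> f \<in> ahom M N"
  using bimod_hom_left left_hom_ahom by blast

lemma left_hom_closed: "f \<in> left_hom A M N \<Longrightarrow> x \<in> carrier M \<Longrightarrow> f x \<in> carrier N"
  by (rule ahom_closed[OF left_hom_ahom])

lemma right_hom_closed: "f \<in> right_hom B M N \<Longrightarrow> x \<in> carrier M \<Longrightarrow> f x \<in> carrier N"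
  by (rule ahom_closed[OF right_hom_ahom])

lemma bimod_hom_closed: "f \<in> bimod_hom A B M N \<Longrightarrow> x \<in> carrier M \<Longrightarrow> f x \<in> carrier N"
  by (rule ahom_closed[OF bimod_hom_ahom])

lemma left_hom_smult:
  "f \<in> left_hom A M N \<Longrightarrow> a \<in> carrier A \<Longrightarrow> x \<in> carrier M \<Longrightarrow> f (a \<odot>\<^bsub>M\<^esub> x) = a \<odot>\<^bsub>N\<^esub> f x"
  by (auto simp: left_hom_iff)

lemma right_hom_rsmult:
  "f \<in> right_hom B M N \<Longrightarrow> b \<in> carrier B \<Longrightarrow> x \<in> carrier M \<Longrightarrow> f (x \<triangleleft>\<^bsub>M\<^esub> b) = f x \<triangleleft>\<^bsub>N\<^esub> b"
  by (auto simp: right_hom_iff)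

lemma left_hom_eqI:
  "f \<in> left_hom A M N \<Longrightarrow> g \<in> left_hom A M N' \<Longrightarrow> (\<And>x. x \<in> carrier M \<Longrightarrow> f x = g x) \<Longrightarrow> f = g"
  by (auto simp: left_hom_iff intro: extensionalityI)

lemma right_hom_eqI:
  "f \<in> right_hom A M N \<Longrightarrow> g \<in> right_hom A M N' \<Longrightarrow> (\<And>x. x \<in> carrier M \<Longrightarrow> f x = g x) \<Longrightarrow> f = g"
  by (auto simp: right_hom_iff intro: extensionalityI)

lemma left_module_abelian: "left_module A M \<Longrightarrow> abelian_group M"
  by (simp add: left_module_def)

lemma right_module_abelian: "right_module B M \<Longrightarrow> abelian_group M"
  by (simp add: right_module_def)

lemma bimodule_left: "bimodule A B M \<Longrightarrow> left_module A M"
  and bimodule_right: "bimodule A B M \<Longrightarrow> right_module B M"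
  by (auto simp: bimodule_def)

lemma smult_closed: "left_module A M \<Longrightarrow> a \<in> carrier A \<Longrightarrow> m \<in> carrier M \<Longrightarrow> a \<odot>\<^bsub>M\<^esub> m \<in> carrier M"
  by (auto simp: left_module_def)

lemma rsmult_closed: "right_module B M \<Longrightarrow> m \<in> carrier M \<Longrightarrow> b \<in> carrier B \<Longrightarrow> m \<triangleleft>\<^bsub>M\<^esub> b \<in> carrier M"
  by (auto simp: right_module_def)

lemma smult_ahom: "left_module A M \<Longrightarrow> a \<in> carrier A \<Longrightarrow> (\<lambda>m. a \<odot>\<^bsub>M\<^esub> m) \<in> ahom M M"
  by (auto simp: left_module_def ahom_def)

lemma rsmult_ahom: "right_module B M \<Longrightarrow> b \<in> carrier B \<Longrightarrow> (\<lambda>m. m \<triangleleft>\<^bsub>M\<^esub> b) \<in> ahom M M"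
  by (auto simp: right_module_def ahom_def)

lemma bimodule_commute:
  "bimodule A B M \<Longrightarrow> a \<in> carrier A \<Longrightarrow> m \<in> carrier M \<Longrightarrow> b \<in> carrier B \<Longrightarrow>
     (a \<odot>\<^bsub>M\<^esub> m) \<triangleleft>\<^bsub>M\<^esub> b = a \<odot>\<^bsub>M\<^esub> (m \<triangleleft>\<^bsub>M\<^esub> b)"
  by (auto simp: bimodule_def)

lemma smult_smult:
  "left_module A M \<Longrightarrow> a \<in> carrier A \<Longrightarrow> a' \<in> carrier A \<Longrightarrow> m \<in> carrier M \<Longrightarrow>
     (a \<otimes>\<^bsub>A\<^esub> a') \<odot>\<^bsub>M\<^esub> m = a \<odot>\<^bsub>M\<^esub> (a' \<odot>\<^bsub>M\<^esub> m)"
  by (auto simp: left_module_def)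

lemma rsmult_rsmult:
  "right_module B M \<Longrightarrow> m \<in> carrier M \<Longrightarrow> b \<in> carrier B \<Longrightarrow> b' \<in> carrier B \<Longrightarrow>
     m \<triangleleft>\<^bsub>M\<^esub> (b \<otimes>\<^bsub>B\<^esub> b') = (m \<triangleleft>\<^bsub>M\<^esub> b) \<triangleleft>\<^bsub>M\<^esub> b'"
  by (auto simp: right_module_def)

section \<open>Balanced maps and tensor products\<close>

definition balanced ::
    "'c ring \<Rightarrow> ('a, 'c, 'm) bimod \<Rightarrow> ('c, 'b, 'n) bimod \<Rightarrow> ('p, 'x) ring_scheme \<Rightarrow>
     ('m \<Rightarrow> 'n \<Rightarrow> 'p) \<Rightarrow> bool" where
  "balanced C M N P \<phi> \<longleftrightarrow>
     (\<forall>n\<in>carrier N. (\<lambda>m. \<phi> m n) \<in> ahom M P) \<and> (\<forall>m\<in>carrier M. \<phi> m \<in> ahom N P)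
     \<and> (\<forall>m\<in>carrier M. \<forall>c\<in>carrier C. \<forall>n\<in>carrier N. \<phi> (m \<triangleleft>\<^bsub>M\<^esub> c) n = \<phi> m (c \<odot>\<^bsub>N\<^esub> n))"

lemma balancedI:
  assumes "\<And>n. n \<in> carrier N \<Longrightarrow> (\<lambda>m. \<phi> m n) \<in> ahom M P"
    and "\<And>m. m \<in> carrier M \<Longrightarrow> (\<lambda>n. \<phi> m n) \<in> ahom N P"
    and "\<And>m c n. m \<in> carrier M \<Longrightarrow> c \<in> carrier C \<Longrightarrow> n \<in> carrier N \<Longrightarrow>
       \<phi> (m \<triangleleft>\<^bsub>M\<^esub> c) n = \<phi> m (c \<odot>\<^bsub>N\<^esub> n)"
  shows "balanced C M N P \<phi>"
  using assms by (auto simp: balanced_def)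

lemma frag_hom_eval:
  assumes P: "abelian_group P" and h: "h \<in> hom (free_Abelian_group S) (add_monoid P)"
    and x: "Poly_Mapping.keys x \<subseteq> S"
  shows "h x = (\<Oplus>\<^bsub>P\<^esub>k\<in>Poly_Mapping.keys x. [Poly_Mapping.lookup x k] \<cdot>\<^bsub>P\<^esub> h (frag_of k))"
proof -
  interpret P: abelian_group P by (rule P)
  interpret h: group_hom "free_Abelian_group S" "add_monoid P" h
    using h P.a_group by (simp add: group_hom_def group_hom_axioms_def)
  have cl: "h (frag_of k) \<in> carrier P" if "k \<in> S" for k
    using h.hom_closed[of "frag_of k"] that by simp
  have scal: "h (frag_cmul c (frag_of k)) = [c] \<cdot>\<^bsub>P\<^esub> h (frag_of k)" if "k \<in> S" for c k
    using h.hom_int_pow[of "frag_of k" c] that by (simp add: add_pow_def)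
  have "h (\<Sum>k\<in>K. frag_cmul (c k) (frag_of k)) = (\<Oplus>\<^bsub>P\<^esub>k\<in>K. [c k] \<cdot>\<^bsub>P\<^esub> h (frag_of k))
      \<and> Poly_Mapping.keys (\<Sum>k\<in>K. frag_cmul (c k) (frag_of k)) \<subseteq> S"
    if "finite K" "K \<subseteq> S" for K and c :: "_ \<Rightarrow> int"
    using that
  proof (induction K rule: finite_induct)
    case empty
    then show ?case using h.hom_one by simp
  next
    case (insert k K)
    have kk: "Poly_Mapping.keys (frag_cmul (c k) (frag_of k)) \<subseteq> S"
      using insert.prems by (auto dest: subsetD[OF keys_cmul])
    have "h (frag_cmul (c k) (frag_of k) + (\<Sum>k\<in>K. frag_cmul (c k) (frag_of k)))
        = h (frag_cmul (c k) (frag_of k)) \<oplus>\<^bsub>P\<^esub> h (\<Sum>k\<in>K. frag_cmul (c k) (frag_of k))"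
      using h.hom_mult[of "frag_cmul (c k) (frag_of k)" "\<Sum>k\<in>K. frag_cmul (c k) (frag_of k)"]
        insert kk by simp
    moreover have "Poly_Mapping.keys (frag_cmul (c k) (frag_of k) + (\<Sum>k\<in>K. frag_cmul (c k) (frag_of k))) \<subseteq> S"
      using insert kk by (auto dest!: subsetD[OF keys_add])
    moreover have "(\<lambda>k. [c k] \<cdot>\<^bsub>P\<^esub> h (frag_of k)) \<in> K \<rightarrow> carrier P" "[c k] \<cdot>\<^bsub>P\<^esub> h (frag_of k) \<in> carrier P"
      using insert.prems cl by (auto simp: P.add.int_pow_closed)
    ultimately show ?case
      using insert by (simp add: scal)
  qed
  from this[of "Poly_Mapping.keys x" "Poly_Mapping.lookup x"] x frag_expansion[of x]
  show ?thesis by (simp add: frag_extend_def)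
qed

context
  fixes C :: "'c ring" and M :: "('a, 'c, 'm) bimod" and N :: "('c, 'b, 'n) bimod"
  assumes rm: "right_module C M" and lm: "left_module C N"
begin

lemma tensor_relators_subset: "tensor_relators C M N \<subseteq> carrier (tensor_free M N)"
proof -
  interpret M: abelian_group M using rm by (rule right_module_abelian)
  interpret N: abelian_group N using lm by (rule left_module_abelian)
  show ?thesis
    unfolding tensor_relators_def tensor_free_def
    by (auto dest!: subsetD[OF keys_diff] simp: rsmult_closed[OF rm] smult_closed[OF lm]
        split: if_splits)
qed

lemma tensor_kernel_normal: "tensor_kernel C M N \<lhd> tensor_free M N"
  unfolding tensor_kernel_def
  by (rule comm_group.subgroup_imp_normal)
     (auto simp: tensor_free_def abelian_free_Abelian_group
       intro!: group.generate_is_subgroup tensor_relators_subset[unfolded tensor_free_def])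

lemma carrier_tensor: "carrier (tensor C M N) = carrier (tensor_free M N Mod tensor_kernel C M N)"
  and add_tensor: "add (tensor C M N) = mult (tensor_free M N Mod tensor_kernel C M N)"
  and zero_tensor: "ring.zero (tensor C M N) = one (tensor_free M N Mod tensor_kernel C M N)"
  by (simp_all add: tensor_def tensor_group_def Let_def)

lemma tensor_abelian_group: "abelian_group (tensor C M N)"
proof -
  interpret Q: comm_group "tensor_free M N Mod tensor_kernel C M N"
    using tensor_kernel_normal
    by (intro comm_group.abelian_FactGroup)
       (auto simp: tensor_free_def abelian_free_Abelian_group normal_imp_subgroup)
  show ?thesis
    by (rule abelian_groupI)
       (simp_all add: carrier_tensor add_tensor zero_tensor Q.m_ac Q.l_inv_ex
         del: mult_FactGroup one_FactGroup)
qed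

lemma coset_hom: "(\<lambda>x. tensor_kernel C M N #>\<^bsub>tensor_free M N\<^esub> x)
    \<in> hom (tensor_free M N) (add_monoid (tensor C M N))"
  using normal.r_coset_hom_Mod[OF tensor_kernel_normal]
  by (simp add: hom_def carrier_tensor add_tensor)

lemma elem_tensor_closed:
  "m \<in> carrier M \<Longrightarrow> n \<in> carrier N \<Longrightarrow> elem_tensor C M N m n \<in> carrier (tensor C M N)"
  using coset_hom unfolding elem_tensor_def
  by (auto simp: hom_def Pi_def tensor_free_def)

lemma coset_relator:
  assumes "x \<in> tensor_relators C M N"
  shows "tensor_kernel C M N #>\<^bsub>tensor_free M N\<^esub> x = \<zero>\<^bsub>tensor C M N\<^esub>"
proof -
  have "x \<in> tensor_kernel C M N"
    unfolding tensor_kernel_def using assms by (rule generate.incl)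
  then have "tensor_kernel C M N #>\<^bsub>tensor_free M N\<^esub> x = tensor_kernel C M N"
    by (intro subgroup.rcos_const normal_imp_subgroup[OF tensor_kernel_normal])
       (auto simp: tensor_free_def)
  then show ?thesis
    by (simp add: tensor_def tensor_group_def Let_def FactGroup_def)
qed

lemma coset_relator2:
  assumes "frag_of k - frag_of k1 - frag_of k2 \<in> tensor_relators C M N"
    and "k \<in> carrier M \<times> carrier N" "k1 \<in> carrier M \<times> carrier N" "k2 \<in> carrier M \<times> carrier N"
  shows "tensor_kernel C M N #>\<^bsub>tensor_free M N\<^esub> frag_of k =
    (tensor_kernel C M N #>\<^bsub>tensor_free M N\<^esub> frag_of k1) \<oplus>\<^bsub>tensor C M N\<^esub>
    (tensor_kernel C M N #>\<^bsub>tensor_free M N\<^esub> frag_of k2)"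
proof -
  interpret T: abelian_group "tensor C M N" by (rule tensor_abelian_group)
  interpret h: group_hom "tensor_free M N" "add_monoid (tensor C M N)"
      "\<lambda>x. tensor_kernel C M N #>\<^bsub>tensor_free M N\<^esub> x"
    using coset_hom T.a_group
    by (simp add: group_hom_def group_hom_axioms_def tensor_free_def)
  let ?h = "\<lambda>x. tensor_kernel C M N #>\<^bsub>tensor_free M N\<^esub> x"
  let ?r = "frag_of k - frag_of k1 - frag_of k2"
  have r: "?r \<in> carrier (tensor_free M N)" using assms(1) tensor_relators_subset by auto
  have "frag_of k1 + frag_of k2 \<in> carrier (tensor_free M N)"
    using assms(3,4) h.G.m_closed[of "frag_of k1" "frag_of k2"] by (simp add: tensor_free_def)
  then have "?h (?r + (frag_of k1 + frag_of k2)) = ?h ?r \<oplus>\<^bsub>tensor C M N\<^esub> ?h (frag_of k1 + frag_of k2)"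
    using h.hom_mult[OF r, of "frag_of k1 + frag_of k2"] by (simp add: tensor_free_def)
  also have "?h (frag_of k1 + frag_of k2) = ?h (frag_of k1) \<oplus>\<^bsub>tensor C M N\<^esub> ?h (frag_of k2)"
    using h.hom_mult[of "frag_of k1" "frag_of k2"] assms(3,4) by (simp add: tensor_free_def)
  finally show ?thesis
    using h.hom_closed[of "frag_of k1"] h.hom_closed[of "frag_of k2"] assms(3,4)
    by (simp add: coset_relator[OF assms(1), unfolded tensor_free_def] tensor_free_def)
qed

lemma elem_tensor_add_left:
  assumes "m \<in> carrier M" "m' \<in> carrier M" "n \<in> carrier N"
  shows "elem_tensor C M N (m \<oplus>\<^bsub>M\<^esub> m') n
    = elem_tensor C M N m n \<oplus>\<^bsub>tensor C M N\<^esub> elem_tensor C M N m' n"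
  unfolding elem_tensor_def using assms right_module_abelian[OF rm]
  by (intro coset_relator2) (auto simp: tensor_relators_def abelian_groupE(1))

lemma elem_tensor_add_right:
  assumes "m \<in> carrier M" "n \<in> carrier N" "n' \<in> carrier N"
  shows "elem_tensor C M N m (n \<oplus>\<^bsub>N\<^esub> n')
    = elem_tensor C M N m n \<oplus>\<^bsub>tensor C M N\<^esub> elem_tensor C M N m n'"
  unfolding elem_tensor_def using assms left_module_abelian[OF lm]
  by (intro coset_relator2) (auto simp: tensor_relators_def abelian_groupE(1))

lemma elem_tensor_balanced:
  assumes "m \<in> carrier M" "c \<in> carrier C" "n \<in> carrier N"
  shows "elem_tensor C M N (m \<triangleleft>\<^bsub>M\<^esub> c) n = elem_tensor C M N m (c \<odot>\<^bsub>N\<^esub> n)"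
proof -
  interpret T: abelian_group "tensor C M N" by (rule tensor_abelian_group)
  interpret h: group_hom "tensor_free M N" "add_monoid (tensor C M N)"
      "\<lambda>x. tensor_kernel C M N #>\<^bsub>tensor_free M N\<^esub> x"
    using coset_hom T.a_group
    by (simp add: group_hom_def group_hom_axioms_def tensor_free_def)
  let ?h = "\<lambda>x. tensor_kernel C M N #>\<^bsub>tensor_free M N\<^esub> x"
  let ?k = "frag_of (m \<triangleleft>\<^bsub>M\<^esub> c, n)" and ?k' = "frag_of (m, c \<odot>\<^bsub>N\<^esub> n)"
  have rel: "?k - ?k' \<in> tensor_relators C M N"
    using assms by (auto simp: tensor_relators_def)
  have cl: "?k' \<in> carrier (tensor_free M N)" 
    using assms by (simp add: tensor_free_def smult_closed[OF lm])
  have "?h ((?k - ?k') + ?k') = ?h (?k - ?k') \<oplus>\<^bsub>tensor C M N\<^esub> ?h ?k'"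
    using h.hom_mult[of "?k - ?k'" "?k'"] rel tensor_relators_subset cl by (auto simp: tensor_free_def)
  then show ?thesis
    using h.hom_closed[OF cl] by (simp add: coset_relator[OF rel, unfolded tensor_free_def] elem_tensor_def tensor_free_def)
qed

lemma elem_tensor_ahom_left: "n \<in> carrier N \<Longrightarrow> (\<lambda>m. elem_tensor C M N m n) \<in> ahom M (tensor C M N)"
  and elem_tensor_ahom_right: "m \<in> carrier M \<Longrightarrow> (\<lambda>n. elem_tensor C M N m n) \<in> ahom N (tensor C M N)"
  by (simp_all add: ahom_def elem_tensor_closed elem_tensor_add_left elem_tensor_add_right)

lemma tensor_induct [consumes 1, case_names elem add]:
  assumes t: "t \<in> carrier (tensor C M N)"
    and elem: "\<And>m n. m \<in> carrier M \<Longrightarrow> n \<in> carrier N \<Longrightarrow> Q (elem_tensor C M N m n)"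
    and add: "\<And>t t'. t \<in> carrier (tensor C M N) \<Longrightarrow> t' \<in> carrier (tensor C M N) \<Longrightarrow> Q t \<Longrightarrow> Q t' \<Longrightarrow>
       Q (t \<oplus>\<^bsub>tensor C M N\<^esub> t')"
  shows "Q t"
proof -
  interpret T: abelian_group "tensor C M N" by (rule tensor_abelian_group)
  interpret M: abelian_group M using rm by (rule right_module_abelian)
  interpret N: abelian_group N using lm by (rule left_module_abelian)
  interpret h: group_hom "tensor_free M N" "add_monoid (tensor C M N)"
      "\<lambda>x. tensor_kernel C M N #>\<^bsub>tensor_free M N\<^esub> x"
    using coset_hom T.a_group
    by (simp add: group_hom_def group_hom_axioms_def tensor_free_def)
  let ?h = "\<lambda>x. tensor_kernel C M N #>\<^bsub>tensor_free M N\<^esub> x"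
  have zero: "Q \<zero>\<^bsub>tensor C M N\<^esub>"
    using elem[of "\<zero>\<^bsub>M\<^esub>" "\<zero>\<^bsub>N\<^esub>"]
      ahom_zero[OF M.abelian_group_axioms T.abelian_group_axioms elem_tensor_ahom_left[of "\<zero>\<^bsub>N\<^esub>"]]
    by simp
  have neg_elem: "Q (\<ominus>\<^bsub>tensor C M N\<^esub> elem_tensor C M N m n)" if "m \<in> carrier M" "n \<in> carrier N" for m n
    using ahom_neg[OF M.abelian_group_axioms T.abelian_group_axioms elem_tensor_ahom_left[of n], of m]
      elem[of "\<ominus>\<^bsub>M\<^esub> m" n] that by simp
  have "?h x \<in> carrier (tensor C M N) \<and> Q (?h x) \<and> Q (\<ominus>\<^bsub>tensor C M N\<^esub> ?h x)"
    (is "?S x") if "Poly_Mapping.keys x \<subseteq> carrier M \<times> carrier N" for x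
  proof (rule free_Abelian_group_induct[of x "carrier M \<times> carrier N" ?S, OF that])
    show "?S 0" using h.hom_one zero T.add.inv_one by (auto simp: tensor_free_def a_inv_def)
  next
    fix x y assume 2: "Poly_Mapping.keys x \<subseteq> carrier M \<times> carrier N"
      "Poly_Mapping.keys y \<subseteq> carrier M \<times> carrier N" "?S x" "?S y"
    have xy: "x \<in> carrier (tensor_free M N)" "y \<in> carrier (tensor_free M N)"
      using 2 by (auto simp: tensor_free_def)
    have "?h (x - y) = ?h x \<oplus>\<^bsub>tensor C M N\<^esub> \<ominus>\<^bsub>tensor C M N\<^esub> ?h y"
      using h.hom_mult[OF xy(1) h.G.inv_closed[OF xy(2)]] h.hom_inv[OF xy(2)] 2
      by (simp add: tensor_free_def a_inv_def)
    moreover have "Q (?h x \<oplus>\<^bsub>tensor C M N\<^esub> \<ominus>\<^bsub>tensor C M N\<^esub> ?h y)"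
      using 2 by (intro add) auto
    moreover have "Q (\<ominus>\<^bsub>tensor C M N\<^esub> ?h x \<oplus>\<^bsub>tensor C M N\<^esub> ?h y)"
      using 2 by (intro add) auto
    moreover have "\<ominus>\<^bsub>tensor C M N\<^esub> (?h x \<oplus>\<^bsub>tensor C M N\<^esub> \<ominus>\<^bsub>tensor C M N\<^esub> ?h y)
        = \<ominus>\<^bsub>tensor C M N\<^esub> ?h x \<oplus>\<^bsub>tensor C M N\<^esub> ?h y"
      using 2 by (simp add: T.minus_add)
    ultimately show "?S (x - y)"
      using 2 by simp
  next
    fix k assume "k \<in> carrier M \<times> carrier N"
    then show "?S (frag_of k)"
      using elem[of "fst k" "snd k"] neg_elem[of "fst k" "snd k"] elem_tensor_closed[of "fst k" "snd k"]
      by (auto simp: elem_tensor_def)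
  qed
  moreover obtain x where "Poly_Mapping.keys x \<subseteq> carrier M \<times> carrier N" "t = ?h x"
    using t by (auto simp: carrier_tensor carrier_FactGroup tensor_free_def)
  ultimately show ?thesis by blast
qed

lemma tensor_lift_rep:
  assumes P: "abelian_group P" and \<phi>: "balanced C M N P \<phi>"
  obtains h where "h \<in> hom (tensor_free M N) (add_monoid P)"
    and "\<And>x. x \<in> carrier (tensor_free M N) \<Longrightarrow>
      tensor_lift P \<phi> (tensor_kernel C M N #>\<^bsub>tensor_free M N\<^esub> x) = h x"
    and "\<And>m n. m \<in> carrier M \<Longrightarrow> n \<in> carrier N \<Longrightarrow> h (frag_of (m, n)) = \<phi> m n"
proof -
  interpret P: abelian_group P by (rule P)
  interpret M: abelian_group M using rm by (rule right_module_abelian)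
  interpret N: abelian_group N using lm by (rule left_module_abelian)
  have \<phi>l: "(\<lambda>m. \<phi> m n) \<in> ahom M P" if "n \<in> carrier N" for n using \<phi> that by (auto simp: balanced_def)
  have \<phi>r: "\<phi> m \<in> ahom N P" if "m \<in> carrier M" for m using \<phi> that by (auto simp: balanced_def)
  have \<phi>b: "\<phi> (m \<triangleleft>\<^bsub>M\<^esub> c) n = \<phi> m (c \<odot>\<^bsub>N\<^esub> n)"
    if "m \<in> carrier M" "c \<in> carrier C" "n \<in> carrier N" for m c n
    using \<phi> that by (auto simp: balanced_def)
  have cl: "\<phi> m n \<in> carrier P" if "m \<in> carrier M" "n \<in> carrier N" for m n
    using ahom_closed[OF \<phi>r] that by blast
  obtain h where h: "h \<in> hom (tensor_free M N) (add_monoid P)"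
    "\<And>x. x \<in> carrier M \<times> carrier N \<Longrightarrow> h (frag_of x) = \<phi> (fst x) (snd x)"
    unfolding tensor_free_def
    using comm_group.free_Abelian_group_universal[OF P.a_comm_group,
      of "\<lambda>x. \<phi> (fst x) (snd x)" "carrier M \<times> carrier N"] cl
    by (auto simp: image_subset_iff)
  interpret h: group_hom "tensor_free M N" "add_monoid P" h
    using h(1) P.a_group by (simp add: group_hom_def group_hom_axioms_def tensor_free_def)
  have minus: "h (x - y) = h x \<oplus>\<^bsub>P\<^esub> \<ominus>\<^bsub>P\<^esub> h y"
    if "x \<in> carrier (tensor_free M N)" "y \<in> carrier (tensor_free M N)" for x y
    using h.hom_mult[OF that(1) h.G.inv_closed[OF that(2)]] h.hom_inv[OF that(2)] that(2)
    by (simp add: tensor_free_def a_inv_def)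
  have minus': "h (frag_of x - frag_of y) = \<phi> (fst x) (snd x) \<oplus>\<^bsub>P\<^esub> \<ominus>\<^bsub>P\<^esub> \<phi> (fst y) (snd y)"
    if "x \<in> carrier M \<times> carrier N" "y \<in> carrier M \<times> carrier N" for x y
    using that minus[of "frag_of x" "frag_of y"] h(2) by (auto simp: tensor_free_def)
  have cl': "frag_of x - frag_of y \<in> carrier (tensor_free M N)"
    if "x \<in> carrier M \<times> carrier N" "y \<in> carrier M \<times> carrier N" for x y
    using that unfolding tensor_free_def by (auto dest!: subsetD[OF keys_diff])
  have minus'': "h (frag_of x - frag_of y - frag_of z)
      = \<phi> (fst x) (snd x) \<oplus>\<^bsub>P\<^esub> \<ominus>\<^bsub>P\<^esub> \<phi> (fst y) (snd y) \<oplus>\<^bsub>P\<^esub> \<ominus>\<^bsub>P\<^esub> \<phi> (fst z) (snd z)"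
    if "x \<in> carrier M \<times> carrier N" "y \<in> carrier M \<times> carrier N" "z \<in> carrier M \<times> carrier N" for x y z
    using that minus[of "frag_of x - frag_of y" "frag_of z"] cl'[of x y] minus'[of x y] h(2)
    by (auto simp: tensor_free_def)
  have ker: "h r = \<zero>\<^bsub>P\<^esub>" if "r \<in> tensor_relators C M N" for r
    using that unfolding tensor_relators_def
  proof (elim UnE CollectE exE conjE)
    fix m m' n assume *: "r = frag_of (m \<oplus>\<^bsub>M\<^esub> m', n) - frag_of (m, n) - frag_of (m', n)"
      "m \<in> carrier M" "m' \<in> carrier M" "n \<in> carrier N"
    then show ?thesis using ahom_add[OF \<phi>l, of n m m'] cl
      by (simp add: minus'' P.r_neg P.a_ac)
  next
    fix m n n' assume *: "r = frag_of (m, n \<oplus>\<^bsub>N\<^esub> n') - frag_of (m, n) - frag_of (m, n')"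
      "m \<in> carrier M" "n \<in> carrier N" "n' \<in> carrier N"
    then show ?thesis using ahom_add[OF \<phi>r, of m n n'] cl
      by (simp add: minus'' P.r_neg P.a_ac)
  next
    fix m c n assume *: "r = frag_of (m \<triangleleft>\<^bsub>M\<^esub> c, n) - frag_of (m, c \<odot>\<^bsub>N\<^esub> n)"
      "m \<in> carrier M" "c \<in> carrier C" "n \<in> carrier N"
    then show ?thesis using cl \<phi>b rsmult_closed[OF rm] smult_closed[OF lm]
      by (simp add: minus' P.r_neg)
  qed
  have ker: "h k = \<zero>\<^bsub>P\<^esub>" if "k \<in> tensor_kernel C M N" for k
  proof -
    have "subgroup (kernel (tensor_free M N) (add_monoid P) h) (tensor_free M N)"
      by (rule h.subgroup_kernel)
    then have "tensor_kernel C M N \<subseteq> kernel (tensor_free M N) (add_monoid P) h"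
      unfolding tensor_kernel_def using ker tensor_relators_subset
      by (intro group.generate_subgroup_incl) (auto simp: kernel_def)
    then show ?thesis using that by (auto simp: kernel_def)
  qed
  have "tensor_lift P \<phi> (tensor_kernel C M N #>\<^bsub>tensor_free M N\<^esub> x) = h x"
    if x: "x \<in> carrier (tensor_free M N)" for x
  proof -
    let ?t = "tensor_kernel C M N #>\<^bsub>tensor_free M N\<^esub> x"
    let ?y = "SOME y. y \<in> ?t"
    have "x \<in> ?t"
      using group.rcos_self[OF _ x normal_imp_subgroup[OF tensor_kernel_normal]]
      by (auto simp: tensor_free_def)
    then have "?y \<in> ?t" by (rule someI)
    then obtain k where k: "k \<in> tensor_kernel C M N" "?y = k + x"
      by (auto simp: r_coset_def tensor_free_def)
    have kc: "k \<in> carrier (tensor_free M N)"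
      using k(1) normal_imp_subgroup[OF tensor_kernel_normal] subgroup.subset by blast
    have yc: "k + x \<in> carrier (tensor_free M N)" using h.G.m_closed[OF kc x] by (simp add: tensor_free_def)
    have hx: "h (k + x) = h x" using h.hom_mult[OF kc x] ker[OF k(1)] h.hom_closed[OF x]
      by (simp add: tensor_free_def)
    have "tensor_lift P \<phi> ?t = (\<Oplus>\<^bsub>P\<^esub>q\<in>Poly_Mapping.keys (k + x).
        [Poly_Mapping.lookup (k + x) q] \<cdot>\<^bsub>P\<^esub> \<phi> (fst q) (snd q))"
      by (simp add: tensor_lift_def Let_def k(2))
    also have "\<dots> = (\<Oplus>\<^bsub>P\<^esub>q\<in>Poly_Mapping.keys (k + x).
        [Poly_Mapping.lookup (k + x) q] \<cdot>\<^bsub>P\<^esub> h (frag_of q))"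
    proof (rule P.finsum_cong'[OF refl])
      have sub: "Poly_Mapping.keys (k + x) \<subseteq> carrier M \<times> carrier N"
        using yc by (simp add: tensor_free_def)
      have hq: "h (frag_of q) = \<phi> (fst q) (snd q)" "\<phi> (fst q) (snd q) \<in> carrier P"
        if "q \<in> Poly_Mapping.keys (k + x)" for q
        using that subsetD[OF sub that] h(2)[of q] cl[of "fst q" "snd q"] by (auto simp: mem_Times_iff)
      then show "(\<lambda>q. [Poly_Mapping.lookup (k + x) q] \<cdot>\<^bsub>P\<^esub> h (frag_of q))
          \<in> Poly_Mapping.keys (k + x) \<rightarrow> carrier P"
        by (intro funcsetI) simp
      fix q assume "q \<in> Poly_Mapping.keys (k + x)"
      with hq show "[Poly_Mapping.lookup (k + x) q] \<cdot>\<^bsub>P\<^esub> \<phi> (fst q) (snd q)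
          = [Poly_Mapping.lookup (k + x) q] \<cdot>\<^bsub>P\<^esub> h (frag_of q)" by simp
    qed
    also have "\<dots> = h (k + x)"
      using frag_hom_eval[OF P h(1)[unfolded tensor_free_def]] yc by (simp add: tensor_free_def)
    finally show ?thesis using hx by simp
  qed
  then show ?thesis using that[OF h(1)] h(2) by simp
qed

lemma tensor_lift_elem:
  assumes "abelian_group P" "balanced C M N P \<phi>" "m \<in> carrier M" "n \<in> carrier N"
  shows "tensor_lift P \<phi> (elem_tensor C M N m n) = \<phi> m n"
proof -
  obtain h where h: "\<And>x. x \<in> carrier (tensor_free M N) \<Longrightarrow>
      tensor_lift P \<phi> (tensor_kernel C M N #>\<^bsub>tensor_free M N\<^esub> x) = h x"
     "\<And>m n. m \<in> carrier M \<Longrightarrow> n \<in> carrier N \<Longrightarrow> h (frag_of (m, n)) = \<phi> m n"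
    using tensor_lift_rep[OF assms(1,2)] by metis
  show ?thesis using assms(3,4) h(1)[of "frag_of (m, n)"] h(2)
    by (simp add: elem_tensor_def tensor_free_def)
qed

lemma tensor_lift_ahom:
  assumes "abelian_group P" "balanced C M N P \<phi>"
  shows "tensor_lift P \<phi> \<in> ahom (tensor C M N) P"
proof -
  obtain h where h: "h \<in> hom (tensor_free M N) (add_monoid P)"
     "\<And>x. x \<in> carrier (tensor_free M N) \<Longrightarrow>
      tensor_lift P \<phi> (tensor_kernel C M N #>\<^bsub>tensor_free M N\<^esub> x) = h x"
    using tensor_lift_rep[OF assms(1,2)] by metis
  have rep: "\<exists>x\<in>carrier (tensor_free M N). t = tensor_kernel C M N #>\<^bsub>tensor_free M N\<^esub> x"
    if "t \<in> carrier (tensor C M N)" for t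
    using that by (auto simp: carrier_tensor carrier_FactGroup)
  have mc: "x \<otimes>\<^bsub>tensor_free M N\<^esub> y \<in> carrier (tensor_free M N)"
    if "x \<in> carrier (tensor_free M N)" "y \<in> carrier (tensor_free M N)" for x y
    using that group.is_monoid[OF group_free_Abelian_group] monoid.m_closed unfolding tensor_free_def by metis
  show ?thesis
  proof (rule ahomI)
    fix t assume "t \<in> carrier (tensor C M N)"
    with rep h show "tensor_lift P \<phi> t \<in> carrier P" by (fastforce simp: hom_def)
  next
    fix t t' assume t: "t \<in> carrier (tensor C M N)" "t' \<in> carrier (tensor C M N)"
    then obtain x x' where x: "x\<in>carrier (tensor_free M N)" "x'\<in>carrier (tensor_free M N)"
       "t = tensor_kernel C M N #>\<^bsub>tensor_free M N\<^esub> x" "t' = tensor_kernel C M N #>\<^bsub>tensor_free M N\<^esub> x'"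
      using rep by blast
    have "t \<oplus>\<^bsub>tensor C M N\<^esub> t' = tensor_kernel C M N #>\<^bsub>tensor_free M N\<^esub> (x \<otimes>\<^bsub>tensor_free M N\<^esub> x')"
      using coset_hom x by (simp add: hom_def)
    then show "tensor_lift P \<phi> (t \<oplus>\<^bsub>tensor C M N\<^esub> t') = tensor_lift P \<phi> t \<oplus>\<^bsub>P\<^esub> tensor_lift P \<phi> t'"
      using x h mc by (simp add: hom_def)
  qed
qed

lemma tensor_eqI:
  assumes "f \<in> ahom (tensor C M N) P" "g \<in> ahom (tensor C M N) P"
    and "\<And>m n. m \<in> carrier M \<Longrightarrow> n \<in> carrier N \<Longrightarrow> f (elem_tensor C M N m n) = g (elem_tensor C M N m n)"
    and "t \<in> carrier (tensor C M N)"
  shows "f t = g t"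
  using assms(4)
proof (induct t rule: tensor_induct)
  case (add t t')
  then show ?case using assms(1,2) by (simp add: ahom_add)
qed (rule assms(3))

end

section \<open>Bimodule structure and canonical maps of tensor products\<close>

lemma ahom_plus:
  assumes "abelian_group Y" "f \<in> ahom X Y" "g \<in> ahom X Y"
  shows "(\<lambda>x. f x \<oplus>\<^bsub>Y\<^esub> g x) \<in> ahom X Y"
proof -
  interpret Y: abelian_group Y by fact
  show ?thesis
    using assms(2,3) by (intro ahomI) (simp_all add: ahom_closed ahom_add Y.a_ac)
qed

lemma restrict_ahom:
  "abelian_group X \<Longrightarrow> f \<in> ahom X Y \<Longrightarrow> restrict f (carrier X) \<in> ahom X Y"
  by (simp add: ahom_def abelian_groupE(1) Pi_def)

lemma tensor_group_simps [simp]: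
  "carrier (tensor_group C M N) = carrier (tensor C M N)"
  "add (tensor_group C M N) = add (tensor C M N)"
  "ring.zero (tensor_group C M N) = ring.zero (tensor C M N)"
  by (simp_all add: tensor_def Let_def)

lemma ahom_tensor_group: "ahom X (tensor_group C M N) = ahom X (tensor C M N)"
  by (simp add: ahom_def)

lemma abelian_group_cong:
  assumes "abelian_group R" "carrier R' = carrier R" "add R' = add R" "ring.zero R' = ring.zero R"
  shows "abelian_group R'"
proof -
  interpret R: abelian_group R by fact
  show ?thesis
    by (rule abelian_groupI) (simp_all add: assms(2-) R.a_ac R.add.l_inv_ex)
qed

lemma tensor_group_abelian_group:
  "right_module C M \<Longrightarrow> left_module C N \<Longrightarrow> abelian_group (tensor_group C M N)"
  by (rule abelian_group_cong[OF tensor_abelian_group]) auto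

declare tensor_abelian_group [simp] elem_tensor_closed [simp] elem_tensor_ahom_left [simp]
  elem_tensor_ahom_right [simp]

lemmas left_rules = left_module_abelian smult_closed smult_ahom
lemmas right_rules = right_module_abelian rsmult_closed rsmult_ahom

lemma smult_balanced:
  assumes "bimodule A C M" "left_module C N" "a \<in> carrier A"
  shows "balanced C M N (tensor C M N) (\<lambda>m n. elem_tensor C M N (a \<odot>\<^bsub>M\<^esub> m) n)"
proof -
  note [simp] = assms bimodule_left[OF assms(1)] bimodule_right[OF assms(1)]
    left_rules[where A = A] left_rules[where A = C] right_rules[where B = C]
  show ?thesis
    by (intro balancedI ahom_comp[OF smult_ahom[of A M a]])
       (simp_all add: bimodule_commute[symmetric, of A C M] elem_tensor_balanced)
qed

lemma rsmult_balanced: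
  assumes "right_module C M" "bimodule C B N" "b \<in> carrier B"
  shows "balanced C M N (tensor C M N) (\<lambda>m n. elem_tensor C M N m (n \<triangleleft>\<^bsub>N\<^esub> b))"
proof -
  note [simp] = assms bimodule_left[OF assms(2)] bimodule_right[OF assms(2)]
    left_rules[where A = C] right_rules[where B = B] right_rules[where B = C]
  show ?thesis
    by (intro balancedI ahom_comp[OF rsmult_ahom[of B N b]])
       (simp_all add: bimodule_commute[of C B N] elem_tensor_balanced)
qed

lemma balanced_tensor_group:
  "balanced C M N (tensor_group C' M' N') \<phi> = balanced C M N (tensor C' M' N') \<phi>"
  by (simp add: balanced_def ahom_tensor_group)

lemma smult_tensor:
  "smult (tensor C M N) a = tensor_lift (tensor_group C M N) (\<lambda>m n. elem_tensor C M N (a \<odot>\<^bsub>M\<^esub> m) n)"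
  and rsmult_tensor: "rsmult (tensor C M N) t b =
     tensor_lift (tensor_group C M N) (\<lambda>m n. elem_tensor C M N m (n \<triangleleft>\<^bsub>N\<^esub> b)) t"
  by (simp_all add: tensor_def Let_def del: tensor_group_simps)

lemma tensor_smult_elem:
  assumes "bimodule A C M" "left_module C N" "a \<in> carrier A" "m \<in> carrier M" "n \<in> carrier N"
  shows "a \<odot>\<^bsub>tensor C M N\<^esub> elem_tensor C M N m n = elem_tensor C M N (a \<odot>\<^bsub>M\<^esub> m) n"
  unfolding smult_tensor
  by (rule tensor_lift_elem[OF bimodule_right[OF assms(1)] assms(2)
        tensor_group_abelian_group[OF bimodule_right[OF assms(1)] assms(2)] _ assms(4,5)])
     (simp add: balanced_tensor_group smult_balanced[OF assms(1-3)])

lemma tensor_rsmult_elem: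
  assumes "right_module C M" "bimodule C B N" "b \<in> carrier B" "m \<in> carrier M" "n \<in> carrier N"
  shows "elem_tensor C M N m n \<triangleleft>\<^bsub>tensor C M N\<^esub> b = elem_tensor C M N m (n \<triangleleft>\<^bsub>N\<^esub> b)"
  unfolding rsmult_tensor
  by (rule tensor_lift_elem[OF assms(1) bimodule_left[OF assms(2)]
        tensor_group_abelian_group[OF assms(1) bimodule_left[OF assms(2)]] _ assms(4,5)])
     (simp add: balanced_tensor_group rsmult_balanced[OF assms(1-3)])

lemma tensor_smult_ahom:
  assumes "bimodule A C M" "left_module C N" "a \<in> carrier A"
  shows "(\<lambda>t. a \<odot>\<^bsub>tensor C M N\<^esub> t) \<in> ahom (tensor C M N) (tensor C M N)"
  using assms tensor_lift_ahom[OF bimodule_right[OF assms(1)] assms(2)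
      tensor_group_abelian_group[OF bimodule_right[OF assms(1)] assms(2)]] smult_balanced[OF assms]
  by (simp add: smult_tensor balanced_tensor_group ahom_tensor_group)

lemma tensor_rsmult_ahom:
  assumes "right_module C M" "bimodule C B N" "b \<in> carrier B"
  shows "(\<lambda>t. t \<triangleleft>\<^bsub>tensor C M N\<^esub> b) \<in> ahom (tensor C M N) (tensor C M N)"
  using assms tensor_lift_ahom[OF assms(1) bimodule_left[OF assms(2)]
      tensor_group_abelian_group[OF assms(1) bimodule_left[OF assms(2)]]] rsmult_balanced[OF assms]
  by (simp add: rsmult_tensor balanced_tensor_group ahom_tensor_group)

lemmas tensor_left_rules = left_rules tensor_smult_elem tensor_smult_ahom
lemmas tensor_right_rules = right_rules tensor_rsmult_elem tensor_rsmult_ahom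

lemma smult_add_left: "left_module A M \<Longrightarrow> a \<in> carrier A \<Longrightarrow> a' \<in> carrier A \<Longrightarrow> m \<in> carrier M \<Longrightarrow>
    (a \<oplus>\<^bsub>A\<^esub> a') \<odot>\<^bsub>M\<^esub> m = a \<odot>\<^bsub>M\<^esub> m \<oplus>\<^bsub>M\<^esub> a' \<odot>\<^bsub>M\<^esub> m"
  by (auto simp: left_module_def)

lemma rsmult_add_right: "right_module B M \<Longrightarrow> b \<in> carrier B \<Longrightarrow> b' \<in> carrier B \<Longrightarrow> m \<in> carrier M \<Longrightarrow>
    m \<triangleleft>\<^bsub>M\<^esub> (b \<oplus>\<^bsub>B\<^esub> b') = m \<triangleleft>\<^bsub>M\<^esub> b \<oplus>\<^bsub>M\<^esub> m \<triangleleft>\<^bsub>M\<^esub> b'"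
  by (auto simp: right_module_def)

lemma left_moduleI:
  assumes "abelian_group M" "\<And>a. a \<in> carrier A \<Longrightarrow> (\<lambda>m. a \<odot>\<^bsub>M\<^esub> m) \<in> ahom M M"
    "\<And>a a' m. a \<in> carrier A \<Longrightarrow> a' \<in> carrier A \<Longrightarrow> m \<in> carrier M \<Longrightarrow>
       (a \<oplus>\<^bsub>A\<^esub> a') \<odot>\<^bsub>M\<^esub> m = a \<odot>\<^bsub>M\<^esub> m \<oplus>\<^bsub>M\<^esub> a' \<odot>\<^bsub>M\<^esub> m"
    "\<And>a a' m. a \<in> carrier A \<Longrightarrow> a' \<in> carrier A \<Longrightarrow> m \<in> carrier M \<Longrightarrow>
       (a \<otimes>\<^bsub>A\<^esub> a') \<odot>\<^bsub>M\<^esub> m = a \<odot>\<^bsub>M\<^esub> (a' \<odot>\<^bsub>M\<^esub> m)"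
  shows "left_module A M"
  using assms by (auto simp: left_module_def ahom_def)

lemma right_moduleI:
  assumes "abelian_group M" "\<And>b. b \<in> carrier B \<Longrightarrow> (\<lambda>m. m \<triangleleft>\<^bsub>M\<^esub> b) \<in> ahom M M"
    "\<And>b b' m. b \<in> carrier B \<Longrightarrow> b' \<in> carrier B \<Longrightarrow> m \<in> carrier M \<Longrightarrow>
       m \<triangleleft>\<^bsub>M\<^esub> (b \<oplus>\<^bsub>B\<^esub> b') = m \<triangleleft>\<^bsub>M\<^esub> b \<oplus>\<^bsub>M\<^esub> m \<triangleleft>\<^bsub>M\<^esub> b'"
    "\<And>b b' m. b \<in> carrier B \<Longrightarrow> b' \<in> carrier B \<Longrightarrow> m \<in> carrier M \<Longrightarrow>
       m \<triangleleft>\<^bsub>M\<^esub> (b \<otimes>\<^bsub>B\<^esub> b') = (m \<triangleleft>\<^bsub>M\<^esub> b) \<triangleleft>\<^bsub>M\<^esub> b'"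
  shows "right_module B M"
  using assms by (auto simp: right_module_def ahom_def)

lemma tensor_left_module [simp]:
  assumes "bimodule A C M" "left_module C N" "nonunital_ring A"
  shows "left_module A (tensor C M N)"
proof (rule left_moduleI)
  have A: "abelian_group A" "\<And>a a'. a \<in> carrier A \<Longrightarrow> a' \<in> carrier A \<Longrightarrow> a \<otimes>\<^bsub>A\<^esub> a' \<in> carrier A"
    using assms(3) by (auto simp: nonunital_ring_def)
  note [simp] = assms bimodule_right[OF assms(1)] bimodule_left[OF assms(1)]
    tensor_left_rules[where A = A]
  show "abelian_group (tensor C M N)" by simp
  show sm: "(\<lambda>m. a \<odot>\<^bsub>tensor C M N\<^esub> m) \<in> ahom (tensor C M N) (tensor C M N)" if "a \<in> carrier A" for a
    using that by (simp add: tensor_smult_ahom)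
  fix a a' t assume a: "a \<in> carrier A" "a' \<in> carrier A" and t: "t \<in> carrier (tensor C M N)"
  have aa: "a \<oplus>\<^bsub>A\<^esub> a' \<in> carrier A" "a \<otimes>\<^bsub>A\<^esub> a' \<in> carrier A"
    using a A by (simp_all add: abelian_groupE(1))
  note T = \<open>abelian_group (tensor C M N)\<close>
  show "(a \<oplus>\<^bsub>A\<^esub> a') \<odot>\<^bsub>tensor C M N\<^esub> t = a \<odot>\<^bsub>tensor C M N\<^esub> t \<oplus>\<^bsub>tensor C M N\<^esub> a' \<odot>\<^bsub>tensor C M N\<^esub> t"
    by (rule tensor_eqI[OF _ _ sm[OF aa(1)] ahom_plus[OF T sm[OF a(1)] sm[OF a(2)]] _ t])
       (use a aa in \<open>simp_all add: smult_add_left[of A] elem_tensor_add_left\<close>)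
  show "(a \<otimes>\<^bsub>A\<^esub> a') \<odot>\<^bsub>tensor C M N\<^esub> t = a \<odot>\<^bsub>tensor C M N\<^esub> (a' \<odot>\<^bsub>tensor C M N\<^esub> t)"
    by (rule tensor_eqI[OF _ _ sm[OF aa(2)] ahom_comp[OF sm[OF a(2)] sm[OF a(1)]] _ t])
       (use a aa in \<open>simp_all add: smult_smult[of A]\<close>)
qed

lemma tensor_right_module [simp]:
  assumes "right_module C M" "bimodule C B N" "nonunital_ring B"
  shows "right_module B (tensor C M N)"
proof (rule right_moduleI)
  have B: "abelian_group B" "\<And>a a'. a \<in> carrier B \<Longrightarrow> a' \<in> carrier B \<Longrightarrow> a \<otimes>\<^bsub>B\<^esub> a' \<in> carrier B"
    using assms(3) by (auto simp: nonunital_ring_def)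
  note [simp] = assms bimodule_right[OF assms(2)] bimodule_left[OF assms(2)]
    tensor_right_rules[where B = B]
  show "abelian_group (tensor C M N)" by simp
  show sm: "(\<lambda>m. m \<triangleleft>\<^bsub>tensor C M N\<^esub> b) \<in> ahom (tensor C M N) (tensor C M N)" if "b \<in> carrier B" for b
    using that by (simp add: tensor_rsmult_ahom)
  fix b b' t assume b: "b \<in> carrier B" "b' \<in> carrier B" and t: "t \<in> carrier (tensor C M N)"
  have bb: "b \<oplus>\<^bsub>B\<^esub> b' \<in> carrier B" "b \<otimes>\<^bsub>B\<^esub> b' \<in> carrier B"
    using b B by (simp_all add: abelian_groupE(1))
  note T = \<open>abelian_group (tensor C M N)\<close>
  show "t \<triangleleft>\<^bsub>tensor C M N\<^esub> (b \<oplus>\<^bsub>B\<^esub> b') = t \<triangleleft>\<^bsub>tensor C M N\<^esub> b \<oplus>\<^bsub>tensor C M N\<^esub> t \<triangleleft>\<^bsub>tensor C M N\<^esub> b'"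
    by (rule tensor_eqI[OF _ _ sm[OF bb(1)] ahom_plus[OF T sm[OF b(1)] sm[OF b(2)]] _ t])
       (use b bb in \<open>simp_all add: rsmult_add_right[of B] elem_tensor_add_right\<close>)
  show "t \<triangleleft>\<^bsub>tensor C M N\<^esub> (b \<otimes>\<^bsub>B\<^esub> b') = t \<triangleleft>\<^bsub>tensor C M N\<^esub> b \<triangleleft>\<^bsub>tensor C M N\<^esub> b'"
    by (rule tensor_eqI[OF _ _ sm[OF bb(2)] ahom_comp[OF sm[OF b(1)] sm[OF b(2)]] _ t])
       (use b bb in \<open>simp_all add: rsmult_rsmult[of B]\<close>)
qed

lemma tensor_bimodule [simp]:
  assumes "bimodule A C M" "bimodule C B N" "nonunital_ring A" "nonunital_ring B"
  shows "bimodule A B (tensor C M N)"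
  unfolding bimodule_def
proof (intro conjI ballI)
  note [simp] = assms bimodule_right[OF assms(1)] bimodule_left[OF assms(1)]
    bimodule_right[OF assms(2)] bimodule_left[OF assms(2)]
    tensor_left_rules[where A = A] tensor_right_rules[where B = B]
  show "left_module A (tensor C M N)" "right_module B (tensor C M N)" by simp_all
  fix a t b assume *: "a \<in> carrier A" "t \<in> carrier (tensor C M N)" "b \<in> carrier B"
  show "a \<odot>\<^bsub>tensor C M N\<^esub> t \<triangleleft>\<^bsub>tensor C M N\<^esub> b = a \<odot>\<^bsub>tensor C M N\<^esub> (t \<triangleleft>\<^bsub>tensor C M N\<^esub> b)"
    by (rule tensor_eqI[of C M N _ "tensor C M N", OF _ _
        ahom_comp[OF tensor_smult_ahom tensor_rsmult_ahom]
        ahom_comp[OF tensor_rsmult_ahom tensor_smult_ahom]])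
      (use * in \<open>simp_all\<close>)
qed

lemma tensor3_eqI_left:
  assumes "right_module C M" "bimodule C D N" "left_module D P" "nonunital_ring D"
    and f: "f \<in> ahom (tensor D (tensor C M N) P) Q" and g: "g \<in> ahom (tensor D (tensor C M N) P) Q"
    and eq: "\<And>m n p. m \<in> carrier M \<Longrightarrow> n \<in> carrier N \<Longrightarrow> p \<in> carrier P \<Longrightarrow>
       f (elem_tensor D (tensor C M N) P (elem_tensor C M N m n) p) =
       g (elem_tensor D (tensor C M N) P (elem_tensor C M N m n) p)"
    and t: "t \<in> carrier (tensor D (tensor C M N) P)"
  shows "f t = g t"
proof (rule tensor_eqI[OF _ _ f g _ t])
  note [simp] = assms(1-4) bimodule_left[OF assms(2)]
  show "right_module D (tensor C M N)" "left_module D P" by simp_all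
  fix u p assume u: "u \<in> carrier (tensor C M N)" and p: "p \<in> carrier P"
  show "f (elem_tensor D (tensor C M N) P u p) = g (elem_tensor D (tensor C M N) P u p)"
    by (rule tensor_eqI[of C M N _ Q, OF _ _ ahom_comp[OF elem_tensor_ahom_left f]
          ahom_comp[OF elem_tensor_ahom_left g]])
      (use u p in \<open>simp_all add: eq\<close>)
qed

lemma tensor3_eqI_right:
  assumes "right_module C M" "bimodule C D N" "left_module D P" "nonunital_ring C"
    and f: "f \<in> ahom (tensor C M (tensor D N P)) Q" and g: "g \<in> ahom (tensor C M (tensor D N P)) Q"
    and eq: "\<And>m n p. m \<in> carrier M \<Longrightarrow> n \<in> carrier N \<Longrightarrow> p \<in> carrier P \<Longrightarrow>
       f (elem_tensor C M (tensor D N P) m (elem_tensor D N P n p)) =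
       g (elem_tensor C M (tensor D N P) m (elem_tensor D N P n p))"
    and t: "t \<in> carrier (tensor C M (tensor D N P))"
  shows "f t = g t"
proof (rule tensor_eqI[OF _ _ f g _ t])
  note [simp] = assms(1-4) bimodule_right[OF assms(2)]
  show "left_module C (tensor D N P)" "right_module C M" by simp_all
  fix u m assume u: "u \<in> carrier (tensor D N P)" and m: "m \<in> carrier M"
  show "f (elem_tensor C M (tensor D N P) m u) = g (elem_tensor C M (tensor D N P) m u)"
    by (rule tensor_eqI[of D N P _ Q, OF _ _ ahom_comp[OF elem_tensor_ahom_right f]
          ahom_comp[OF elem_tensor_ahom_right g]])
      (use u m in \<open>simp_all add: eq\<close>)
qed

subsection \<open>Functoriality\<close>

lemma tensor_map_balanced:
  assumes "right_module C M'" "left_module C N'" "f \<in> right_hom C M M'" "g \<in> left_hom C N N'"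
  shows "balanced C M N (tensor C M' N') (\<lambda>m n. elem_tensor C M' N' (f m) (g n))"
  using assms
  by (intro balancedI ahom_comp[OF right_hom_ahom[OF assms(3)]] ahom_comp[OF left_hom_ahom[OF assms(4)]])
     (simp_all add: right_hom_closed left_hom_closed right_hom_rsmult left_hom_smult elem_tensor_balanced)

context
  fixes C :: "'c ring" and M :: "('a, 'c, 'm) bimod" and N :: "('c, 'b, 'n) bimod"
    and M' :: "('a', 'c, 'm') bimod" and N' :: "('c, 'b', 'n') bimod" and f g
  assumes MN: "right_module C M" "left_module C N" "right_module C M'" "left_module C N'"
    and fg: "f \<in> right_hom C M M'" "g \<in> left_hom C N N'"
begin

lemma tensor_map_elem [simp]: "m \<in> carrier M \<Longrightarrow> n \<in> carrier N \<Longrightarrow>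
    tensor_map C M N M' N' f g (elem_tensor C M N m n) = elem_tensor C M' N' (f m) (g n)"
  using MN fg by (simp add: tensor_map_def tensor_lift_elem[OF _ _ _ tensor_map_balanced])

lemma tensor_map_ahom [simp]: "tensor_map C M N M' N' f g \<in> ahom (tensor C M N) (tensor C M' N')"
  using MN fg by (simp add: tensor_map_def restrict_ahom tensor_lift_ahom[OF _ _ _ tensor_map_balanced])

lemma tensor_map_closed [simp]:
  "t \<in> carrier (tensor C M N) \<Longrightarrow> tensor_map C M N M' N' f g t \<in> carrier (tensor C M' N')"
  by (rule ahom_closed[OF tensor_map_ahom])

end

lemma tensor_map_extensional [simp]: "tensor_map C M N M' N' f g \<in> extensional (carrier (tensor C M N))"
  by (simp add: tensor_map_def)

lemma tensor_map_left_hom [simp]: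
  assumes "bimodule A C M" "left_module C N" "bimodule A C M'" "left_module C N'"
    "f \<in> bimod_hom A C M M'" "g \<in> left_hom C N N'"
  shows "tensor_map C M N M' N' f g \<in> left_hom A (tensor C M N) (tensor C M' N')"
  unfolding left_hom_iff
proof (intro conjI ballI)
  note [simp] = assms bimodule_right[OF assms(1)] bimodule_right[OF assms(3)]
    bimodule_left[OF assms(1)] bimodule_left[OF assms(3)] bimod_hom_right[OF assms(5)] bimod_hom_left[OF assms(5)]
    tensor_left_rules[where A = A]
  show F: "tensor_map C M N M' N' f g \<in> ahom (tensor C M N) (tensor C M' N')" by simp
  fix a t assume at: "a \<in> carrier A" "t \<in> carrier (tensor C M N)"
  show "tensor_map C M N M' N' f g (a \<odot>\<^bsub>tensor C M N\<^esub> t)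
      = a \<odot>\<^bsub>tensor C M' N'\<^esub> tensor_map C M N M' N' f g t"
    by (rule tensor_eqI[of C M N _ "tensor C M' N'", OF _ _ ahom_comp[OF tensor_smult_ahom F] ahom_comp[OF F tensor_smult_ahom]])
       (use at in \<open>simp_all add: bimod_hom_closed[OF assms(5)] left_hom_closed[OF assms(6)]
          left_hom_smult[OF bimod_hom_left[OF assms(5)]]\<close>)
qed simp

lemma tensor_map_right_hom [simp]:
  assumes "right_module C M" "bimodule C B N" "right_module C M'" "bimodule C B N'"
    "f \<in> right_hom C M M'" "g \<in> bimod_hom C B N N'"
  shows "tensor_map C M N M' N' f g \<in> right_hom B (tensor C M N) (tensor C M' N')"
  unfolding right_hom_iff
proof (intro conjI ballI)
  note [simp] = assms bimodule_right[OF assms(2)] bimodule_right[OF assms(4)]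
    bimodule_left[OF assms(2)] bimodule_left[OF assms(4)] bimod_hom_right[OF assms(6)] bimod_hom_left[OF assms(6)]
    tensor_right_rules[where B = B]
  show F: "tensor_map C M N M' N' f g \<in> ahom (tensor C M N) (tensor C M' N')" by simp
  fix b t assume at: "b \<in> carrier B" "t \<in> carrier (tensor C M N)"
  show "tensor_map C M N M' N' f g (t \<triangleleft>\<^bsub>tensor C M N\<^esub> b)
      = tensor_map C M N M' N' f g t \<triangleleft>\<^bsub>tensor C M' N'\<^esub> b"
    by (rule tensor_eqI[of C M N _ "tensor C M' N'", OF _ _ ahom_comp[OF tensor_rsmult_ahom F] ahom_comp[OF F tensor_rsmult_ahom]])
       (use at in \<open>simp_all add: bimod_hom_closed[OF assms(6)] right_hom_closed[OF assms(5)]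
          right_hom_rsmult[OF bimod_hom_right[OF assms(6)]]\<close>)
qed simp

lemma tensor_map_bimod_hom [simp]:
  assumes "bimodule A C M" "bimodule C B N" "bimodule A C M'" "bimodule C B N'"
    "f \<in> bimod_hom A C M M'" "g \<in> bimod_hom C B N N'"
  shows "tensor_map C M N M' N' f g \<in> bimod_hom A B (tensor C M N) (tensor C M' N')"
  using assms bimodule_left[OF assms(2)] bimodule_left[OF assms(4)] bimodule_right[OF assms(1)]
     bimodule_right[OF assms(3)] bimod_hom_right[OF assms(5)] bimod_hom_left[OF assms(6)]
  by (simp add: bimod_hom_iff[of _ A B])

lemma ident_left_hom [simp]: "left_module A M \<Longrightarrow> ident M \<in> left_hom A M M"
  and ident_right_hom [simp]: "right_module B N \<Longrightarrow> ident N \<in> right_hom B N N"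
  by (simp_all add: left_rules[where A = A] right_rules[where B = B] left_hom_iff right_hom_iff restrict_ahom ahom_ident)

lemma ident_bimod_hom [simp]: "bimodule A B M \<Longrightarrow> ident M \<in> bimod_hom A B M M"
  by (simp add: bimod_hom_iff bimodule_left bimodule_right)

lemma left_hom_comp:
  "f \<in> left_hom A X Y \<Longrightarrow> g \<in> left_hom A Y Z \<Longrightarrow> left_module A X \<Longrightarrow> (\<lambda>x\<in>carrier X. g (f x)) \<in> left_hom A X Z"
  by (auto simp: left_rules[where A = A] left_hom_iff restrict_ahom ahom_comp ahom_closed)

lemma right_hom_comp:
  "f \<in> right_hom A X Y \<Longrightarrow> g \<in> right_hom A Y Z \<Longrightarrow> right_module A X \<Longrightarrow> (\<lambda>x\<in>carrier X. g (f x)) \<in> right_hom A X Z"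
  by (auto simp: right_rules[where B = A] right_hom_iff restrict_ahom ahom_comp ahom_closed)

lemma bimod_hom_comp:
  "f \<in> bimod_hom A B X Y \<Longrightarrow> g \<in> bimod_hom A B Y Z \<Longrightarrow> bimodule A B X \<Longrightarrow>
     (\<lambda>x\<in>carrier X. g (f x)) \<in> bimod_hom A B X Z"
  unfolding bimod_hom_iff by (blast intro: left_hom_comp right_hom_comp bimodule_left bimodule_right)

definition hom_inv :: "('a, 'b, 'm) bimod \<Rightarrow> ('c, 'd, 'n) bimod \<Rightarrow> ('m \<Rightarrow> 'n) \<Rightarrow> 'n \<Rightarrow> 'm" where
  "hom_inv M N f = (\<lambda>y\<in>carrier N. inv_into (carrier M) f y)"

lemma hom_inv_left [simp]:
  "bij_betw f (carrier M) (carrier N) \<Longrightarrow> x \<in> carrier M \<Longrightarrow> hom_inv M N f (f x) = x"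
  by (auto simp: hom_inv_def bij_betw_def)

lemma hom_inv_right [simp]:
  "bij_betw f (carrier M) (carrier N) \<Longrightarrow> y \<in> carrier N \<Longrightarrow> f (hom_inv M N f y) = y"
  by (auto simp: hom_inv_def bij_betw_def f_inv_into_f)

lemma hom_inv_closed [simp]:
  "bij_betw f (carrier M) (carrier N) \<Longrightarrow> y \<in> carrier N \<Longrightarrow> hom_inv M N f y \<in> carrier M"
  by (auto simp: hom_inv_def bij_betw_def inv_into_into)

lemma hom_inv_bij: "bij_betw f (carrier M) (carrier N) \<Longrightarrow> bij_betw (hom_inv M N f) (carrier N) (carrier M)"
  by (rule bij_betw_byWitness[where f' = f]) (auto dest: bij_betwE)

lemma hom_inv_ahom:
  assumes "f \<in> ahom M N" "bij_betw f (carrier M) (carrier N)" "abelian_group M"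
  shows "hom_inv M N f \<in> ahom N M"
proof (rule ahomI)
  fix y y' assume y: "y \<in> carrier N" "y' \<in> carrier N"
  let ?g = "hom_inv M N f"
  have g: "?g y \<in> carrier M" "?g y' \<in> carrier M" "f (?g y) = y" "f (?g y') = y'"
    using y assms(2) by simp_all
  have gg: "?g y \<oplus>\<^bsub>M\<^esub> ?g y' \<in> carrier M"
    by (rule abelian_groupE(1)[OF assms(3) g(1,2)])
  have "f (?g y \<oplus>\<^bsub>M\<^esub> ?g y') = y \<oplus>\<^bsub>N\<^esub> y'"
    using ahom_add[OF assms(1) g(1,2)] g by simp
  then show "?g (y \<oplus>\<^bsub>N\<^esub> y') = ?g y \<oplus>\<^bsub>M\<^esub> ?g y'"
    using hom_inv_left[OF assms(2) gg] by simp
qed (simp add: assms(2))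

lemma hom_inv_left_hom:
  assumes "f \<in> left_hom A M N" "bij_betw f (carrier M) (carrier N)" "left_module A M"
  shows "hom_inv M N f \<in> left_hom A N M"
  unfolding left_hom_iff
proof (intro conjI ballI)
  show "hom_inv M N f \<in> ahom N M" using assms by (blast intro: hom_inv_ahom left_hom_ahom left_module_abelian)
  fix a y assume "a \<in> carrier A" "y \<in> carrier N"
  then show "hom_inv M N f (a \<odot>\<^bsub>N\<^esub> y) = a \<odot>\<^bsub>M\<^esub> hom_inv M N f y"
    using assms left_hom_smult[OF assms(1), of a "hom_inv M N f y"]
      hom_inv_left[OF assms(2), of "a \<odot>\<^bsub>M\<^esub> hom_inv M N f y"]
    by (simp add: smult_closed[of A])
qed (simp add: hom_inv_def)

lemma hom_inv_right_hom:
  assumes "f \<in> right_hom A M N" "bij_betw f (carrier M) (carrier N)" "right_module A M"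
  shows "hom_inv M N f \<in> right_hom A N M"
  unfolding right_hom_iff
proof (intro conjI ballI)
  show "hom_inv M N f \<in> ahom N M" using assms by (blast intro: hom_inv_ahom right_hom_ahom right_module_abelian)
  fix a y assume "a \<in> carrier A" "y \<in> carrier N"
  then show "hom_inv M N f (y \<triangleleft>\<^bsub>N\<^esub> a) = hom_inv M N f y \<triangleleft>\<^bsub>M\<^esub> a"
    using assms right_hom_rsmult[OF assms(1), of a "hom_inv M N f y"]
      hom_inv_left[OF assms(2), of "hom_inv M N f y \<triangleleft>\<^bsub>M\<^esub> a"]
    by (simp add: rsmult_closed[of A])
qed (simp add: hom_inv_def)

lemma hom_inv_bimod_hom:
  "f \<in> bimod_hom A B M N \<Longrightarrow> bij_betw f (carrier M) (carrier N) \<Longrightarrow> bimodule A B M \<Longrightarrow>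
     hom_inv M N f \<in> bimod_hom A B N M"
  unfolding bimod_hom_iff
  by (blast intro: hom_inv_left_hom hom_inv_right_hom bimodule_left bimodule_right)

lemma tensor_map_bij:
  assumes "right_module C M" "left_module C N" "right_module C M'" "left_module C N'"
    "f \<in> right_hom C M M'" "g \<in> left_hom C N N'"
    "bij_betw f (carrier M) (carrier M')" "bij_betw g (carrier N) (carrier N')"
  shows "bij_betw (tensor_map C M N M' N' f g) (carrier (tensor C M N)) (carrier (tensor C M' N'))"
proof (rule bij_betw_byWitness[where f' = "tensor_map C M' N' M N (hom_inv M M' f) (hom_inv N N' g)"])
  note [simp] = assms hom_inv_right_hom[OF assms(5,7,1)] hom_inv_left_hom[OF assms(6,8,2)]
    right_hom_closed[OF assms(5)] left_hom_closed[OF assms(6)]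
  show "\<forall>t\<in>carrier (tensor C M N). tensor_map C M' N' M N (hom_inv M M' f) (hom_inv N N' g)
      (tensor_map C M N M' N' f g t) = t"
    by (intro ballI, rule tensor_eqI[of C M N _ "tensor C M N", OF _ _ ahom_comp[OF tensor_map_ahom tensor_map_ahom] ahom_ident])
       simp_all
  show "\<forall>t\<in>carrier (tensor C M' N'). tensor_map C M N M' N' f g
      (tensor_map C M' N' M N (hom_inv M M' f) (hom_inv N N' g) t) = t"
    by (intro ballI, rule tensor_eqI[of C M' N' _ "tensor C M' N'", OF _ _ ahom_comp[OF tensor_map_ahom tensor_map_ahom] ahom_ident])
       simp_all
qed (use assms hom_inv_right_hom[OF assms(5,7,1)] hom_inv_left_hom[OF assms(6,8,2)] in auto)

subsection \<open>Associativity\<close>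

context
  fixes C :: "'c ring" and D :: "'d ring" and M :: "('a, 'c, 'm) bimod" and N :: "('c, 'd, 'n) bimod"
    and P :: "('d, 'b, 'p) bimod"
  assumes M: "right_module C M" and N: "bimodule C D N" and P: "left_module D P"
    and C: "nonunital_ring C" and D: "nonunital_ring D"
begin

private abbreviation (input) "MN_P \<equiv> tensor D (tensor C M N) P"
private abbreviation (input) "M_NP \<equiv> tensor C M (tensor D N P)"

lemma assoc_elem: "m \<in> carrier M \<Longrightarrow> n \<in> carrier N \<Longrightarrow> p \<in> carrier P \<Longrightarrow>
    assoc C D M N P (elem_tensor D (tensor C M N) P (elem_tensor C M N m n) p)
      = elem_tensor C M (tensor D N P) m (elem_tensor D N P n p)"
  and assoc_ahom: "assoc C D M N P \<in> ahom MN_P M_NP"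
proof -
  note [simp] = M N P C D bimodule_left[OF N] bimodule_right[OF N]
    tensor_left_rules[where A = C] tensor_left_rules[where A = D]
    tensor_right_rules[where B = C] tensor_right_rules[where B = D]
  let ?L = "\<lambda>p. tensor_lift M_NP
     (\<lambda>m n. elem_tensor C M (tensor D N P) m (elem_tensor D N P n p))"
  have bal: "balanced C M N M_NP (\<lambda>m n. elem_tensor C M (tensor D N P) m (elem_tensor D N P n p))"
    if "p \<in> carrier P" for p
    using that
    by (intro balancedI ahom_comp[OF elem_tensor_ahom_left elem_tensor_ahom_right])
       (simp_all add: elem_tensor_balanced)
  have L: "?L p \<in> ahom (tensor C M N) M_NP" if "p \<in> carrier P" for p
    using that by (simp add: tensor_lift_ahom bal)
  have Le: "?L p (elem_tensor C M N m n) = elem_tensor C M (tensor D N P) m (elem_tensor D N P n p)"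
    if "m \<in> carrier M" "n \<in> carrier N" "p \<in> carrier P" for m n p
    using that by (simp add: tensor_lift_elem bal)
  have bal2: "balanced D (tensor C M N) P M_NP (\<lambda>u p. ?L p u)"
  proof (intro balancedI L)
    fix u assume u: "u \<in> carrier (tensor C M N)"
    show "(\<lambda>p. ?L p u) \<in> ahom P M_NP"
    proof (rule ahomI)
      fix p p' assume p: "p \<in> carrier P" "p' \<in> carrier P"
      then have pp: "p \<oplus>\<^bsub>P\<^esub> p' \<in> carrier P" by (simp add: abelian_groupE(1) left_module_abelian[OF P])
      show "?L (p \<oplus>\<^bsub>P\<^esub> p') u = ?L p u \<oplus>\<^bsub>M_NP\<^esub> ?L p' u"
        by (rule tensor_eqI[OF _ _ L[OF pp] ahom_plus[OF _ L[OF p(1)] L[OF p(2)]] _ u])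
           (use p pp in \<open>simp_all add: Le elem_tensor_add_right\<close>)
    qed (rule ahom_closed[OF L u])
  next
    fix u d p assume u: "u \<in> carrier (tensor C M N)" and d: "d \<in> carrier D" and p: "p \<in> carrier P"
    have dp: "d \<odot>\<^bsub>P\<^esub> p \<in> carrier P" using d p by simp
    show "?L p (u \<triangleleft>\<^bsub>tensor C M N\<^esub> d) = ?L (d \<odot>\<^bsub>P\<^esub> p) u"
      by (rule tensor_eqI[OF _ _ ahom_comp[OF tensor_rsmult_ahom[OF M N d] L[OF p]] L[OF dp] _ u])
         (use p d dp in \<open>simp_all add: Le elem_tensor_balanced\<close>)
  qed
  show "assoc C D M N P \<in> ahom MN_P M_NP"
    unfolding assoc_def by (intro restrict_ahom tensor_lift_ahom bal2) simp_all
  show "m \<in> carrier M \<Longrightarrow> n \<in> carrier N \<Longrightarrow> p \<in> carrier P \<Longrightarrow>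
    assoc C D M N P (elem_tensor D (tensor C M N) P (elem_tensor C M N m n) p)
      = elem_tensor C M (tensor D N P) m (elem_tensor D N P n p)"
    by (simp add: assoc_def tensor_lift_elem[OF _ _ _ bal2] Le)
qed

lemma assoc_inv_elem: "m \<in> carrier M \<Longrightarrow> n \<in> carrier N \<Longrightarrow> p \<in> carrier P \<Longrightarrow>
    assoc_inv C D M N P (elem_tensor C M (tensor D N P) m (elem_tensor D N P n p))
      = elem_tensor D (tensor C M N) P (elem_tensor C M N m n) p"
  and assoc_inv_ahom: "assoc_inv C D M N P \<in> ahom M_NP MN_P"
proof -
  note [simp] = M N P C D bimodule_left[OF N] bimodule_right[OF N]
    tensor_left_rules[where A = C] tensor_left_rules[where A = D]
    tensor_right_rules[where B = C] tensor_right_rules[where B = D]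
  let ?L = "\<lambda>m. tensor_lift MN_P
     (\<lambda>n p. elem_tensor D (tensor C M N) P (elem_tensor C M N m n) p)"
  have bal: "balanced D N P MN_P (\<lambda>n p. elem_tensor D (tensor C M N) P (elem_tensor C M N m n) p)"
    if "m \<in> carrier M" for m
    using that
    by (intro balancedI ahom_comp[OF elem_tensor_ahom_right elem_tensor_ahom_left])
       (simp_all add: elem_tensor_balanced[symmetric])
  have L: "?L m \<in> ahom (tensor D N P) MN_P" if "m \<in> carrier M" for m
    using that by (simp add: tensor_lift_ahom bal)
  have Le: "?L m (elem_tensor D N P n p) = elem_tensor D (tensor C M N) P (elem_tensor C M N m n) p"
    if "m \<in> carrier M" "n \<in> carrier N" "p \<in> carrier P" for m n p
    using that by (simp add: tensor_lift_elem bal)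
  have bal2: "balanced C M (tensor D N P) MN_P ?L"
  proof (rule balancedI)
    fix u assume u: "u \<in> carrier (tensor D N P)"
    show "(\<lambda>m. ?L m u) \<in> ahom M MN_P"
    proof (rule ahomI)
      fix m m' assume m: "m \<in> carrier M" "m' \<in> carrier M"
      then have mm: "m \<oplus>\<^bsub>M\<^esub> m' \<in> carrier M" by (simp add: abelian_groupE(1) right_module_abelian[OF M])
      show "?L (m \<oplus>\<^bsub>M\<^esub> m') u = ?L m u \<oplus>\<^bsub>MN_P\<^esub> ?L m' u"
        by (rule tensor_eqI[OF _ _ L[OF mm] ahom_plus[OF _ L[OF m(1)] L[OF m(2)]] _ u])
           (use m mm in \<open>simp_all add: Le elem_tensor_add_left\<close>)
    qed (rule ahom_closed[OF L u])
  next
    fix m c u assume u: "u \<in> carrier (tensor D N P)" and c: "c \<in> carrier C" and m: "m \<in> carrier M"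
    have mc: "m \<triangleleft>\<^bsub>M\<^esub> c \<in> carrier M" using c m by simp
    show "?L (m \<triangleleft>\<^bsub>M\<^esub> c) u = ?L m (c \<odot>\<^bsub>tensor D N P\<^esub> u)"
      by (rule tensor_eqI[OF _ _ L[OF mc] ahom_comp[OF tensor_smult_ahom[OF N P c] L[OF m]] _ u])
         (use m c mc in \<open>simp_all add: Le elem_tensor_balanced\<close>)
  qed (rule L)
  show "assoc_inv C D M N P \<in> ahom M_NP MN_P"
    unfolding assoc_inv_def by (intro restrict_ahom tensor_lift_ahom bal2) simp_all
  show "m \<in> carrier M \<Longrightarrow> n \<in> carrier N \<Longrightarrow> p \<in> carrier P \<Longrightarrow>
    assoc_inv C D M N P (elem_tensor C M (tensor D N P) m (elem_tensor D N P n p))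
      = elem_tensor D (tensor C M N) P (elem_tensor C M N m n) p"
    by (simp add: assoc_inv_def tensor_lift_elem[OF _ _ _ bal2] Le)
qed

lemma assoc_closed: "t \<in> carrier MN_P \<Longrightarrow> assoc C D M N P t \<in> carrier M_NP"
  by (rule ahom_closed[OF assoc_ahom])

lemma assoc_inv_closed: "t \<in> carrier M_NP \<Longrightarrow> assoc_inv C D M N P t \<in> carrier MN_P"
  by (rule ahom_closed[OF assoc_inv_ahom])

lemma assoc_inv_assoc: "t \<in> carrier MN_P \<Longrightarrow> assoc_inv C D M N P (assoc C D M N P t) = t"
  by (rule tensor3_eqI_left[OF M N P D ahom_comp[OF assoc_ahom assoc_inv_ahom] ahom_ident])
     (simp_all add: assoc_elem assoc_inv_elem)

lemma assoc_assoc_inv: "t \<in> carrier M_NP \<Longrightarrow> assoc C D M N P (assoc_inv C D M N P t) = t"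
  by (rule tensor3_eqI_right[OF M N P C ahom_comp[OF assoc_inv_ahom assoc_ahom] ahom_ident])
     (simp_all add: assoc_elem assoc_inv_elem)

lemma assoc_bij: "bij_betw (assoc C D M N P) (carrier MN_P) (carrier M_NP)"
  by (rule bij_betw_byWitness[where f' = "assoc_inv C D M N P"])
     (auto simp: assoc_inv_assoc assoc_assoc_inv assoc_closed assoc_inv_closed)

lemma assoc_inv_bij: "bij_betw (assoc_inv C D M N P) (carrier M_NP) (carrier MN_P)"
  by (rule bij_betw_byWitness[where f' = "assoc C D M N P"])
     (auto simp: assoc_inv_assoc assoc_assoc_inv assoc_closed assoc_inv_closed)

lemma assoc_right_hom:
  assumes "bimodule D B P" "nonunital_ring B"
  shows "assoc C D M N P \<in> right_hom B MN_P M_NP"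
  unfolding right_hom_iff
proof (intro conjI ballI)
  note [simp] = M N P C D bimodule_left[OF N] bimodule_right[OF N] assms bimodule_right[OF assms(1)]
    tensor_right_rules[where B = B]
  fix b t assume b: "b \<in> carrier B" and t: "t \<in> carrier MN_P"
  show "assoc C D M N P (t \<triangleleft>\<^bsub>MN_P\<^esub> b) = assoc C D M N P t \<triangleleft>\<^bsub>M_NP\<^esub> b"
    by (rule tensor3_eqI_left[OF M N P D ahom_comp[OF tensor_rsmult_ahom assoc_ahom]
          ahom_comp[OF assoc_ahom tensor_rsmult_ahom] _ t])
       (use b in \<open>simp_all add: assoc_elem\<close>)
qed (simp_all add: assoc_ahom, simp add: assoc_def)

lemma assoc_left_hom:
  assumes "bimodule A C M" "nonunital_ring A"
  shows "assoc C D M N P \<in> left_hom A MN_P M_NP"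
  unfolding left_hom_iff
proof (intro conjI ballI)
  note [simp] = M N P C D bimodule_left[OF N] bimodule_right[OF N] assms bimodule_left[OF assms(1)]
    tensor_left_rules[where A = A]
  fix a t assume b: "a \<in> carrier A" and t: "t \<in> carrier MN_P"
  show "assoc C D M N P (a \<odot>\<^bsub>MN_P\<^esub> t) = a \<odot>\<^bsub>M_NP\<^esub> assoc C D M N P t"
    by (rule tensor3_eqI_left[OF M N P D ahom_comp[OF tensor_smult_ahom assoc_ahom]
          ahom_comp[OF assoc_ahom tensor_smult_ahom] _ t])
       (use b in \<open>simp_all add: assoc_elem\<close>)
qed (simp_all add: assoc_ahom, simp add: assoc_def)

lemma assoc_inv_eq: "assoc_inv C D M N P = hom_inv MN_P M_NP (assoc C D M N P)"
proof (rule extensionalityI[of _ "carrier M_NP"])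
  fix t assume t: "t \<in> carrier M_NP"
  show "assoc_inv C D M N P t = hom_inv MN_P M_NP (assoc C D M N P) t"
    using hom_inv_left[OF assoc_bij assoc_inv_closed[OF t]] assoc_assoc_inv[OF t] by simp
qed (simp_all add: assoc_inv_def hom_inv_def)

end

lemma assoc_inv_right_hom:
  assumes "right_module C M" "bimodule C D N" "bimodule D B P"
    "nonunital_ring C" "nonunital_ring D" "nonunital_ring B"
  shows "assoc_inv C D M N P \<in> right_hom B (tensor C M (tensor D N P)) (tensor D (tensor C M N) P)"
proof -
  note [simp] = assms bimodule_left[OF assms(3)]
  show ?thesis by (simp add: assoc_inv_eq) (intro hom_inv_right_hom assoc_right_hom assoc_bij; simp)
qed

lemma assoc_inv_left_hom:
  assumes "bimodule A C M" "bimodule C D N" "left_module D P"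
    "nonunital_ring C" "nonunital_ring D" "nonunital_ring A"
  shows "assoc_inv C D M N P \<in> left_hom A (tensor C M (tensor D N P)) (tensor D (tensor C M N) P)"
proof -
  note [simp] = assms bimodule_right[OF assms(1)]
  show ?thesis by (simp add: assoc_inv_eq) (intro hom_inv_left_hom assoc_left_hom assoc_bij; simp)
qed

subsection \<open>Action maps and firmness\<close>

lemma regular_simps [simp]:
  "carrier (regular A) = carrier A" "add (regular A) = add A" "ring.zero (regular A) = ring.zero A"
  "smult (regular A) = mult A" "rsmult (regular A) = mult A"
  by (simp_all add: regular_def)

lemma nonunital_ring_abelian: "nonunital_ring A \<Longrightarrow> abelian_group A"
  by (simp add: nonunital_ring_def)

lemma nonunital_ring_mult_closed:
  "nonunital_ring A \<Longrightarrow> a \<in> carrier A \<Longrightarrow> b \<in> carrier A \<Longrightarrow> a \<otimes>\<^bsub>A\<^esub> b \<in> carrier A"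
  by (simp add: nonunital_ring_def)

lemma regular_bimodule [simp]: assumes "nonunital_ring A" shows "bimodule A A (regular A)"
proof -
  have "abelian_group (regular A)"
    by (rule abelian_group_cong[OF nonunital_ring_abelian[OF assms]]) simp_all
  then show ?thesis
    using assms by (simp add: bimodule_def left_module_def right_module_def nonunital_ring_def)
qed

lemma regular_left_module [simp]: "nonunital_ring A \<Longrightarrow> left_module A (regular A)"
  and regular_right_module [simp]: "nonunital_ring A \<Longrightarrow> right_module A (regular A)"
  by (auto intro: bimodule_left bimodule_right regular_bimodule)

lemma ident_regular [simp]:
  assumes "nonunital_ring A"
  shows "(\<lambda>m\<in>carrier A. m) \<in> left_hom A (regular A) (regular A)"
    "(\<lambda>m\<in>carrier A. m) \<in> right_hom A (regular A) (regular A)"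
    "(\<lambda>m\<in>carrier A. m) \<in> bimod_hom A A (regular A) (regular A)"
  using ident_bimod_hom[OF regular_bimodule[OF assms]] by (auto simp: bimod_hom_iff)

lemma lact_balanced:
  "left_module A M \<Longrightarrow> balanced A (regular A) M M (\<lambda>a m. a \<odot>\<^bsub>M\<^esub> m)"
  by (simp add: balanced_def left_module_def ahom_def)

lemma ract_balanced:
  "right_module B M \<Longrightarrow> balanced B M (regular B) M (\<lambda>m b. m \<triangleleft>\<^bsub>M\<^esub> b)"
  by (simp add: balanced_def right_module_def ahom_def)

lemma lact_elem [simp]: "left_module A M \<Longrightarrow> nonunital_ring A \<Longrightarrow> a \<in> carrier A \<Longrightarrow> m \<in> carrier M \<Longrightarrow>
    lact A M (elem_tensor A (regular A) M a m) = a \<odot>\<^bsub>M\<^esub> m"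
  by (simp add: lact_def tensor_lift_elem[OF _ _ _ lact_balanced] left_module_abelian[of A])

lemma ract_elem [simp]: "right_module B M \<Longrightarrow> nonunital_ring B \<Longrightarrow> b \<in> carrier B \<Longrightarrow> m \<in> carrier M \<Longrightarrow>
    ract B M (elem_tensor B M (regular B) m b) = m \<triangleleft>\<^bsub>M\<^esub> b"
  by (simp add: ract_def tensor_lift_elem[OF _ _ _ ract_balanced] right_module_abelian[of B])

lemma lact_ahom: "left_module A M \<Longrightarrow> nonunital_ring A \<Longrightarrow>
    lact A M \<in> ahom (tensor A (regular A) M) M"
  by (simp add: lact_def restrict_ahom tensor_lift_ahom[OF _ _ _ lact_balanced] left_module_abelian[of A])

lemma ract_ahom: "right_module B M \<Longrightarrow> nonunital_ring B \<Longrightarrow>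
    ract B M \<in> ahom (tensor B M (regular B)) M"
  by (simp add: ract_def restrict_ahom tensor_lift_ahom[OF _ _ _ ract_balanced] right_module_abelian[of B])

lemma lact_left_hom: assumes "left_module A M" "nonunital_ring A"
  shows "lact A M \<in> left_hom A (tensor A (regular A) M) M"
  unfolding left_hom_iff
proof (intro conjI ballI)
  note [simp] = assms tensor_left_rules[where A = A] nonunital_ring_mult_closed[OF assms(2)]
  fix a t assume a: "a \<in> carrier A" and t: "t \<in> carrier (tensor A (regular A) M)"
  show "lact A M (a \<odot>\<^bsub>tensor A (regular A) M\<^esub> t) = a \<odot>\<^bsub>M\<^esub> lact A M t"
    by (rule tensor_eqI[OF _ _ ahom_comp[OF tensor_smult_ahom lact_ahom] ahom_comp[OF lact_ahom smult_ahom] _ t])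
       (use a in \<open>simp_all add: smult_smult[of A]\<close>)
qed (simp_all add: lact_ahom assms, simp add: lact_def)

lemma ract_right_hom: assumes "right_module B M" "nonunital_ring B"
  shows "ract B M \<in> right_hom B (tensor B M (regular B)) M"
  unfolding right_hom_iff
proof (intro conjI ballI)
  note [simp] = assms tensor_right_rules[where B = B] nonunital_ring_mult_closed[OF assms(2)]
  fix a t assume a: "a \<in> carrier B" and t: "t \<in> carrier (tensor B M (regular B))"
  show "ract B M (t \<triangleleft>\<^bsub>tensor B M (regular B)\<^esub> a) = ract B M t \<triangleleft>\<^bsub>M\<^esub> a"
    by (rule tensor_eqI[OF _ _ ahom_comp[OF tensor_rsmult_ahom ract_ahom] ahom_comp[OF ract_ahom rsmult_ahom] _ t])
       (use a in \<open>simp_all add: rsmult_rsmult[of B]\<close>)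
qed (simp_all add: ract_ahom assms, simp add: ract_def)

lemma lact_right_hom: assumes "bimodule A B M" "nonunital_ring A" "nonunital_ring B"
  shows "lact A M \<in> right_hom B (tensor A (regular A) M) M"
  unfolding right_hom_iff
proof (intro conjI ballI)
  note [simp] = assms tensor_right_rules[where B = B] bimodule_left[OF assms(1)] bimodule_right[OF assms(1)]
  fix b t assume b: "b \<in> carrier B" and t: "t \<in> carrier (tensor A (regular A) M)"
  show "lact A M (t \<triangleleft>\<^bsub>tensor A (regular A) M\<^esub> b) = lact A M t \<triangleleft>\<^bsub>M\<^esub> b"
    by (rule tensor_eqI[OF _ _ ahom_comp[OF tensor_rsmult_ahom lact_ahom] ahom_comp[OF lact_ahom rsmult_ahom] _ t])
       (use b in \<open>simp_all add: bimodule_commute[OF assms(1)]\<close>)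
qed (simp_all add: lact_ahom assms bimodule_left[OF assms(1)], simp add: lact_def)

lemma ract_left_hom: assumes "bimodule A B M" "nonunital_ring A" "nonunital_ring B"
  shows "ract B M \<in> left_hom A (tensor B M (regular B)) M"
  unfolding left_hom_iff
proof (intro conjI ballI)
  note [simp] = assms tensor_left_rules[where A = A] bimodule_left[OF assms(1)] bimodule_right[OF assms(1)]
  fix a t assume a: "a \<in> carrier A" and t: "t \<in> carrier (tensor B M (regular B))"
  show "ract B M (a \<odot>\<^bsub>tensor B M (regular B)\<^esub> t) = a \<odot>\<^bsub>M\<^esub> ract B M t"
    by (rule tensor_eqI[OF _ _ ahom_comp[OF tensor_smult_ahom ract_ahom] ahom_comp[OF ract_ahom smult_ahom] _ t])
       (use a in \<open>simp_all add: bimodule_commute[OF assms(1)]\<close>)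
qed (simp_all add: ract_ahom assms bimodule_right[OF assms(1)], simp add: ract_def)

lemma lact_inv_eq: "lact_inv A M = hom_inv (tensor A (regular A) M) M (lact A M)"
  and ract_inv_eq: "ract_inv B N = hom_inv (tensor B N (regular B)) N (ract B N)"
  by (simp_all add: lact_inv_def ract_inv_def hom_inv_def)

lemma firm_left_module: "firm_left A M \<Longrightarrow> left_module A M"
  and firm_left_bij: "firm_left A M \<Longrightarrow> bij_betw (lact A M) (carrier (tensor A (regular A) M)) (carrier M)"
  by (auto simp: firm_left_def)

lemma firm_right_module: "firm_right B M \<Longrightarrow> right_module B M"
  and firm_right_bij: "firm_right B M \<Longrightarrow> bij_betw (ract B M) (carrier (tensor B M (regular B))) (carrier M)"
  by (auto simp: firm_right_def)

lemmas tensor_induct' [consumes 3, case_names elem add] = tensor_induct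

lemma firm_left_induct [consumes 3, case_names elem add]:
  assumes "firm_left A M" "nonunital_ring A" "t \<in> carrier M"
    and "\<And>a m. a \<in> carrier A \<Longrightarrow> m \<in> carrier M \<Longrightarrow> Q (a \<odot>\<^bsub>M\<^esub> m)"
    and "\<And>t t'. t \<in> carrier M \<Longrightarrow> t' \<in> carrier M \<Longrightarrow> Q t \<Longrightarrow> Q t' \<Longrightarrow> Q (t \<oplus>\<^bsub>M\<^esub> t')"
  shows "Q t"
proof -
  note [simp] = assms(2) firm_left_module[OF assms(1)]
  have "Q (lact A M u)" if "u \<in> carrier (tensor A (regular A) M)" for u
    using regular_right_module[OF assms(2)] firm_left_module[OF assms(1)] that
  proof (induct rule: tensor_induct')
    case (elem a m)
    then show ?case by (simp add: assms(4))
  next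
    case (add u u')
    then show ?case
      by (simp add: ahom_add[OF lact_ahom] ahom_closed[OF lact_ahom] assms(5))
  qed
  moreover obtain u where "u \<in> carrier (tensor A (regular A) M)" "t = lact A M u"
    using firm_left_bij[OF assms(1)] assms(3) by (auto simp: bij_betw_def)
  ultimately show ?thesis by simp
qed

lemma firm_right_induct [consumes 3, case_names elem add]:
  assumes "firm_right B M" "nonunital_ring B" "t \<in> carrier M"
    and "\<And>m b. m \<in> carrier M \<Longrightarrow> b \<in> carrier B \<Longrightarrow> Q (m \<triangleleft>\<^bsub>M\<^esub> b)"
    and "\<And>t t'. t \<in> carrier M \<Longrightarrow> t' \<in> carrier M \<Longrightarrow> Q t \<Longrightarrow> Q t' \<Longrightarrow> Q (t \<oplus>\<^bsub>M\<^esub> t')"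
  shows "Q t"
proof -
  note [simp] = assms(2) firm_right_module[OF assms(1)]
  have "Q (ract B M u)" if "u \<in> carrier (tensor B M (regular B))" for u
    using firm_right_module[OF assms(1)] regular_left_module[OF assms(2)] that
  proof (induct rule: tensor_induct')
    case (elem a m)
    then show ?case by (simp add: assms(4))
  next
    case (add u u')
    then show ?case
      by (simp add: ahom_add[OF ract_ahom] ahom_closed[OF ract_ahom] assms(5))
  qed
  moreover obtain u where "u \<in> carrier (tensor B M (regular B))" "t = ract B M u"
    using firm_right_bij[OF assms(1)] assms(3) by (auto simp: bij_betw_def)
  ultimately show ?thesis by simp
qed

lemma firm_right_eqI:
  assumes "firm_right B M" "nonunital_ring B" "f \<in> ahom M P" "g \<in> ahom M P"
    and "\<And>m b. m \<in> carrier M \<Longrightarrow> b \<in> carrier B \<Longrightarrow> f (m \<triangleleft>\<^bsub>M\<^esub> b) = g (m \<triangleleft>\<^bsub>M\<^esub> b)" "t \<in> carrier M"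
  shows "f t = g t"
  using assms(1,2,6)
proof (induct rule: firm_right_induct)
  case (add t t')
  then show ?case using assms(3,4) by (simp add: ahom_add)
qed (rule assms(5))

lemma firm_left_eqI:
  assumes "firm_left A M" "nonunital_ring A" "f \<in> ahom M P" "g \<in> ahom M P"
    and "\<And>a m. a \<in> carrier A \<Longrightarrow> m \<in> carrier M \<Longrightarrow> f (a \<odot>\<^bsub>M\<^esub> m) = g (a \<odot>\<^bsub>M\<^esub> m)" "t \<in> carrier M"
  shows "f t = g t"
  using assms(1,2,6)
proof (induct rule: firm_left_induct)
  case (add t t')
  then show ?case using assms(3,4) by (simp add: ahom_add)
qed (rule assms(5))

lemma lact_inv_smult:
  assumes "firm_left A M" "nonunital_ring A" "a \<in> carrier A" "m \<in> carrier M"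
  shows "lact_inv A M (a \<odot>\<^bsub>M\<^esub> m) = elem_tensor A (regular A) M a m"
  using hom_inv_left[OF firm_left_bij[OF assms(1)], of "elem_tensor A (regular A) M a m"] assms
    firm_left_module[OF assms(1)]
  by (simp add: lact_inv_eq)

lemma ract_inv_rsmult:
  assumes "firm_right B M" "nonunital_ring B" "b \<in> carrier B" "m \<in> carrier M"
  shows "ract_inv B M (m \<triangleleft>\<^bsub>M\<^esub> b) = elem_tensor B M (regular B) m b"
  using hom_inv_left[OF firm_right_bij[OF assms(1)], of "elem_tensor B M (regular B) m b"] assms
    firm_right_module[OF assms(1)]
  by (simp add: ract_inv_eq)

lemma lact_inv_left_hom: "firm_left A M \<Longrightarrow> nonunital_ring A \<Longrightarrow> lact_inv A M \<in> left_hom A M (tensor A (regular A) M)"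
  unfolding lact_inv_eq
  by (intro hom_inv_left_hom lact_left_hom firm_left_bij firm_left_module tensor_left_module regular_bimodule)

lemma ract_inv_right_hom: "firm_right B M \<Longrightarrow> nonunital_ring B \<Longrightarrow> ract_inv B M \<in> right_hom B M (tensor B M (regular B))"
  unfolding ract_inv_eq
  by (intro hom_inv_right_hom ract_right_hom firm_right_bij firm_right_module tensor_right_module regular_bimodule)

lemma lact_inv_right_hom: "firm_left A M \<Longrightarrow> bimodule A B M \<Longrightarrow> nonunital_ring A \<Longrightarrow> nonunital_ring B \<Longrightarrow>
    lact_inv A M \<in> right_hom B M (tensor A (regular A) M)"
  unfolding lact_inv_eq
  by (intro hom_inv_right_hom lact_right_hom firm_left_bij tensor_right_module)
     (auto intro: bimodule_right)

lemma lact_regular: "lact A (regular A) = ract A (regular A)"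
  by (simp add: lact_def ract_def)

lemma firm_ring_nonunital [simp]: "firm_ring A \<Longrightarrow> nonunital_ring A"
  and firm_ring_right: "firm_ring A \<Longrightarrow> firm_right A (regular A)"
  by (simp_all add: firm_ring_def)

lemma firm_ring_left: "firm_ring A \<Longrightarrow> firm_left A (regular A)"
  using firm_right_bij[OF firm_ring_right] by (simp add: firm_left_def lact_regular)

lemma firm_ring_bimodule: "firm_ring A \<Longrightarrow> firm_bimodule A A (regular A)"
  by (simp add: firm_bimodule_def firm_ring_left firm_ring_right)

lemma firm_bimoduleD:
  assumes "firm_bimodule A B M"
  shows "bimodule A B M" "left_module A M" "right_module B M" "firm_left A M" "firm_right B M"
  using assms by (auto simp: firm_bimodule_def firm_left_def firm_right_def)

lemma firm_left_tensor:
  assumes "firm_left A M" "bimodule A C M" "left_module C N" "nonunital_ring A" "nonunital_ring C"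
  shows "firm_left A (tensor C M N)"
proof -
  note [simp] = assms bimodule_left[OF assms(2)] bimodule_right[OF assms(2)] tensor_left_rules[where A = A]
    assoc_elem assoc_inv_elem lact_right_hom
  have "bij_betw (\<lambda>t. tensor_map C (tensor A (regular A) M) N M N (lact A M) (ident N)
      (assoc_inv A C (regular A) M N t)) (carrier (tensor A (regular A) (tensor C M N))) (carrier (tensor C M N))"
    (is "bij_betw ?f _ _")
    by (rule bij_betw_trans[OF assoc_inv_bij tensor_map_bij, unfolded comp_def])
       (simp_all add: firm_left_bij bij_betw_id[unfolded id_def])
  moreover have "?f t = lact A (tensor C M N) t" if "t \<in> carrier (tensor A (regular A) (tensor C M N))" for t
    by (rule tensor3_eqI_right[OF _ _ _ _ ahom_comp[OF assoc_inv_ahom tensor_map_ahom] lact_ahom _ that])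
       simp_all
  ultimately show ?thesis
    using bij_betw_cong[of "carrier (tensor A (regular A) (tensor C M N))" ?f] by (simp add: firm_left_def)
qed

lemma firm_right_tensor:
  assumes "firm_right B N" "bimodule C B N" "right_module C M" "nonunital_ring B" "nonunital_ring C"
  shows "firm_right B (tensor C M N)"
proof -
  note [simp] = assms bimodule_left[OF assms(2)] bimodule_right[OF assms(2)] tensor_right_rules[where B = B]
    assoc_elem assoc_inv_elem ract_left_hom
  have "bij_betw (\<lambda>t. tensor_map C M (tensor B N (regular B)) M N (ident M) (ract B N)
      (assoc C B M N (regular B) t)) (carrier (tensor B (tensor C M N) (regular B))) (carrier (tensor C M N))"
    (is "bij_betw ?f _ _")
    by (rule bij_betw_trans[OF assoc_bij tensor_map_bij, unfolded comp_def])
       (simp_all add: firm_right_bij bij_betw_id[unfolded id_def])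
  moreover have "?f t = ract B (tensor C M N) t" if "t \<in> carrier (tensor B (tensor C M N) (regular B))" for t
    by (rule tensor3_eqI_left[OF _ _ _ _ ahom_comp[OF assoc_ahom tensor_map_ahom] ract_ahom _ that])
       simp_all
  ultimately show ?thesis
    using bij_betw_cong[of "carrier (tensor B (tensor C M N) (regular B))" ?f] by (simp add: firm_right_def)
qed

lemma firm_left_retract:
  assumes "firm_left A M" "left_module A N" "nonunital_ring A"
    and r: "r \<in> left_hom A M N" and s: "s \<in> left_hom A N M" and rs: "\<And>x. x \<in> carrier N \<Longrightarrow> r (s x) = x"
  shows "firm_left A N"
  unfolding firm_left_def bij_betw_def
proof (intro conjI subset_antisym)
  note [simp] = assms(1-3) firm_left_module[OF assms(1)] r s left_hom_closed[OF r] left_hom_closed[OF s]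
  let ?A = "regular A"
  have nat_r: "lact A N (tensor_map A ?A M ?A N (ident ?A) r t) = r (lact A M t)"
    if "t \<in> carrier (tensor A ?A M)" for t
    by (rule tensor_eqI[OF _ _ ahom_comp[OF tensor_map_ahom lact_ahom] ahom_comp[OF lact_ahom left_hom_ahom[OF r]] _ that])
       (simp_all add: left_hom_smult[OF r])
  have nat_s: "lact A M (tensor_map A ?A N ?A M (ident ?A) s t) = s (lact A N t)"
    if "t \<in> carrier (tensor A ?A N)" for t
    by (rule tensor_eqI[OF _ _ ahom_comp[OF tensor_map_ahom lact_ahom] ahom_comp[OF lact_ahom left_hom_ahom[OF s]] _ that])
       (simp_all add: left_hom_smult[OF s])
  have id: "tensor_map A ?A M ?A N (ident ?A) r (tensor_map A ?A N ?A M (ident ?A) s t) = t"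
    if "t \<in> carrier (tensor A ?A N)" for t
    by (rule tensor_eqI[OF _ _ ahom_comp[OF tensor_map_ahom tensor_map_ahom] ahom_ident _ that])
       (simp_all add: rs)
  show "left_module A N" by simp
  show "inj_on (lact A N) (carrier (tensor A ?A N))"
  proof (rule inj_onI)
    fix t t' assume t: "t \<in> carrier (tensor A ?A N)" "t' \<in> carrier (tensor A ?A N)" "lact A N t = lact A N t'"
    let ?s = "tensor_map A ?A N ?A M (ident ?A) s"
    have "lact A M (?s t) = lact A M (?s t')" by (simp only: nat_s[OF t(1)] nat_s[OF t(2)] t(3))
    then have "?s t = ?s t'"
      by (rule inj_onD[OF bij_betw_imp_inj_on[OF firm_left_bij[OF assms(1)]]]) (use t in simp_all)
    then show "t = t'" using id t by metis
  qed
  show "lact A N ` carrier (tensor A ?A N) \<subseteq> carrier N"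
    using ahom_closed[OF lact_ahom[of A N]] by auto
  show "carrier N \<subseteq> lact A N ` carrier (tensor A ?A N)"
  proof
    fix x assume x: "x \<in> carrier N"
    obtain t where t: "t \<in> carrier (tensor A ?A M)" "s x = lact A M t"
      using firm_left_bij[OF assms(1)] left_hom_closed[OF s x] by (auto simp: bij_betw_def)
    then have "x = lact A N (tensor_map A ?A M ?A N (ident ?A) r t)"
      by (simp only: nat_r[OF t(1)] t(2)[symmetric] rs[OF x])
    then show "x \<in> lact A N ` carrier (tensor A ?A N)" using t(1) by auto
  qed
qed

lemma firm_right_retract:
  assumes "firm_right A M" "right_module A N" "nonunital_ring A"
    and r: "r \<in> right_hom A M N" and s: "s \<in> right_hom A N M" and rs: "\<And>x. x \<in> carrier N \<Longrightarrow> r (s x) = x"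
  shows "firm_right A N"
  unfolding firm_right_def bij_betw_def
proof (intro conjI subset_antisym)
  note [simp] = assms(1-3) firm_right_module[OF assms(1)] r s right_hom_closed[OF r] right_hom_closed[OF s]
  let ?A = "regular A"
  have nat_r: "ract A N (tensor_map A M ?A N ?A r (ident ?A) t) = r (ract A M t)"
    if "t \<in> carrier (tensor A M ?A)" for t
    by (rule tensor_eqI[OF _ _ ahom_comp[OF tensor_map_ahom ract_ahom] ahom_comp[OF ract_ahom right_hom_ahom[OF r]] _ that])
       (simp_all add: right_hom_rsmult[OF r])
  have nat_s: "ract A M (tensor_map A N ?A M ?A s (ident ?A) t) = s (ract A N t)"
    if "t \<in> carrier (tensor A N ?A)" for t
    by (rule tensor_eqI[OF _ _ ahom_comp[OF tensor_map_ahom ract_ahom] ahom_comp[OF ract_ahom right_hom_ahom[OF s]] _ that])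
       (simp_all add: right_hom_rsmult[OF s])
  have id: "tensor_map A M ?A N ?A r (ident ?A) (tensor_map A N ?A M ?A s (ident ?A) t) = t"
    if "t \<in> carrier (tensor A N ?A)" for t
    by (rule tensor_eqI[OF _ _ ahom_comp[OF tensor_map_ahom tensor_map_ahom] ahom_ident _ that])
       (simp_all add: rs)
  show "right_module A N" by simp
  show "inj_on (ract A N) (carrier (tensor A N ?A))"
  proof (rule inj_onI)
    fix t t' assume t: "t \<in> carrier (tensor A N ?A)" "t' \<in> carrier (tensor A N ?A)" "ract A N t = ract A N t'"
    let ?s = "tensor_map A N ?A M ?A s (ident ?A)"
    have "ract A M (?s t) = ract A M (?s t')" by (simp only: nat_s[OF t(1)] nat_s[OF t(2)] t(3))
    then have "?s t = ?s t'"
      by (rule inj_onD[OF bij_betw_imp_inj_on[OF firm_right_bij[OF assms(1)]]]) (use t in simp_all)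
    then show "t = t'" using id t by metis
  qed
  show "ract A N ` carrier (tensor A N ?A) \<subseteq> carrier N"
    using ahom_closed[OF ract_ahom[of A N]] by auto
  show "carrier N \<subseteq> ract A N ` carrier (tensor A N ?A)"
  proof
    fix x assume x: "x \<in> carrier N"
    obtain t where t: "t \<in> carrier (tensor A M ?A)" "s x = ract A M t"
      using firm_right_bij[OF assms(1)] right_hom_closed[OF s x] by (auto simp: bij_betw_def)
    then have "x = ract A N (tensor_map A M ?A N ?A r (ident ?A) t)"
      by (simp only: nat_r[OF t(1)] t(2)[symmetric] rs[OF x])
    then show "x \<in> ract A N ` carrier (tensor A N ?A)" using t(1) by auto
  qed
qed

lemma firm_bimodule_retract:
  assumes "firm_bimodule A B M" "bimodule A B N" "nonunital_ring A" "nonunital_ring B"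
    and "r \<in> bimod_hom A B M N" "s \<in> bimod_hom A B N M" "\<And>x. x \<in> carrier N \<Longrightarrow> r (s x) = x"
  shows "firm_bimodule A B N"
  using assms(2)
    firm_left_retract[OF firm_bimoduleD(4)[OF assms(1)] bimodule_left[OF assms(2)] assms(3)
      bimod_hom_left[OF assms(5)] bimod_hom_left[OF assms(6)] assms(7)]
    firm_right_retract[OF firm_bimoduleD(5)[OF assms(1)] bimodule_right[OF assms(2)] assms(4)
      bimod_hom_right[OF assms(5)] bimod_hom_right[OF assms(6)] assms(7)]
  by (simp add: firm_bimodule_def)

subsection \<open>Transport of structure\<close>

lemma tensor_mult_update [simp]:
  "tensor C M (N\<lparr>mult := f\<rparr>) = tensor C M N" "tensor C (M\<lparr>mult := g\<rparr>) N = tensor C M N"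
  by (simp_all add: tensor_def tensor_group_def tensor_free_def tensor_kernel_def tensor_relators_def
      elem_tensor_def Let_def del: tensor_group_simps)

lemma elem_tensor_mult_update [simp]:
  "elem_tensor C M (N\<lparr>mult := f\<rparr>) = elem_tensor C M N"
  "elem_tensor C (M\<lparr>mult := g\<rparr>) N = elem_tensor C M N"
  by (simp_all add: fun_eq_iff tensor_free_def tensor_kernel_def tensor_relators_def elem_tensor_def)

lemma tensor_lift_mult_update [simp]:
  fixes P :: "('p, 'x) ring_scheme"
  shows "tensor_lift (P\<lparr>mult := f\<rparr>) \<phi> = tensor_lift P \<phi>"
  by (simp add: fun_eq_iff tensor_lift_def finsum_def add_pow_def)

lemma bimod_hom_mult_update [simp]: "bimod_hom A B M (N\<lparr>mult := f\<rparr>) = bimod_hom A B M N"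
  by (auto simp: bimod_hom_def left_hom_def right_hom_def additive_hom_def)

definition copy_mod :: "('m \<Rightarrow> 'u) \<Rightarrow> ('a, 'b, 'm) bimod \<Rightarrow> ('a, 'b, 'u) bimod" where
  "copy_mod j M = (let k = inv_into (carrier M) j in
     \<lparr>carrier = j ` carrier M, mult = undefined, one = undefined, ring.zero = j \<zero>\<^bsub>M\<^esub>,
      add = (\<lambda>x y. j (k x \<oplus>\<^bsub>M\<^esub> k y)), smult = (\<lambda>a x. j (a \<odot>\<^bsub>M\<^esub> k x)),
      rsmult = (\<lambda>x b. j (k x \<triangleleft>\<^bsub>M\<^esub> b))\<rparr>)"

definition forget_left :: "('a, 'b, 'm) bimod \<Rightarrow> (unit, 'b, 'm) bimod" where
  "forget_left M = \<lparr>carrier = carrier M, mult = mult M, one = one M, ring.zero = ring.zero M,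
     add = add M, smult = undefined, rsmult = rsmult M\<rparr>"

lemma copy_mod_carrier [simp]: "carrier (copy_mod j M) = j ` carrier M"
  by (simp add: copy_mod_def Let_def)

context
  fixes M :: "('a, 'b, 'm) bimod" and j :: "'m \<Rightarrow> 'u"
  assumes j: "inj_on j (carrier M)"
begin

lemma copy_mod_ops:
  "x \<in> carrier M \<Longrightarrow> y \<in> carrier M \<Longrightarrow> j x \<oplus>\<^bsub>copy_mod j M\<^esub> j y = j (x \<oplus>\<^bsub>M\<^esub> y)"
  "x \<in> carrier M \<Longrightarrow> a \<odot>\<^bsub>copy_mod j M\<^esub> j x = j (a \<odot>\<^bsub>M\<^esub> x)"
  "x \<in> carrier M \<Longrightarrow> j x \<triangleleft>\<^bsub>copy_mod j M\<^esub> b = j (x \<triangleleft>\<^bsub>M\<^esub> b)"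
  "\<zero>\<^bsub>copy_mod j M\<^esub> = j \<zero>\<^bsub>M\<^esub>"
  using j by (simp_all add: copy_mod_def Let_def)

lemma copy_mod_abelian_group:
  assumes "abelian_group M" shows "abelian_group (copy_mod j M)"
proof -
  interpret M: abelian_group M by fact
  show ?thesis
  proof (rule abelian_groupI)
    fix x assume "x \<in> carrier (copy_mod j M)"
    then obtain x' where x': "x = j x'" "x' \<in> carrier M" by auto
    then show "\<exists>y\<in>carrier (copy_mod j M). y \<oplus>\<^bsub>copy_mod j M\<^esub> x = \<zero>\<^bsub>copy_mod j M\<^esub>"
      by (intro bexI[of _ "j (\<ominus>\<^bsub>M\<^esub> x')"]) (simp_all add: copy_mod_ops M.l_neg)
  qed (auto simp: copy_mod_ops M.a_ac)
qed

lemma copy_mod_left_module: "left_module A M \<Longrightarrow> left_module A (copy_mod j M)"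
  using copy_mod_abelian_group
  by (auto simp: left_module_def copy_mod_ops abelian_groupE(1))

lemma copy_mod_right_module: "right_module B M \<Longrightarrow> right_module B (copy_mod j M)"
  using copy_mod_abelian_group
  by (auto simp: right_module_def copy_mod_ops abelian_groupE(1))

lemma copy_mod_bimodule: "bimodule A B M \<Longrightarrow> bimodule A B (copy_mod j M)"
  using copy_mod_left_module[of A] copy_mod_right_module[of B]
  by (auto simp: bimodule_def copy_mod_ops smult_closed[of A] rsmult_closed[of B])

lemma copy_mod_ahom: "abelian_group M \<Longrightarrow> restrict j (carrier M) \<in> ahom M (copy_mod j M)"
  by (simp add: ahom_def copy_mod_ops abelian_groupE(1) Pi_def)

lemma copy_mod_left_hom: "left_module A M \<Longrightarrow> restrict j (carrier M) \<in> left_hom A M (copy_mod j M)"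
  by (simp add: left_hom_iff copy_mod_ahom left_module_abelian[of A] copy_mod_ops smult_closed[of A])

lemma copy_mod_right_hom: "right_module B M \<Longrightarrow> restrict j (carrier M) \<in> right_hom B M (copy_mod j M)"
  by (simp add: right_hom_iff copy_mod_ahom right_module_abelian[of B] copy_mod_ops rsmult_closed[of B])

end

lemma forget_left_simps [simp]:
  "carrier (forget_left M) = carrier M" "add (forget_left M) = add M" "rsmult (forget_left M) = rsmult M"
  "ring.zero (forget_left M) = ring.zero M"
  by (simp_all add: forget_left_def)

lemma forget_left_right_module: "right_module B M \<Longrightarrow> right_module B (forget_left M)"
  using abelian_group_cong[of M "forget_left M"] by (simp add: right_module_def)

lemma right_hom_forget_left [simp]:
  "right_hom B M (forget_left N) = right_hom B M N" "right_hom B (forget_left M) N = right_hom B M N"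
  by (auto simp: right_hom_def additive_hom_def)

lemma bimodule_copy_ex:
  fixes M :: "('a, 'b, 'm) bimod" and U :: "'u set"
  assumes "bimodule A B M" "carrier M \<lesssim> U"
  obtains M' :: "('a, 'b, 'u) bimod" and j where "bimodule A B M'" "carrier M' \<subseteq> U"
    "j \<in> bimod_hom A B M M'" "bij_betw j (carrier M) (carrier M')"
proof -
  obtain j where j: "inj_on j (carrier M)" "j ` carrier M \<subseteq> U"
    using assms(2) by (auto simp: lepoll_def)
  show ?thesis
    using that[of "copy_mod j M" "restrict j (carrier M)"] assms(1) j
      copy_mod_left_hom[OF j(1) bimodule_left[OF assms(1)]]
      copy_mod_right_hom[OF j(1) bimodule_right[OF assms(1)]]
    by (simp add: copy_mod_bimodule inj_on_imp_bij_betw bimod_hom_iff)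
qed

lemma right_module_copy_ex:
  fixes M :: "('a, 'b, 'm) bimod" and U :: "'u set"
  assumes "right_module B M" "carrier M \<lesssim> U"
  obtains M' :: "(unit, 'b, 'u) bimod" and j where "right_module B M'" "carrier M' \<subseteq> U"
    "j \<in> right_hom B M M'" "bij_betw j (carrier M) (carrier M')"
proof -
  obtain j where j: "inj_on j (carrier M)" "j ` carrier M \<subseteq> U"
    using assms(2) by (auto simp: lepoll_def)
  show ?thesis
    using that[of "forget_left (copy_mod j M)" "restrict j (carrier M)"] j
      copy_mod_right_hom[OF j(1) assms(1)] forget_left_right_module[OF copy_mod_right_module[OF j(1) assms(1)]]
    by (simp add: inj_on_imp_bij_betw)
qed

lemma firm_right_iso:
  assumes "firm_right A M" "right_module A N" "nonunital_ring A" "f \<in> right_hom A M N"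
    "bij_betw f (carrier M) (carrier N)"
  shows "firm_right A N"
  by (rule firm_right_retract[OF assms(1-4) hom_inv_right_hom[OF assms(4,5) firm_right_module[OF assms(1)]]])
     (simp add: assms(5))

lemma firm_bimodule_iso:
  assumes "firm_bimodule A B M" "bimodule A B N" "nonunital_ring A" "nonunital_ring B"
    "f \<in> bimod_hom A B M N" "bij_betw f (carrier M) (carrier N)"
  shows "firm_bimodule A B N"
  by (rule firm_bimodule_retract[OF assms(1-5) hom_inv_bimod_hom[OF assms(5,6) firm_bimoduleD(1)[OF assms(1)]]])
     (simp add: assms(6))

lemma firm_bimodule_tensor:
  assumes "firm_bimodule A C M" "firm_bimodule C B N" "nonunital_ring A" "nonunital_ring B" "nonunital_ring C"
  shows "firm_bimodule A B (tensor C M N)"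
  using assms firm_bimoduleD[OF assms(1)] firm_bimoduleD[OF assms(2)]
    firm_left_tensor[of A M C N] firm_right_tensor[of B N C M]
  by (simp add: firm_bimodule_def)

subsection \<open>Cardinality\<close>

lemma Times_lepoll_infinite:
  assumes "infinite U" "X \<lesssim> U" "Y \<lesssim> U"
  shows "X \<times> Y \<lesssim> U"
proof -
  obtain f g where "inj_on f X" "f ` X \<subseteq> U" "inj_on g Y" "g ` Y \<subseteq> U"
    using assms(2,3) by (auto simp: lepoll_def)
  then have "X \<times> Y \<lesssim> U \<times> U"
    unfolding lepoll_def by (intro exI[of _ "map_prod f g"]) (auto intro: map_prod_inj_on)
  also have "U \<times> U \<approx> U"
    using card_of_Times_same_infinite[OF assms(1)] by (simp add: eqpoll_iff_card_of_ordIso)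
  finally show ?thesis .
qed

lemma free_Abelian_group_lepoll:
  assumes "infinite U" "X \<lesssim> U"
  shows "carrier (free_Abelian_group X) \<lesssim> U"
proof -
  obtain f where f: "inj_on f X" "f ` X \<subseteq> U" using assms(2) by (auto simp: lepoll_def)
  have "X \<approx> f ` X" using f(1) by (simp add: eqpoll_sym)
  then have "carrier (free_Abelian_group X) \<approx> carrier (free_Abelian_group (f ` X))"
    by (simp add: iso_imp_eqpoll_carrier isomorphic_free_Abelian_groups)
  also have "carrier (free_Abelian_group (f ` X)) \<lesssim> carrier (free_Abelian_group U)"
    using f(2) by (intro subset_imp_lepoll) auto
  also have "carrier (free_Abelian_group U) \<approx> U"
    by (rule eqpoll_free_Abelian_group_infinite[OF assms(1)])
  finally show ?thesis .
qed

lemma tensor_lepoll: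
  assumes "infinite U" "right_module C M" "left_module C N" "carrier M \<lesssim> U" "carrier N \<lesssim> U"
  shows "carrier (tensor C M N) \<lesssim> U"
proof -
  have "carrier (tensor C M N)
      = (\<lambda>x. tensor_kernel C M N #>\<^bsub>tensor_free M N\<^esub> x) ` carrier (tensor_free M N)"
    using assms(2,3) by (auto simp: carrier_tensor carrier_FactGroup)
  also have "\<dots> \<lesssim> carrier (tensor_free M N)" by (rule image_lepoll)
  also have "\<dots> \<lesssim> U"
    unfolding tensor_free_def using assms by (intro free_Abelian_group_lepoll Times_lepoll_infinite)
  finally show ?thesis .
qed

section \<open>The adjunction and the actions of the ring \<open>S\<close>\<close>

lemma r_counit_elem:
  assumes "right_module B Z" "bimodule B A N" "bimodule A B M" "nonunital_ring A" "nonunital_ring B"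
    "\<epsilon> \<in> bimod_hom B B (tensor A N M) (regular B)"
    "z \<in> carrier Z" "n \<in> carrier N" "m \<in> carrier M"
  shows "r_counit A B M N \<epsilon> Z (elem_tensor A (tensor B Z N) M (elem_tensor B Z N z n) m)
    = z \<triangleleft>\<^bsub>Z\<^esub> \<epsilon> (elem_tensor A N M n m)"
proof -
  note [simp] = assms bimodule_left[OF assms(2)] bimodule_right[OF assms(2)]
    bimodule_left[OF assms(3)] bimodule_right[OF assms(3)] bimod_hom_left[OF assms(6)]
  show ?thesis using bimod_hom_closed[OF assms(6)] by (simp add: r_counit_def assoc_elem)
qed

lemma r_counit_right_hom:
  assumes "right_module B Z" "bimodule B A N" "bimodule A B M" "nonunital_ring A" "nonunital_ring B"
    "\<epsilon> \<in> bimod_hom B B (tensor A N M) (regular B)"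
  shows "r_counit A B M N \<epsilon> Z \<in> right_hom B (tensor A (tensor B Z N) M) Z"
proof -
  note [simp] = assms bimodule_left[OF assms(2)] bimodule_right[OF assms(2)]
    bimodule_left[OF assms(3)] bimodule_right[OF assms(3)] bimod_hom_left[OF assms(6)]
  have "(\<lambda>t\<in>carrier (tensor A (tensor B Z N) M).
      (\<lambda>u\<in>carrier (tensor B Z (tensor A N M)).
         ract B Z (tensor_map B Z (tensor A N M) Z (regular B) (ident Z) \<epsilon> u)) (assoc B A Z N M t))
    \<in> right_hom B (tensor A (tensor B Z N) M) Z"
    by (intro right_hom_comp[OF assoc_right_hom right_hom_comp[OF tensor_map_right_hom ract_right_hom]]) simp_all
  moreover have "(\<lambda>t\<in>carrier (tensor A (tensor B Z N) M).
      (\<lambda>u\<in>carrier (tensor B Z (tensor A N M)).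
         ract B Z (tensor_map B Z (tensor A N M) Z (regular B) (ident Z) \<epsilon> u)) (assoc B A Z N M t))
    = r_counit A B M N \<epsilon> Z"
    by (rule ext) (simp add: r_counit_def assoc_closed)
  ultimately show ?thesis by simp
qed

lemma l_counit_elem:
  assumes "left_module B Z" "bimodule B A N" "bimodule A B M" "nonunital_ring A" "nonunital_ring B"
    "\<epsilon> \<in> bimod_hom B B (tensor A N M) (regular B)"
    "z \<in> carrier Z" "n \<in> carrier N" "m \<in> carrier M"
  shows "l_counit A B M N \<epsilon> Z (elem_tensor A N (tensor B M Z) n (elem_tensor B M Z m z))
    = \<epsilon> (elem_tensor A N M n m) \<odot>\<^bsub>Z\<^esub> z"
proof -
  note [simp] = assms bimodule_left[OF assms(2)] bimodule_right[OF assms(2)]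
    bimodule_left[OF assms(3)] bimodule_right[OF assms(3)] bimod_hom_right[OF assms(6)]
  show ?thesis using bimod_hom_closed[OF assms(6)] by (simp add: l_counit_def assoc_inv_elem)
qed

lemma l_counit_left_hom:
  assumes "left_module B Z" "bimodule B A N" "bimodule A B M" "nonunital_ring A" "nonunital_ring B"
    "\<epsilon> \<in> bimod_hom B B (tensor A N M) (regular B)"
  shows "l_counit A B M N \<epsilon> Z \<in> left_hom B (tensor A N (tensor B M Z)) Z"
proof -
  note [simp] = assms bimodule_left[OF assms(2)] bimodule_right[OF assms(2)]
    bimodule_left[OF assms(3)] bimodule_right[OF assms(3)] bimod_hom_right[OF assms(6)]
  have "(\<lambda>t\<in>carrier (tensor A N (tensor B M Z)).
      (\<lambda>u\<in>carrier (tensor B (tensor A N M) Z).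
         lact B Z (tensor_map B (tensor A N M) Z (regular B) Z \<epsilon> (ident Z) u)) (assoc_inv A B N M Z t))
    \<in> left_hom B (tensor A N (tensor B M Z)) Z"
    by (intro left_hom_comp[OF assoc_inv_left_hom left_hom_comp[OF tensor_map_left_hom lact_left_hom]]) simp_all
  moreover have "(\<lambda>t\<in>carrier (tensor A N (tensor B M Z)).
      (\<lambda>u\<in>carrier (tensor B (tensor A N M) Z).
         lact B Z (tensor_map B (tensor A N M) Z (regular B) Z \<epsilon> (ident Z) u)) (assoc_inv A B N M Z t))
    = l_counit A B M N \<epsilon> Z"
    by (rule ext) (simp add: l_counit_def assoc_inv_closed)
  ultimately show ?thesis by simp
qed

locale firm_adjunction =
  fixes A :: "'a ring" and B :: "'b ring" and M :: "('a, 'b, 'm) bimod"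
    and N :: "('b, 'a, 'n) bimod" and \<eta> \<epsilon>
  assumes firm_A: "firm_ring A" and firm_B: "firm_ring B" and firm_M: "firm_bimodule A B M"
    and adjoint: "right_adjoint A B M N \<eta> \<epsilon>"
begin

abbreviation S where "S \<equiv> tensor B M N"
abbreviation C where "C \<equiv> tensor A N M"

lemma firm_N: "firm_bimodule B A N"
  and eta_bimod_hom [simp]: "\<eta> \<in> bimod_hom A A (regular A) S"
  and eps_bimod_hom [simp]: "\<epsilon> \<in> bimod_hom B B C (regular B)"
  using adjoint by (simp_all add: right_adjoint_def)

lemmas module_rules [simp] = firm_ring_nonunital[OF firm_A] firm_ring_nonunital[OF firm_B]
  firm_bimoduleD[OF firm_M] firm_bimoduleD[OF firm_N]
  tensor_left_rules[where A = A] tensor_left_rules[where A = B]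
  tensor_right_rules[where B = A] tensor_right_rules[where B = B]
  bimod_hom_left[OF eta_bimod_hom] bimod_hom_right[OF eta_bimod_hom]
  bimod_hom_left[OF eps_bimod_hom] bimod_hom_right[OF eps_bimod_hom]
  assoc_elem assoc_inv_elem assoc_ahom assoc_inv_ahom assoc_closed assoc_inv_closed
  nonunital_ring_mult_closed[OF firm_ring_nonunital[OF firm_A]]
  nonunital_ring_mult_closed[OF firm_ring_nonunital[OF firm_B]]
  bimodule_commute[OF firm_bimoduleD(1)[OF firm_M]] bimodule_commute[OF firm_bimoduleD(1)[OF firm_N]]

lemma eta_closed [simp]: "a \<in> carrier A \<Longrightarrow> \<eta> a \<in> carrier S"
  using bimod_hom_closed[OF eta_bimod_hom] by simp

lemma eps_closed [simp]: "c \<in> carrier C \<Longrightarrow> \<epsilon> c \<in> carrier B"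
  using bimod_hom_closed[OF eps_bimod_hom] by simp

lemma eta_ahom: "\<eta> \<in> ahom A S"
  using bimod_hom_ahom[OF eta_bimod_hom] by (simp add: ahom_def)

lemma eps_ahom: "\<epsilon> \<in> ahom C (regular B)"
  by (rule bimod_hom_ahom[OF eps_bimod_hom])

lemma eta_mult: "a \<in> carrier A \<Longrightarrow> b \<in> carrier A \<Longrightarrow> \<eta> (a \<otimes>\<^bsub>A\<^esub> b) = a \<odot>\<^bsub>S\<^esub> \<eta> b"
  "a \<in> carrier A \<Longrightarrow> b \<in> carrier A \<Longrightarrow> \<eta> (a \<otimes>\<^bsub>A\<^esub> b) = \<eta> a \<triangleleft>\<^bsub>S\<^esub> b"
  using left_hom_smult[OF bimod_hom_left[OF eta_bimod_hom], of a b]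
    right_hom_rsmult[OF bimod_hom_right[OF eta_bimod_hom], of b a] by simp_all

lemma eps_smult [simp]: "b \<in> carrier B \<Longrightarrow> c \<in> carrier C \<Longrightarrow> \<epsilon> (b \<odot>\<^bsub>C\<^esub> c) = b \<otimes>\<^bsub>B\<^esub> \<epsilon> c"
  "b \<in> carrier B \<Longrightarrow> c \<in> carrier C \<Longrightarrow> \<epsilon> (c \<triangleleft>\<^bsub>C\<^esub> b) = \<epsilon> c \<otimes>\<^bsub>B\<^esub> b"
  using left_hom_smult[OF bimod_hom_left[OF eps_bimod_hom], of b c]
    right_hom_rsmult[OF bimod_hom_right[OF eps_bimod_hom], of b c] by simp_all

definition mn where "mn = elem_tensor B M N"
definition nm where "nm = elem_tensor A N M"

lemma mn_closed [simp]: "m \<in> carrier M \<Longrightarrow> n \<in> carrier N \<Longrightarrow> mn m n \<in> carrier S"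
  and nm_closed [simp]: "m \<in> carrier M \<Longrightarrow> n \<in> carrier N \<Longrightarrow> nm n m \<in> carrier C"
  by (simp_all add: mn_def nm_def)

lemma mn_ahom_left: "n \<in> carrier N \<Longrightarrow> (\<lambda>m. mn m n) \<in> ahom M S"
  and nm_ahom_left: "m \<in> carrier M \<Longrightarrow> (\<lambda>n. nm n m) \<in> ahom N C"
  and nm_ahom_right: "n \<in> carrier N \<Longrightarrow> (\<lambda>m. nm n m) \<in> ahom M C"
  by (simp_all add: mn_def nm_def)

lemma mn_smult [simp]:
  "a \<in> carrier A \<Longrightarrow> m \<in> carrier M \<Longrightarrow> n \<in> carrier N \<Longrightarrow> a \<odot>\<^bsub>S\<^esub> mn m n = mn (a \<odot>\<^bsub>M\<^esub> m) n"
  "a \<in> carrier A \<Longrightarrow> m \<in> carrier M \<Longrightarrow> n \<in> carrier N \<Longrightarrow> mn m n \<triangleleft>\<^bsub>S\<^esub> a = mn m (n \<triangleleft>\<^bsub>N\<^esub> a)"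
  "b \<in> carrier B \<Longrightarrow> m \<in> carrier M \<Longrightarrow> n \<in> carrier N \<Longrightarrow> mn m (b \<odot>\<^bsub>N\<^esub> n) = mn (m \<triangleleft>\<^bsub>M\<^esub> b) n"
  by (simp_all add: mn_def elem_tensor_balanced)

lemma nm_smult [simp]:
  "b \<in> carrier B \<Longrightarrow> m \<in> carrier M \<Longrightarrow> n \<in> carrier N \<Longrightarrow> b \<odot>\<^bsub>C\<^esub> nm n m = nm (b \<odot>\<^bsub>N\<^esub> n) m"
  "b \<in> carrier B \<Longrightarrow> m \<in> carrier M \<Longrightarrow> n \<in> carrier N \<Longrightarrow> nm n m \<triangleleft>\<^bsub>C\<^esub> b = nm n (m \<triangleleft>\<^bsub>M\<^esub> b)"
  "a \<in> carrier A \<Longrightarrow> m \<in> carrier M \<Longrightarrow> n \<in> carrier N \<Longrightarrow> nm n (a \<odot>\<^bsub>M\<^esub> m) = nm (n \<triangleleft>\<^bsub>N\<^esub> a) m"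
  by (simp_all add: nm_def elem_tensor_balanced)

lemma S_eqI:
  assumes "f \<in> ahom S P" "g \<in> ahom S P" "\<And>m n. m \<in> carrier M \<Longrightarrow> n \<in> carrier N \<Longrightarrow> f (mn m n) = g (mn m n)"
    "s \<in> carrier S"
  shows "f s = g s"
  by (rule tensor_eqI[OF _ _ assms(1,2) _ assms(4)]) (simp_all add: assms(3) flip: mn_def)

lemma C_eqI:
  assumes "f \<in> ahom C P" "g \<in> ahom C P" "\<And>m n. m \<in> carrier M \<Longrightarrow> n \<in> carrier N \<Longrightarrow> f (nm n m) = g (nm n m)"
    "c \<in> carrier C"
  shows "f c = g c"
  by (rule tensor_eqI[OF _ _ assms(1,2) _ assms(4)]) (simp_all add: assms(3) flip: nm_def)

subsection \<open>\<open>M\<close> and \<open>N\<close> as modules over \<open>S\<close>\<close>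

definition sm where "sm s m = r_counit A B M N \<epsilon> M (elem_tensor A S M s m)"
definition ns where "ns n s = l_counit A B M N \<epsilon> N (elem_tensor A N S n s)"
definition ss where "ss s s' = s \<otimes>\<^bsub>S_ring A B M N \<epsilon>\<^esub> s'"

lemma r_counit_M_right_hom [simp]: "r_counit A B M N \<epsilon> M \<in> right_hom B (tensor A S M) M"
  by (rule r_counit_right_hom) simp_all

lemma l_counit_N_left_hom [simp]: "l_counit A B M N \<epsilon> N \<in> left_hom B (tensor A N S) N"
  by (rule l_counit_left_hom) simp_all

lemma sm_ahom_left: "m \<in> carrier M \<Longrightarrow> (\<lambda>s. sm s m) \<in> ahom S M"
  unfolding sm_def by (intro ahom_comp[OF elem_tensor_ahom_left right_hom_ahom[OF r_counit_M_right_hom]]) simp_all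

lemma sm_ahom_right: "s \<in> carrier S \<Longrightarrow> (\<lambda>m. sm s m) \<in> ahom M M"
  unfolding sm_def by (intro ahom_comp[OF elem_tensor_ahom_right right_hom_ahom[OF r_counit_M_right_hom]]) simp_all

lemma ns_ahom_left: "s \<in> carrier S \<Longrightarrow> (\<lambda>n. ns n s) \<in> ahom N N"
  unfolding ns_def by (intro ahom_comp[OF elem_tensor_ahom_left left_hom_ahom[OF l_counit_N_left_hom]]) simp_all

lemma ns_ahom_right: "n \<in> carrier N \<Longrightarrow> (\<lambda>s. ns n s) \<in> ahom S N"
  unfolding ns_def by (intro ahom_comp[OF elem_tensor_ahom_right left_hom_ahom[OF l_counit_N_left_hom]]) simp_all

lemmas sm_closed [simp] = ahom_closed[OF sm_ahom_left]
lemmas ns_closed [simp] = ahom_closed[OF ns_ahom_left]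

lemma sm_mn [simp]: "m \<in> carrier M \<Longrightarrow> n \<in> carrier N \<Longrightarrow> m' \<in> carrier M \<Longrightarrow>
    sm (mn m n) m' = m \<triangleleft>\<^bsub>M\<^esub> \<epsilon> (nm n m')"
  by (simp add: sm_def mn_def nm_def r_counit_elem)

lemma ns_mn [simp]: "m \<in> carrier M \<Longrightarrow> n \<in> carrier N \<Longrightarrow> n' \<in> carrier N \<Longrightarrow>
    ns n' (mn m n) = \<epsilon> (nm n' m) \<odot>\<^bsub>N\<^esub> n"
  by (simp add: ns_def mn_def nm_def l_counit_elem)

lemma sm_rsmult: "s \<in> carrier S \<Longrightarrow> m \<in> carrier M \<Longrightarrow> b \<in> carrier B \<Longrightarrow>
    sm s (m \<triangleleft>\<^bsub>M\<^esub> b) = sm s m \<triangleleft>\<^bsub>M\<^esub> b"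
  using right_hom_rsmult[OF r_counit_M_right_hom, of b "elem_tensor A S M s m"]
  by (simp add: sm_def)

lemma ns_smult: "s \<in> carrier S \<Longrightarrow> n \<in> carrier N \<Longrightarrow> b \<in> carrier B \<Longrightarrow>
    ns (b \<odot>\<^bsub>N\<^esub> n) s = b \<odot>\<^bsub>N\<^esub> ns n s"
  using left_hom_smult[OF l_counit_N_left_hom, of b "elem_tensor A N S n s"]
  by (simp add: ns_def)

lemma sm_balanced: "s \<in> carrier S \<Longrightarrow> m \<in> carrier M \<Longrightarrow> a \<in> carrier A \<Longrightarrow>
    sm (s \<triangleleft>\<^bsub>S\<^esub> a) m = sm s (a \<odot>\<^bsub>M\<^esub> m)"
  by (simp add: sm_def elem_tensor_balanced)

lemma sm_smult: assumes "s \<in> carrier S" "m \<in> carrier M" "a \<in> carrier A"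
  shows "sm (a \<odot>\<^bsub>S\<^esub> s) m = a \<odot>\<^bsub>M\<^esub> sm s m"
  by (rule S_eqI[OF ahom_comp[OF _ sm_ahom_left] ahom_comp[OF sm_ahom_left smult_ahom]])
     (use assms in simp_all)

lemma ns_rsmult: assumes "s \<in> carrier S" "n \<in> carrier N" "a \<in> carrier A"
  shows "ns n (s \<triangleleft>\<^bsub>S\<^esub> a) = ns n s \<triangleleft>\<^bsub>N\<^esub> a"
  by (rule S_eqI[OF ahom_comp[OF _ ns_ahom_right] ahom_comp[OF ns_ahom_right rsmult_ahom]])
     (use assms in simp_all)

lemma sm_eta [simp]: assumes "a \<in> carrier A" "m \<in> carrier M" shows "sm (\<eta> a) m = a \<odot>\<^bsub>M\<^esub> m"
proof -
  have "r_counit A B M N \<epsilon> M (tensor_map A (regular A) M S M \<eta> (ident M) (lact_inv A M (a \<odot>\<^bsub>M\<^esub> m)))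
      = a \<odot>\<^bsub>M\<^esub> m"
    using adjoint assms by (simp add: right_adjoint_def)
  then show ?thesis using assms by (simp add: lact_inv_smult sm_def)
qed

lemma ns_eta [simp]: assumes "a \<in> carrier A" "n \<in> carrier N" shows "ns n (\<eta> a) = n \<triangleleft>\<^bsub>N\<^esub> a"
proof -
  have "l_counit A B M N \<epsilon> N (tensor_map A N (regular A) N S (ident N) \<eta> (ract_inv A N (n \<triangleleft>\<^bsub>N\<^esub> a)))
      = n \<triangleleft>\<^bsub>N\<^esub> a"
    using adjoint assms by (simp add: right_adjoint_def)
  then show ?thesis using assms by (simp add: ract_inv_rsmult ns_def)
qed

lemma ss_eq: "ss s s' = tensor_map B M (tensor A N S) M N (ident M) (l_counit A B M N \<epsilon> N)
     (assoc B A M N S (elem_tensor A S S s s'))"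
  by (simp add: ss_def S_ring_def Let_def)

lemma ss_ahom_left: "s' \<in> carrier S \<Longrightarrow> (\<lambda>s. ss s s') \<in> ahom S S"
  unfolding ss_eq
  by (intro ahom_comp[OF elem_tensor_ahom_left ahom_comp[OF assoc_ahom tensor_map_ahom]]) simp_all

lemma ss_ahom_right: "s \<in> carrier S \<Longrightarrow> (\<lambda>s'. ss s s') \<in> ahom S S"
  unfolding ss_eq
  by (intro ahom_comp[OF elem_tensor_ahom_right ahom_comp[OF assoc_ahom tensor_map_ahom]]) simp_all

lemmas ss_closed [simp] = ahom_closed[OF ss_ahom_left]

lemma ss_mn_left [simp]: "m \<in> carrier M \<Longrightarrow> n \<in> carrier N \<Longrightarrow> s \<in> carrier S \<Longrightarrow>
    ss (mn m n) s = mn m (ns n s)"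
  by (simp add: ss_eq mn_def ns_def left_hom_closed[OF l_counit_N_left_hom])

lemma ss_mn_right: assumes "m \<in> carrier M" "n \<in> carrier N" "s \<in> carrier S"
  shows "ss s (mn m n) = mn (sm s m) n"
  by (rule S_eqI[OF ss_ahom_left ahom_comp[OF sm_ahom_left mn_ahom_left]]) (use assms in simp_all)

lemma sm_ss: assumes "s \<in> carrier S" "s' \<in> carrier S" "m \<in> carrier M"
  shows "sm (ss s s') m = sm s (sm s' m)"
proof (rule S_eqI[OF ahom_comp[OF ss_ahom_right sm_ahom_left] ahom_comp[OF sm_ahom_left sm_ahom_right]])
  fix m' n' assume *: "m' \<in> carrier M" "n' \<in> carrier N"
  then show "sm (ss s (mn m' n')) m = sm s (sm (mn m' n') m)"
    using assms by (simp add: ss_mn_right sm_rsmult)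
qed (use assms in simp_all)

lemma ns_ss: assumes "s \<in> carrier S" "s' \<in> carrier S" "n \<in> carrier N"
  shows "ns n (ss s s') = ns (ns n s) s'"
proof (rule S_eqI[OF ahom_comp[OF ss_ahom_left ns_ahom_right] ahom_comp[OF ns_ahom_right ns_ahom_left]])
  fix m' n' assume *: "m' \<in> carrier M" "n' \<in> carrier N"
  then show "ns n (ss (mn m' n') s') = ns (ns n (mn m' n')) s'"
    using assms by (simp add: ns_smult)
qed (use assms in simp_all)

lemma eps_ns: assumes "s \<in> carrier S" "m \<in> carrier M" "n \<in> carrier N"
  shows "\<epsilon> (nm (ns n s) m) = \<epsilon> (nm n (sm s m))"
proof (rule S_eqI[OF ahom_comp[OF ahom_comp[OF ns_ahom_right nm_ahom_left] eps_ahom]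
      ahom_comp[OF ahom_comp[OF sm_ahom_left nm_ahom_right] eps_ahom]])
  fix m' n' assume *: "m' \<in> carrier M" "n' \<in> carrier N"
  then show "\<epsilon> (nm (ns n (mn m' n')) m) = \<epsilon> (nm n (sm (mn m' n') m))"
    using assms eps_smult(1)[of "\<epsilon> (nm n m')" "nm n' m"] eps_smult(2)[of "\<epsilon> (nm n' m)" "nm n m'"]
    by simp
qed (use assms in simp_all)

lemma ss_eta [simp]: assumes "s \<in> carrier S" "a \<in> carrier A"
  shows "ss s (\<eta> a) = s \<triangleleft>\<^bsub>S\<^esub> a" "ss (\<eta> a) s = a \<odot>\<^bsub>S\<^esub> s"
  by (rule S_eqI[OF ss_ahom_left rsmult_ahom] S_eqI[OF ss_ahom_right smult_ahom];
      use assms in \<open>simp add: ss_mn_right\<close>)+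

lemma ss_smult: assumes "s \<in> carrier S" "s' \<in> carrier S" "a \<in> carrier A"
  shows "ss (a \<odot>\<^bsub>S\<^esub> s) s' = a \<odot>\<^bsub>S\<^esub> ss s s'"
  by (rule S_eqI[OF ahom_comp[OF smult_ahom ss_ahom_left] ahom_comp[OF ss_ahom_left smult_ahom]])
     (use assms in simp_all)

lemma ss_rsmult: assumes "s \<in> carrier S" "s' \<in> carrier S" "a \<in> carrier A"
  shows "ss s (s' \<triangleleft>\<^bsub>S\<^esub> a) = ss s s' \<triangleleft>\<^bsub>S\<^esub> a"
  by (rule S_eqI[OF ahom_comp[OF rsmult_ahom ss_ahom_right] ahom_comp[OF ss_ahom_right rsmult_ahom]])
     (use assms in \<open>simp_all add: ss_mn_right\<close>)

lemma ss_balanced: "s \<in> carrier S \<Longrightarrow> s' \<in> carrier S \<Longrightarrow> a \<in> carrier A \<Longrightarrow>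
    ss (s \<triangleleft>\<^bsub>S\<^esub> a) s' = ss s (a \<odot>\<^bsub>S\<^esub> s')"
  by (simp add: ss_eq elem_tensor_balanced)

subsection \<open>Units, comultiplication and the twisted coactions\<close>

lemma l_unit_elem: assumes "firm_left A X" "a \<in> carrier A" "x \<in> carrier X"
  shows "l_unit A B M N \<eta> X (a \<odot>\<^bsub>X\<^esub> x) = assoc B A M N X (elem_tensor A S X (\<eta> a) x)"
  using assms firm_left_module[OF assms(1)] by (simp add: l_unit_def lact_inv_smult)

lemma r_unit_elem: assumes "firm_right A X" "a \<in> carrier A" "x \<in> carrier X"
  shows "r_unit A B M N \<eta> X (x \<triangleleft>\<^bsub>X\<^esub> a) = assoc_inv A B X M N (elem_tensor A X S x (\<eta> a))"
  using assms firm_right_module[OF assms(1)] by (simp add: r_unit_def ract_inv_rsmult)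

lemma l_unit_left_hom: assumes "firm_left A X"
  shows "l_unit A B M N \<eta> X \<in> left_hom A X (tensor B M (tensor A N X))"
proof -
  note [simp] = assms firm_left_module[OF assms]
  have "(\<lambda>x\<in>carrier X. (\<lambda>t\<in>carrier (tensor A (regular A) X).
      assoc B A M N X (tensor_map A (regular A) X S X \<eta> (ident X) t)) (lact_inv A X x))
    \<in> left_hom A X (tensor B M (tensor A N X))"
    by (intro left_hom_comp[OF lact_inv_left_hom left_hom_comp[OF tensor_map_left_hom assoc_left_hom]]) simp_all
  moreover have "(\<lambda>x\<in>carrier X. (\<lambda>t\<in>carrier (tensor A (regular A) X).
      assoc B A M N X (tensor_map A (regular A) X S X \<eta> (ident X) t)) (lact_inv A X x)) = l_unit A B M N \<eta> X"
    using left_hom_closed[OF lact_inv_left_hom[of A X]] by (auto simp: l_unit_def fun_eq_iff)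
  ultimately show ?thesis by simp
qed

lemma r_unit_right_hom: assumes "firm_right A X"
  shows "r_unit A B M N \<eta> X \<in> right_hom A X (tensor B (tensor A X M) N)"
proof -
  note [simp] = assms firm_right_module[OF assms]
  have "(\<lambda>x\<in>carrier X. (\<lambda>t\<in>carrier (tensor A X (regular A)).
      assoc_inv A B X M N (tensor_map A X (regular A) X S (ident X) \<eta> t)) (ract_inv A X x))
    \<in> right_hom A X (tensor B (tensor A X M) N)"
    by (intro right_hom_comp[OF ract_inv_right_hom right_hom_comp[OF tensor_map_right_hom assoc_inv_right_hom]]) simp_all
  moreover have "(\<lambda>x\<in>carrier X. (\<lambda>t\<in>carrier (tensor A X (regular A)).
      assoc_inv A B X M N (tensor_map A X (regular A) X S (ident X) \<eta> t)) (ract_inv A X x)) = r_unit A B M N \<eta> X"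
    using right_hom_closed[OF ract_inv_right_hom[of A X]] by (auto simp: r_unit_def fun_eq_iff)
  ultimately show ?thesis by simp
qed

lemma l_unit_M_right_hom: "l_unit A B M N \<eta> M \<in> right_hom B M (tensor B M C)"
proof -
  have "(\<lambda>x\<in>carrier M. (\<lambda>t\<in>carrier (tensor A (regular A) M).
      assoc B A M N M (tensor_map A (regular A) M S M \<eta> (ident M) t)) (lact_inv A M x))
    \<in> right_hom B M (tensor B M C)"
    by (intro right_hom_comp[OF lact_inv_right_hom right_hom_comp[OF tensor_map_right_hom assoc_right_hom]]) simp_all
  moreover have "(\<lambda>x\<in>carrier M. (\<lambda>t\<in>carrier (tensor A (regular A) M).
      assoc B A M N M (tensor_map A (regular A) M S M \<eta> (ident M) t)) (lact_inv A M x)) = l_unit A B M N \<eta> M"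
    using left_hom_closed[OF lact_inv_left_hom[of A M]] by (auto simp: l_unit_def fun_eq_iff)
  ultimately show ?thesis by simp
qed

lemma l_unit_M_bimod_hom [simp]: "l_unit A B M N \<eta> M \<in> bimod_hom A B M (tensor B M C)"
  by (simp add: bimod_hom_iff l_unit_left_hom l_unit_M_right_hom)

lemmas l_unit_M_homs [simp] = bimod_hom_left[OF l_unit_M_bimod_hom] bimod_hom_right[OF l_unit_M_bimod_hom]

definition delta where
  "delta n s m = assoc_inv A B N M C (elem_tensor A N (tensor B M C) n
     (assoc B A M N M (elem_tensor A S M s m)))"

lemma delta_mn [simp]: "m \<in> carrier M \<Longrightarrow> n \<in> carrier N \<Longrightarrow> m' \<in> carrier M \<Longrightarrow> n' \<in> carrier N \<Longrightarrow>
    delta n (mn m' n') m = elem_tensor B C C (nm n m') (nm n' m)"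
  by (simp add: delta_def mn_def nm_def)

lemma delta_ahom: "m \<in> carrier M \<Longrightarrow> n \<in> carrier N \<Longrightarrow> (\<lambda>s. delta n s m) \<in> ahom S (tensor B C C)"
  unfolding delta_def
  by (intro ahom_comp[OF elem_tensor_ahom_left ahom_comp[OF assoc_ahom
        ahom_comp[OF elem_tensor_ahom_right assoc_inv_ahom]]]) simp_all

lemma C_comult_nm: "n \<in> carrier N \<Longrightarrow> m \<in> carrier M \<Longrightarrow> a \<in> carrier A \<Longrightarrow>
    C_comult A B M N \<eta> (nm n (a \<odot>\<^bsub>M\<^esub> m)) = delta n (\<eta> a) m"
  by (simp add: C_comult_def Let_def nm_def delta_def l_unit_elem del: nm_smult)

lemma C_comult_ahom: "C_comult A B M N \<eta> \<in> ahom C (tensor B C C)"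
  unfolding C_comult_def Let_def
  by (intro restrict_ahom ahom_comp[OF tensor_map_ahom assoc_inv_ahom]) simp_all

definition theta where
  "theta f s m = assoc_inv B A M N M (tensor_map B M C M C (ident M) f
     (assoc B A M N M (elem_tensor A S M s m)))"

text \<open>\<open>\<Phi>\<^sub>f\<close> is \<open>(M \<otimes> f)(\<eta> \<otimes> M)\<close>, and \<open>\<theta>\<^sub>f\<close> is \<open>M \<otimes> f\<close> on \<open>S \<otimes>\<^sub>A M\<close>.\<close>

definition Phi where
  "Phi f = (\<lambda>m\<in>carrier M. assoc_inv B A M N M (tensor_map B M C M C (ident M) f (l_unit A B M N \<eta> M m)))"

definition nu where "nu n t = l_counit A B M N \<epsilon> C (elem_tensor A N (tensor B M C) n (assoc B A M N M t))"

lemma l_counit_C_left_hom [simp]: "l_counit A B M N \<epsilon> C \<in> left_hom B (tensor A N (tensor B M C)) C"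
  by (rule l_counit_left_hom) simp_all

lemma nu_ahom: "n \<in> carrier N \<Longrightarrow> nu n \<in> ahom (tensor A S M) C"
  unfolding nu_def
  by (intro ahom_comp[OF assoc_ahom ahom_comp[OF elem_tensor_ahom_right left_hom_ahom[OF l_counit_C_left_hom]]])
     simp_all

lemma nu_elem: assumes "n \<in> carrier N" "s \<in> carrier S" "m \<in> carrier M"
  shows "nu n (elem_tensor A S M s m) = nm (ns n s) m"
proof (rule S_eqI[OF ahom_comp[OF elem_tensor_ahom_left nu_ahom] ahom_comp[OF ns_ahom_right nm_ahom_left]])
  fix m' n' assume *: "m' \<in> carrier M" "n' \<in> carrier N"
  have "nu n (elem_tensor A S M (mn m' n') m) = \<epsilon> (nm n m') \<odot>\<^bsub>C\<^esub> nm n' m"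
    using * assms by (simp add: nu_def mn_def nm_def l_counit_elem del: nm_smult)
  then show "nu n (elem_tensor A S M (mn m' n') m) = nm (ns n (mn m' n')) m"
    using * assms by simp
qed (use assms in simp_all)

context
  fixes f assumes f: "f \<in> bimod_hom B B C C"
begin

lemmas f_rules [simp] = f bimod_hom_left[OF f] bimod_hom_right[OF f] bimod_hom_closed[OF f]

lemma theta_ahom: "m \<in> carrier M \<Longrightarrow> (\<lambda>s. theta f s m) \<in> ahom S (tensor A S M)"
  unfolding theta_def
  by (intro ahom_comp[OF elem_tensor_ahom_left ahom_comp[OF assoc_ahom
        ahom_comp[OF tensor_map_ahom assoc_inv_ahom]]]) simp_all

lemma theta_mn: "m \<in> carrier M \<Longrightarrow> n \<in> carrier N \<Longrightarrow> m' \<in> carrier M \<Longrightarrow>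
    theta f (mn m n) m' = assoc_inv B A M N M (elem_tensor B M C m (f (nm n m')))"
  by (simp add: theta_def mn_def flip: nm_def)

lemma Phi_elem: "a \<in> carrier A \<Longrightarrow> m \<in> carrier M \<Longrightarrow> Phi f (a \<odot>\<^bsub>M\<^esub> m) = theta f (\<eta> a) m"
  by (simp add: Phi_def theta_def l_unit_elem)

lemma Phi_right_hom: "Phi f \<in> right_hom B M (tensor A S M)"
proof -
  have "(\<lambda>m\<in>carrier M. (\<lambda>t\<in>carrier (tensor B M C). assoc_inv B A M N M
      (tensor_map B M C M C (ident M) f t)) (l_unit A B M N \<eta> M m)) \<in> right_hom B M (tensor A S M)"
    by (intro right_hom_comp[OF l_unit_M_right_hom right_hom_comp[OF tensor_map_right_hom assoc_inv_right_hom]])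
       simp_all
  moreover have "(\<lambda>m\<in>carrier M. (\<lambda>t\<in>carrier (tensor B M C). assoc_inv B A M N M
      (tensor_map B M C M C (ident M) f t)) (l_unit A B M N \<eta> M m)) = Phi f"
    using right_hom_closed[OF l_unit_M_right_hom] by (auto simp: Phi_def fun_eq_iff)
  ultimately show ?thesis by simp
qed

lemma Phi_left_hom: "Phi f \<in> left_hom A M (tensor A S M)"
proof -
  have "(\<lambda>m\<in>carrier M. (\<lambda>t\<in>carrier (tensor B M C). assoc_inv B A M N M
      (tensor_map B M C M C (ident M) f t)) (l_unit A B M N \<eta> M m)) \<in> left_hom A M (tensor A S M)"
    by (intro left_hom_comp[OF l_unit_left_hom left_hom_comp[OF tensor_map_left_hom assoc_inv_left_hom]])
       simp_all
  moreover have "(\<lambda>m\<in>carrier M. (\<lambda>t\<in>carrier (tensor B M C). assoc_inv B A M N M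
      (tensor_map B M C M C (ident M) f t)) (l_unit A B M N \<eta> M m)) = Phi f"
    using right_hom_closed[OF l_unit_M_right_hom] by (auto simp: Phi_def fun_eq_iff)
  ultimately show ?thesis by simp
qed

lemma Phi_ahom: "Phi f \<in> ahom M (tensor A S M)"
  by (rule right_hom_ahom[OF Phi_right_hom])

lemma nu_Phi: assumes "n \<in> carrier N" "m \<in> carrier M"
  shows "nu n (Phi f m) = f (nm n m)"
proof (rule firm_left_eqI[of A M _ C, OF _ _ ahom_comp[OF Phi_ahom nu_ahom] ahom_comp[OF nm_ahom_right bimod_hom_ahom[OF f]]])
  fix a m assume am: "a \<in> carrier A" "m \<in> carrier M"
  have "nu n (theta f s m) = f (nm (ns n s) m)" if "s \<in> carrier S" for s
  proof (rule S_eqI[OF ahom_comp[OF theta_ahom nu_ahom]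
        ahom_comp[OF ns_ahom_right ahom_comp[OF nm_ahom_left bimod_hom_ahom[OF f]]] _ that])
    fix m' n' assume *: "m' \<in> carrier M" "n' \<in> carrier N"
    then have "nu n (theta f (mn m' n') m) = \<epsilon> (nm n m') \<odot>\<^bsub>C\<^esub> f (nm n' m)"
      using am assms by (simp add: theta_mn nu_def assoc_assoc_inv l_counit_elem flip: nm_def)
    also have "\<dots> = f (\<epsilon> (nm n m') \<odot>\<^bsub>C\<^esub> nm n' m)"
      using * am assms left_hom_smult[OF bimod_hom_left[OF f], of "\<epsilon> (nm n m')" "nm n' m"] by simp
    finally show "nu n (theta f (mn m' n') m) = f (nm (ns n (mn m' n')) m)"
      using * am assms by simp
  qed (use am assms in simp_all)
  from this[of "\<eta> a"] show "nu n (Phi f (a \<odot>\<^bsub>M\<^esub> m)) = f (nm n (a \<odot>\<^bsub>M\<^esub> m))"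
    using am assms by (simp add: Phi_elem)
qed (use assms in simp_all)

end

end

section \<open>Invertible subbimodules and coring endomorphisms\<close>

context firm_adjunction
begin

abbreviation xi where "xi I i \<equiv> xi_r A B M N \<epsilon> I i"

definition mu :: "('a, 'a, 'u) bimod \<Rightarrow> ('u \<Rightarrow> ('m, 'n) tens) \<Rightarrow> ('u, ('m, 'n) tens) tens \<Rightarrow> ('m, 'n) tens" where
  "mu I i = tensor_lift S (\<lambda>x s. ss (i x) s)"

text \<open>\<open>represents f I i\<close> is \<open>f = \<Gamma>(I, i)\<close>, written without inverting \<open>\<xi>\<close>.\<close>

definition inv_pair :: "('a, 'a, 'u) bimod \<Rightarrow> ('u \<Rightarrow> ('m, 'n) tens) \<Rightarrow> bool" where
  "inv_pair I i \<longleftrightarrow> firm_bimodule A A I \<and> i \<in> bimod_hom A A I S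
     \<and> bij_betw (xi I i) (carrier (tensor A I M)) (carrier M)"

definition represents :: "(('n, 'm) tens \<Rightarrow> ('n, 'm) tens) \<Rightarrow> ('a, 'a, 'u) bimod \<Rightarrow> ('u \<Rightarrow> ('m, 'n) tens) \<Rightarrow> bool" where
  "represents f I i \<longleftrightarrow> (\<forall>x\<in>carrier I. \<forall>n\<in>carrier N. \<forall>m\<in>carrier M.
     f (nm n (sm (i x) m)) = nm (ns n (i x)) m)"

context
  fixes I :: "('a, 'a, 'u) bimod" and i
  assumes I: "firm_bimodule A A I" and i: "i \<in> bimod_hom A A I S"
begin

lemmas I_rules [simp] = I firm_bimoduleD[OF I] i bimod_hom_left[OF i] bimod_hom_right[OF i]
  bimod_hom_closed[OF i] bimod_hom_ahom[OF i] left_hom_smult[OF bimod_hom_left[OF i]]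
  right_hom_rsmult[OF bimod_hom_right[OF i]]

lemma xi_elem [simp]: "x \<in> carrier I \<Longrightarrow> m \<in> carrier M \<Longrightarrow> xi I i (elem_tensor A I M x m) = sm (i x) m"
  by (simp add: xi_r_def sm_def)

lemma xi_ahom: "xi I i \<in> ahom (tensor A I M) M"
  unfolding xi_r_def
  by (intro restrict_ahom ahom_comp[OF tensor_map_ahom right_hom_ahom[OF r_counit_M_right_hom]]) simp_all

lemma xi_bimod_hom: "xi I i \<in> bimod_hom A B (tensor A I M) M"
  unfolding bimod_hom_iff left_hom_iff right_hom_iff
proof (intro conjI ballI)
  fix a t assume a: "a \<in> carrier A" and t: "t \<in> carrier (tensor A I M)"
  show "xi I i (a \<odot>\<^bsub>tensor A I M\<^esub> t) = a \<odot>\<^bsub>M\<^esub> xi I i t"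
    by (rule tensor_eqI[OF _ _ ahom_comp[OF tensor_smult_ahom xi_ahom] ahom_comp[OF xi_ahom smult_ahom] _ t])
       (use a in \<open>simp_all add: sm_smult\<close>)
next
  fix b t assume b: "b \<in> carrier B" and t: "t \<in> carrier (tensor A I M)"
  show "xi I i (t \<triangleleft>\<^bsub>tensor A I M\<^esub> b) = xi I i t \<triangleleft>\<^bsub>M\<^esub> b"
    by (rule tensor_eqI[OF _ _ ahom_comp[OF tensor_rsmult_ahom xi_ahom] ahom_comp[OF xi_ahom rsmult_ahom] _ t])
       (use b in \<open>simp_all add: sm_rsmult\<close>)
qed (simp_all add: xi_ahom, simp_all add: xi_r_def)

lemma mu_balanced: "balanced A I S S (\<lambda>x s. ss (i x) s)"
  by (intro balancedI ahom_comp[OF bimod_hom_ahom[OF i] ss_ahom_left] ss_ahom_right)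
     (simp_all add: ss_balanced)

lemma mu_elem [simp]: "x \<in> carrier I \<Longrightarrow> s \<in> carrier S \<Longrightarrow> mu I i (elem_tensor A I S x s) = ss (i x) s"
  by (simp add: mu_def tensor_lift_elem[OF _ _ _ mu_balanced])

lemma mu_ahom: "mu I i \<in> ahom (tensor A I S) S"
  by (simp add: mu_def tensor_lift_ahom[OF _ _ _ mu_balanced])

lemma mu_smult: assumes "t \<in> carrier (tensor A I S)" "a \<in> carrier A"
  shows "mu I i (a \<odot>\<^bsub>tensor A I S\<^esub> t) = a \<odot>\<^bsub>S\<^esub> mu I i t"
  by (rule tensor_eqI[OF _ _ ahom_comp[OF tensor_smult_ahom mu_ahom] ahom_comp[OF mu_ahom smult_ahom] _ assms(1)])
     (use assms in \<open>simp_all add: ss_smult\<close>)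

lemma mu_rsmult: assumes "t \<in> carrier (tensor A I S)" "a \<in> carrier A"
  shows "mu I i (t \<triangleleft>\<^bsub>tensor A I S\<^esub> a) = mu I i t \<triangleleft>\<^bsub>S\<^esub> a"
  by (rule tensor_eqI[OF _ _ ahom_comp[OF tensor_rsmult_ahom mu_ahom] ahom_comp[OF mu_ahom rsmult_ahom] _ assms(1)])
     (use assms in \<open>simp_all add: ss_rsmult\<close>)

lemma mn_left_hom: "n \<in> carrier N \<Longrightarrow> (\<lambda>m\<in>carrier M. mn m n) \<in> left_hom A M S"
  by (simp add: left_hom_iff restrict_ahom mn_ahom_left)

text \<open>\<open>- \<otimes>\<^sub>B N\<close> is faithful on maps out of \<open>I \<otimes>\<^sub>A M\<close>, since \<open>am\<close> is a sum of terms \<open>p \<triangleleft> \<epsilon>(q \<otimes> m)\<close>.\<close>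

lemma xi_bij_of_mu:
  assumes bij: "bij_betw (mu I i) (carrier (tensor A I S)) (carrier S)"
  shows "bij_betw (xi I i) (carrier (tensor A I M)) (carrier M)"
proof -
  let ?IM = "tensor A I M" and ?IS = "tensor A I S"
  let ?W = "\<lambda>t. tensor_map A I (tensor A S M) I M (ident I) (r_counit A B M N \<epsilon> M) (assoc A A I S M t)"
  let ?T = "\<lambda>n. tensor_map A I M I S (ident I) (\<lambda>m\<in>carrier M. mn m n)"
  have rc: "r_counit A B M N \<epsilon> M \<in> left_hom A (tensor A S M) M"
    unfolding left_hom_iff
  proof (intro conjI ballI)
    fix a t assume a: "a \<in> carrier A" and t: "t \<in> carrier (tensor A S M)"
    show "r_counit A B M N \<epsilon> M (a \<odot>\<^bsub>tensor A S M\<^esub> t) = a \<odot>\<^bsub>M\<^esub> r_counit A B M N \<epsilon> M t"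
      by (rule tensor_eqI[OF _ _ ahom_comp[OF tensor_smult_ahom right_hom_ahom[OF r_counit_M_right_hom]]
            ahom_comp[OF right_hom_ahom[OF r_counit_M_right_hom] smult_ahom] _ t])
         (use a in \<open>simp_all add: sm_smult flip: sm_def\<close>)
  qed (use right_hom_ahom[OF r_counit_M_right_hom] in \<open>simp_all add: r_counit_def\<close>)
  have rc': "r_counit A B M N \<epsilon> M \<in> bimod_hom A B (tensor A S M) M"
    using rc by (simp add: bimod_hom_iff)
  note [simp] = rc rc' mn_left_hom
  have W_ahom: "?W \<in> ahom (tensor A ?IS M) ?IM"
    by (intro ahom_comp[OF assoc_ahom tensor_map_ahom]) simp_all
  have W: "?W (elem_tensor A ?IS M (elem_tensor A I S x s) m) = elem_tensor A I M x (sm s m)"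
    if "x \<in> carrier I" "s \<in> carrier S" "m \<in> carrier M" for x s m
    using that by (simp flip: sm_def)
  have T: "?T n \<in> ahom ?IM ?IS" if "n \<in> carrier N" for n
    using that by simp
  have xi_W: "xi I i (?W (elem_tensor A ?IS M w m)) = sm (mu I i w) m"
    if w: "w \<in> carrier ?IS" and m: "m \<in> carrier M" for w m
    by (rule tensor_eqI[OF _ _ ahom_comp[OF ahom_comp[OF elem_tensor_ahom_left W_ahom] xi_ahom]
          ahom_comp[OF mu_ahom sm_ahom_left] _ w])
       (use m in \<open>simp_all add: sm_ss flip: sm_def\<close>)
  have mu_T: "mu I i (?T n z) = mn (xi I i z) n" if n: "n \<in> carrier N" and z: "z \<in> carrier ?IM" for n z
    by (rule tensor_eqI[OF _ _ ahom_comp[OF T mu_ahom] ahom_comp[OF xi_ahom mn_ahom_left] _ z])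
       (use n in \<open>simp_all add: ss_mn_right\<close>)
  have W_T: "?W (elem_tensor A ?IS M (?T n z) m) = z \<triangleleft>\<^bsub>?IM\<^esub> \<epsilon> (nm n m)"
    if n: "n \<in> carrier N" and m: "m \<in> carrier M" and z: "z \<in> carrier ?IM" for n m z
    by (rule tensor_eqI[OF _ _ ahom_comp[OF ahom_comp[OF T elem_tensor_ahom_left] W_ahom]
          tensor_rsmult_ahom[where B = B] _ z])
       (use n m in \<open>simp_all flip: sm_def\<close>)
  let ?g = "\<lambda>a\<in>carrier A. hom_inv ?IS S (mu I i) (\<eta> a)"
  have mui: "hom_inv ?IS S (mu I i) \<in> ahom S ?IS"
    using mu_ahom bij by (intro hom_inv_ahom) simp_all
  have g: "?g \<in> right_hom A (regular A) ?IS"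
    unfolding right_hom_iff
  proof (intro conjI ballI)
    show "?g \<in> ahom (regular A) ?IS"
      by (intro restrict_ahom[of "regular A", unfolded regular_simps] ahom_comp[OF _ mui]
          bimod_hom_ahom[OF eta_bimod_hom]) simp
    fix b a assume ab: "b \<in> carrier A" "a \<in> carrier (regular A)"
    then have "mu I i (?g a \<triangleleft>\<^bsub>?IS\<^esub> b) = \<eta> (a \<otimes>\<^bsub>A\<^esub> b)"
      using bij by (simp add: mu_rsmult eta_mult(2))
    then show "?g (a \<triangleleft>\<^bsub>regular A\<^esub> b) = ?g a \<triangleleft>\<^bsub>?IS\<^esub> b"
      using hom_inv_left[OF bij, of "?g a \<triangleleft>\<^bsub>?IS\<^esub> b"] ab bij by simp
  qed simp
  note [simp] = g
  let ?\<sigma> = "\<lambda>m\<in>carrier M. ?W (tensor_map A (regular A) M ?IS M ?g (ident M) (lact_inv A M m))"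
  have sig_elem: "?\<sigma> (a \<odot>\<^bsub>M\<^esub> m) = ?W (elem_tensor A ?IS M (hom_inv ?IS S (mu I i) (\<eta> a)) m)"
    if "a \<in> carrier A" "m \<in> carrier M" for a m
    using that by (simp add: lact_inv_smult)
  have "(\<lambda>x\<in>carrier M. (\<lambda>t\<in>carrier (tensor A (regular A) M). (\<lambda>u\<in>carrier (tensor A ?IS M).
       ?W u) (tensor_map A (regular A) M ?IS M ?g (ident M) t)) (lact_inv A M x)) \<in> right_hom B M ?IM"
    by (intro right_hom_comp[OF lact_inv_right_hom right_hom_comp[OF tensor_map_right_hom
          right_hom_comp[OF assoc_right_hom tensor_map_right_hom]]]) simp_all
  moreover have "(\<lambda>x\<in>carrier M. (\<lambda>t\<in>carrier (tensor A (regular A) M). (\<lambda>u\<in>carrier (tensor A ?IS M).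
       ?W u) (tensor_map A (regular A) M ?IS M ?g (ident M) t)) (lact_inv A M x)) = ?\<sigma>"
    using left_hom_closed[OF lact_inv_left_hom[of A M]] by (intro ext) simp
  ultimately have sig: "?\<sigma> \<in> right_hom B M ?IM" by simp
  have xi_sig: "xi I i (?\<sigma> m) = m" if m: "m \<in> carrier M" for m
    by (rule firm_left_eqI[of A M _ M, OF _ _ ahom_comp[OF right_hom_ahom[OF sig] xi_ahom] ahom_ident _ m])
       (use bij in \<open>simp_all only: sig_elem, simp_all add: xi_W\<close>)
  define k where "k z = ?\<sigma> (xi I i z)" for z
  have k: "k \<in> ahom ?IM ?IM"
    unfolding k_def[abs_def] by (rule ahom_comp[OF xi_ahom right_hom_ahom[OF sig]])
  have k_r: "k (z \<triangleleft>\<^bsub>?IM\<^esub> b) = k z \<triangleleft>\<^bsub>?IM\<^esub> b" if "z \<in> carrier ?IM" "b \<in> carrier B" for z b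
    using that right_hom_rsmult[OF sig, of b "xi I i z"] right_hom_rsmult[OF bimod_hom_right[OF xi_bimod_hom], of b z]
      ahom_closed[OF xi_ahom, of z]
    by (simp only: k_def)
  have T_k: "?T n (k z) = ?T n z" if n: "n \<in> carrier N" and z: "z \<in> carrier ?IM" for n z
  proof (rule inj_onD[OF bij_betw_imp_inj_on[OF bij]])
    show "mu I i (?T n (k z)) = mu I i (?T n z)"
      using n z xi_sig[OF ahom_closed[OF xi_ahom z]] ahom_closed[OF k z] by (simp only: mu_T k_def)
  qed (use ahom_closed[OF T[OF n]] z ahom_closed[OF k z] in auto)
  have k_id: "k z = z" if z: "z \<in> carrier ?IM" for z
  proof (rule tensor_eqI[OF _ _ k ahom_ident _ z])
    fix x m assume x: "x \<in> carrier I" and m: "m \<in> carrier M"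
    show "k (elem_tensor A I M x m) = elem_tensor A I M x m"
    proof (rule firm_left_eqI[of A M _ ?IM, OF _ _ ahom_comp[OF elem_tensor_ahom_right k] elem_tensor_ahom_right _ m])
      fix a m assume am: "a \<in> carrier A" "m \<in> carrier M"
      have "k (elem_tensor A I M x (sm s m)) = elem_tensor A I M x (sm s m)" if s: "s \<in> carrier S" for s
      proof (rule S_eqI[OF ahom_comp[OF ahom_comp[OF sm_ahom_left elem_tensor_ahom_right] k]
              ahom_comp[OF sm_ahom_left elem_tensor_ahom_right] _ s])
        fix p q assume pq: "p \<in> carrier M" "q \<in> carrier N"
        let ?z = "elem_tensor A I M x p"
        have z: "?z \<in> carrier ?IM" using x pq by simp
        have "k (?z \<triangleleft>\<^bsub>?IM\<^esub> \<epsilon> (nm q m)) = k ?z \<triangleleft>\<^bsub>?IM\<^esub> \<epsilon> (nm q m)"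
          using am pq by (intro k_r z) simp
        also have "\<dots> = ?W (elem_tensor A ?IS M (?T q (k ?z)) m)"
          by (rule W_T[OF pq(2) am(2) ahom_closed[OF k z], symmetric])
        also have "\<dots> = ?z \<triangleleft>\<^bsub>?IM\<^esub> \<epsilon> (nm q m)"
          by (simp only: T_k[OF pq(2) z] W_T[OF pq(2) am(2) z])
        finally show "k (elem_tensor A I M x (sm (mn p q) m)) = elem_tensor A I M x (sm (mn p q) m)"
          using x am pq by simp
      qed (use x am in simp_all)
      from this[of "\<eta> a"] show "k (elem_tensor A I M x (a \<odot>\<^bsub>M\<^esub> m)) = elem_tensor A I M x (a \<odot>\<^bsub>M\<^esub> m)"
        using am by simp
    qed (use x in simp_all)
  qed simp_all
  show ?thesis
    using xi_sig k_id ahom_closed[OF xi_ahom] right_hom_closed[OF sig]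
    by (intro bij_betw_byWitness[where f' = ?\<sigma>]) (auto simp only: k_def image_subset_iff)
qed

lemma mu_bij_of_xi:
  assumes "bij_betw (xi I i) (carrier (tensor A I M)) (carrier M)"
  shows "bij_betw (mu I i) (carrier (tensor A I S)) (carrier S)"
proof -
  note [simp] = bimod_hom_right[OF xi_bimod_hom]
  let ?f = "\<lambda>t. tensor_map B (tensor A I M) N M N (xi I i) (ident N) (assoc_inv A B I M N t)"
  have "bij_betw ?f (carrier (tensor A I S)) (carrier S)"
    by (rule bij_betw_trans[OF assoc_inv_bij tensor_map_bij, unfolded comp_def])
       (simp_all add: assms bij_betw_id[unfolded id_def])
  moreover have "?f t = mu I i t" if t: "t \<in> carrier (tensor A I S)" for t
    by (rule tensor3_eqI_right[OF _ _ _ _ ahom_comp[OF assoc_inv_ahom tensor_map_ahom] mu_ahom _ t])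
       (simp_all add: ss_mn_right[unfolded mn_def])
  ultimately show ?thesis by (simp cong: bij_betw_cong)
qed

context
  assumes bij: "bij_betw (xi I i) (carrier (tensor A I M)) (carrier M)"
begin

lemma M_xi_induct [consumes 1, case_names sm add]:
  assumes "m \<in> carrier M" "\<And>x m. x \<in> carrier I \<Longrightarrow> m \<in> carrier M \<Longrightarrow> Q (sm (i x) m)"
    "\<And>m m'. m \<in> carrier M \<Longrightarrow> m' \<in> carrier M \<Longrightarrow> Q m \<Longrightarrow> Q m' \<Longrightarrow> Q (m \<oplus>\<^bsub>M\<^esub> m')"
  shows "Q m"
proof -
  have "Q (xi I i z)" if "z \<in> carrier (tensor A I M)" for z
    by (rule tensor_induct[OF _ _ that])
       (simp_all add: assms(2,3) ahom_add[OF xi_ahom] ahom_closed[OF xi_ahom])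
  from this[of "hom_inv (tensor A I M) M (xi I i) m"] show ?thesis
    using bij assms(1) by simp
qed

lemma C_xi_eqI:
  assumes "f \<in> ahom C P" "g \<in> ahom C P"
    "\<And>n x m. n \<in> carrier N \<Longrightarrow> x \<in> carrier I \<Longrightarrow> m \<in> carrier M \<Longrightarrow> f (nm n (sm (i x) m)) = g (nm n (sm (i x) m))"
    "c \<in> carrier C"
  shows "f c = g c"
proof (rule C_eqI[OF assms(1,2) _ assms(4)])
  fix m n assume "m \<in> carrier M" and n: "n \<in> carrier N"
  then show "f (nm n m) = g (nm n m)"
  proof (induct rule: M_xi_induct)
    case (add m m')
    then show ?case
      using n by (simp add: ahom_add[OF nm_ahom_right] ahom_add[OF assms(1)] ahom_add[OF assms(2)])
  qed (simp add: assms(3))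
qed

lemma represents_unique:
  assumes "f \<in> ahom C C" "g \<in> ahom C C" "represents f I i" "represents g I i" "c \<in> carrier C"
  shows "f c = g c"
  by (rule C_xi_eqI[OF assms(1,2) _ assms(5)]) (use assms(3,4) in \<open>simp add: represents_def\<close>)

lemma gamma_r_represents: "represents (gamma_r A B M N \<epsilon> I i) I i"
  unfolding represents_def
proof (intro ballI)
  fix x n m assume *: "x \<in> carrier I" "n \<in> carrier N" "m \<in> carrier M"
  let ?IM = "tensor A I M"
  have hi: "(\<lambda>m\<in>carrier M. inv_into (carrier ?IM) (xi I i) m) = hom_inv ?IM M (xi I i)"
    by (simp add: hom_inv_def)
  have hl: "hom_inv ?IM M (xi I i) \<in> left_hom A M ?IM"
    by (rule hom_inv_left_hom[OF bimod_hom_left[OF xi_bimod_hom] bij]) simp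
  have "hom_inv ?IM M (xi I i) (sm (i x) m) = elem_tensor A I M x m"
    using hom_inv_left[OF bij, of "elem_tensor A I M x m"] * by simp
  then have "gamma_r A B M N \<epsilon> I i (nm n (sm (i x) m)) = nu n (elem_tensor A S M (i x) m)"
    using * hl unfolding gamma_r_def Let_def hi
    by (simp add: nm_def nu_def assoc_left_hom)
  then show "gamma_r A B M N \<epsilon> I i (nm n (sm (i x) m)) = nm (ns n (i x)) m"
    using * by (simp add: nu_elem)
qed

lemma gamma_r_ahom: "gamma_r A B M N \<epsilon> I i \<in> ahom C C"
proof -
  let ?IM = "tensor A I M"
  have hi: "(\<lambda>m\<in>carrier M. inv_into (carrier ?IM) (xi I i) m) = hom_inv ?IM M (xi I i)"
    by (simp add: hom_inv_def)
  have hl: "hom_inv ?IM M (xi I i) \<in> left_hom A M ?IM"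
    by (rule hom_inv_left_hom[OF bimod_hom_left[OF xi_bimod_hom] bij]) simp
  note [simp] = hl assoc_left_hom
  show ?thesis
    unfolding gamma_r_def Let_def hi
    by (intro restrict_ahom ahom_comp[OF tensor_map_ahom ahom_comp[OF tensor_map_ahom
          ahom_comp[OF tensor_map_ahom left_hom_ahom[OF l_counit_C_left_hom]]]]) simp_all
qed

lemma represents_bimod_hom:
  assumes f: "f \<in> ahom C C" "f \<in> extensional (carrier C)" and rep: "represents f I i"
  shows "f \<in> bimod_hom B B C C"
  unfolding bimod_hom_iff left_hom_iff right_hom_iff
proof (intro conjI ballI f)
  have r: "f (nm n (sm (i x) m)) = nm (ns n (i x)) m"
    if "x \<in> carrier I" "n \<in> carrier N" "m \<in> carrier M" for x n m
    using rep that by (simp add: represents_def)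
  fix b c assume b: "b \<in> carrier B" and c: "c \<in> carrier C"
  show "f (b \<odot>\<^bsub>C\<^esub> c) = b \<odot>\<^bsub>C\<^esub> f c"
    by (rule C_xi_eqI[OF ahom_comp[OF tensor_smult_ahom f(1)] ahom_comp[OF f(1) tensor_smult_ahom] _ c])
       (use b in \<open>simp_all add: r ns_smult\<close>)
  show "f (c \<triangleleft>\<^bsub>C\<^esub> b) = f c \<triangleleft>\<^bsub>C\<^esub> b"
    by (rule C_xi_eqI[OF ahom_comp[OF tensor_rsmult_ahom f(1)] ahom_comp[OF f(1) tensor_rsmult_ahom] _ c])
       (use b in \<open>simp_all add: r flip: sm_rsmult\<close>)
qed

lemma represents_coring_endo:
  assumes f: "f \<in> bimod_hom B B C C" and rep: "represents f I i"
  shows "f \<in> carrier (coring_endo A B M N \<eta> \<epsilon>)"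
proof -
  note [simp] = f bimod_hom_left[OF f] bimod_hom_right[OF f] bimod_hom_closed[OF f]
  note fa = bimod_hom_ahom[OF f]
  have r: "f (nm n (sm (i x) m)) = nm (ns n (i x)) m"
    if "x \<in> carrier I" "n \<in> carrier N" "m \<in> carrier M" for x n m
    using rep that by (simp add: represents_def)
  have eps: "\<epsilon> (f c) = \<epsilon> c" if "c \<in> carrier C" for c
    by (rule C_xi_eqI[OF ahom_comp[OF fa eps_ahom] eps_ahom _ that]) (simp add: r eps_ns)
  let ?D = "C_comult A B M N \<eta>" and ?CC = "tensor B C C"
  let ?ff = "tensor_map B C C C C f f" and ?f1 = "tensor_map B C C C C f (ident C)"
  have ff: "?ff \<in> ahom ?CC ?CC" and f1: "?f1 \<in> ahom ?CC ?CC" by simp_all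
  have 1: "?ff (?D (nm n (sm (i x) m))) = ?f1 (delta n (i x) m)"
    if x: "x \<in> carrier I" and n: "n \<in> carrier N" and m: "m \<in> carrier M" for x n m
  proof (rule firm_left_eqI[of A I _ ?CC, OF _ _ 
          ahom_comp[OF ahom_comp[OF ahom_comp[OF ahom_comp[OF bimod_hom_ahom[OF i] sm_ahom_left] nm_ahom_right] C_comult_ahom] ff]
          ahom_comp[OF ahom_comp[OF bimod_hom_ahom[OF i] delta_ahom] f1] _ x])
    fix a x assume ax: "a \<in> carrier A" "x \<in> carrier I"
    have "?ff (delta n s (sm (i x) m)) = ?f1 (delta n (ss s (i x)) m)" if s: "s \<in> carrier S" for s
      by (rule S_eqI[OF ahom_comp[OF delta_ahom ff] ahom_comp[OF ahom_comp[OF ss_ahom_left delta_ahom] f1] _ s])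
         (use ax n m in \<open>simp_all add: r\<close>)
    from this[of "\<eta> a"] show "?ff (?D (nm n (sm (i (a \<odot>\<^bsub>I\<^esub> x)) m))) = ?f1 (delta n (i (a \<odot>\<^bsub>I\<^esub> x)) m)"
      using ax n m by (simp add: sm_smult C_comult_nm del: nm_smult)
  qed (use n m in simp_all)
  have 2: "?f1 (delta n (i x) m) = ?D (nm (ns n (i x)) m)"
    if x: "x \<in> carrier I" and n: "n \<in> carrier N" and m: "m \<in> carrier M" for x n m
  proof (rule firm_right_eqI[of A I _ ?CC, OF _ _ ahom_comp[OF ahom_comp[OF bimod_hom_ahom[OF i] delta_ahom] f1]
          ahom_comp[OF ahom_comp[OF ahom_comp[OF bimod_hom_ahom[OF i] ns_ahom_right] nm_ahom_left] C_comult_ahom] _ x])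
    fix x a assume ax: "x \<in> carrier I" "a \<in> carrier A"
    have "?f1 (delta n (ss (i x) s) m) = delta (ns n (i x)) s m" if s: "s \<in> carrier S" for s
      by (rule S_eqI[OF ahom_comp[OF ahom_comp[OF ss_ahom_right delta_ahom] f1] delta_ahom _ s])
         (use ax n m in \<open>simp_all add: r ss_mn_right\<close>)
    from this[of "\<eta> a"] have "?f1 (delta n (i x \<triangleleft>\<^bsub>S\<^esub> a) m) = ?D (nm (ns n (i x)) (a \<odot>\<^bsub>M\<^esub> m))"
      using ax n m by (simp add: C_comult_nm del: nm_smult)
    then show "?f1 (delta n (i (x \<triangleleft>\<^bsub>I\<^esub> a)) m) = ?D (nm (ns n (i (x \<triangleleft>\<^bsub>I\<^esub> a))) m)"
      using ax n m by (simp add: ns_rsmult)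
  qed (use n m in simp_all)
  have "?D (f c) = ?ff (?D c)" if "c \<in> carrier C" for c
    by (rule C_xi_eqI[OF ahom_comp[OF fa C_comult_ahom] ahom_comp[OF C_comult_ahom ff] _ that])
       (simp add: r 1 2)
  with eps show ?thesis by (simp add: coring_endo_def Let_def)
qed

lemma gamma_r_coring_endo: "gamma_r A B M N \<epsilon> I i \<in> carrier (coring_endo A B M N \<eta> \<epsilon>)"
  by (rule represents_coring_endo[OF represents_bimod_hom[OF gamma_r_ahom _ gamma_r_represents] gamma_r_represents])
     (simp add: gamma_r_def Let_def)

end

lemma Phi_represented:
  assumes f: "f \<in> bimod_hom B B C C" and rep: "represents f I i"
    and x: "x \<in> carrier I" and m: "m \<in> carrier M"
  shows "Phi f (sm (i x) m) = elem_tensor A S M (i x) m"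
proof (rule firm_left_eqI[of A I _ "tensor A S M", OF _ _
        ahom_comp[OF ahom_comp[OF bimod_hom_ahom[OF i] sm_ahom_left] Phi_ahom[OF f]]
        ahom_comp[OF bimod_hom_ahom[OF i] elem_tensor_ahom_left] _ x])
  fix a x assume ax: "a \<in> carrier A" "x \<in> carrier I"
  have "theta f s (sm (i x) m) = elem_tensor A S M (ss s (i x)) m" if s: "s \<in> carrier S" for s
  proof (rule S_eqI[OF theta_ahom[OF f] ahom_comp[OF ss_ahom_left elem_tensor_ahom_left] _ s])
    fix p q assume pq: "p \<in> carrier M" "q \<in> carrier N"
    have "f (nm q (sm (i x) m)) = nm (ns q (i x)) m"
      using rep pq ax m by (simp add: represents_def)
    then show "theta f (mn p q) (sm (i x) m) = elem_tensor A S M (ss (mn p q) (i x)) m"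
      using pq ax m by (simp add: theta_mn[OF f], simp add: nm_def mn_def)
  qed (use ax m in simp_all)
  from this[of "\<eta> a"] show "Phi f (sm (i (a \<odot>\<^bsub>I\<^esub> x)) m) = elem_tensor A S M (i (a \<odot>\<^bsub>I\<^esub> x)) m"
    using ax m by (simp add: sm_smult Phi_elem[OF f])
qed (use m in simp_all)

lemma represents_of_Phi:
  assumes f: "f \<in> bimod_hom B B C C"
    and "\<And>x m. x \<in> carrier I \<Longrightarrow> m \<in> carrier M \<Longrightarrow> Phi f (sm (i x) m) = elem_tensor A S M (i x) m"
  shows "represents f I i"
  using assms(2) nu_Phi[OF f] by (simp add: represents_def nu_elem flip: nu_Phi[OF f])

end

lemma eq_of_sm_eq:
  assumes X: "firm_right A X" and u: "u \<in> right_hom A X S" and v: "v \<in> right_hom A X S"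
    and eq: "\<And>x m. x \<in> carrier X \<Longrightarrow> m \<in> carrier M \<Longrightarrow> sm (u x) m = sm (v x) m" and x: "x \<in> carrier X"
  shows "u x = v x"
proof (rule firm_right_eqI[OF X _ right_hom_ahom[OF u] right_hom_ahom[OF v] _ x])
  fix x a assume *: "x \<in> carrier X" "a \<in> carrier A"
  note [simp] = right_hom_closed[OF u] right_hom_closed[OF v]
  have "ss (u x) s = ss (v x) s" if "s \<in> carrier S" for s
    by (rule S_eqI[OF ss_ahom_right ss_ahom_right _ that]) (use * in \<open>simp_all add: ss_mn_right eq\<close>)
  from this[of "\<eta> a"] show "u (x \<triangleleft>\<^bsub>X\<^esub> a) = v (x \<triangleleft>\<^bsub>X\<^esub> a)"
    using * by (simp add: right_hom_rsmult[OF u] right_hom_rsmult[OF v])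
qed simp

abbreviation endos where "endos \<equiv> coring_endo A B M N \<eta> \<epsilon>"
abbreviation SR where "SR \<equiv> S_ring A B M N \<epsilon>"

lemma S_ring_simps [simp]:
  "carrier SR = carrier S" "add SR = add S"
  "mult SR = ss"
  "tensor A I SR = tensor A I S" "tensor_lift SR \<phi> = tensor_lift S \<phi>"
  "bimod_hom A A I SR = bimod_hom A A I S"
  by (simp_all add: S_ring_def Let_def, simp add: ss_eq[abs_def])

lemma r_inv_sub_iff:
  "r_inv_sub U A SR J I i \<longleftrightarrow>
     carrier I \<subseteq> U \<and> firm_mono U A I i \<and> inv_pair I i \<and> i ` carrier I = J"
proof -
  have "bij_betw (mu I i) (carrier (tensor A I S)) (carrier S) \<longleftrightarrow>
      bij_betw (xi I i) (carrier (tensor A I M)) (carrier M)"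
    if "firm_bimodule A A I" "i \<in> bimod_hom A A I S"
    using xi_bij_of_mu[OF that] mu_bij_of_xi[OF that] by blast
  then show ?thesis
    by (auto simp: r_inv_sub_def firm_sub_def inv_pair_def mu_def)
qed

lemma inv_pairD:
  assumes "inv_pair I i"
  shows "firm_bimodule A A I" "i \<in> bimod_hom A A I S"
    "bij_betw (xi I i) (carrier (tensor A I M)) (carrier M)"
  using assms by (auto simp: inv_pair_def)

lemma inv_pair_iso:
  assumes ip: "inv_pair I i" and I': "bimodule A A I'" and j: "j \<in> bimod_hom A A I' I"
    and bij: "bij_betw j (carrier I') (carrier I)"
  shows "inv_pair I' (\<lambda>x\<in>carrier I'. i (j x))"
proof -
  note I = inv_pairD[OF ip]
  note [simp] = I_rules[OF I(1,2)]
  have firm: "firm_bimodule A A I'"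
    by (rule firm_bimodule_iso[OF I(1) I' _ _ hom_inv_bimod_hom[OF j bij I'] hom_inv_bij[OF bij]]) simp_all
  have i': "(\<lambda>x\<in>carrier I'. i (j x)) \<in> bimod_hom A A I' S" (is "?i' \<in> _")
    by (rule bimod_hom_comp[OF j I(2) I'])
  note [simp] = I_rules[OF firm i'] bimod_hom_right[OF j] bimod_hom_closed[OF j] xi_elem[OF I(1,2)] xi_elem[OF firm i']
  have "bij_betw (\<lambda>t. xi I i (tensor_map A I' M I M j (ident M) t)) (carrier (tensor A I' M)) (carrier M)"
    by (rule bij_betw_trans[OF tensor_map_bij I(3), unfolded comp_def])
       (simp_all add: bij bij_betw_id[unfolded id_def])
  moreover have "xi I i (tensor_map A I' M I M j (ident M) t) = xi I' ?i' t"
    if t: "t \<in> carrier (tensor A I' M)" for t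
    by (rule tensor_eqI[OF _ _ ahom_comp[OF tensor_map_ahom xi_ahom[OF I(1,2)]] xi_ahom[OF firm i'] _ t]) simp_all
  ultimately show ?thesis
    using firm i' by (simp add: inv_pair_def cong: bij_betw_cong)
qed

lemma inv_pair_copy:
  fixes I :: "('a, 'a, 'v) bimod" and U :: "'u set"
  assumes ip: "inv_pair I i" and U: "carrier I \<lesssim> U"
  obtains I' :: "('a, 'a, 'u) bimod" and i' where "carrier I' \<subseteq> U" "inv_pair I' i'"
    "i' ` carrier I' = i ` carrier I"
proof -
  note I = inv_pairD[OF ip]
  obtain I' :: "('a, 'a, 'u) bimod" and j where I': "bimodule A A I'" "carrier I' \<subseteq> U"
    and j: "j \<in> bimod_hom A A I I'" "bij_betw j (carrier I) (carrier I')"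
    using bimodule_copy_ex[OF firm_bimoduleD(1)[OF I(1)] U] .
  let ?k = "hom_inv I I' j"
  have "inv_pair I' (\<lambda>x\<in>carrier I'. i (?k x))"
    by (rule inv_pair_iso[OF ip I'(1) hom_inv_bimod_hom[OF j firm_bimoduleD(1)[OF I(1)]] hom_inv_bij[OF j(2)]])
  moreover have "(\<lambda>x\<in>carrier I'. i (?k x)) ` carrier I' = i ` carrier I"
    using bij_betw_imp_surj_on[OF hom_inv_bij[OF j(2)]]
    by (simp add: image_image[of i ?k, symmetric])
  ultimately show ?thesis using that I'(2) by blast
qed

definition rep_set where
  "rep_set f J \<longleftrightarrow> (\<forall>s\<in>J. \<forall>n\<in>carrier N. \<forall>m\<in>carrier M. f (nm n (sm s m)) = nm (ns n s) m)"

lemma represents_iff_rep_set: "represents f I i \<longleftrightarrow> rep_set f (i ` carrier I)"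
  by (auto simp: represents_def rep_set_def)

lemma inv_pair_unit: "inv_pair (regular A) \<eta>"
proof -
  note I = firm_ring_bimodule[OF firm_A] eta_bimod_hom
  have "xi (regular A) \<eta> t = lact A M t" if t: "t \<in> carrier (tensor A (regular A) M)" for t
    by (rule tensor_eqI[OF _ _ xi_ahom[OF I] lact_ahom _ t]) (use xi_elem[OF I] in simp_all)
  then show ?thesis
    using I firm_left_bij[of A M] by (simp add: inv_pair_def cong: bij_betw_cong)
qed

lemma rep_set_unit: "rep_set (ident C) (\<eta> ` carrier A)"
  by (auto simp: rep_set_def)

definition prod_map where
  "prod_map I i I' i' = (\<lambda>z\<in>carrier (tensor A I I'). mu I i (tensor_map A I I' I S (ident I) i' z))"

context
  fixes I :: "('a, 'a, 'u) bimod" and i and I' :: "('a, 'a, 'v) bimod" and i'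
  assumes ip: "inv_pair I i" and ip': "inv_pair I' i'"
begin

lemmas pair_rules [simp] = I_rules[OF inv_pairD(1,2)[OF ip]] I_rules[OF inv_pairD(1,2)[OF ip']]
  xi_elem[OF inv_pairD(1,2)[OF ip]] xi_elem[OF inv_pairD(1,2)[OF ip']] mu_elem[OF inv_pairD(1,2)[OF ip]]

lemma prod_map_elem [simp]: "x \<in> carrier I \<Longrightarrow> x' \<in> carrier I' \<Longrightarrow>
    prod_map I i I' i' (elem_tensor A I I' x x') = ss (i x) (i' x')"
  by (simp add: prod_map_def)

lemma mu_bimod_hom: "restrict (mu I i) (carrier (tensor A I S)) \<in> bimod_hom A A (tensor A I S) S"
  unfolding bimod_hom_iff left_hom_iff right_hom_iff
  using mu_smult[OF inv_pairD(1,2)[OF ip]] mu_rsmult[OF inv_pairD(1,2)[OF ip]]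
    restrict_ahom[OF _ mu_ahom[OF inv_pairD(1,2)[OF ip]]]
  by simp

lemma prod_map_bimod_hom: "prod_map I i I' i' \<in> bimod_hom A A (tensor A I I') S"
proof -
  have "(\<lambda>z\<in>carrier (tensor A I I'). restrict (mu I i) (carrier (tensor A I S))
      (tensor_map A I I' I S (ident I) i' z)) \<in> bimod_hom A A (tensor A I I') S"
    by (rule bimod_hom_comp[OF tensor_map_bimod_hom mu_bimod_hom]) simp_all
  moreover have "(\<lambda>z\<in>carrier (tensor A I I'). restrict (mu I i) (carrier (tensor A I S))
      (tensor_map A I I' I S (ident I) i' z)) = prod_map I i I' i'"
    by (rule ext) (simp add: prod_map_def)
  ultimately show ?thesis by simp
qed

lemma inv_pair_prod: "inv_pair (tensor A I I') (prod_map I i I' i')"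
proof -
  note I = inv_pairD[OF ip] and I' = inv_pairD[OF ip']
  have firm: "firm_bimodule A A (tensor A I I')"
    by (rule firm_bimodule_tensor) simp_all
  note T = firm prod_map_bimod_hom
  note [simp] = bimod_hom_left[OF xi_bimod_hom[OF I'(1,2)]] I_rules[OF T] xi_elem[OF T]
  let ?f = "\<lambda>t. xi I i (tensor_map A I (tensor A I' M) I M (ident I) (xi I' i') (assoc A A I I' M t))"
  have "bij_betw ?f (carrier (tensor A (tensor A I I') M)) (carrier M)"
    by (rule bij_betw_trans[OF bij_betw_trans[OF assoc_bij tensor_map_bij] I(3), unfolded comp_def])
       (simp_all add: I'(3) bij_betw_id[unfolded id_def])
  moreover have "?f t = xi (tensor A I I') (prod_map I i I' i') t"
    if t: "t \<in> carrier (tensor A (tensor A I I') M)" for t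
    by (rule tensor3_eqI_left[OF _ _ _ _ ahom_comp[OF assoc_ahom ahom_comp[OF tensor_map_ahom xi_ahom[OF I(1,2)]]]
          xi_ahom[OF T] _ t])
       (simp_all add: sm_ss)
  ultimately show ?thesis
    using T by (simp add: inv_pair_def cong: bij_betw_cong)
qed

lemma prod_map_image:
  "prod_map I i I' i' ` carrier (tensor A I I') = ideal_prod SR (i ` carrier I) (i' ` carrier I')"
    (is "?L = ?R")
proof (intro subset_antisym subsetI)
  note pa = bimod_hom_ahom[OF prod_map_bimod_hom]
  fix s assume "s \<in> ?L"
  then obtain z where z: "z \<in> carrier (tensor A I I')" "s = prod_map I i I' i' z" by auto
  have "prod_map I i I' i' z \<in> ?R"
  proof (rule tensor_induct[OF _ _ z(1)])
    fix x x' assume "x \<in> carrier I" "x' \<in> carrier I'"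
    then show "prod_map I i I' i' (elem_tensor A I I' x x') \<in> ?R"
      using ideal_prod.prod[of "i x" "i ` carrier I" "i' x'" "i' ` carrier I'" SR] by simp
  next
    fix t t' assume "t \<in> carrier (tensor A I I')" "t' \<in> carrier (tensor A I I')"
      "prod_map I i I' i' t \<in> ?R" "prod_map I i I' i' t' \<in> ?R"
    then show "prod_map I i I' i' (t \<oplus>\<^bsub>tensor A I I'\<^esub> t') \<in> ?R"
      using ideal_prod.sum[of _ SR] by (simp add: ahom_add[OF pa])
  qed simp_all
  then show "s \<in> ?R" using z by simp
next
  note pa = bimod_hom_ahom[OF prod_map_bimod_hom]
  fix s assume "s \<in> ?R"
  then show "s \<in> ?L"
  proof induct
    case (prod s s')
    then obtain x x' where "x \<in> carrier I" "x' \<in> carrier I'" "s = i x" "s' = i' x'" by auto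
    then show ?case by (intro image_eqI[of _ _ "elem_tensor A I I' x x'"]) simp_all
  next
    case (sum s s')
    then obtain z z' where z: "z \<in> carrier (tensor A I I')" "z' \<in> carrier (tensor A I I')"
      "s = prod_map I i I' i' z" "s' = prod_map I i I' i' z'" by auto
    then have "z \<oplus>\<^bsub>tensor A I I'\<^esub> z' \<in> carrier (tensor A I I')"
      using abelian_groupE(1)[OF tensor_abelian_group[of A I I']] by simp
    then show ?case using z by (intro image_eqI[of _ _ "z \<oplus>\<^bsub>tensor A I I'\<^esub> z'"]) (simp_all add: ahom_add[OF pa])
  qed
qed

lemma rep_set_prod:
  assumes f: "f \<in> bimod_hom B B C C" "rep_set f (i ` carrier I)"
    and g: "g \<in> bimod_hom B B C C" "rep_set g (i' ` carrier I')"
  shows "rep_set (compose (carrier C) g f) (prod_map I i I' i' ` carrier (tensor A I I'))"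
  unfolding rep_set_def
proof (intro ballI, elim imageE, hypsubst)
  note pa = bimod_hom_ahom[OF prod_map_bimod_hom]
  fix n m z assume n: "n \<in> carrier N" and m: "m \<in> carrier M" and z: "z \<in> carrier (tensor A I I')"
  have "g (f (nm n (sm (prod_map I i I' i' z) m))) = nm (ns n (prod_map I i I' i' z)) m"
  proof (rule tensor_eqI[OF _ _ ahom_comp[OF pa ahom_comp[OF sm_ahom_left ahom_comp[OF nm_ahom_right
            ahom_comp[OF bimod_hom_ahom[OF f(1)] bimod_hom_ahom[OF g(1)]]]]]
        ahom_comp[OF pa ahom_comp[OF ns_ahom_right nm_ahom_left]] _ z])
    fix x x' assume "x \<in> carrier I" "x' \<in> carrier I'"
    then show "g (f (nm n (sm (prod_map I i I' i' (elem_tensor A I I' x x')) m)))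
        = nm (ns n (prod_map I i I' i' (elem_tensor A I I' x x'))) m"
      using f(2) g(2) n m by (simp add: rep_set_def sm_ss ns_ss)
  qed (use n m in simp_all)
  then show "compose (carrier C) g f (nm n (sm (prod_map I i I' i' z) m)) = nm (ns n (prod_map I i I' i' z)) m"
    using n m ahom_closed[OF pa z] by (simp add: compose_def)
qed

end

text \<open>What comonadicity (or separability) provides: \<open>\<Gamma>\<close> is bijective on pairs \<open>(I, i)\<close>, and the maps \<open>i\<close>
  are monomorphisms of firm bimodules.\<close>

definition reconstructs :: "'u set \<Rightarrow> bool" where
  "reconstructs U \<longleftrightarrow>
     (\<forall>(I :: ('a, 'a, 'u) bimod) i. inv_pair I i \<and> carrier I \<subseteq> U \<longrightarrow> firm_mono U A I i)
   \<and> (\<forall>(I :: ('a, 'a, 'u) bimod) i (I' :: ('a, 'a, 'u) bimod) i' f.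
        f \<in> carrier endos \<and> inv_pair I i \<and> carrier I \<subseteq> U \<and> inv_pair I' i' \<and> carrier I' \<subseteq> U
        \<and> represents f I i \<and> represents f I' i' \<longrightarrow> i ` carrier I \<subseteq> i' ` carrier I')
   \<and> (\<forall>f\<in>carrier endos. \<exists>(I :: ('a, 'a, 'u) bimod) i. inv_pair I i \<and> carrier I \<subseteq> U \<and> represents f I i)"

context
  fixes U :: "'u set"
  assumes inf: "infinite U" and AU: "carrier A \<lesssim> U" and rec: "reconstructs U"
begin

abbreviation Ir where "Ir \<equiv> I_r U A B M N \<eta> \<epsilon>"
abbreviation G where "G \<equiv> Gamma_r U A B M N \<epsilon>"

lemma Ir_ops: "mult Ir = ideal_prod SR" "one Ir = \<eta> ` carrier A"
  by (simp_all add: I_r_def Let_def)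

lemma Ir_r_inv_sub: "J \<in> carrier Ir \<longleftrightarrow> (\<exists>I i. r_inv_sub U A SR J I i)"
  by (simp add: I_r_def Let_def)

lemma Ir_iff: "J \<in> carrier Ir \<longleftrightarrow>
    (\<exists>(I :: ('a, 'a, 'u) bimod) i. carrier I \<subseteq> U \<and> inv_pair I i \<and> i ` carrier I = J)"
  using rec by (auto simp: Ir_r_inv_sub r_inv_sub_iff reconstructs_def)

lemma IrI:
  assumes "inv_pair I i" "carrier I \<lesssim> U" shows "i ` carrier I \<in> carrier Ir"
proof -
  obtain I' :: "('a, 'a, 'u) bimod" and i' where "carrier I' \<subseteq> U" "inv_pair I' i'" "i' ` carrier I' = i ` carrier I"
    using inv_pair_copy[OF assms] .
  then show ?thesis unfolding Ir_iff by blast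
qed

lemma endo_bimod_hom: "f \<in> carrier endos \<Longrightarrow> f \<in> bimod_hom B B C C"
  by (simp add: coring_endo_def Let_def)

lemma G_spec: assumes "J \<in> carrier Ir" shows "G J \<in> carrier endos" "rep_set (G J) J"
proof -
  let ?p = "SOME (I :: ('a, 'a, 'u) bimod, i). r_inv_sub U A SR J I i"
  have "\<exists>p. case p of (I :: ('a, 'a, 'u) bimod, i) \<Rightarrow> r_inv_sub U A SR J I i"
    using assms by (auto simp: Ir_r_inv_sub)
  then have "case ?p of (I, i) \<Rightarrow> r_inv_sub U A SR J I i"
    by (rule someI_ex)
  moreover obtain I i where p: "?p = (I, i)" by (cases ?p)
  ultimately have "r_inv_sub U A SR J I i" by simp
  then have *: "inv_pair I i" "i ` carrier I = J" by (simp_all add: r_inv_sub_iff)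
  have G: "G J = gamma_r A B M N \<epsilon> I i"
    unfolding Gamma_r_def p by simp
  show "G J \<in> carrier endos"
    unfolding G by (rule gamma_r_coring_endo[OF inv_pairD[OF *(1)]])
  show "rep_set (G J) J"
    using gamma_r_represents[OF inv_pairD[OF *(1)]] by (simp add: G represents_iff_rep_set *(2))
qed

lemma G_unique:
  assumes J: "J \<in> carrier Ir" and f: "f \<in> bimod_hom B B C C" "rep_set f J"
  shows "G J = f"
proof -
  obtain I :: "('a, 'a, 'u) bimod" and i where I: "inv_pair I i" "i ` carrier I = J"
    using J by (auto simp: Ir_iff)
  note g = endo_bimod_hom[OF G_spec(1)[OF J]]
  show ?thesis
  proof (rule left_hom_eqI[OF bimod_hom_left[OF g] bimod_hom_left[OF f(1)]])
    fix c assume "c \<in> carrier C"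
    then show "G J c = f c"
      using G_spec(2)[OF J] f(2)
      by (intro represents_unique[OF inv_pairD[OF I(1)] bimod_hom_ahom[OF g] bimod_hom_ahom[OF f(1)]])
         (simp_all add: represents_iff_rep_set I(2))
  qed
qed

lemma G_inj: "inj_on G (carrier Ir)"
proof (rule inj_onI)
  have sub: "J \<subseteq> J'" if J: "J \<in> carrier Ir" "J' \<in> carrier Ir" "G J = G J'" for J J'
  proof -
    obtain I :: "('a, 'a, 'u) bimod" and i where I: "carrier I \<subseteq> U" "inv_pair I i" "i ` carrier I = J"
      using J(1) by (auto simp: Ir_iff)
    obtain I' :: "('a, 'a, 'u) bimod" and i' where I': "carrier I' \<subseteq> U" "inv_pair I' i'" "i' ` carrier I' = J'"
      using J(2) by (auto simp: Ir_iff)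
    have "represents (G J) I i" "represents (G J) I' i'"
      using G_spec(2)[OF J(1)] G_spec(2)[OF J(2)] J(3) by (simp_all add: represents_iff_rep_set I(3) I'(3))
    then show ?thesis
      using rec G_spec(1)[OF J(1)] I I' unfolding reconstructs_def by blast
  qed
  show "J = J'" if "J \<in> carrier Ir" "J' \<in> carrier Ir" "G J = G J'" for J J'
    using sub[of J J'] sub[of J' J] that by auto
qed

lemma G_surj: "f \<in> carrier endos \<Longrightarrow> \<exists>J\<in>carrier Ir. G J = f"
proof -
  assume f: "f \<in> carrier endos"
  then obtain I :: "('a, 'a, 'u) bimod" and i where I: "carrier I \<subseteq> U" "inv_pair I i" "represents f I i"
    using rec by (auto simp: reconstructs_def)
  have "i ` carrier I \<in> carrier Ir" using I by (auto simp: Ir_iff)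
  then show ?thesis
    using G_unique[OF _ endo_bimod_hom[OF f]] I(3) by (auto simp: represents_iff_rep_set)
qed

lemma G_prod:
  assumes "J \<in> carrier Ir" "J' \<in> carrier Ir"
  shows "ideal_prod SR J J' \<in> carrier Ir"
    "G (ideal_prod SR J J') = compose (carrier C) (G J') (G J)"
proof -
  obtain I :: "('a, 'a, 'u) bimod" and i where I: "carrier I \<subseteq> U" "inv_pair I i" "i ` carrier I = J"
    using assms(1) by (auto simp: Ir_iff)
  obtain I' :: "('a, 'a, 'u) bimod" and i' where I': "carrier I' \<subseteq> U" "inv_pair I' i'" "i' ` carrier I' = J'"
    using assms(2) by (auto simp: Ir_iff)
  have "carrier (tensor A I I') \<lesssim> U"
    using firm_bimoduleD[OF inv_pairD(1)[OF I(2)]] firm_bimoduleD[OF inv_pairD(1)[OF I'(2)]] I(1) I'(1)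
    by (intro tensor_lepoll inf subset_imp_lepoll)
  from IrI[OF inv_pair_prod[OF I(2) I'(2)] this]
  show P: "ideal_prod SR J J' \<in> carrier Ir"
    by (simp add: prod_map_image[OF I(2) I'(2)] I(3) I'(3))
  note g = endo_bimod_hom[OF G_spec(1)[OF assms(1)]] and g' = endo_bimod_hom[OF G_spec(1)[OF assms(2)]]
  show "G (ideal_prod SR J J') = compose (carrier C) (G J') (G J)"
  proof (rule G_unique[OF P])
    show "compose (carrier C) (G J') (G J) \<in> bimod_hom B B C C"
      unfolding compose_def by (rule bimod_hom_comp[OF g g']) simp
    show "rep_set (compose (carrier C) (G J') (G J)) (ideal_prod SR J J')"
      using rep_set_prod[OF I(2) I'(2) g _ g'] G_spec(2)[OF assms(1)] G_spec(2)[OF assms(2)]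
      by (simp add: prod_map_image[OF I(2) I'(2)] I(3) I'(3))
  qed
qed

lemma G_one: "\<eta> ` carrier A \<in> carrier Ir" "G (\<eta> ` carrier A) = ident C"
proof -
  show P: "\<eta> ` carrier A \<in> carrier Ir"
    using IrI[OF inv_pair_unit] AU by simp
  show "G (\<eta> ` carrier A) = ident C"
    by (rule G_unique[OF P _ rep_set_unit]) simp
qed

lemma endos_funcset: "f \<in> carrier endos \<Longrightarrow> f \<in> carrier C \<rightarrow> carrier C \<and> f \<in> extensional (carrier C)"
  using bimod_hom_left[OF endo_bimod_hom] by (auto simp: left_hom_iff ahom_def)

lemma endos_ops: "mult endos = compose (carrier C)" "one endos = ident C"
  by (simp_all add: coring_endo_def Let_def)

lemma endos_closed: "f \<in> carrier endos \<Longrightarrow> g \<in> carrier endos \<Longrightarrow> compose (carrier C) f g \<in> carrier endos"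
proof -
  assume "f \<in> carrier endos" "g \<in> carrier endos"
  then obtain J J' where J: "J \<in> carrier Ir" "G J = f" "J' \<in> carrier Ir" "G J' = g"
    using G_surj[of f] G_surj[of g] by auto
  show ?thesis
    using G_spec(1)[OF G_prod(1)[OF J(3,1)]] by (simp only: G_prod(2)[OF J(3,1)] J(2,4))
qed

lemma endos_monoid: "monoid endos"
proof (rule monoidI)
  show "\<one>\<^bsub>endos\<^esub> \<in> carrier endos"
    using G_spec(1)[OF G_one(1)] by (simp add: endos_ops G_one(2))
  fix f g h assume f: "f \<in> carrier endos"
  show "\<one>\<^bsub>endos\<^esub> \<otimes>\<^bsub>endos\<^esub> f = f" "f \<otimes>\<^bsub>endos\<^esub> \<one>\<^bsub>endos\<^esub> = f"
    using endos_funcset[OF f] Id_compose[of f "carrier C" "carrier C"] compose_Id[of f "carrier C" "carrier C"]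
    by (simp_all add: endos_ops)
  assume g: "g \<in> carrier endos"
  show "f \<otimes>\<^bsub>endos\<^esub> g \<in> carrier endos"
    using f g by (simp add: endos_ops endos_closed)
  assume h: "h \<in> carrier endos"
  show "f \<otimes>\<^bsub>endos\<^esub> g \<otimes>\<^bsub>endos\<^esub> h = f \<otimes>\<^bsub>endos\<^esub> (g \<otimes>\<^bsub>endos\<^esub> h)"
    unfolding endos_ops using endos_funcset[OF h] by (intro compose_assoc[symmetric]) simp
qed

theorem Gamma_r_iso: "monoid_iso (op_monoid Ir) endos G"
proof -
  interpret E: monoid endos by (rule endos_monoid)
  have bij: "bij_betw G (carrier Ir) (carrier endos)"
    unfolding bij_betw_def using G_inj G_surj G_spec(1) by blast
  have ops: "carrier (op_monoid Ir) = carrier Ir" "x \<otimes>\<^bsub>op_monoid Ir\<^esub> y = ideal_prod SR y x"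
    "\<one>\<^bsub>op_monoid Ir\<^esub> = \<eta> ` carrier A" for x y
    by (simp_all add: op_monoid_def Ir_ops)
  have mult: "G (x \<otimes>\<^bsub>op_monoid Ir\<^esub> y) = G x \<otimes>\<^bsub>endos\<^esub> G y" "x \<otimes>\<^bsub>op_monoid Ir\<^esub> y \<in> carrier Ir"
    if "x \<in> carrier Ir" "y \<in> carrier Ir" for x y
    using that by (simp_all add: ops endos_ops G_prod)
  have one: "G \<one>\<^bsub>op_monoid Ir\<^esub> = \<one>\<^bsub>endos\<^esub>" "\<one>\<^bsub>op_monoid Ir\<^esub> \<in> carrier Ir"
    by (simp_all add: ops endos_ops G_one)
  note inj = inj_onD[OF G_inj]
  have "monoid (op_monoid Ir)"
  proof (rule monoidI; (unfold ops(1))?)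
    fix x y z assume x: "x \<in> carrier Ir"
    show "\<one>\<^bsub>op_monoid Ir\<^esub> \<otimes>\<^bsub>op_monoid Ir\<^esub> x = x" "x \<otimes>\<^bsub>op_monoid Ir\<^esub> \<one>\<^bsub>op_monoid Ir\<^esub> = x"
      by (rule inj; use x G_spec(1)[OF x] in \<open>simp add: mult one\<close>)+
    assume y: "y \<in> carrier Ir"
    show "x \<otimes>\<^bsub>op_monoid Ir\<^esub> y \<in> carrier Ir" by (rule mult(2)[OF x y])
    assume z: "z \<in> carrier Ir"
    show "x \<otimes>\<^bsub>op_monoid Ir\<^esub> y \<otimes>\<^bsub>op_monoid Ir\<^esub> z = x \<otimes>\<^bsub>op_monoid Ir\<^esub> (y \<otimes>\<^bsub>op_monoid Ir\<^esub> z)"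
      by (rule inj) (use x y z G_spec(1) in \<open>simp_all add: mult E.m_assoc\<close>)
  qed (rule one(2))
  then show ?thesis
    unfolding monoid_iso_def iso_def hom_def
    using endos_monoid bij mult(1) one(1) G_spec(1) by (auto simp: ops(1))
qed

end

end

section \<open>The comodule \<open>M\<close> with coaction twisted by a coring endomorphism\<close>

context firm_adjunction
begin

abbreviation GM where "GM \<equiv> tensor A S M"

context
  fixes f assumes f_endo: "f \<in> carrier endos"
begin

lemma f_hom: "f \<in> bimod_hom B B C C"
  and f_eps: "c \<in> carrier C \<Longrightarrow> \<epsilon> (f c) = \<epsilon> c"
  and f_comult: "c \<in> carrier C \<Longrightarrow> C_comult A B M N \<eta> (f c) = tensor_map B C C C C f f (C_comult A B M N \<eta> c)"
  using f_endo by (simp_all add: coring_endo_def Let_def)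

lemmas endo_rules [simp] = f_rules[OF f_hom] Phi_right_hom[OF f_hom] Phi_left_hom[OF f_hom]
  right_hom_closed[OF Phi_right_hom[OF f_hom]] ahom_closed[OF theta_ahom[OF f_hom]]

lemma Phi_counit: assumes "m \<in> carrier M" shows "r_counit A B M N \<epsilon> M (Phi f m) = m"
proof (rule firm_left_eqI[of A M _ M, OF _ _ ahom_comp[OF Phi_ahom[OF f_hom] right_hom_ahom[OF r_counit_M_right_hom]]
      ahom_ident _ assms])
  note rc = right_hom_ahom[OF r_counit_M_right_hom]
  fix a m assume am: "a \<in> carrier A" "m \<in> carrier M"
  have 1: "r_counit A B M N \<epsilon> M (assoc_inv B A M N M (elem_tensor B M C p c)) = p \<triangleleft>\<^bsub>M\<^esub> \<epsilon> c"
    if p: "p \<in> carrier M" and c: "c \<in> carrier C" for p c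
  proof (rule C_eqI[OF ahom_comp[OF elem_tensor_ahom_right ahom_comp[OF assoc_inv_ahom rc]] _ _ c])
    show "(\<lambda>c. p \<triangleleft>\<^bsub>M\<^esub> \<epsilon> c) \<in> ahom C M"
      using p by (intro ahom_comp[OF eps_ahom] ahomI) (simp_all add: rsmult_add_right[of B])
    fix m n assume "m \<in> carrier M" "n \<in> carrier N"
    then show "r_counit A B M N \<epsilon> M (assoc_inv B A M N M (elem_tensor B M C p (nm n m))) = p \<triangleleft>\<^bsub>M\<^esub> \<epsilon> (nm n m)"
      using p by (simp add: nm_def r_counit_elem)
  qed (use p in simp_all)
  have "r_counit A B M N \<epsilon> M (theta f s m) = sm s m" if s: "s \<in> carrier S" for s
    by (rule S_eqI[OF ahom_comp[OF theta_ahom[OF f_hom] rc] sm_ahom_left _ s])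
       (use am in \<open>simp_all add: theta_mn[OF f_hom] 1 f_eps\<close>)
  from this[of "\<eta> a"] show "r_counit A B M N \<epsilon> M (Phi f (a \<odot>\<^bsub>M\<^esub> m)) = a \<odot>\<^bsub>M\<^esub> m"
    using am by (simp add: Phi_elem[OF f_hom])
qed simp_all

definition coact_L where
  "coact_L = tensor_map A S M (tensor B GM N) M (tensor_map B M N GM N (Phi f) (ident N)) (ident M)"

definition coact_R where
  "coact_R = tensor_map A S M (tensor B GM N) M (r_unit A B M N \<eta> S) (ident M)"

lemma firm_S: "firm_bimodule A A S"
  by (rule firm_bimodule_tensor[OF firm_M firm_N]) simp_all

lemmas S_rules [simp] = firm_bimoduleD[OF firm_S]

lemma r_unit_S_right_hom [simp]: "r_unit A B M N \<eta> S \<in> right_hom A S (tensor B GM N)"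
  by (rule r_unit_right_hom) simp

lemma coact_L_ahom: "coact_L \<in> ahom GM (tensor A (tensor B GM N) M)"
  by (simp add: coact_L_def)

lemma coact_R_ahom: "coact_R \<in> ahom GM (tensor A (tensor B GM N) M)"
  by (simp add: coact_R_def)

lemma coact_L_elem: assumes "p \<in> carrier M" "c \<in> carrier C"
  shows "coact_L (assoc_inv B A M N M (elem_tensor B M C p c))
    = assoc_inv B A GM N M (elem_tensor B GM C (Phi f p) c)"
proof (rule C_eqI[OF ahom_comp[OF elem_tensor_ahom_right ahom_comp[OF assoc_inv_ahom coact_L_ahom]]
      ahom_comp[OF elem_tensor_ahom_right assoc_inv_ahom] _ assms(2)])
  fix m n assume "m \<in> carrier M" "n \<in> carrier N"
  then show "coact_L (assoc_inv B A M N M (elem_tensor B M C p (nm n m)))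
    = assoc_inv B A GM N M (elem_tensor B GM C (Phi f p) (nm n m))"
    using assms by (simp add: nm_def coact_L_def)
qed (use assms in simp_all)

definition alpha where "alpha p = (\<lambda>c\<in>carrier C. assoc_inv B A M N M (elem_tensor B M C p c))"

lemma alpha_right_hom [simp]: assumes "p \<in> carrier M" shows "alpha p \<in> right_hom B C GM"
proof -
  have "assoc_inv B A M N M (elem_tensor B M C p (c \<triangleleft>\<^bsub>C\<^esub> b))
      = assoc_inv B A M N M (elem_tensor B M C p c) \<triangleleft>\<^bsub>GM\<^esub> b" if "c \<in> carrier C" "b \<in> carrier B" for b c
    using right_hom_rsmult[OF assoc_inv_right_hom[of B M A N B M], of b "elem_tensor B M C p c"] that assms by simp
  moreover have "alpha p \<in> ahom C GM"
    unfolding alpha_def using assms by (intro restrict_ahom ahom_comp[OF elem_tensor_ahom_right assoc_inv_ahom]) simp_all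
  ultimately show ?thesis
    unfolding right_hom_iff by (simp add: alpha_def)
qed

definition Psi where
  "Psi p u = assoc_inv B A GM N M (tensor_map B C C GM C (alpha p) (ident C) u)"

lemma Psi_ahom: "p \<in> carrier M \<Longrightarrow> Psi p \<in> ahom (tensor B C C) (tensor A (tensor B GM N) M)"
  unfolding Psi_def by (intro ahom_comp[OF tensor_map_ahom assoc_inv_ahom]) simp_all

lemma Psi_elem: "p \<in> carrier M \<Longrightarrow> c \<in> carrier C \<Longrightarrow> c' \<in> carrier C \<Longrightarrow>
    Psi p (elem_tensor B C C c c')
      = assoc_inv B A GM N M (elem_tensor B GM C (assoc_inv B A M N M (elem_tensor B M C p c)) c')"
  by (simp add: Psi_def) (simp add: alpha_def)

lemma coact_R_elem: assumes p: "p \<in> carrier M" and c: "c \<in> carrier C"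
  shows "coact_R (assoc_inv B A M N M (elem_tensor B M C p c)) = Psi p (C_comult A B M N \<eta> c)"
proof (rule C_eqI[OF ahom_comp[OF elem_tensor_ahom_right ahom_comp[OF assoc_inv_ahom coact_R_ahom]]
      ahom_comp[OF C_comult_ahom Psi_ahom] _ c])
  fix m n assume m: "m \<in> carrier M" and n: "n \<in> carrier N"
  show "coact_R (assoc_inv B A M N M (elem_tensor B M C p (nm n m))) = Psi p (C_comult A B M N \<eta> (nm n m))"
  proof (rule firm_left_eqI[of A M _ "tensor A (tensor B GM N) M", OF _ _
        ahom_comp[OF ahom_comp[OF nm_ahom_right elem_tensor_ahom_right] ahom_comp[OF assoc_inv_ahom coact_R_ahom]]
        ahom_comp[OF nm_ahom_right ahom_comp[OF C_comult_ahom Psi_ahom]] _ m])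
    fix a m assume am: "a \<in> carrier A" "m \<in> carrier M"
    have "elem_tensor A (tensor B GM N) M (assoc_inv A B S M N (elem_tensor A S S (mn p n) s)) m = Psi p (delta n s m)"
      if s: "s \<in> carrier S" for s
      by (rule S_eqI[OF ahom_comp[OF elem_tensor_ahom_right ahom_comp[OF assoc_inv_ahom elem_tensor_ahom_left]]
            ahom_comp[OF delta_ahom Psi_ahom] _ s])
         (use p n am in \<open>simp_all add: Psi_elem, simp_all add: nm_def mn_def\<close>)
    from this[of "\<eta> a"]
    have "Psi p (C_comult A B M N \<eta> (nm n (a \<odot>\<^bsub>M\<^esub> m)))
      = elem_tensor A (tensor B GM N) M (r_unit A B M N \<eta> S (mn p n \<triangleleft>\<^bsub>S\<^esub> a)) m"
      using p n am by (simp add: C_comult_nm r_unit_elem del: nm_smult mn_smult)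
    also have "mn p n \<triangleleft>\<^bsub>S\<^esub> a = mn p (n \<triangleleft>\<^bsub>N\<^esub> a)" using p n am by simp
    also have "elem_tensor A (tensor B GM N) M (r_unit A B M N \<eta> S (mn p (n \<triangleleft>\<^bsub>N\<^esub> a))) m
      = coact_R (assoc_inv B A M N M (elem_tensor B M C p (nm (n \<triangleleft>\<^bsub>N\<^esub> a) m)))"
      using p n am by (simp add: nm_def coact_R_def mn_def)
    also have "nm (n \<triangleleft>\<^bsub>N\<^esub> a) m = nm n (a \<odot>\<^bsub>M\<^esub> m)" using n am by simp
    finally show "coact_R (assoc_inv B A M N M (elem_tensor B M C p (nm n (a \<odot>\<^bsub>M\<^esub> m))))
      = Psi p (C_comult A B M N \<eta> (nm n (a \<odot>\<^bsub>M\<^esub> m)))" ..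
  qed (use p n in simp_all)
qed (use p in simp_all)

lemma Phi_coassoc: assumes m: "m \<in> carrier M" shows "coact_L (Phi f m) = coact_R (Phi f m)"
proof (rule firm_left_eqI[of A M _ "tensor A (tensor B GM N) M", OF _ _ ahom_comp[OF Phi_ahom[OF f_hom] coact_L_ahom]
      ahom_comp[OF Phi_ahom[OF f_hom] coact_R_ahom] _ m])
  let ?X = "tensor A (tensor B GM N) M"
  fix a m assume am: "a \<in> carrier A" and m: "m \<in> carrier M"
  show "coact_L (Phi f (a \<odot>\<^bsub>M\<^esub> m)) = coact_R (Phi f (a \<odot>\<^bsub>M\<^esub> m))"
  proof (rule firm_left_eqI[of A M _ ?X, OF _ _
        ahom_comp[OF ahom_comp[OF smult_ahom Phi_ahom[OF f_hom]] coact_L_ahom]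
        ahom_comp[OF ahom_comp[OF smult_ahom Phi_ahom[OF f_hom]] coact_R_ahom] _ m])
    fix a' m assume am': "a' \<in> carrier A" "m \<in> carrier M"
    let ?Th = "\<lambda>t\<in>carrier GM. assoc_inv B A M N M (tensor_map B M C M C (ident M) f (assoc B A M N M t))"
    have "(\<lambda>t\<in>carrier GM. (\<lambda>u\<in>carrier (tensor B M C). assoc_inv B A M N M (tensor_map B M C M C (ident M) f u))
        (assoc B A M N M t)) \<in> right_hom B GM GM"
      by (intro right_hom_comp[OF assoc_right_hom right_hom_comp[OF tensor_map_right_hom assoc_inv_right_hom]]) simp_all
    moreover have "(\<lambda>t\<in>carrier GM. (\<lambda>u\<in>carrier (tensor B M C). assoc_inv B A M N M (tensor_map B M C M C (ident M) f u))
        (assoc B A M N M t)) = ?Th" by (intro ext) simp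
    ultimately have Th: "?Th \<in> right_hom B GM GM" by simp
    have Th_elem: "?Th (elem_tensor A S M s p) = theta f s p" if "s \<in> carrier S" "p \<in> carrier M" for s p
      using that by (simp add: theta_def)
    note [simp] = Th
    let ?K = "\<lambda>s s''. assoc_inv B A GM N M (tensor_map B GM C GM C ?Th f
       (assoc_inv A B S M C (elem_tensor A S (tensor B M C) s (assoc B A M N M (elem_tensor A S M s'' m)))))"
    have K: "?K s (mn p2 q2) = assoc_inv B A GM N M (elem_tensor B GM C (theta f s p2) (f (nm q2 m)))"
      if "s \<in> carrier S" "p2 \<in> carrier M" "q2 \<in> carrier N" for s p2 q2
      using that am' by (simp add: mn_def Th_elem nm_def del: restrict_apply)
    have KL: "(\<lambda>s''. ?K s s'') \<in> ahom S ?X" if "s \<in> carrier S" for s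
      using that am'
      by (intro ahom_comp[OF elem_tensor_ahom_left ahom_comp[OF assoc_ahom ahom_comp[OF elem_tensor_ahom_right
              ahom_comp[OF assoc_inv_ahom ahom_comp[OF tensor_map_ahom assoc_inv_ahom]]]]]) simp_all
    have KR: "(\<lambda>s. ?K s s'') \<in> ahom S ?X" if "s'' \<in> carrier S" for s''
      using that am'
      by (intro ahom_comp[OF elem_tensor_ahom_left
              ahom_comp[OF assoc_inv_ahom ahom_comp[OF tensor_map_ahom assoc_inv_ahom]]]) simp_all
    have L: "coact_L (theta f (a \<odot>\<^bsub>S\<^esub> s) m) = ?K (\<eta> a) s" if s: "s \<in> carrier S" for s
    proof (rule S_eqI[OF ahom_comp[OF smult_ahom ahom_comp[OF theta_ahom[OF f_hom] coact_L_ahom]] KL _ s])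
      fix p q assume pq: "p \<in> carrier M" "q \<in> carrier N"
      show "coact_L (theta f (a \<odot>\<^bsub>S\<^esub> mn p q) m) = ?K (\<eta> a) (mn p q)"
        using pq am am' by (simp only: K eta_closed) (simp add: theta_mn[OF f_hom] coact_L_elem Phi_elem[OF f_hom])
    qed (use am am' in simp_all)
    have R: "coact_R (theta f s (a' \<odot>\<^bsub>M\<^esub> m)) = ?K s (\<eta> a')" if s: "s \<in> carrier S" for s
    proof (rule S_eqI[OF ahom_comp[OF theta_ahom[OF f_hom] coact_R_ahom] KR _ s])
      fix p q assume pq: "p \<in> carrier M" "q \<in> carrier N"
      let ?ff = "tensor_map B C C C C f f"
      have "Psi p (?ff (delta q s'' m)) = ?K (mn p q) s''" if s'': "s'' \<in> carrier S" for s''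
      proof (rule S_eqI[OF ahom_comp[OF delta_ahom ahom_comp[OF tensor_map_ahom Psi_ahom]] KL _ s''])
        fix p2 q2 assume pq2: "p2 \<in> carrier M" "q2 \<in> carrier N"
        show "Psi p (?ff (delta q (mn p2 q2) m)) = ?K (mn p q) (mn p2 q2)"
          using pq pq2 am' by (simp only: K mn_closed) (simp add: Psi_elem theta_mn[OF f_hom])
      qed (use pq am' in simp_all)
      from this[of "\<eta> a'"] show "coact_R (theta f (mn p q) (a' \<odot>\<^bsub>M\<^esub> m)) = ?K (mn p q) (\<eta> a')"
        using pq am' by (simp add: theta_mn[OF f_hom] coact_R_elem f_comult C_comult_nm
            del: nm_smult restrict_apply)
    qed (use am' in simp_all)
    have "Phi f (a \<odot>\<^bsub>M\<^esub> (a' \<odot>\<^bsub>M\<^esub> m)) = theta f (a \<odot>\<^bsub>S\<^esub> \<eta> a') m"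
      using am am' by (simp add: eta_mult(1)[symmetric] smult_smult[of A, symmetric] Phi_elem[OF f_hom])
    moreover have "Phi f (a \<odot>\<^bsub>M\<^esub> (a' \<odot>\<^bsub>M\<^esub> m)) = theta f (\<eta> a) (a' \<odot>\<^bsub>M\<^esub> m)"
      using am am' by (simp add: Phi_elem[OF f_hom])
    ultimately show "coact_L (Phi f (a \<odot>\<^bsub>M\<^esub> (a' \<odot>\<^bsub>M\<^esub> m))) = coact_R (Phi f (a \<odot>\<^bsub>M\<^esub> (a' \<odot>\<^bsub>M\<^esub> m)))"
      using L[OF eta_closed[OF am'(1)]] R[OF eta_closed[OF am]] by simp
  qed (use am in simp_all)
qed simp_all

end

end

section \<open>The separable case\<close>

lemma image_bimodule:
  assumes X: "bimodule A B X" and Y: "bimodule A B Y" and h: "h \<in> bimod_hom A B X Y"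
  shows "bimodule A B (Y\<lparr>carrier := h ` carrier X\<rparr>)"
proof -
  interpret X: abelian_group X using bimodule_left[OF X] by (rule left_module_abelian)
  interpret Y: abelian_group Y using bimodule_left[OF Y] by (rule left_module_abelian)
  note ha = bimod_hom_ahom[OF h]
  note [simp] = ahom_closed[OF ha]
  have add: "h x \<oplus>\<^bsub>Y\<^esub> h y = h (x \<oplus>\<^bsub>X\<^esub> y)" if "x \<in> carrier X" "y \<in> carrier X" for x y
    using that by (simp add: ahom_add[OF ha])
  have zero: "\<zero>\<^bsub>Y\<^esub> = h \<zero>\<^bsub>X\<^esub>"
    by (rule ahom_zero[OF X.abelian_group_axioms Y.abelian_group_axioms ha, symmetric])
  have ag: "abelian_group (Y\<lparr>carrier := h ` carrier X\<rparr>)"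
  proof (rule abelian_groupI)
    fix y assume "y \<in> carrier (Y\<lparr>carrier := h ` carrier X\<rparr>)"
    then obtain x where x: "x \<in> carrier X" "y = h x" by auto
    then show "\<exists>z\<in>carrier (Y\<lparr>carrier := h ` carrier X\<rparr>).
        z \<oplus>\<^bsub>Y\<lparr>carrier := h ` carrier X\<rparr>\<^esub> y = \<zero>\<^bsub>Y\<lparr>carrier := h ` carrier X\<rparr>\<^esub>"
      by (intro bexI[of _ "h (\<ominus>\<^bsub>X\<^esub> x)"]) (simp_all add: add X.l_neg zero)
  qed (auto simp: zero add X.a_ac)
  have sm: "a \<odot>\<^bsub>Y\<^esub> h x = h (a \<odot>\<^bsub>X\<^esub> x)" if "a \<in> carrier A" "x \<in> carrier X" for a x
    using left_hom_smult[OF bimod_hom_left[OF h]] that by simp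
  have rsm: "h x \<triangleleft>\<^bsub>Y\<^esub> b = h (x \<triangleleft>\<^bsub>X\<^esub> b)" if "b \<in> carrier B" "x \<in> carrier X" for b x
    using right_hom_rsmult[OF bimod_hom_right[OF h]] that by simp
  have XA: "a \<odot>\<^bsub>X\<^esub> x \<in> carrier X" if "a \<in> carrier A" "x \<in> carrier X" for a x
    using smult_closed[OF bimodule_left[OF X]] that by simp
  have XB: "x \<triangleleft>\<^bsub>X\<^esub> b \<in> carrier X" if "b \<in> carrier B" "x \<in> carrier X" for b x
    using rsmult_closed[OF bimodule_right[OF X]] that by simp
  have "left_module A (Y\<lparr>carrier := h ` carrier X\<rparr>)"
    using bimodule_left[OF Y] ag unfolding left_module_def
    by (simp add: sm XA)
  moreover have "right_module B (Y\<lparr>carrier := h ` carrier X\<rparr>)"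
    using bimodule_right[OF Y] ag unfolding right_module_def
    by (simp add: rsm XB)
  ultimately show ?thesis
    using Y unfolding bimodule_def by auto
qed

lemma bimod_hom_image:
  "h \<in> bimod_hom A B X Y \<Longrightarrow> h \<in> bimod_hom A B X (Y\<lparr>carrier := h ` carrier X\<rparr>)"
  by (simp add: bimod_hom_iff left_hom_iff right_hom_iff ahom_def)

lemma inclusion_bimod_hom:
  assumes "bimodule A B (Y\<lparr>carrier := J\<rparr>)" "J \<subseteq> carrier Y"
  shows "(\<lambda>x\<in>J. x) \<in> bimod_hom A B (Y\<lparr>carrier := J\<rparr>) Y"
proof -
  have "x \<oplus>\<^bsub>Y\<^esub> y \<in> J" if "x \<in> J" "y \<in> J" for x y
    using abelian_groupE(1)[OF left_module_abelian[OF bimodule_left[OF assms(1)]], of x y] that by simp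
  moreover have "a \<odot>\<^bsub>Y\<^esub> x \<in> J" if "a \<in> carrier A" "x \<in> J" for a x
    using smult_closed[OF bimodule_left[OF assms(1)], of a x] that by simp
  moreover have "x \<triangleleft>\<^bsub>Y\<^esub> b \<in> J" if "b \<in> carrier B" "x \<in> J" for b x
    using rsmult_closed[OF bimodule_right[OF assms(1)], of x b] that by simp
  ultimately show ?thesis
    using subsetD[OF assms(2)] by (simp add: bimod_hom_iff left_hom_iff right_hom_iff ahom_def Pi_iff)
qed

context firm_adjunction
begin

context
  fixes \<pi> assumes pi: "\<pi> \<in> bimod_hom A A S (regular A)" and pi_eta: "\<And>a. a \<in> carrier A \<Longrightarrow> \<pi> (\<eta> a) = a"
begin

lemma pi_closed: "s \<in> carrier S \<Longrightarrow> \<pi> s \<in> carrier A"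
  using bimod_hom_closed[OF pi] by simp

lemmas pi_rules [simp] = pi bimod_hom_left[OF pi] bimod_hom_right[OF pi] pi_eta pi_closed

text \<open>\<open>\<eta>\<close> being split, \<open>I \<cong> I \<otimes>\<^sub>A A \<rightarrow> I \<otimes>\<^sub>A S \<cong> S\<close> has a left inverse.\<close>

lemma inv_pair_inj:
  assumes ip: "inv_pair I i"
  shows "inj_on i (carrier I)"
proof -
  note I = inv_pairD[OF ip]
  note [simp] = I_rules[OF I(1,2)]
  have bij: "bij_betw (mu I i) (carrier (tensor A I S)) (carrier S)"
    by (rule mu_bij_of_xi[OF I])
  let ?r = "\<lambda>s. ract A I (tensor_map A I S I (regular A) (ident I) \<pi> (hom_inv (tensor A I S) S (mu I i) s))"
  have "?r (i x) = x" if x: "x \<in> carrier I" for x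
  proof (rule firm_right_eqI[of A I _ I, OF _ _ ahom_comp[OF bimod_hom_ahom[OF I(2)]
          ahom_comp[OF hom_inv_ahom[OF mu_ahom[OF I(1,2)] bij] ahom_comp[OF tensor_map_ahom ract_ahom]]] ahom_ident _ x])
    fix x a assume xa: "x \<in> carrier I" "a \<in> carrier A"
    have "hom_inv (tensor A I S) S (mu I i) (i (x \<triangleleft>\<^bsub>I\<^esub> a)) = elem_tensor A I S x (\<eta> a)"
      using hom_inv_left[OF bij, of "elem_tensor A I S x (\<eta> a)"] xa by (simp add: mu_elem[OF I(1,2)])
    then show "?r (i (x \<triangleleft>\<^bsub>I\<^esub> a)) = x \<triangleleft>\<^bsub>I\<^esub> a" using xa by simp
  qed simp_all
  then show ?thesis by (rule inj_on_inverseI)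
qed

lemma inv_pair_image_firm:
  assumes ip: "inv_pair I i"
  shows "firm_bimodule A A (S\<lparr>carrier := i ` carrier I\<rparr>)"
proof -
  note I = inv_pairD[OF ip]
  note [simp] = I_rules[OF I(1,2)]
  have 1: "bimodule A A (S\<lparr>carrier := i ` carrier I\<rparr>)"
    by (rule image_bimodule[OF _ _ I(2)]) simp_all
  have 2: "bij_betw i (carrier I) (carrier (S\<lparr>carrier := i ` carrier I\<rparr>))"
    using inv_pair_inj[OF ip] by (simp add: inj_on_imp_bij_betw)
  show ?thesis
    by (rule firm_bimodule_iso[OF I(1) 1 _ _ bimod_hom_image[OF I(2)] 2]) simp_all
qed

text \<open>The idempotent of \<open>S\<close> attached to \<open>f\<close> is \<open>retr\<close> after \<open>\<Phi>\<^sub>f \<otimes> N\<close>.\<close>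

definition retr where
  "retr t = ract A S (tensor_map A S S S (regular A) (ident S) \<pi> (assoc A B S M N t))"

lemma firm_S': "firm_bimodule A A S"
  by (rule firm_bimodule_tensor[OF firm_M firm_N]) simp_all

lemmas S_rules' [simp] = firm_bimoduleD[OF firm_S']

lemma retr_ahom: "retr \<in> ahom (tensor B GM N) S"
  unfolding retr_def[abs_def] by (intro ahom_comp[OF assoc_ahom ahom_comp[OF tensor_map_ahom ract_ahom]]) simp_all

lemma retr_elem: "s \<in> carrier S \<Longrightarrow> m \<in> carrier M \<Longrightarrow> n \<in> carrier N \<Longrightarrow>
    retr (elem_tensor B GM N (elem_tensor A S M s m) n) = s \<triangleleft>\<^bsub>S\<^esub> \<pi> (mn m n)"
  by (simp add: retr_def mn_def)

lemma retr_homs: "restrict retr (carrier (tensor B GM N)) \<in> bimod_hom A A (tensor B GM N) S"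
proof -
  have eq: "(\<lambda>t\<in>carrier (tensor B GM N). (\<lambda>u\<in>carrier (tensor A S S).
      ract A S (tensor_map A S S S (regular A) (ident S) \<pi> u)) (assoc A B S M N t))
    = restrict retr (carrier (tensor B GM N))"
    by (rule ext) (simp add: retr_def)
  have "(\<lambda>t\<in>carrier (tensor B GM N). (\<lambda>u\<in>carrier (tensor A S S).
      ract A S (tensor_map A S S S (regular A) (ident S) \<pi> u)) (assoc A B S M N t))
    \<in> left_hom A (tensor B GM N) S"
    by (intro left_hom_comp[OF assoc_left_hom left_hom_comp[OF tensor_map_left_hom ract_left_hom]]) simp_all
  moreover have "(\<lambda>t\<in>carrier (tensor B GM N). (\<lambda>u\<in>carrier (tensor A S S).
      ract A S (tensor_map A S S S (regular A) (ident S) \<pi> u)) (assoc A B S M N t))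
    \<in> right_hom A (tensor B GM N) S"
    by (intro right_hom_comp[OF assoc_right_hom right_hom_comp[OF tensor_map_right_hom ract_right_hom]]) simp_all
  ultimately show ?thesis unfolding bimod_hom_iff eq by (rule conjI)
qed

lemma retr_assoc_inv: assumes s: "s \<in> carrier S" "s' \<in> carrier S"
  shows "retr (assoc_inv A B S M N (elem_tensor A S S s s')) = s \<triangleleft>\<^bsub>S\<^esub> \<pi> s'"
  using s by (simp add: retr_def assoc_assoc_inv)

lemma retr_r_unit: assumes "s \<in> carrier S" shows "retr (r_unit A B M N \<eta> S s) = s"
  by (rule firm_right_eqI[of A S _ S, OF _ _ ahom_comp[OF right_hom_ahom[OF r_unit_right_hom] retr_ahom] ahom_ident _ assms])
     (simp_all add: r_unit_elem retr_assoc_inv)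

context
  fixes f assumes f_endo: "f \<in> carrier endos"
begin

lemmas endo_rules' [simp] = f_rules[OF f_hom[OF f_endo]] Phi_right_hom[OF f_hom[OF f_endo]]
  Phi_left_hom[OF f_hom[OF f_endo]] right_hom_closed[OF Phi_right_hom[OF f_hom[OF f_endo]]]
  r_unit_S_right_hom[OF f_endo]

lemma Phi_bimod_hom [simp]: "Phi f \<in> bimod_hom A B M GM"
  by (simp add: bimod_hom_iff)

definition idem where
  "idem = (\<lambda>s\<in>carrier S. retr (tensor_map B M N GM N (Phi f) (ident N) s))"

lemma idem_bimod_hom: "idem \<in> bimod_hom A A S S"
proof -
  have "(\<lambda>s\<in>carrier S. restrict retr (carrier (tensor B GM N))
      (tensor_map B M N GM N (Phi f) (ident N) s)) \<in> bimod_hom A A S S"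
    by (rule bimod_hom_comp[OF tensor_map_bimod_hom retr_homs]) simp_all
  moreover have "(\<lambda>s\<in>carrier S. restrict retr (carrier (tensor B GM N))
      (tensor_map B M N GM N (Phi f) (ident N) s)) = idem"
    by (rule ext) (simp add: idem_def)
  ultimately show ?thesis by simp
qed

lemmas idem_rules [simp] = idem_bimod_hom bimod_hom_left[OF idem_bimod_hom]
  bimod_hom_right[OF idem_bimod_hom] bimod_hom_closed[OF idem_bimod_hom]

lemma idem_mn: "m \<in> carrier M \<Longrightarrow> n \<in> carrier N \<Longrightarrow> idem (mn m n) = retr (elem_tensor B GM N (Phi f m) n)"
  by (simp add: idem_def mn_def)

lemma represented_image:
  assumes ip: "inv_pair I i" and rep: "represents f I i"
  shows "i ` carrier I = idem ` carrier S"
proof -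
  note I = inv_pairD[OF ip]
  note [simp] = I_rules[OF I(1,2)]
  have bij: "bij_betw (mu I i) (carrier (tensor A I S)) (carrier S)"
    by (rule mu_bij_of_xi[OF I])
  note ia = bimod_hom_ahom[OF I(2)] and ea = bimod_hom_ahom[OF idem_bimod_hom]
  have e: "idem (ss (i x) s) = i x \<triangleleft>\<^bsub>S\<^esub> \<pi> s" if x: "x \<in> carrier I" and s: "s \<in> carrier S" for x s
  proof (rule S_eqI[OF ahom_comp[OF ss_ahom_right ea] _ _ s])
    show "(\<lambda>s. i x \<triangleleft>\<^bsub>S\<^esub> \<pi> s) \<in> ahom S S"
      using x ahom_add[OF bimod_hom_ahom[OF pi]] by (intro ahomI) (simp_all add: rsmult_add_right[of A])
  qed (use x in \<open>simp_all add: ss_mn_right idem_mn Phi_represented[OF I(1,2) f_hom[OF f_endo] rep] retr_elem\<close>)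
  have fix_i: "idem (i x) = i x" if x: "x \<in> carrier I" for x
    by (rule firm_right_eqI[of A I _ S, OF _ _ ahom_comp[OF ia ea] ia _ x])
       (use e[OF _ eta_closed] in simp_all)
  have im: "idem (mu I i z) = i (ract A I (tensor_map A I S I (regular A) (ident I) \<pi> z))"
    if z: "z \<in> carrier (tensor A I S)" for z
    by (rule tensor_eqI[OF _ _ ahom_comp[OF mu_ahom[OF I(1,2)] ea]
          ahom_comp[OF tensor_map_ahom ahom_comp[OF ract_ahom ia]] _ z])
       (simp_all add: mu_elem[OF I(1,2)] e)
  show ?thesis
  proof (intro subset_antisym subsetI)
    fix s assume "s \<in> i ` carrier I"
    then show "s \<in> idem ` carrier S" using fix_i by (auto intro!: image_eqI[of _ idem, OF sym])
  next
    fix s assume "s \<in> idem ` carrier S"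
    then obtain z where "z \<in> carrier (tensor A I S)" "s = idem (mu I i z)"
      unfolding bij_betw_imp_surj_on[OF bij, symmetric] by blast
    then show "s \<in> i ` carrier I"
      using im ahom_closed[OF ract_ahom[of A I] tensor_map_closed[of A I S I "regular A" "ident I" \<pi> z]] by simp
  qed
qed

lemma idem_Phi: assumes m: "m \<in> carrier M"
  shows "tensor_map A S M S M idem (ident M) (Phi f m) = Phi f m"
proof -
  let ?W = "restrict retr (carrier (tensor B GM N))"
  let ?WM = "tensor_map A (tensor B GM N) M S M ?W (ident M)"
  note [simp] = retr_homs bimod_hom_right[OF retr_homs]
  have 1: "?WM (coact_L f t) = tensor_map A S M S M idem (ident M) t" if t: "t \<in> carrier GM" for t
    by (rule tensor_eqI[OF _ _ ahom_comp[OF coact_L_ahom[OF f_endo] tensor_map_ahom] tensor_map_ahom _ t])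
       (simp_all add: coact_L_def[OF f_endo], simp add: idem_def)
  have 2: "?WM (coact_R t) = t" if t: "t \<in> carrier GM" for t
    by (rule tensor_eqI[OF _ _ ahom_comp[OF coact_R_ahom[OF f_endo] tensor_map_ahom] ahom_ident _ t])
       (simp_all add: coact_R_def[OF f_endo] retr_r_unit right_hom_closed[OF r_unit_S_right_hom[OF f_endo]])
  show ?thesis
    using m 1[of "Phi f m"] 2[of "Phi f m"] Phi_coassoc[OF f_endo m] by simp
qed

lemma idem_idem: assumes "s \<in> carrier S" shows "idem (idem s) = idem s"
proof -
  note ea = bimod_hom_ahom[OF idem_bimod_hom]
  have 1: "idem (retr (elem_tensor B GM N t n)) = retr (elem_tensor B GM N (tensor_map A S M S M idem (ident M) t) n)"
    if t: "t \<in> carrier GM" and n: "n \<in> carrier N" for t n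
    by (rule tensor_eqI[OF _ _ ahom_comp[OF ahom_comp[OF elem_tensor_ahom_left retr_ahom] ea]
          ahom_comp[OF tensor_map_ahom ahom_comp[OF elem_tensor_ahom_left retr_ahom]] _ t])
       (use n in \<open>simp_all add: retr_elem right_hom_rsmult[OF bimod_hom_right[OF idem_bimod_hom]]\<close>)
  show ?thesis
    by (rule S_eqI[OF ahom_comp[OF ea ea] ea _ assms]) (simp_all add: idem_mn 1 idem_Phi)
qed

lemma Phi_idem: assumes s: "s \<in> carrier S" and m: "m \<in> carrier M"
  shows "Phi f (sm (idem s) m) = elem_tensor A S M (idem s) m"
proof (rule S_eqI[OF ahom_comp[OF bimod_hom_ahom[OF idem_bimod_hom] ahom_comp[OF sm_ahom_left Phi_ahom[OF f_hom[OF f_endo]]]]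
      ahom_comp[OF bimod_hom_ahom[OF idem_bimod_hom] elem_tensor_ahom_left] _ s])
  fix m1 n assume m1: "m1 \<in> carrier M" and n: "n \<in> carrier N"
  let ?k = "\<lambda>m'\<in>carrier M. \<pi> (mn m' n) \<odot>\<^bsub>M\<^esub> m"
  let ?X = "tensor B GM N"
  have k: "?k \<in> left_hom A M M"
    unfolding left_hom_iff
  proof (intro conjI ballI)
    show "?k \<in> ahom M M"
    proof (rule restrict_ahom, simp, rule ahomI)
      fix x y assume "x \<in> carrier M" "y \<in> carrier M"
      then show "\<pi> (mn (x \<oplus>\<^bsub>M\<^esub> y) n) \<odot>\<^bsub>M\<^esub> m = \<pi> (mn x n) \<odot>\<^bsub>M\<^esub> m \<oplus>\<^bsub>M\<^esub> \<pi> (mn y n) \<odot>\<^bsub>M\<^esub> m"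
        using m n ahom_add[OF bimod_hom_ahom[OF pi], of "mn x n" "mn y n"]
        by (simp add: ahom_add[OF mn_ahom_left] smult_add_left[of A])
    qed (use m n in simp)
    fix a m' assume "a \<in> carrier A" "m' \<in> carrier M"
    then show "?k (a \<odot>\<^bsub>M\<^esub> m') = a \<odot>\<^bsub>M\<^esub> ?k m'"
      using m n left_hom_smult[OF bimod_hom_left[OF pi], of a "mn m' n"] by (simp add: smult_smult[of A])
  qed simp
  note [simp] = k
  let ?V = "\<lambda>u. r_counit A B M N \<epsilon> GM (tensor_map A ?X M ?X M (ident ?X) ?k u)"
  have rc: "r_counit A B M N \<epsilon> GM \<in> right_hom B (tensor A ?X M) GM"
    by (rule r_counit_right_hom) simp_all
  have V: "?V \<in> ahom (tensor A ?X M) GM"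
    by (rule ahom_comp[OF tensor_map_ahom right_hom_ahom[OF rc]]) simp_all
  have V_elem: "?V (elem_tensor A ?X M (elem_tensor B GM N z q) m') = z \<triangleleft>\<^bsub>GM\<^esub> \<epsilon> (nm q (?k m'))"
    if "z \<in> carrier GM" "q \<in> carrier N" "m' \<in> carrier M" for z q m'
    using that m n by (simp add: r_counit_elem nm_def)
  have L: "?V (coact_L f t) = Phi f (sm (retr (elem_tensor B GM N t n)) m)" if t: "t \<in> carrier GM" for t
  proof (rule tensor3_eqI_left[OF _ _ _ _ ahom_comp[OF coact_L_ahom[OF f_endo] V]
        ahom_comp[OF ahom_comp[OF ahom_comp[OF elem_tensor_ahom_left retr_ahom] sm_ahom_left] Phi_ahom[OF f_hom[OF f_endo]]] _ t])
    fix p q m' assume pq: "p \<in> carrier M" "q \<in> carrier N" "m' \<in> carrier M"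
    have "coact_L f (elem_tensor A S M (elem_tensor B M N p q) m') = elem_tensor A ?X M (elem_tensor B GM N (Phi f p) q) m'"
      using pq by (simp add: coact_L_def[OF f_endo])
    then have "?V (coact_L f (elem_tensor A S M (elem_tensor B M N p q) m')) = Phi f p \<triangleleft>\<^bsub>GM\<^esub> \<epsilon> (nm q (?k m'))"
      using pq by (simp only: V_elem right_hom_closed[OF Phi_right_hom[OF f_hom[OF f_endo]]])
    also have "\<dots> = Phi f (sm (mn p q) (?k m'))"
      using pq m n by (simp add: right_hom_rsmult[OF Phi_right_hom[OF f_hom[OF f_endo]], symmetric] del: nm_smult)
    also have "sm (mn p q) (?k m') = sm (mn p q \<triangleleft>\<^bsub>S\<^esub> \<pi> (mn m' n)) m"
      using pq m n by (simp only: sm_balanced mn_closed pi_closed restrict_apply if_True)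
    also have "mn p q \<triangleleft>\<^bsub>S\<^esub> \<pi> (mn m' n) = retr (elem_tensor B GM N (elem_tensor A S M (mn p q) m') n)"
      using pq n by (simp only: retr_elem mn_closed)
    finally show "?V (coact_L f (elem_tensor A S M (elem_tensor B M N p q) m'))
        = Phi f (sm (retr (elem_tensor B GM N (elem_tensor A S M (elem_tensor B M N p q) m') n)) m)"
      by (simp only: mn_def)
  qed (use m n in simp_all)
  have R: "?V (coact_R t) = elem_tensor A S M (retr (elem_tensor B GM N t n)) m" if t: "t \<in> carrier GM" for t
  proof (rule tensor_eqI[OF _ _ ahom_comp[OF coact_R_ahom[OF f_endo] V]
        ahom_comp[OF ahom_comp[OF elem_tensor_ahom_left retr_ahom] elem_tensor_ahom_left] _ t])
    fix s m' assume s: "s \<in> carrier S" and m': "m' \<in> carrier M"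
    show "?V (coact_R (elem_tensor A S M s m')) = elem_tensor A S M (retr (elem_tensor B GM N (elem_tensor A S M s m') n)) m"
    proof (rule firm_right_eqI[of A S _ GM, OF _ _ ahom_comp[OF elem_tensor_ahom_left ahom_comp[OF coact_R_ahom[OF f_endo] V]]
          ahom_comp[OF ahom_comp[OF elem_tensor_ahom_left ahom_comp[OF elem_tensor_ahom_left retr_ahom]] elem_tensor_ahom_left] _ s])
      fix s a assume sa: "s \<in> carrier S" "a \<in> carrier A"
      have km: "?k m' \<in> carrier M" using m m' n by simp
      have "?V (elem_tensor A ?X M (assoc_inv A B S M N (elem_tensor A S S s s'')) m') = elem_tensor A S M s (sm s'' (?k m'))"
        if s'': "s'' \<in> carrier S" for s''
      proof (rule S_eqI[OF ahom_comp[OF elem_tensor_ahom_right ahom_comp[OF assoc_inv_ahom ahom_comp[OF elem_tensor_ahom_left V]]]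
            ahom_comp[OF sm_ahom_left elem_tensor_ahom_right] _ s''])
        fix p q assume pq: "p \<in> carrier M" "q \<in> carrier N"
        have "assoc_inv A B S M N (elem_tensor A S S s (mn p q)) = elem_tensor B GM N (elem_tensor A S M s p) q"
          using pq sa by (simp add: mn_def)
        then have "?V (elem_tensor A ?X M (assoc_inv A B S M N (elem_tensor A S S s (mn p q))) m')
            = elem_tensor A S M s p \<triangleleft>\<^bsub>GM\<^esub> \<epsilon> (nm q (?k m'))"
          using pq sa m' V_elem[of "elem_tensor A S M s p" q m'] by simp
        then show "?V (elem_tensor A ?X M (assoc_inv A B S M N (elem_tensor A S S s (mn p q))) m')
            = elem_tensor A S M s (sm (mn p q) (?k m'))"
          using pq sa km by (simp del: restrict_apply nm_smult)
      qed (use sa m' km in simp_all)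
      note VR = this
      have c: "coact_R (elem_tensor A S M (s \<triangleleft>\<^bsub>S\<^esub> a) m')
          = elem_tensor A ?X M (assoc_inv A B S M N (elem_tensor A S S s (\<eta> a))) m'"
        using sa m' by (simp add: coact_R_def[OF f_endo] r_unit_elem)
      have "?V (coact_R (elem_tensor A S M (s \<triangleleft>\<^bsub>S\<^esub> a) m')) = elem_tensor A S M s (sm (\<eta> a) (?k m'))"
        unfolding c by (rule VR[OF eta_closed[OF sa(2)]])
      also have "sm (\<eta> a) (?k m') = a \<odot>\<^bsub>M\<^esub> ?k m'"
        by (rule sm_eta[OF sa(2) km])
      also have "elem_tensor A S M s (a \<odot>\<^bsub>M\<^esub> ?k m') = elem_tensor A S M (s \<triangleleft>\<^bsub>S\<^esub> a) (?k m')"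
        by (rule elem_tensor_balanced[symmetric]) (use sa km in simp_all)
      also have "\<dots> = elem_tensor A S M (s \<triangleleft>\<^bsub>S\<^esub> a \<triangleleft>\<^bsub>S\<^esub> \<pi> (mn m' n)) m"
        using sa m m' n by (simp add: elem_tensor_balanced)
      also have "\<dots> = elem_tensor A S M (retr (elem_tensor B GM N (elem_tensor A S M (s \<triangleleft>\<^bsub>S\<^esub> a) m') n)) m"
        using sa m' n by (simp add: retr_elem)
      finally show "?V (coact_R (elem_tensor A S M (s \<triangleleft>\<^bsub>S\<^esub> a) m'))
          = elem_tensor A S M (retr (elem_tensor B GM N (elem_tensor A S M (s \<triangleleft>\<^bsub>S\<^esub> a) m') n)) m" .
    qed (use m m' n in simp_all)
  qed (use m n in simp_all)
  show "Phi f (sm (idem (mn m1 n)) m) = elem_tensor A S M (idem (mn m1 n)) m"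
    unfolding idem_mn[OF m1 n] L[OF right_hom_closed[OF Phi_right_hom[OF f_hom[OF f_endo]] m1], symmetric]
      R[OF right_hom_closed[OF Phi_right_hom[OF f_hom[OF f_endo]] m1], symmetric]
    by (simp only: Phi_coassoc[OF f_endo m1])
qed (use m in simp_all)

lemma idem_pair:
  defines "I \<equiv> S\<lparr>carrier := idem ` carrier S\<rparr>"
  shows "inv_pair I (ident I)" "represents f I (ident I)"
proof -
  have sub: "carrier I \<subseteq> carrier S" by (auto simp: I_def)
  have fix_I: "idem x = x" if "x \<in> carrier I" for x using that by (auto simp: I_def idem_idem)
  have bI: "bimodule A A I" unfolding I_def by (rule image_bimodule[OF _ _ idem_bimod_hom]) simp_all
  have i: "ident I \<in> bimod_hom A A I S"
    using inclusion_bimod_hom[OF bI[unfolded I_def]] sub by (simp add: I_def)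
  have e: "idem \<in> bimod_hom A A S I"
    unfolding I_def by (rule bimod_hom_image[OF idem_bimod_hom])
  have firm: "firm_bimodule A A I"
    by (rule firm_bimodule_retract[OF firm_S' bI _ _ e i]) (simp_all add: fix_I)
  note [simp] = I_rules[OF firm i] e bimod_hom_right[OF e]
  have sub': "x \<in> carrier S" if "x \<in> carrier I" for x using that sub by blast
  have key: "Phi f (sm x m) = elem_tensor A S M x m" if "x \<in> carrier I" "m \<in> carrier M" for x m
    using that by (auto simp: I_def Phi_idem)
  show "represents f I (ident I)"
    by (rule represents_of_Phi[OF firm i f_hom[OF f_endo]]) (simp add: key)
  let ?E = "tensor_map A S M I M idem (ident M)" and ?J = "tensor_map A I M S M (ident I) (ident M)"
  have JE: "?J (?E t) = tensor_map A S M S M idem (ident M) t" if t: "t \<in> carrier GM" for t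
    by (rule tensor_eqI[OF _ _ ahom_comp[OF tensor_map_ahom tensor_map_ahom] tensor_map_ahom _ t])
       (use bimod_hom_closed[OF e] in simp_all)
  have 1: "?E (Phi f (xi I (ident I) z)) = z" if z: "z \<in> carrier (tensor A I M)" for z
    by (rule tensor_eqI[OF _ _ ahom_comp[OF xi_ahom[OF firm i] ahom_comp[OF Phi_ahom[OF f_hom[OF f_endo]] tensor_map_ahom]]
          ahom_ident _ z])
       (simp_all add: xi_elem[OF firm i] key sub' fix_I)
  have 2: "xi I (ident I) (?E (Phi f m)) = m" if m: "m \<in> carrier M" for m
    using m by (simp add: xi_r_def JE idem_Phi Phi_counit[OF f_endo])
  show "inv_pair I (ident I)"
    unfolding inv_pair_def
  proof (intro conjI firm i)
    show "bij_betw (xi I (ident I)) (carrier (tensor A I M)) (carrier M)"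
      by (rule bij_betw_byWitness[where f' = "\<lambda>m. ?E (Phi f m)"])
         (use 1 2 ahom_closed[OF xi_ahom[OF firm i]] in auto)
  qed
qed

end

lemma separable_reconstructs:
  fixes U :: "'u set"
  assumes U: "infinite U" "carrier M \<lesssim> U" "carrier N \<lesssim> U"
  shows "reconstructs U"
  unfolding reconstructs_def
proof (intro conjI allI impI ballI)
  fix I :: "('a, 'a, 'u) bimod" and i assume "inv_pair I i \<and> carrier I \<subseteq> U"
  then have inj: "inj_on i (carrier I)" using inv_pair_inj by blast
  show "firm_mono U A I i"
    unfolding firm_mono_def
  proof (intro allI impI, elim conjE)
    fix T :: "('a, 'a, 'u) bimod" and f g
    assume f: "f \<in> bimod_hom A A T I" and g: "g \<in> bimod_hom A A T I" and eq: "\<forall>t\<in>carrier T. i (f t) = i (g t)"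
    show "f = g"
      using eq bimod_hom_closed[OF f] bimod_hom_closed[OF g] inj_onD[OF inj]
      by (intro left_hom_eqI[OF bimod_hom_left[OF f] bimod_hom_left[OF g]]) blast
  qed
next
  fix I I' :: "('a, 'a, 'u) bimod" and i i' f
  assume "f \<in> carrier endos \<and> inv_pair I i \<and> carrier I \<subseteq> U \<and> inv_pair I' i' \<and> carrier I' \<subseteq> U
    \<and> represents f I i \<and> represents f I' i'"
  then show "i ` carrier I \<subseteq> i' ` carrier I'"
    using represented_image[of f I i] represented_image[of f I' i'] by simp
next
  fix f assume f: "f \<in> carrier endos"
  let ?I = "S\<lparr>carrier := idem f ` carrier S\<rparr>"
  have "carrier ?I \<subseteq> carrier S" using bimod_hom_closed[OF idem_bimod_hom[OF f]] by auto
  then have "carrier ?I \<lesssim> U"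
    using lepoll_trans[OF subset_imp_lepoll tensor_lepoll[OF U(1) _ _ U(2,3)]] by simp
  from inv_pair_copy[OF idem_pair(1)[OF f] this] obtain I' :: "('a, 'a, 'u) bimod" and i'
    where "carrier I' \<subseteq> U" "inv_pair I' i'" "i' ` carrier I' = ident ?I ` carrier ?I" .
  then show "\<exists>(I :: ('a, 'a, 'u) bimod) i. inv_pair I i \<and> carrier I \<subseteq> U \<and> represents f I i"
    using idem_pair(2)[OF f] by (intro exI[of _ I'] exI[of _ i']) (simp add: represents_iff_rep_set)
qed

end

end

section \<open>The comonadic case\<close>

context firm_adjunction
begin

abbreviation Gmap where "Gmap \<equiv> r_comonad_map A B M N"
abbreviation coact where "coact X \<equiv> r_coaction A B M N \<eta> X"
abbreviation Gobj where "Gobj Z \<equiv> tensor A (tensor B Z N) M"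
abbreviation FF where "FF X Y u \<equiv> tensor_map A X M Y M u (ident M)"
abbreviation UU where "UU Z Z' h \<equiv> tensor_map B Z N Z' N h (ident N)"

lemma Gmap_right_hom [simp]:
  assumes "right_module B Z" "right_module B Z'" "h \<in> right_hom B Z Z'"
  shows "Gmap Z Z' h \<in> right_hom B (Gobj Z) (Gobj Z')"
  using assms by (simp add: r_comonad_map_def)

lemma Gmap_ahom:
  assumes "right_module B Z" "right_module B Z'" "h \<in> right_hom B Z Z'"
  shows "Gmap Z Z' h \<in> ahom (Gobj Z) (Gobj Z')"
  by (rule right_hom_ahom[OF Gmap_right_hom[OF assms]])

lemma Gmap_elem:
  assumes "right_module B Z" "right_module B Z'" "h \<in> right_hom B Z Z'"
    "z \<in> carrier Z" "n \<in> carrier N" "m \<in> carrier M"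
  shows "Gmap Z Z' h (elem_tensor A (tensor B Z N) M (elem_tensor B Z N z n) m)
    = elem_tensor A (tensor B Z' N) M (elem_tensor B Z' N (h z) n) m"
  using assms by (simp add: r_comonad_map_def)

lemma Gobj_eqI:
  assumes "right_module B Z" "f \<in> ahom (Gobj Z) P" "g \<in> ahom (Gobj Z) P"
    "\<And>z n m. z \<in> carrier Z \<Longrightarrow> n \<in> carrier N \<Longrightarrow> m \<in> carrier M \<Longrightarrow>
       f (elem_tensor A (tensor B Z N) M (elem_tensor B Z N z n) m)
         = g (elem_tensor A (tensor B Z N) M (elem_tensor B Z N z n) m)"
    "t \<in> carrier (Gobj Z)"
  shows "f t = g t"
  by (rule tensor3_eqI_left[OF assms(1) _ _ _ assms(2,3,4,5)]) simp_all

lemma Gmap_comp: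
  assumes "right_module B Z" "right_module B Z'" "right_module B Z''"
    "g \<in> right_hom B Z Z'" "h \<in> right_hom B Z' Z''" "k \<in> right_hom B Z Z''"
    "\<And>z. z \<in> carrier Z \<Longrightarrow> k z = h (g z)" "t \<in> carrier (Gobj Z)"
  shows "Gmap Z' Z'' h (Gmap Z Z' g t) = Gmap Z Z'' k t"
  by (rule Gobj_eqI[OF assms(1) ahom_comp[OF Gmap_ahom[OF assms(1,2,4)] Gmap_ahom[OF assms(2,3,5)]]
        Gmap_ahom[OF assms(1,3,6)] _ assms(8)])
     (use assms right_hom_closed[OF assms(4)] in \<open>simp add: Gmap_elem\<close>)

lemma Gmap_ident:
  assumes "right_module B Z" "k \<in> right_hom B Z Z" "\<And>z. z \<in> carrier Z \<Longrightarrow> k z = z" "t \<in> carrier (Gobj Z)"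
  shows "Gmap Z Z k t = t"
  by (rule Gobj_eqI[OF assms(1) Gmap_ahom[OF assms(1,1,2)] ahom_ident _ assms(4)])
     (use assms in \<open>simp add: Gmap_elem\<close>)

lemma r_coalgebra_homD:
  assumes "h \<in> r_coalgebra_hom A B M N Z \<rho> Z' \<rho>'"
  shows "h \<in> right_hom B Z Z'" "\<And>z. z \<in> carrier Z \<Longrightarrow> \<rho>' (h z) = Gmap Z Z' h (\<rho> z)"
  using assms by (auto simp: r_coalgebra_hom_def)

lemma r_coalgebra_hom_comp:
  assumes Z: "right_module B Z" "right_module B Z'" "right_module B Z''"
    and \<rho>: "\<And>z. z \<in> carrier Z \<Longrightarrow> \<rho> z \<in> carrier (Gobj Z)"
    and g: "g \<in> r_coalgebra_hom A B M N Z \<rho> Z' \<rho>'" and h: "h \<in> r_coalgebra_hom A B M N Z' \<rho>' Z'' \<rho>''"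
  shows "(\<lambda>z\<in>carrier Z. h (g z)) \<in> r_coalgebra_hom A B M N Z \<rho> Z'' \<rho>''"
proof -
  note g' = r_coalgebra_homD[OF g] and h' = r_coalgebra_homD[OF h]
  have c: "(\<lambda>z\<in>carrier Z. h (g z)) \<in> right_hom B Z Z''"
    by (rule right_hom_comp[OF g'(1) h'(1) Z(1)])
  have "\<rho>'' (h (g z)) = Gmap Z Z'' (\<lambda>z\<in>carrier Z. h (g z)) (\<rho> z)" if z: "z \<in> carrier Z" for z
    using h'(2)[OF right_hom_closed[OF g'(1) z]] g'(2)[OF z]
      Gmap_comp[OF Z g'(1) h'(1) c _ \<rho>[OF z]] by simp
  then show ?thesis using c by (simp add: r_coalgebra_hom_def)
qed

lemma r_coalgebra_hom_inv:
  assumes Z: "right_module B Z" "right_module B Z'"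
    and \<rho>: "\<And>z. z \<in> carrier Z \<Longrightarrow> \<rho> z \<in> carrier (Gobj Z)"
    and h: "h \<in> r_coalgebra_hom A B M N Z \<rho> Z' \<rho>'" and bij: "bij_betw h (carrier Z) (carrier Z')"
  shows "hom_inv Z Z' h \<in> r_coalgebra_hom A B M N Z' \<rho>' Z \<rho>"
proof -
  note h' = r_coalgebra_homD[OF h]
  have k: "hom_inv Z Z' h \<in> right_hom B Z' Z" by (rule hom_inv_right_hom[OF h'(1) bij Z(1)])
  have "\<rho> (hom_inv Z Z' h y) = Gmap Z' Z (hom_inv Z Z' h) (\<rho>' y)" if y: "y \<in> carrier Z'" for y
  proof -
    let ?z = "hom_inv Z Z' h y"
    have z: "?z \<in> carrier Z" "h ?z = y" using bij y by simp_all
    have "Gmap Z' Z (hom_inv Z Z' h) (\<rho>' y) = Gmap Z' Z (hom_inv Z Z' h) (Gmap Z Z' h (\<rho> ?z))"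
      using h'(2)[OF z(1)] z(2) by simp
    also have "\<dots> = Gmap Z Z (ident Z) (\<rho> ?z)"
      by (rule Gmap_comp[OF Z(1,2,1) h'(1) k]) (use Z bij \<rho>[OF z(1)] in simp_all)
    also have "\<dots> = \<rho> ?z" by (rule Gmap_ident[OF Z(1)]) (use Z \<rho>[OF z(1)] in simp_all)
    finally show ?thesis by simp
  qed
  with k show ?thesis by (simp add: r_coalgebra_hom_def)
qed

lemma r_unit_natural:
  assumes X: "firm_right A X" and Y: "firm_right A Y" and u: "u \<in> right_hom A X Y" and x: "x \<in> carrier X"
  shows "UU (tensor A X M) (tensor A Y M) (FF X Y u) (r_unit A B M N \<eta> X x) = r_unit A B M N \<eta> Y (u x)"
proof -
  note [simp] = X Y u firm_right_module[OF X] firm_right_module[OF Y] right_hom_closed[OF u]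
  show ?thesis
  proof (rule firm_right_eqI[OF X _ ahom_comp[OF right_hom_ahom[OF r_unit_right_hom[OF X]] tensor_map_ahom]
        ahom_comp[OF right_hom_ahom[OF u] right_hom_ahom[OF r_unit_right_hom[OF Y]]] _ x])
    fix x a assume xa: "x \<in> carrier X" "a \<in> carrier A"
    have "UU (tensor A X M) (tensor A Y M) (FF X Y u) (assoc_inv A B X M N (elem_tensor A X S x s))
        = assoc_inv A B Y M N (elem_tensor A Y S (u x) s)" if s: "s \<in> carrier S" for s
      by (rule S_eqI[OF ahom_comp[OF ahom_comp[OF elem_tensor_ahom_right assoc_inv_ahom] tensor_map_ahom]
            ahom_comp[OF elem_tensor_ahom_right assoc_inv_ahom] _ s])
         (use xa in \<open>simp_all add: mn_def\<close>)
    from this[of "\<eta> a"]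
    show "UU (tensor A X M) (tensor A Y M) (FF X Y u) (r_unit A B M N \<eta> X (x \<triangleleft>\<^bsub>X\<^esub> a))
        = r_unit A B M N \<eta> Y (u (x \<triangleleft>\<^bsub>X\<^esub> a))"
      using xa by (simp add: r_unit_elem right_hom_rsmult[OF u])
  qed simp_all
qed

lemma r_counit_natural:
  assumes Z: "right_module B Z" "right_module B Z'" and h: "h \<in> right_hom B Z Z'" and t: "t \<in> carrier (Gobj Z)"
  shows "r_counit A B M N \<epsilon> Z' (Gmap Z Z' h t) = h (r_counit A B M N \<epsilon> Z t)"
proof -
  have rc: "r_counit A B M N \<epsilon> Z \<in> right_hom B (Gobj Z) Z" 
    by (rule r_counit_right_hom) (simp_all add: Z)
  have rc': "r_counit A B M N \<epsilon> Z' \<in> right_hom B (Gobj Z') Z'"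
    by (rule r_counit_right_hom) (simp_all add: Z)
  show ?thesis
    by (rule Gobj_eqI[OF Z(1) ahom_comp[OF Gmap_ahom[OF Z h] right_hom_ahom[OF rc']]
          ahom_comp[OF right_hom_ahom[OF rc] right_hom_ahom[OF h]] _ t])
       (use Z h right_hom_closed[OF h] in \<open>simp add: Gmap_elem r_counit_elem right_hom_rsmult[OF h] flip: nm_def\<close>)
qed

lemma coact_elem: assumes "firm_right A X" "x \<in> carrier X" "m \<in> carrier M"
  shows "coact X (elem_tensor A X M x m)
    = elem_tensor A (tensor B (tensor A X M) N) M (r_unit A B M N \<eta> X x) m"
  using assms firm_right_module[OF assms(1)] r_unit_right_hom[OF assms(1)] by (simp add: r_coaction_def)

lemma coact_right_hom: assumes "firm_right A X"
  shows "coact X \<in> right_hom B (tensor A X M) (Gobj (tensor A X M))"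
  using assms firm_right_module[OF assms(1)] r_unit_right_hom[OF assms(1)] by (simp add: r_coaction_def)

lemmas coact_closed = right_hom_closed[OF coact_right_hom]

lemma FF_coalgebra_hom:
  assumes X: "firm_right A X" and Y: "firm_right A Y" and u: "u \<in> right_hom A X Y"
  shows "FF X Y u \<in> r_coalgebra_hom A B M N (tensor A X M) (coact X) (tensor A Y M) (coact Y)"
proof -
  note [simp] = X Y u firm_right_module[OF X] firm_right_module[OF Y] right_hom_closed[OF u]
  have F: "FF X Y u \<in> right_hom B (tensor A X M) (tensor A Y M)" by simp
  have "coact Y (FF X Y u z) = Gmap (tensor A X M) (tensor A Y M) (FF X Y u) (coact X z)"
    if z: "z \<in> carrier (tensor A X M)" for z
    by (rule tensor_eqI[OF _ _ ahom_comp[OF right_hom_ahom[OF F] right_hom_ahom[OF coact_right_hom[OF Y]]]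
          ahom_comp[OF right_hom_ahom[OF coact_right_hom[OF X]] Gmap_ahom[OF _ _ F]] _ z])
       (simp_all add: coact_elem r_comonad_map_def r_unit_natural right_hom_closed[OF r_unit_right_hom])
  with F show ?thesis by (simp add: r_coalgebra_hom_def)
qed

lemma r_coalgebra_transport:
  assumes Z: "r_coalgebra A B M N \<eta> \<epsilon> Z \<rho>" and Z': "right_module B Z'"
    and j: "j \<in> right_hom B Z Z'" and bij: "bij_betw j (carrier Z) (carrier Z')"
  defines "\<rho>' \<equiv> \<lambda>z\<in>carrier Z'. Gmap Z Z' j (\<rho> (hom_inv Z Z' j z))"
  shows "r_coalgebra A B M N \<eta> \<epsilon> Z' \<rho>'" "j \<in> r_coalgebra_hom A B M N Z \<rho> Z' \<rho>'"
proof -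
  have Zf: "firm_right B Z" and \<rho>: "\<rho> \<in> right_hom B Z (Gobj Z)"
    and cu: "\<And>z. z \<in> carrier Z \<Longrightarrow> r_counit A B M N \<epsilon> Z (\<rho> z) = z"
    and ca: "\<And>z. z \<in> carrier Z \<Longrightarrow> Gmap Z (Gobj Z) \<rho> (\<rho> z)
          = tensor_map A (tensor B Z N) M (tensor B (Gobj Z) N) M (r_unit A B M N \<eta> (tensor B Z N)) (ident M) (\<rho> z)"
    using Z by (auto simp: r_coalgebra_def Let_def)
  note Zm = firm_right_module[OF Zf]
  note [simp] = Zm Z' j bij right_hom_closed[OF j] right_hom_closed[OF \<rho>] \<rho>
  have Zf': "firm_right B Z'" by (rule firm_right_iso[OF Zf Z' _ j bij]) simp
  have Gj: "Gmap Z Z' j \<in> right_hom B (Gobj Z) (Gobj Z')" by simp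
  have "(\<lambda>z\<in>carrier Z'. (\<lambda>y\<in>carrier Z. Gmap Z Z' j (\<rho> y)) (hom_inv Z Z' j z)) \<in> right_hom B Z' (Gobj Z')"
    by (rule right_hom_comp[OF hom_inv_right_hom[OF j bij Zm] right_hom_comp[OF \<rho> Gj Zm] Z'])
  moreover have "(\<lambda>z\<in>carrier Z'. (\<lambda>y\<in>carrier Z. Gmap Z Z' j (\<rho> y)) (hom_inv Z Z' j z)) = \<rho>'"
    by (rule ext) (simp add: \<rho>'_def)
  ultimately have \<rho>': "\<rho>' \<in> right_hom B Z' (Gobj Z')" by simp
  have \<rho>'_j: "\<rho>' (j z) = Gmap Z Z' j (\<rho> z)" if "z \<in> carrier Z" for z
    using that by (simp add: \<rho>'_def)
  show "j \<in> r_coalgebra_hom A B M N Z \<rho> Z' \<rho>'"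
    by (simp add: r_coalgebra_hom_def \<rho>'_j)
  let ?UZ = "tensor B Z N" and ?UZ' = "tensor B Z' N"
  have f: "firm_right A ?UZ" "firm_right A ?UZ'" by (rule firm_right_tensor; simp)+
  note [simp] = f r_unit_right_hom[OF f(1)] r_unit_right_hom[OF f(2)]
    right_hom_closed[OF r_unit_right_hom[OF f(1)]] right_hom_closed[OF r_unit_right_hom[OF f(2)]]
  let ?RU = "tensor_map A ?UZ M (tensor B (Gobj Z) N) M (r_unit A B M N \<eta> ?UZ) (ident M)"
  let ?RU' = "tensor_map A ?UZ' M (tensor B (Gobj Z') N) M (r_unit A B M N \<eta> ?UZ') (ident M)"
  have nat: "?RU' (Gmap Z Z' j t) = Gmap (Gobj Z) (Gobj Z') (Gmap Z Z' j) (?RU t)" if t: "t \<in> carrier (Gobj Z)" for t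
  proof (rule tensor_eqI[OF _ _ ahom_comp[OF right_hom_ahom[OF Gj] tensor_map_ahom]
        ahom_comp[OF tensor_map_ahom Gmap_ahom[OF _ _ Gj]] _ t])
    fix y m assume y: "y \<in> carrier ?UZ" and m: "m \<in> carrier M"
    have "UU (Gobj Z) (Gobj Z') (Gmap Z Z' j) (r_unit A B M N \<eta> ?UZ y) = r_unit A B M N \<eta> ?UZ' (UU Z Z' j y)"
      using r_unit_natural[OF f, of "UU Z Z' j" y] y by (simp add: r_comonad_map_def)
    then show "?RU' (Gmap Z Z' j (elem_tensor A ?UZ M y m))
        = Gmap (Gobj Z) (Gobj Z') (Gmap Z Z' j) (?RU (elem_tensor A ?UZ M y m))"
      using y m by (simp add: r_comonad_map_def)
  qed simp_all
  have k: "(\<lambda>z\<in>carrier Z. Gmap Z Z' j (\<rho> z)) \<in> right_hom B Z (Gobj Z')"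
    by (rule right_hom_comp[OF \<rho> Gj Zm])
  show "r_coalgebra A B M N \<eta> \<epsilon> Z' \<rho>'"
    unfolding r_coalgebra_def Let_def
  proof (intro conjI ballI Zf' \<rho>')
    fix y assume y: "y \<in> carrier Z'"
    define z where "z = hom_inv Z Z' j y"
    have z: "z \<in> carrier Z" "j z = y" using y by (simp_all add: z_def)
    have rz: "\<rho> z \<in> carrier (Gobj Z)" by (rule right_hom_closed[OF \<rho> z(1)])
    have py: "\<rho>' y = Gmap Z Z' j (\<rho> z)" using \<rho>'_j[OF z(1)] z(2) by simp
    show "r_counit A B M N \<epsilon> Z' (\<rho>' y) = y"
      unfolding py using r_counit_natural[OF Zm Z' j rz] cu[OF z(1)] z(2) by simp
    have "Gmap Z' (Gobj Z') \<rho>' (\<rho>' y) = Gmap Z (Gobj Z') (\<lambda>z\<in>carrier Z. Gmap Z Z' j (\<rho> z)) (\<rho> z)"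
      unfolding py by (rule Gmap_comp[OF Zm Z' _ j \<rho>' k _ rz]) (simp_all add: \<rho>'_j)
    also have "\<dots> = Gmap (Gobj Z) (Gobj Z') (Gmap Z Z' j) (Gmap Z (Gobj Z) \<rho> (\<rho> z))"
      by (rule Gmap_comp[OF Zm _ _ \<rho> Gj k _ rz, symmetric]) simp_all
    also have "\<dots> = ?RU' (\<rho>' y)"
      unfolding py nat[OF rz] ca[OF z(1)] ..
    finally show "Gmap Z' (Gobj Z') \<rho>' (\<rho>' y) = ?RU' (\<rho>' y)" .
  qed
qed

lemma Phi_coalgebra: assumes "f \<in> carrier endos" shows "r_coalgebra A B M N \<eta> \<epsilon> M (Phi f)"
  using Phi_right_hom[OF f_hom[OF assms]] Phi_counit[OF assms] Phi_coassoc[OF assms]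
  by (simp add: r_coalgebra_def Let_def r_comonad_map_def coact_L_def[OF assms] coact_R_def[OF assms])

lemma represented_coalgebra_hom:
  assumes f: "f \<in> carrier endos" and ip: "inv_pair I i" and rep: "represents f I i"
  shows "xi I i \<in> r_coalgebra_hom A B M N (tensor A I M) (coact I) M (Phi f)"
proof -
  note I = inv_pairD[OF ip]
  note [simp] = I_rules[OF I(1,2)] xi_elem[OF I(1,2)]
  have x: "xi I i \<in> right_hom B (tensor A I M) M" by (rule bimod_hom_right[OF xi_bimod_hom[OF I(1,2)]])
  note [simp] = x
  have 1: "UU (tensor A I M) M (xi I i) (r_unit A B M N \<eta> I x) = i x" if x': "x \<in> carrier I" for x
  proof (rule firm_right_eqI[of A I _ S, OF _ _ ahom_comp[OF right_hom_ahom[OF r_unit_right_hom] tensor_map_ahom]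
        bimod_hom_ahom[OF I(2)] _ x'])
    fix x a assume xa: "x \<in> carrier I" "a \<in> carrier A"
    have "UU (tensor A I M) M (xi I i) (assoc_inv A B I M N (elem_tensor A I S x s)) = ss (i x) s" if s: "s \<in> carrier S" for s
      by (rule S_eqI[OF ahom_comp[OF ahom_comp[OF elem_tensor_ahom_right assoc_inv_ahom] tensor_map_ahom] ss_ahom_right _ s])
         (use xa in \<open>simp_all add: ss_mn_right, simp_all add: mn_def\<close>)
    from this[of "\<eta> a"] show "UU (tensor A I M) M (xi I i) (r_unit A B M N \<eta> I (x \<triangleleft>\<^bsub>I\<^esub> a)) = i (x \<triangleleft>\<^bsub>I\<^esub> a)"
      using xa by (simp add: r_unit_elem)
  qed simp_all
  have "Phi f (xi I i z) = Gmap (tensor A I M) M (xi I i) (coact I z)" if z: "z \<in> carrier (tensor A I M)" for z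
    by (rule tensor_eqI[OF _ _ ahom_comp[OF xi_ahom[OF I(1,2)] Phi_ahom[OF f_hom[OF f]]]
          ahom_comp[OF right_hom_ahom[OF coact_right_hom] Gmap_ahom[OF _ _ x]] _ z])
       (simp_all add: coact_elem r_comonad_map_def 1 right_hom_closed[OF r_unit_right_hom]
          Phi_represented[OF I(1,2) f_hom[OF f] rep])
  then show ?thesis by (simp add: r_coalgebra_hom_def)
qed

context
  fixes U :: "'u set"
  assumes inf: "infinite U" and AU: "carrier A \<lesssim> U" and MU: "carrier M \<lesssim> U"
    and comonadic: "r_comonadic U A B M N \<eta> \<epsilon>"
begin

lemma comparison_bij:
  fixes X Y :: "(unit, 'a, 'u) bimod"
  assumes "firm_right A X" "carrier X \<subseteq> U" "firm_right A Y" "carrier Y \<subseteq> U"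
  shows "bij_betw (FF X Y) (right_hom A X Y)
    (r_coalgebra_hom A B M N (tensor A X M) (coact X) (tensor A Y M) (coact Y))"
  using comonadic assms by (simp add: r_comonadic_def)

lemma firm_right_copy:
  fixes X :: "('c, 'a, 'x) bimod"
  assumes "firm_right A X" "carrier X \<lesssim> U"
  obtains X' :: "(unit, 'a, 'u) bimod" and j where "firm_right A X'" "carrier X' \<subseteq> U"
    "j \<in> right_hom A X X'" "bij_betw j (carrier X) (carrier X')"
proof -
  obtain X' :: "(unit, 'a, 'u) bimod" and j where *: "right_module A X'" "carrier X' \<subseteq> U"
    "j \<in> right_hom A X X'" "bij_betw j (carrier X) (carrier X')"
    using right_module_copy_ex[OF firm_right_module[OF assms(1)] assms(2)] .
  show ?thesis
    by (rule that[OF firm_right_iso[OF assms(1) *(1) _ *(3,4)] *(2-4)]) simp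
qed

lemma comparison_full:
  fixes X :: "('c, 'a, 'x) bimod" and Y :: "('d, 'a, 'y) bimod"
  assumes X: "firm_right A X" "carrier X \<lesssim> U" and Y: "firm_right A Y" "carrier Y \<lesssim> U"
    and k: "k \<in> r_coalgebra_hom A B M N (tensor A X M) (coact X) (tensor A Y M) (coact Y)"
  obtains u where "u \<in> right_hom A X Y" "FF X Y u = k"
proof -
  obtain X' :: "(unit, 'a, 'u) bimod" and p where X': "firm_right A X'" "carrier X' \<subseteq> U"
    and p: "p \<in> right_hom A X X'" "bij_betw p (carrier X) (carrier X')" using firm_right_copy[OF X] .
  obtain Y' :: "(unit, 'a, 'u) bimod" and q where Y': "firm_right A Y'" "carrier Y' \<subseteq> U"
    and q: "q \<in> right_hom A Y Y'" "bij_betw q (carrier Y) (carrier Y')" using firm_right_copy[OF Y] .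
  let ?p = "hom_inv X X' p" and ?q = "hom_inv Y Y' q"
  have ip: "?p \<in> right_hom A X' X" by (rule hom_inv_right_hom[OF p firm_right_module[OF X(1)]])
  have iq: "?q \<in> right_hom A Y' Y" by (rule hom_inv_right_hom[OF q firm_right_module[OF Y(1)]])
  note [simp] = firm_right_module[OF X(1)] firm_right_module[OF X'(1)] firm_right_module[OF Y(1)]
    firm_right_module[OF Y'(1)] p q ip iq right_hom_closed[OF p(1)] right_hom_closed[OF q(1)]
  note kh = r_coalgebra_homD(1)[OF k]
  let ?k1 = "\<lambda>z\<in>carrier (tensor A X' M). k (FF X' X ?p z)"
  have k1: "?k1 \<in> r_coalgebra_hom A B M N (tensor A X' M) (coact X') (tensor A Y M) (coact Y)"
    by (rule r_coalgebra_hom_comp[OF _ _ _ coact_closed[OF X'(1)] FF_coalgebra_hom[OF X'(1) X(1) ip] k]) simp_all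
  let ?k2 = "\<lambda>z\<in>carrier (tensor A X' M). FF Y Y' q (?k1 z)"
  have k2: "?k2 \<in> r_coalgebra_hom A B M N (tensor A X' M) (coact X') (tensor A Y' M) (coact Y')"
    by (rule r_coalgebra_hom_comp[OF _ _ _ coact_closed[OF X'(1)] k1 FF_coalgebra_hom[OF Y(1) Y'(1) q(1)]]) simp_all
  have "?k2 \<in> FF X' Y' ` right_hom A X' Y'"
    unfolding bij_betw_imp_surj_on[OF comparison_bij[OF X' Y']] by (rule k2)
  then obtain u where u: "u \<in> right_hom A X' Y'" "FF X' Y' u = ?k2" by (elim imageE) simp
  let ?v = "\<lambda>x\<in>carrier X. ?q (u (p x))"
  have "(\<lambda>x\<in>carrier X. ?q ((\<lambda>x\<in>carrier X. u (p x)) x)) \<in> right_hom A X Y"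
    by (rule right_hom_comp[OF right_hom_comp[OF p(1) u(1)] iq]) simp_all
  then have v: "?v \<in> right_hom A X Y" by (simp cong: restrict_cong)
  note [simp] = u(1) v right_hom_closed[OF u(1)]
  have "FF X Y ?v z = k z" if z: "z \<in> carrier (tensor A X M)" for z
  proof -
    have 1: "FF X Y ?v z = FF Y' Y ?q (FF X' Y' u (FF X X' p z))"
      by (rule tensor_eqI[OF _ _ tensor_map_ahom ahom_comp[OF tensor_map_ahom ahom_comp[OF tensor_map_ahom tensor_map_ahom]] _ z]) simp_all
    have 2: "FF X' X ?p (FF X X' p z) = z"
      by (rule tensor_eqI[OF _ _ ahom_comp[OF tensor_map_ahom tensor_map_ahom] ahom_ident _ z]) simp_all
    have 3: "FF Y' Y ?q (FF Y Y' q y) = y" if y: "y \<in> carrier (tensor A Y M)" for y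
      by (rule tensor_eqI[OF _ _ ahom_comp[OF tensor_map_ahom tensor_map_ahom] ahom_ident _ y]) simp_all
    have pz: "FF X X' p z \<in> carrier (tensor A X' M)" using z by simp
    have "FF X Y ?v z = FF Y' Y ?q (FF Y Y' q (k (FF X' X ?p (FF X X' p z))))"
      unfolding 1 u(2) restrict_apply'[OF pz] ..
    also have "\<dots> = k z" unfolding 2 by (rule 3[OF right_hom_closed[OF kh z]])
    finally show ?thesis .
  qed
  then have "FF X Y ?v = k"
    using kh by (intro extensionalityI[OF tensor_map_extensional]) (simp_all add: right_hom_iff)
  from that[OF v this] show ?thesis .
qed

lemma comparison_faithful:
  fixes X :: "('c, 'a, 'x) bimod" and Y :: "('d, 'a, 'y) bimod"
  assumes X: "firm_right A X" "carrier X \<lesssim> U" and Y: "firm_right A Y" "carrier Y \<lesssim> U"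
    and u: "u \<in> right_hom A X Y" and v: "v \<in> right_hom A X Y"
    and eq: "\<And>x m. x \<in> carrier X \<Longrightarrow> m \<in> carrier M \<Longrightarrow>
      elem_tensor A Y M (u x) m = elem_tensor A Y M (v x) m"
    and x: "x \<in> carrier X"
  shows "u x = v x"
proof -
  obtain X' :: "(unit, 'a, 'u) bimod" and p where X': "firm_right A X'" "carrier X' \<subseteq> U"
    and p: "p \<in> right_hom A X X'" "bij_betw p (carrier X) (carrier X')" using firm_right_copy[OF X] .
  obtain Y' :: "(unit, 'a, 'u) bimod" and q where Y': "firm_right A Y'" "carrier Y' \<subseteq> U"
    and q: "q \<in> right_hom A Y Y'" "bij_betw q (carrier Y) (carrier Y')" using firm_right_copy[OF Y] .
  let ?p = "hom_inv X X' p"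
  have ip: "?p \<in> right_hom A X' X" by (rule hom_inv_right_hom[OF p firm_right_module[OF X(1)]])
  note [simp] = firm_right_module[OF X(1)] firm_right_module[OF X'(1)] firm_right_module[OF Y(1)]
    firm_right_module[OF Y'(1)] p q ip right_hom_closed[OF p(1)] right_hom_closed[OF q(1)]
  let ?w = "\<lambda>u. \<lambda>x\<in>carrier X'. q ((\<lambda>x\<in>carrier X'. u (?p x)) x)"
  have w: "?w u \<in> right_hom A X' Y'" if "u \<in> right_hom A X Y" for u
    by (rule right_hom_comp[OF right_hom_comp[OF ip that] q(1)]) simp_all
  have "FF X' Y' (?w u) z = FF X' Y' (?w v) z" if z: "z \<in> carrier (tensor A X' M)" for z
  proof (rule tensor_eqI[OF _ _ tensor_map_ahom tensor_map_ahom _ z])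
    fix x m assume xm: "x \<in> carrier X'" "m \<in> carrier M"
    then have "FF Y Y' q (elem_tensor A Y M (u (?p x)) m) = FF Y Y' q (elem_tensor A Y M (v (?p x)) m)"
      using eq[of "?p x" m] by simp
    then show "FF X' Y' (?w u) (elem_tensor A X' M x m) = FF X' Y' (?w v) (elem_tensor A X' M x m)"
      using xm w[OF u] w[OF v] right_hom_closed[OF u] right_hom_closed[OF v] by simp
  qed (use w[OF u] w[OF v] in simp_all)
  then have "FF X' Y' (?w u) = FF X' Y' (?w v)"
    by (rule extensionalityI[OF tensor_map_extensional tensor_map_extensional])
  from inj_onD[OF bij_betw_imp_inj_on[OF comparison_bij[OF X' Y']] this w[OF u] w[OF v]]
  have "?w u (p x) = ?w v (p x)" by (rule fun_cong)
  then have "q (u x) = q (v x)" using x by simp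
  then show ?thesis
    by (rule inj_onD[OF bij_betw_imp_inj_on[OF q(2)] _ right_hom_closed[OF u x] right_hom_closed[OF v x]])
qed

lemma comparison_reaches_M:
  assumes f: "f \<in> carrier endos"
  obtains X :: "(unit, 'a, 'u) bimod" and h where "firm_right A X" "carrier X \<subseteq> U"
    "h \<in> r_coalgebra_hom A B M N (tensor A X M) (coact X) M (Phi f)"
    "bij_betw h (carrier (tensor A X M)) (carrier M)"
proof -
  obtain M' :: "(unit, 'b, 'u) bimod" and j where M': "right_module B M'" "carrier M' \<subseteq> U"
    and j: "j \<in> right_hom B M M'" "bij_betw j (carrier M) (carrier M')"
    using right_module_copy_ex[OF firm_bimoduleD(3)[OF firm_M] MU] .
  let ?\<rho> = "\<lambda>z\<in>carrier M'. Gmap M M' j (Phi f (hom_inv M M' j z))"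
  note t = r_coalgebra_transport[OF Phi_coalgebra[OF f] M'(1) j]
  obtain X :: "(unit, 'a, 'u) bimod" and h where X: "firm_right A X" "carrier X \<subseteq> U"
    and h: "h \<in> r_coalgebra_hom A B M N (tensor A X M) (coact X) M' ?\<rho>"
      "bij_betw h (carrier (tensor A X M)) (carrier M')"
    using conjunct2[OF comonadic[unfolded r_comonadic_def], rule_format, OF conjI[OF t(1) M'(2)]] by blast
  have ij: "hom_inv M M' j \<in> r_coalgebra_hom A B M N M' ?\<rho> M (Phi f)"
    by (rule r_coalgebra_hom_inv[OF _ M'(1) _ t(2) j(2)]) (simp_all add: right_hom_closed[OF Phi_right_hom[OF f_hom[OF f]]])
  have "(\<lambda>z\<in>carrier (tensor A X M). hom_inv M M' j (h z))
      \<in> r_coalgebra_hom A B M N (tensor A X M) (coact X) M (Phi f)"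
    by (rule r_coalgebra_hom_comp[OF _ M'(1) _ coact_closed[OF X(1)] h(1) ij])
       (simp_all add: firm_right_module[OF X(1)])
  moreover have "bij_betw (\<lambda>z\<in>carrier (tensor A X M). hom_inv M M' j (h z)) (carrier (tensor A X M)) (carrier M)"
    using bij_betw_trans[OF h(2) hom_inv_bij[OF j(2)]] by (simp add: comp_def cong: bij_betw_cong)
  ultimately show ?thesis using that X by blast
qed

end

context
  fixes U :: "'u set"
  assumes inf: "infinite U" and AU: "carrier A \<lesssim> U" and MU: "carrier M \<lesssim> U"
    and comonadic: "r_comonadic U A B M N \<eta> \<epsilon>"
begin

lemma comonadic_firm_mono:
  fixes I :: "('a, 'a, 'u) bimod"
  assumes ip: "inv_pair I i" and IU: "carrier I \<subseteq> U"
  shows "firm_mono U A I i"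
  unfolding firm_mono_def
proof (intro allI impI, elim conjE)
  note I = inv_pairD[OF ip]
  fix T :: "('a, 'a, 'u) bimod" and f g
  assume T: "firm_bimodule A A T" "carrier T \<subseteq> U"
    and f: "f \<in> bimod_hom A A T I" and g: "g \<in> bimod_hom A A T I"
    and eq: "\<forall>t\<in>carrier T. i (f t) = i (g t)"
  note [simp] = I_rules[OF I(1,2)] xi_elem[OF I(1,2)] bimod_hom_closed[OF f] bimod_hom_closed[OF g]
  have "elem_tensor A I M (f x) m = elem_tensor A I M (g x) m" if "x \<in> carrier T" "m \<in> carrier M" for x m
    by (rule inj_onD[OF bij_betw_imp_inj_on[OF I(3)]]) (use that eq in simp_all)
  then show "f = g"
    by (intro right_hom_eqI[OF bimod_hom_right[OF f] bimod_hom_right[OF g]]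
        comparison_faithful[OF inf AU MU comonadic firm_bimoduleD(5)[OF T(1)] subset_imp_lepoll[OF T(2)]
          firm_bimoduleD(5)[OF I(1)] subset_imp_lepoll[OF IU] bimod_hom_right[OF f] bimod_hom_right[OF g]])
qed

lemma comonadic_image_subset:
  fixes I I' :: "('a, 'a, 'u) bimod"
  assumes f: "f \<in> carrier endos"
    and ip: "inv_pair I i" "carrier I \<subseteq> U" "represents f I i"
    and ip': "inv_pair I' i'" "carrier I' \<subseteq> U" "represents f I' i'"
  shows "i ` carrier I \<subseteq> i' ` carrier I'"
proof -
  note I = inv_pairD[OF ip(1)] and I' = inv_pairD[OF ip'(1)]
  note [simp] = I_rules[OF I(1,2)] I_rules[OF I'(1,2)] xi_elem[OF I(1,2)] xi_elem[OF I'(1,2)]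
  note c = represented_coalgebra_hom[OF f ip(1,3)] and c' = represented_coalgebra_hom[OF f ip'(1,3)]
  let ?h = "hom_inv (tensor A I' M) M (xi I' i')"
  have h: "?h \<in> r_coalgebra_hom A B M N M (Phi f) (tensor A I' M) (coact I')"
    by (rule r_coalgebra_hom_inv[OF _ _ coact_closed c' I'(3)]) simp_all
  have k: "(\<lambda>z\<in>carrier (tensor A I M). ?h (xi I i z))
      \<in> r_coalgebra_hom A B M N (tensor A I M) (coact I) (tensor A I' M) (coact I')"
    by (rule r_coalgebra_hom_comp[OF _ _ _ coact_closed c h]) simp_all
  obtain u where u: "u \<in> right_hom A I I'" "FF I I' u = (\<lambda>z\<in>carrier (tensor A I M). ?h (xi I i z))"
    using comparison_full[OF inf AU MU comonadic firm_bimoduleD(5)[OF I(1)] subset_imp_lepoll[OF ip(2)]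
          firm_bimoduleD(5)[OF I'(1)] subset_imp_lepoll[OF ip'(2)] k] .
  note [simp] = u(1) right_hom_closed[OF u(1)]
  have sm_u: "sm (i' (u x)) m = sm (i x) m" if "x \<in> carrier I" "m \<in> carrier M" for x m
  proof -
    have "xi I' i' (FF I I' u (elem_tensor A I M x m)) = xi I i (elem_tensor A I M x m)"
      unfolding u(2)
      using that I'(3) by simp
    then show ?thesis using that by simp
  qed
  have v: "(\<lambda>x\<in>carrier I. i' (u x)) \<in> right_hom A I S"
    by (rule right_hom_comp[OF u(1) bimod_hom_right[OF I'(2)]]) simp
  have "(\<lambda>x\<in>carrier I. i' (u x)) x = i x" if "x \<in> carrier I" for x
    by (rule eq_of_sm_eq[OF firm_bimoduleD(5)[OF I(1)] v bimod_hom_right[OF I(2)] _ that]) (simp add: sm_u)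
  then have "i x = i' (u x)" if "x \<in> carrier I" for x using that by simp
  then show ?thesis using right_hom_closed[OF u(1)] by auto
qed

text \<open>If \<open>X \<otimes>\<^sub>A M \<cong> (M, \<Phi>\<^sub>f)\<close>, then \<open>A\<close> acts on \<open>X\<close> from the left because the comparison functor is full and
  faithful; \<open>I = A \<otimes>\<^sub>A X\<close> is firm on both sides.\<close>

lemma comonadic_exists:
  assumes f: "f \<in> carrier endos"
  obtains I :: "('a, 'a, 'u) bimod" and i where "inv_pair I i" "carrier I \<subseteq> U" "represents f I i"
proof -
  note fh = f_hom[OF f]
  obtain X :: "(unit, 'a, 'u) bimod" and h where X: "firm_right A X" "carrier X \<subseteq> U"
    and h: "h \<in> r_coalgebra_hom A B M N (tensor A X M) (coact X) M (Phi f)"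
    and bij: "bij_betw h (carrier (tensor A X M)) (carrier M)"
    using comparison_reaches_M[OF inf AU MU comonadic f] .
  note Xm = firm_right_module[OF X(1)]
  note XU = subset_imp_lepoll[OF X(2)]
  note hr = r_coalgebra_homD(1)[OF h] and hc = r_coalgebra_homD(2)[OF h]
  note ha = right_hom_ahom[OF hr]
  note [simp] = X(1) Xm hr right_hom_closed[OF hr] right_module_abelian[OF Xm]
  note ru = r_unit_right_hom[OF X(1)]
  note [simp] = ru right_hom_closed[OF ru]
  let ?e = "elem_tensor A X M"
  define i0 where "i0 = (\<lambda>x\<in>carrier X. UU (tensor A X M) M h (r_unit A B M N \<eta> X x))"
  have i0: "i0 \<in> right_hom A X S"
    unfolding i0_def by (rule right_hom_comp[OF ru tensor_map_right_hom Xm]) simp_all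
  note [simp] = i0 right_hom_closed[OF i0]
  have sm_i0: "sm (i0 x) m = h (?e x m)" if x: "x \<in> carrier X" and m: "m \<in> carrier M" for x m
  proof (rule firm_right_eqI[OF X(1) _ ahom_comp[OF right_hom_ahom[OF i0] sm_ahom_left]
        ahom_comp[OF elem_tensor_ahom_left ha] _ x])
    fix x a assume xa: "x \<in> carrier X" "a \<in> carrier A"
    have "sm (UU (tensor A X M) M h (assoc_inv A B X M N (elem_tensor A X S x s))) m = h (?e x (sm s m))"
      if s: "s \<in> carrier S" for s
    proof (rule S_eqI[OF ahom_comp[OF ahom_comp[OF elem_tensor_ahom_right assoc_inv_ahom] ahom_comp[OF tensor_map_ahom sm_ahom_left]]
          ahom_comp[OF sm_ahom_left ahom_comp[OF elem_tensor_ahom_right ha]] _ s])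
      fix p q assume pq: "p \<in> carrier M" "q \<in> carrier N"
      have "UU (tensor A X M) M h (assoc_inv A B X M N (elem_tensor A X S x (mn p q))) = mn (h (?e x p)) q"
        using xa pq by (simp add: mn_def)
      then show "sm (UU (tensor A X M) M h (assoc_inv A B X M N (elem_tensor A X S x (mn p q)))) m
          = h (?e x (sm (mn p q) m))"
        using xa pq m right_hom_rsmult[OF hr, of "\<epsilon> (nm q m)" "?e x p"] by simp
    qed (use xa m in simp_all)
    from this[of "\<eta> a"] show "sm (i0 (x \<triangleleft>\<^bsub>X\<^esub> a)) m = h (?e (x \<triangleleft>\<^bsub>X\<^esub> a) m)"
      using xa m by (simp add: i0_def r_unit_elem elem_tensor_balanced)
  qed (use m in simp_all)
  have Phi_i0: "Phi f (sm (i0 x) m) = elem_tensor A S M (i0 x) m" if x: "x \<in> carrier X" and m: "m \<in> carrier M" for x m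
    using x m hc[of "?e x m"] by (simp add: sm_i0 coact_elem[OF X(1)] r_comonad_map_def) (simp add: i0_def)
  have "\<exists>u. u \<in> right_hom A X X \<and> (\<forall>x\<in>carrier X. \<forall>m\<in>carrier M. h (?e (u x) m) = a \<odot>\<^bsub>M\<^esub> h (?e x m))"
    if a: "a \<in> carrier A" for a
  proof -
    let ?l = "\<lambda>m\<in>carrier M. a \<odot>\<^bsub>M\<^esub> m"
    have l: "?l \<in> right_hom B M M"
      using a by (simp add: right_hom_iff restrict_ahom)
    have "Gmap M M ?l t = a \<odot>\<^bsub>GM\<^esub> t" if t: "t \<in> carrier GM" for t
      by (rule Gobj_eqI[OF _ Gmap_ahom[OF _ _ l] tensor_smult_ahom _ t])
         (use a l in \<open>simp_all add: Gmap_elem\<close>)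
    then have l': "?l \<in> r_coalgebra_hom A B M N M (Phi f) M (Phi f)"
      using l a left_hom_smult[OF Phi_left_hom[OF fh]] right_hom_closed[OF Phi_right_hom[OF fh]]
      by (simp add: r_coalgebra_hom_def)
    have h': "hom_inv (tensor A X M) M h \<in> r_coalgebra_hom A B M N M (Phi f) (tensor A X M) (coact X)"
      by (rule r_coalgebra_hom_inv[OF _ _ coact_closed[OF X(1)] h bij]) simp_all
    have k1: "(\<lambda>z\<in>carrier (tensor A X M). ?l (h z)) \<in> r_coalgebra_hom A B M N (tensor A X M) (coact X) M (Phi f)"
      by (rule r_coalgebra_hom_comp[OF _ _ _ coact_closed[OF X(1)] h l']) simp_all
    let ?k = "\<lambda>z\<in>carrier (tensor A X M). hom_inv (tensor A X M) M h ((\<lambda>z\<in>carrier (tensor A X M). ?l (h z)) z)"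
    have k2: "?k \<in> r_coalgebra_hom A B M N (tensor A X M) (coact X) (tensor A X M) (coact X)"
      by (rule r_coalgebra_hom_comp[OF _ _ _ coact_closed[OF X(1)] k1 h']) simp_all
    obtain u where u: "u \<in> right_hom A X X" "FF X X u = ?k"
      using comparison_full[OF inf AU MU comonadic X(1) XU X(1) XU k2] .
    have "h (?e (u x) m) = a \<odot>\<^bsub>M\<^esub> h (?e x m)" if x: "x \<in> carrier X" and m: "m \<in> carrier M" for x m
    proof -
      have e: "?e x m \<in> carrier (tensor A X M)" using x m by simp
      have "?e (u x) m = FF X X u (?e x m)" using x m u(1) by simp
      also have "\<dots> = hom_inv (tensor A X M) M h (a \<odot>\<^bsub>M\<^esub> h (?e x m))"
        unfolding u(2) using x m e by simp
      finally show ?thesis using x m a bij by simp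
    qed
    with u(1) show ?thesis by blast
  qed
  then obtain u where u: "\<And>a. a \<in> carrier A \<Longrightarrow> u a \<in> right_hom A X X"
    and hu: "\<And>a x m. a \<in> carrier A \<Longrightarrow> x \<in> carrier X \<Longrightarrow> m \<in> carrier M \<Longrightarrow>
      h (?e (u a x) m) = a \<odot>\<^bsub>M\<^esub> h (?e x m)"
    by metis
  note uc = right_hom_closed[OF u]
  have e_eq: "?e x m = ?e y m"
    if "x \<in> carrier X" "y \<in> carrier X" "m \<in> carrier M" "h (?e x m) = h (?e y m)" for x y m
    by (rule inj_onD[OF bij_betw_imp_inj_on[OF bij] that(4)]) (use that in simp_all)
  define Xb :: "('a, 'a, 'u) bimod" where
    "Xb = \<lparr>carrier = carrier X, mult = mult X, one = one X, ring.zero = ring.zero X, add = add X,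
       smult = u, rsmult = rsmult X\<rparr>"
  have Xb_simps [simp]: "carrier Xb = carrier X" "add Xb = add X" "ring.zero Xb = ring.zero X"
    "smult Xb = u" "rsmult Xb = rsmult X"
    by (simp_all add: Xb_def)
  have Xb_ab: "abelian_group Xb"
    by (rule abelian_group_cong[OF right_module_abelian[OF Xm]]) simp_all
  have Xb_r: "right_module A Xb"
    using Xm Xb_ab by (simp add: right_module_def)
  have add_hom: "(\<lambda>x\<in>carrier X. v x \<oplus>\<^bsub>X\<^esub> w x) \<in> right_hom A X X"
    if v: "v \<in> right_hom A X X" and w: "w \<in> right_hom A X X" for v w
    unfolding right_hom_iff
  proof (intro conjI ballI)
    show "(\<lambda>x\<in>carrier X. v x \<oplus>\<^bsub>X\<^esub> w x) \<in> ahom X X"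
      by (intro restrict_ahom ahom_plus right_hom_ahom[OF v] right_hom_ahom[OF w]) simp_all
    fix b x assume "b \<in> carrier A" "x \<in> carrier X"
    then show "(\<lambda>x\<in>carrier X. v x \<oplus>\<^bsub>X\<^esub> w x) (x \<triangleleft>\<^bsub>X\<^esub> b) = (\<lambda>x\<in>carrier X. v x \<oplus>\<^bsub>X\<^esub> w x) x \<triangleleft>\<^bsub>X\<^esub> b"
      using ahom_add[OF rsmult_ahom[OF Xm], of b "v x" "w x"]
      by (simp add: right_hom_rsmult[OF v] right_hom_rsmult[OF w] right_hom_closed[OF v] right_hom_closed[OF w])
  qed simp
  have "left_module A Xb"
  proof (rule left_moduleI[OF Xb_ab])
    fix a assume a: "a \<in> carrier A"
    show "(\<lambda>m. a \<odot>\<^bsub>Xb\<^esub> m) \<in> ahom Xb Xb"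
      using right_hom_ahom[OF u[OF a]] by (simp add: ahom_def)
  next
    fix a a' x assume aa: "a \<in> carrier A" "a' \<in> carrier A" and "x \<in> carrier Xb"
    then have x: "x \<in> carrier X" by simp
    have s: "a \<oplus>\<^bsub>A\<^esub> a' \<in> carrier A"
      using aa by (simp add: abelian_groupE(1) nonunital_ring_abelian)
    have "u (a \<oplus>\<^bsub>A\<^esub> a') x = (\<lambda>x\<in>carrier X. u a x \<oplus>\<^bsub>X\<^esub> u a' x) x"
    proof (rule comparison_faithful[OF inf AU MU comonadic X(1) XU X(1) XU u[OF s] add_hom[OF u[OF aa(1)] u[OF aa(2)]] _ x])
      fix x m assume x: "x \<in> carrier X" and m: "m \<in> carrier M"
      have "h (?e (u (a \<oplus>\<^bsub>A\<^esub> a') x) m) = h (?e (u a x) m \<oplus>\<^bsub>tensor A X M\<^esub> ?e (u a' x) m)"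
        using x m aa s uc by (simp add: hu ahom_add[OF ha] smult_add_left[of A])
      then show "?e (u (a \<oplus>\<^bsub>A\<^esub> a') x) m = ?e ((\<lambda>x\<in>carrier X. u a x \<oplus>\<^bsub>X\<^esub> u a' x) x) m"
        using x m aa s uc abelian_groupE(1)[OF right_module_abelian[OF Xm]]
        by (intro e_eq) (simp_all add: elem_tensor_add_left)
    qed
    then show "(a \<oplus>\<^bsub>A\<^esub> a') \<odot>\<^bsub>Xb\<^esub> x = a \<odot>\<^bsub>Xb\<^esub> x \<oplus>\<^bsub>Xb\<^esub> a' \<odot>\<^bsub>Xb\<^esub> x"
      using x by simp
    have s: "a \<otimes>\<^bsub>A\<^esub> a' \<in> carrier A" using aa by simp
    have "u (a \<otimes>\<^bsub>A\<^esub> a') x = (\<lambda>x\<in>carrier X. u a (u a' x)) x"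
    proof (rule comparison_faithful[OF inf AU MU comonadic X(1) XU X(1) XU u[OF s] right_hom_comp[OF u[OF aa(2)] u[OF aa(1)] Xm] _ x])
      fix x m assume x: "x \<in> carrier X" and m: "m \<in> carrier M"
      show "?e (u (a \<otimes>\<^bsub>A\<^esub> a') x) m = ?e ((\<lambda>x\<in>carrier X. u a (u a' x)) x) m"
        using x m aa s uc by (intro e_eq) (simp_all add: hu smult_smult[of A])
    qed
    then show "(a \<otimes>\<^bsub>A\<^esub> a') \<odot>\<^bsub>Xb\<^esub> x = a \<odot>\<^bsub>Xb\<^esub> (a' \<odot>\<^bsub>Xb\<^esub> x)"
      using x by simp
  qed
  then have Xb: "bimodule A A Xb"
    using Xb_r right_hom_rsmult[OF u] by (simp add: bimodule_def)
  note [simp] = Xb Xb_r bimodule_left[OF Xb]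
  have idX: "ident X \<in> right_hom A X Xb" "ident X \<in> right_hom A Xb X"
    using ident_right_hom[OF Xm] by (simp_all add: right_hom_iff ahom_def)
  have Xb_firm: "firm_right A Xb"
    by (rule firm_right_iso[OF X(1) Xb_r _ idX(1)]) (simp_all add: bij_betw_id[unfolded id_def])
  have i0_u: "i0 (u a x) = a \<odot>\<^bsub>S\<^esub> i0 x" if a: "a \<in> carrier A" and x: "x \<in> carrier X" for a x
  proof -
    have v: "(\<lambda>x\<in>carrier X. i0 (u a x)) \<in> right_hom A X S" by (rule right_hom_comp[OF u[OF a] i0 Xm])
    have w: "(\<lambda>x\<in>carrier X. a \<odot>\<^bsub>S\<^esub> i0 x) \<in> right_hom A X S"
      unfolding right_hom_iff
    proof (intro conjI ballI)
      show "(\<lambda>x\<in>carrier X. a \<odot>\<^bsub>S\<^esub> i0 x) \<in> ahom X S"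
        using a by (intro restrict_ahom ahom_comp[OF right_hom_ahom[OF i0]]) simp_all
      fix b x assume "b \<in> carrier A" "x \<in> carrier X"
      then show "(\<lambda>x\<in>carrier X. a \<odot>\<^bsub>S\<^esub> i0 x) (x \<triangleleft>\<^bsub>X\<^esub> b) = (\<lambda>x\<in>carrier X. a \<odot>\<^bsub>S\<^esub> i0 x) x \<triangleleft>\<^bsub>S\<^esub> b"
        using a bimodule_commute[of A A S a "i0 x" b] by (simp add: right_hom_rsmult[OF i0])
    qed simp
    have "(\<lambda>x\<in>carrier X. i0 (u a x)) x = (\<lambda>x\<in>carrier X. a \<odot>\<^bsub>S\<^esub> i0 x) x"
      by (rule eq_of_sm_eq[OF X(1) v w _ x]) (use a in \<open>simp add: sm_i0 sm_smult hu uc\<close>)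
    then show ?thesis using x by simp
  qed
  have i0b: "i0 \<in> bimod_hom A A Xb S"
    using i0 by (simp add: bimod_hom_iff left_hom_iff right_hom_iff i0_u ahom_def)
  let ?I = "tensor A (regular A) Xb"
  have lb: "lact A Xb \<in> bimod_hom A A ?I Xb"
    by (simp add: bimod_hom_iff lact_left_hom lact_right_hom)
  define i where "i = (\<lambda>z\<in>carrier ?I. i0 (lact A Xb z))"
  have I: "firm_bimodule A A ?I"
    unfolding firm_bimodule_def
    using firm_left_tensor[OF firm_ring_left[OF firm_A], of A Xb] firm_right_tensor[OF Xb_firm, of A "regular A"]
    by simp
  have i: "i \<in> bimod_hom A A ?I S"
    unfolding i_def by (rule bimod_hom_comp[OF lb i0b]) simp
  note [simp] = I_rules[OF I i] xi_elem[OF I i]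
  note [simp] = idX
  define hb where "hb = (\<lambda>z\<in>carrier (tensor A Xb M). h (tensor_map A Xb M X M (ident X) (ident M) z))"
  have hb_elem: "hb (elem_tensor A Xb M x m) = h (?e x m)" if "x \<in> carrier X" "m \<in> carrier M" for x m
    using that by (simp add: hb_def)
  have hba: "hb \<in> ahom (tensor A Xb M) M"
    unfolding hb_def by (intro restrict_ahom ahom_comp[OF tensor_map_ahom ha]) simp_all
  have hb: "hb \<in> left_hom A (tensor A Xb M) M"
    unfolding left_hom_iff
  proof (intro conjI ballI hba)
    fix a z assume a: "a \<in> carrier A" and z: "z \<in> carrier (tensor A Xb M)"
    show "hb (a \<odot>\<^bsub>tensor A Xb M\<^esub> z) = a \<odot>\<^bsub>M\<^esub> hb z"
      by (rule tensor_eqI[OF _ _ ahom_comp[OF tensor_smult_ahom hba] ahom_comp[OF hba smult_ahom] _ z])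
         (use a uc in \<open>simp_all add: hu hb_elem\<close>)
  qed (simp add: hb_def)
  have hb_bij: "bij_betw hb (carrier (tensor A Xb M)) (carrier M)"
  proof -
    have b: "bij_betw (\<lambda>z. h (tensor_map A Xb M X M (ident X) (ident M) z)) (carrier (tensor A Xb M)) (carrier M)"
      by (rule bij_betw_trans[OF tensor_map_bij bij, unfolded comp_def])
         (simp_all add: bij_betw_id[unfolded id_def])
    show ?thesis by (rule iffD1[OF bij_betw_cong b]) (simp add: hb_def)
  qed
  note [simp] = hb hb_bij
  have "bij_betw (\<lambda>t. lact A M (tensor_map A (regular A) (tensor A Xb M) (regular A) M (ident (regular A)) hb
      (assoc A A (regular A) Xb M t))) (carrier (tensor A ?I M)) (carrier M)" (is "bij_betw ?g _ _")
    by (rule bij_betw_trans[OF bij_betw_trans[OF assoc_bij tensor_map_bij] firm_left_bij, unfolded comp_def])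
       (simp_all add: bij_betw_id[unfolded id_def])
  moreover have "?g t = xi ?I i t" if t: "t \<in> carrier (tensor A ?I M)" for t
  proof (rule tensor3_eqI_left[OF _ _ _ _ ahom_comp[OF assoc_ahom ahom_comp[OF tensor_map_ahom lact_ahom]] xi_ahom[OF I i] _ t])
    fix a x m assume axm: "a \<in> carrier (regular A)" "x \<in> carrier Xb" "m \<in> carrier M"
    have "i (elem_tensor A (regular A) Xb a x) = i0 (u a x)"
      using axm by (simp add: i_def)
    then show "?g (elem_tensor A ?I M (elem_tensor A (regular A) Xb a x) m)
        = xi ?I i (elem_tensor A ?I M (elem_tensor A (regular A) Xb a x) m)"
      using axm uc by (simp add: sm_i0 hu hb_elem)
  qed simp_all
  ultimately have "bij_betw (xi ?I i) (carrier (tensor A ?I M)) (carrier M)"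
    using bij_betw_cong[of "carrier (tensor A ?I M)" ?g "xi ?I i"] by blast
  then have ip: "inv_pair ?I i" using I i by (simp add: inv_pair_def)
  have "Phi f (sm (i y) m) = elem_tensor A S M (i y) m" if "y \<in> carrier ?I" "m \<in> carrier M" for y m
    using that Phi_i0[of "lact A Xb y" m] ahom_closed[OF lact_ahom[of A Xb], of y] by (simp add: i_def)
  then have rep: "represents f ?I i" by (intro represents_of_Phi[OF I i fh])
  have "carrier ?I \<lesssim> U"
    using XU AU by (intro tensor_lepoll[OF inf]) simp_all
  from inv_pair_copy[OF ip this] obtain I' :: "('a, 'a, 'u) bimod" and i' where
    "carrier I' \<subseteq> U" "inv_pair I' i'" "i' ` carrier I' = i ` carrier ?I" .
  then show ?thesis using that[of I' i'] rep by (simp add: represents_iff_rep_set)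
qed

theorem comonadic_reconstructs: "reconstructs U"
  unfolding reconstructs_def
proof (intro conjI allI impI ballI)
  fix I :: "('a, 'a, 'u) bimod" and i assume "inv_pair I i \<and> carrier I \<subseteq> U"
  then show "firm_mono U A I i" using comonadic_firm_mono[of I i] by simp
next
  fix I I' :: "('a, 'a, 'u) bimod" and i i' f
  assume "f \<in> carrier endos \<and> inv_pair I i \<and> carrier I \<subseteq> U \<and> inv_pair I' i' \<and> carrier I' \<subseteq> U
    \<and> represents f I i \<and> represents f I' i'"
  then show "i ` carrier I \<subseteq> i' ` carrier I'"
    using comonadic_image_subset[of f I i I' i'] by simp
next
  fix f assume "f \<in> carrier endos"
  then show "\<exists>(I :: ('a, 'a, 'u) bimod) i. inv_pair I i \<and> carrier I \<subseteq> U \<and> represents f I i"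
    using comonadic_exists[of f] by metis
qed

end

end

section \<open>Opposite rings and bimodules\<close>

definition opp_ring :: "'a ring \<Rightarrow> 'a ring" where
  "opp_ring R = \<lparr>carrier = carrier R, mult = (\<lambda>x y. y \<otimes>\<^bsub>R\<^esub> x), one = one R, ring.zero = ring.zero R, add = add R\<rparr>"

definition opp_mod :: "('a, 'b, 'm) bimod \<Rightarrow> ('b, 'a, 'm) bimod" where
  "opp_mod M = \<lparr>carrier = carrier M, mult = (\<lambda>x y. y \<otimes>\<^bsub>M\<^esub> x), one = one M, ring.zero = ring.zero M, add = add M,
     smult = (\<lambda>b m. m \<triangleleft>\<^bsub>M\<^esub> b), rsmult = (\<lambda>m a. a \<odot>\<^bsub>M\<^esub> m)\<rparr>"

lemma opp_ring_simps [simp]: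
  "carrier (opp_ring R) = carrier R" "add (opp_ring R) = add R" "ring.zero (opp_ring R) = ring.zero R"
  "x \<otimes>\<^bsub>opp_ring R\<^esub> y = y \<otimes>\<^bsub>R\<^esub> x" "opp_ring (opp_ring R) = R"
  by (simp_all add: opp_ring_def)

lemma opp_mod_simps [simp]:
  "carrier (opp_mod M) = carrier M" "add (opp_mod M) = add M" "ring.zero (opp_mod M) = ring.zero M"
  "b \<odot>\<^bsub>opp_mod M\<^esub> m = m \<triangleleft>\<^bsub>M\<^esub> b" "m \<triangleleft>\<^bsub>opp_mod M\<^esub> a = a \<odot>\<^bsub>M\<^esub> m" "opp_mod (opp_mod M) = M"
  "opp_mod (regular R) = regular (opp_ring R)"
  by (simp_all add: opp_mod_def regular_def opp_ring_def)

lemma abelian_group_opp [simp]: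
  "abelian_group (opp_ring R) = abelian_group R" "abelian_group (opp_mod M) = abelian_group M"
  using abelian_group_cong[of R "opp_ring R"] abelian_group_cong[of "opp_ring R" R]
    abelian_group_cong[of M "opp_mod M"] abelian_group_cong[of "opp_mod M" M] by auto

lemma nonunital_ring_opp [simp]: "nonunital_ring (opp_ring R) = nonunital_ring R"
  unfolding nonunital_ring_def by (auto simp del: opp_ring_simps(5))

lemma module_opp [simp]:
  "left_module (opp_ring R) (opp_mod M) = right_module R M"
  "right_module (opp_ring R) (opp_mod N) = left_module R N"
  unfolding left_module_def right_module_def by auto

lemma bimodule_opp [simp]: "bimodule (opp_ring B) (opp_ring A) (opp_mod M) = bimodule A B M"
  unfolding bimodule_def by auto

lemma hom_opp [simp]:
  "ahom (opp_mod M) X = ahom M X" "ahom Y (opp_mod N) = ahom Y N"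
  "left_hom (opp_ring R) (opp_mod M) (opp_mod N) = right_hom R M N"
  "right_hom (opp_ring R) (opp_mod M') (opp_mod N') = left_hom R M' N'"
  by (auto simp: ahom_def left_hom_iff right_hom_iff)

lemma bimod_hom_opp [simp]:
  "bimod_hom (opp_ring B) (opp_ring A) (opp_mod M) (opp_mod N) = bimod_hom A B M N"
  by (auto simp: bimod_hom_iff)

definition swap :: "'c ring \<Rightarrow> ('a, 'c, 'm) bimod \<Rightarrow> ('c, 'b, 'n) bimod \<Rightarrow> ('m, 'n) tens \<Rightarrow> ('n, 'm) tens" where
  "swap C M N = (\<lambda>t\<in>carrier (tensor C M N). tensor_lift (tensor (opp_ring C) (opp_mod N) (opp_mod M))
     (\<lambda>m n. elem_tensor (opp_ring C) (opp_mod N) (opp_mod M) n m) t)"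

context
  fixes C :: "'c ring" and M :: "('a, 'c, 'm) bimod" and N :: "('c, 'b, 'n) bimod"
  assumes M: "right_module C M" and N: "left_module C N"
begin

private abbreviation (input) "T \<equiv> tensor C M N"
private abbreviation (input) "T' \<equiv> tensor (opp_ring C) (opp_mod N) (opp_mod M)"

lemma swap_balanced: "balanced C M N T' (\<lambda>m n. elem_tensor (opp_ring C) (opp_mod N) (opp_mod M) n m)"
proof (rule balancedI)
  fix n assume "n \<in> carrier N"
  then show "(\<lambda>m. elem_tensor (opp_ring C) (opp_mod N) (opp_mod M) n m) \<in> ahom M T'"
    using elem_tensor_ahom_right[of "opp_ring C" "opp_mod N" "opp_mod M" n] M N by simp
next
  fix m assume "m \<in> carrier M"
  then show "(\<lambda>n. elem_tensor (opp_ring C) (opp_mod N) (opp_mod M) n m) \<in> ahom N T'"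
    using elem_tensor_ahom_left[of "opp_ring C" "opp_mod N" "opp_mod M" m] M N by simp
next
  fix m c n assume "m \<in> carrier M" "c \<in> carrier C" "n \<in> carrier N"
  then show "elem_tensor (opp_ring C) (opp_mod N) (opp_mod M) n (m \<triangleleft>\<^bsub>M\<^esub> c)
      = elem_tensor (opp_ring C) (opp_mod N) (opp_mod M) (c \<odot>\<^bsub>N\<^esub> n) m"
    using elem_tensor_balanced[of "opp_ring C" "opp_mod N" "opp_mod M" n c m] M N by simp
qed

lemma swap_elem: "m \<in> carrier M \<Longrightarrow> n \<in> carrier N \<Longrightarrow>
    swap C M N (elem_tensor C M N m n) = elem_tensor (opp_ring C) (opp_mod N) (opp_mod M) n m"
  using M N by (simp add: swap_def tensor_lift_elem[OF _ _ _ swap_balanced])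

lemma swap_ahom: "swap C M N \<in> ahom T T'"
  unfolding swap_def using M N by (intro restrict_ahom tensor_lift_ahom swap_balanced) simp_all

lemma swap_closed: "t \<in> carrier T \<Longrightarrow> swap C M N t \<in> carrier T'"
  by (rule ahom_closed[OF swap_ahom])

end

lemma swap_swap:
  assumes "right_module C M" "left_module C N" "t \<in> carrier (tensor C M N)"
  shows "swap (opp_ring C) (opp_mod N) (opp_mod M) (swap C M N t) = t"
proof -
  have a: "swap (opp_ring C) (opp_mod N) (opp_mod M)
      \<in> ahom (tensor (opp_ring C) (opp_mod N) (opp_mod M)) (tensor C M N)"
    using swap_ahom[of "opp_ring C" "opp_mod N" "opp_mod M"] assms by simp
  have e: "swap (opp_ring C) (opp_mod N) (opp_mod M) (elem_tensor (opp_ring C) (opp_mod N) (opp_mod M) n m)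
      = elem_tensor C M N m n" if "m \<in> carrier M" "n \<in> carrier N" for m n
    using swap_elem[of "opp_ring C" "opp_mod N" "opp_mod M" n m] assms that by simp
  show ?thesis
    by (rule tensor_eqI[OF assms(1,2) ahom_comp[OF swap_ahom[OF assms(1,2)] a] ahom_ident _ assms(3)])
       (simp add: swap_elem[OF assms(1,2)] e)
qed

lemma swap_bij:
  assumes "right_module C M" "left_module C N"
  shows "bij_betw (swap C M N) (carrier (tensor C M N)) (carrier (tensor (opp_ring C) (opp_mod N) (opp_mod M)))"
proof (rule bij_betw_byWitness[where f' = "swap (opp_ring C) (opp_mod N) (opp_mod M)"])
  show "\<forall>t\<in>carrier (tensor (opp_ring C) (opp_mod N) (opp_mod M)).
      swap C M N (swap (opp_ring C) (opp_mod N) (opp_mod M) t) = t"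
    using swap_swap[of "opp_ring C" "opp_mod N" "opp_mod M"] assms by simp
  show "swap (opp_ring C) (opp_mod N) (opp_mod M) ` carrier (tensor (opp_ring C) (opp_mod N) (opp_mod M))
      \<subseteq> carrier (tensor C M N)"
    using swap_closed[of "opp_ring C" "opp_mod N" "opp_mod M"] assms by auto
qed (use swap_swap[OF assms] swap_closed[OF assms] in auto)

lemma swap_left_hom:
  assumes "bimodule A C M" "left_module C N" "nonunital_ring A"
  shows "swap C M N \<in> left_hom A (tensor C M N) (opp_mod (tensor (opp_ring C) (opp_mod N) (opp_mod M)))"
  unfolding left_hom_iff
proof (intro conjI ballI)
  note r = bimodule_right[OF assms(1)]
  let ?T = "tensor C M N" and ?T' = "tensor (opp_ring C) (opp_mod N) (opp_mod M)"
  show "swap C M N \<in> ahom ?T (opp_mod ?T')" using swap_ahom[OF r assms(2)] by simp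
  fix a t assume a: "a \<in> carrier A" and t: "t \<in> carrier ?T"
  have b: "(\<lambda>t. t \<triangleleft>\<^bsub>?T'\<^esub> a) \<in> ahom ?T' ?T'"
    using tensor_rsmult_ahom[of "opp_ring C" "opp_mod N" "opp_ring A" "opp_mod M" a] assms a by simp
  have "swap C M N (a \<odot>\<^bsub>?T\<^esub> t) = swap C M N t \<triangleleft>\<^bsub>?T'\<^esub> a"
  proof (rule tensor_eqI[OF r assms(2) ahom_comp[OF tensor_smult_ahom[OF assms(1,2) a] swap_ahom[OF r assms(2)]]
        ahom_comp[OF swap_ahom[OF r assms(2)] b] _ t])
    fix m n assume mn: "m \<in> carrier M" "n \<in> carrier N"
    then have am: "a \<odot>\<^bsub>M\<^esub> m \<in> carrier M" using smult_closed[OF bimodule_left[OF assms(1)]] a by simp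
    show "swap C M N (a \<odot>\<^bsub>?T\<^esub> elem_tensor C M N m n) = swap C M N (elem_tensor C M N m n) \<triangleleft>\<^bsub>?T'\<^esub> a"
      using tensor_smult_elem[OF assms(1,2) a mn] swap_elem[OF r assms(2) am mn(2)] swap_elem[OF r assms(2) mn]
        tensor_rsmult_elem[of "opp_ring C" "opp_mod N" "opp_ring A" "opp_mod M" a n m] assms a mn r by simp
  qed
  then show "swap C M N (a \<odot>\<^bsub>?T\<^esub> t) = a \<odot>\<^bsub>opp_mod ?T'\<^esub> swap C M N t" by simp
qed (simp add: swap_def)

lemma swap_right_hom:
  assumes "right_module C M" "bimodule C B N" "nonunital_ring B"
  shows "swap C M N \<in> right_hom B (tensor C M N) (opp_mod (tensor (opp_ring C) (opp_mod N) (opp_mod M)))"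
  unfolding right_hom_iff
proof (intro conjI ballI)
  note l = bimodule_left[OF assms(2)]
  let ?T = "tensor C M N" and ?T' = "tensor (opp_ring C) (opp_mod N) (opp_mod M)"
  show "swap C M N \<in> ahom ?T (opp_mod ?T')" using swap_ahom[OF assms(1) l] by simp
  fix b t assume b: "b \<in> carrier B" and t: "t \<in> carrier ?T"
  have s: "(\<lambda>t. b \<odot>\<^bsub>?T'\<^esub> t) \<in> ahom ?T' ?T'"
    using tensor_smult_ahom[of "opp_ring B" "opp_ring C" "opp_mod N" "opp_mod M" b] assms b by simp
  have "swap C M N (t \<triangleleft>\<^bsub>?T\<^esub> b) = b \<odot>\<^bsub>?T'\<^esub> swap C M N t"
  proof (rule tensor_eqI[OF assms(1) l ahom_comp[OF tensor_rsmult_ahom[OF assms(1,2) b] swap_ahom[OF assms(1) l]]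
        ahom_comp[OF swap_ahom[OF assms(1) l] s] _ t])
    fix m n assume mn: "m \<in> carrier M" "n \<in> carrier N"
    then have nb: "n \<triangleleft>\<^bsub>N\<^esub> b \<in> carrier N" using rsmult_closed[OF bimodule_right[OF assms(2)]] b by simp
    show "swap C M N (elem_tensor C M N m n \<triangleleft>\<^bsub>?T\<^esub> b) = b \<odot>\<^bsub>?T'\<^esub> swap C M N (elem_tensor C M N m n)"
      using tensor_rsmult_elem[OF assms(1,2) b mn] swap_elem[OF assms(1) l mn(1) nb] swap_elem[OF assms(1) l mn]
        tensor_smult_elem[of "opp_ring B" "opp_ring C" "opp_mod N" "opp_mod M" b n m] assms b mn l by simp
  qed
  then show "swap C M N (t \<triangleleft>\<^bsub>?T\<^esub> b) = swap C M N t \<triangleleft>\<^bsub>opp_mod ?T'\<^esub> b" by simp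
qed (simp add: swap_def)

lemma swap_bimod_hom:
  assumes "bimodule A C M" "bimodule C B N" "nonunital_ring A" "nonunital_ring B"
  shows "swap C M N \<in> bimod_hom A B (tensor C M N) (opp_mod (tensor (opp_ring C) (opp_mod N) (opp_mod M)))"
  unfolding bimod_hom_iff
  using swap_left_hom[OF assms(1) bimodule_left[OF assms(2)] assms(3)]
    swap_right_hom[OF bimodule_right[OF assms(1)] assms(2,4)] by simp

lemma firm_right_opp:
  assumes "firm_left A M" "nonunital_ring A"
  shows "firm_right (opp_ring A) (opp_mod M)"
proof -
  note l = firm_left_module[OF assms(1)]
  let ?A = "opp_ring A" and ?M = "opp_mod M"
  have s: "swap ?A ?M (regular ?A) \<in> ahom (tensor ?A ?M (regular ?A)) (tensor A (regular A) M)"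
    and sb: "bij_betw (swap ?A ?M (regular ?A)) (carrier (tensor ?A ?M (regular ?A))) (carrier (tensor A (regular A) M))"
    using swap_ahom[of ?A ?M "regular ?A"] swap_bij[of ?A ?M "regular ?A"] assms(2) l by simp_all
  have r: "ract ?A ?M \<in> ahom (tensor ?A ?M (regular ?A)) M"
    using ract_ahom[of ?A ?M] assms(2) l by simp
  have "lact A M (swap ?A ?M (regular ?A) t) = ract ?A ?M t" if t: "t \<in> carrier (tensor ?A ?M (regular ?A))" for t
  proof (rule tensor_eqI[OF _ _ ahom_comp[OF s lact_ahom[OF l assms(2)]] r _ t])
    fix m a assume "m \<in> carrier ?M" "a \<in> carrier (regular ?A)"
    then show "lact A M (swap ?A ?M (regular ?A) (elem_tensor ?A ?M (regular ?A) m a))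
        = ract ?A ?M (elem_tensor ?A ?M (regular ?A) m a)"
      using swap_elem[of ?A ?M "regular ?A" m a] ract_elem[of ?A ?M a m] assms(2) l by simp
  qed (use assms(2) l in simp_all)
  then have "bij_betw (ract ?A ?M) (carrier (tensor ?A ?M (regular ?A))) (carrier M)"
    using iffD1[OF bij_betw_cong bij_betw_trans[OF sb firm_left_bij[OF assms(1)]]] by (simp add: comp_def)
  then show ?thesis using l by (simp add: firm_right_def)
qed

lemma firm_left_opp:
  assumes "firm_right A M" "nonunital_ring A"
  shows "firm_left (opp_ring A) (opp_mod M)"
proof -
  note l = firm_right_module[OF assms(1)]
  let ?A = "opp_ring A" and ?M = "opp_mod M"
  have s: "swap ?A (regular ?A) ?M \<in> ahom (tensor ?A (regular ?A) ?M) (tensor A M (regular A))"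
    and sb: "bij_betw (swap ?A (regular ?A) ?M) (carrier (tensor ?A (regular ?A) ?M)) (carrier (tensor A M (regular A)))"
    using swap_ahom[of ?A "regular ?A" ?M] swap_bij[of ?A "regular ?A" ?M] assms(2) l by simp_all
  have r: "lact ?A ?M \<in> ahom (tensor ?A (regular ?A) ?M) M"
    using lact_ahom[of ?A ?M] assms(2) l by simp
  have "ract A M (swap ?A (regular ?A) ?M t) = lact ?A ?M t" if t: "t \<in> carrier (tensor ?A (regular ?A) ?M)" for t
  proof (rule tensor_eqI[OF _ _ ahom_comp[OF s ract_ahom[OF l assms(2)]] r _ t])
    fix m a assume "m \<in> carrier ?M" "a \<in> carrier (regular ?A)"
    then show "ract A M (swap ?A (regular ?A) ?M (elem_tensor ?A (regular ?A) ?M a m))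
        = lact ?A ?M (elem_tensor ?A (regular ?A) ?M a m)"
      using swap_elem[of ?A "regular ?A" ?M a m] lact_elem[of ?A ?M a m] assms(2) l by simp
  qed (use assms(2) l in simp_all)
  then have "bij_betw (lact ?A ?M) (carrier (tensor ?A (regular ?A) ?M)) (carrier M)"
    using iffD1[OF bij_betw_cong bij_betw_trans[OF sb firm_right_bij[OF assms(1)]]] by (simp add: comp_def)
  then show ?thesis using l by (simp add: firm_left_def)
qed

lemma firm_bimodule_opp:
  "firm_bimodule A B M \<Longrightarrow> nonunital_ring A \<Longrightarrow> nonunital_ring B \<Longrightarrow>
     firm_bimodule (opp_ring B) (opp_ring A) (opp_mod M)"
  by (simp add: firm_bimodule_def firm_left_opp firm_right_opp)

lemma firm_ring_opp: "firm_ring A \<Longrightarrow> firm_ring (opp_ring A)"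
  using firm_right_opp[OF firm_ring_left[of A]] by (simp add: firm_ring_def)

section \<open>The opposite adjunction\<close>

context firm_adjunction
begin

abbreviation Ao where "Ao \<equiv> opp_ring A"
abbreviation Bo where "Bo \<equiv> opp_ring B"
abbreviation Mo where "Mo \<equiv> opp_mod M"
abbreviation No where "No \<equiv> opp_mod N"

definition eta_op where "eta_op = (\<lambda>a\<in>carrier A. swap B M N (\<eta> a))"
definition eps_op where
  "eps_op = (\<lambda>c\<in>carrier (tensor Ao Mo No).
     \<epsilon> (swap Ao Mo No c))"

abbreviation S' where "S' \<equiv> tensor Bo No Mo"
abbreviation C' where "C' \<equiv> tensor Ao Mo No"

lemma swapS_rules:
  "swap B M N \<in> ahom S S'" "\<And>s. s \<in> carrier S \<Longrightarrow> swap B M N s \<in> carrier S'"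
  "bij_betw (swap B M N) (carrier S) (carrier S')"
  "swap B M N \<in> bimod_hom A A S (opp_mod S')"
  using swap_ahom[of B M N] swap_closed[of B M N] swap_bij[of B M N] swap_bimod_hom[of A B M A N] by simp_all

lemma swapC_rules:
  "swap A N M \<in> ahom C C'" "\<And>c. c \<in> carrier C \<Longrightarrow> swap A N M c \<in> carrier C'"
  "bij_betw (swap A N M) (carrier C) (carrier C')"
  "swap A N M \<in> bimod_hom B B C (opp_mod C')"
  using swap_ahom[of A N M] swap_closed[of A N M] swap_bij[of A N M] swap_bimod_hom[of B A N B M] by simp_all

lemma swapC'_rules:
  "swap Ao Mo No \<in> ahom C' C"
  "\<And>c. c \<in> carrier C' \<Longrightarrow> swap Ao Mo No c \<in> carrier C"
  "bij_betw (swap Ao Mo No) (carrier C') (carrier C)"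
  "swap Ao Mo No \<in> bimod_hom Bo Bo C' (opp_mod C)"
  using swap_ahom[of Ao Mo No] swap_closed[of Ao Mo No]
    swap_bij[of Ao Mo No]
    swap_bimod_hom[of Bo Ao Mo Bo No] by simp_all

lemma swap_mn: "m \<in> carrier M \<Longrightarrow> n \<in> carrier N \<Longrightarrow>
    swap B M N (mn m n) = elem_tensor Bo No Mo n m"
  by (simp add: mn_def swap_elem)

lemma swap_nm: "m \<in> carrier M \<Longrightarrow> n \<in> carrier N \<Longrightarrow>
    swap A N M (nm n m) = elem_tensor Ao Mo No m n"
  by (simp add: nm_def swap_elem)

lemma swap_nm': "m \<in> carrier M \<Longrightarrow> n \<in> carrier N \<Longrightarrow>
    swap Ao Mo No (elem_tensor Ao Mo No m n) = nm n m"
  using swap_elem[of Ao Mo No m n] by (simp add: nm_def)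

lemma eps_op_elem: "m \<in> carrier M \<Longrightarrow> n \<in> carrier N \<Longrightarrow>
    eps_op (elem_tensor Ao Mo No m n) = \<epsilon> (nm n m)"
  by (simp add: eps_op_def swap_nm')

lemma eta_op_bimod_hom: "eta_op \<in> bimod_hom Ao Ao (regular Ao) S'"
proof -
  have "(\<lambda>a\<in>carrier (regular A). swap B M N (\<eta> a)) \<in> bimod_hom A A (regular A) (opp_mod S')"
    by (rule bimod_hom_comp[OF eta_bimod_hom swapS_rules(4)]) simp
  then have "eta_op \<in> bimod_hom A A (regular A) (opp_mod S')" by (simp add: eta_op_def)
  then show ?thesis
    using bimod_hom_opp[of Ao Ao "regular Ao" S'] opp_mod_simps(7)[of Ao] by simp
qed

lemma eps_op_bimod_hom: "eps_op \<in> bimod_hom Bo Bo C' (regular Bo)"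
proof -
  have "\<epsilon> \<in> bimod_hom Bo Bo (opp_mod C) (opp_mod (regular B))"
    unfolding bimod_hom_opp by simp
  from bimod_hom_comp[OF swapC'_rules(4) this] show ?thesis by (simp add: eps_op_def)
qed

lemma opp_adjunction: "firm_adjunction Ao Bo No Mo eta_op eps_op"
proof -
  let ?A = Ao and ?B = Bo and ?M = Mo and ?N = No
  have fA: "firm_ring ?A" and fB: "firm_ring ?B" using firm_A firm_B by (simp_all add: firm_ring_opp)
  have fN: "firm_bimodule ?A ?B ?N" and fM: "firm_bimodule ?B ?A ?M"
    using firm_M firm_N by (simp_all add: firm_bimodule_opp)
  note [simp] = firm_bimoduleD[OF fN] firm_bimoduleD[OF fM]
  note e = eps_op_bimod_hom and h = eta_op_bimod_hom
  have rc: "r_counit ?A ?B ?N ?M eps_op ?N \<in> ahom (tensor ?A S' ?N) N"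
    using right_hom_ahom[OF r_counit_right_hom[of ?B ?N ?A ?M ?N eps_op]] e by simp
  have lc: "l_counit ?A ?B ?N ?M eps_op ?M \<in> ahom (tensor ?A ?M S') M"
    using left_hom_ahom[OF l_counit_left_hom[of ?B ?M ?A ?M ?N eps_op]] e by simp
  have S'm: "left_module ?A S'" "right_module ?A S'" "bimodule ?A ?A S'"
    by (rule tensor_left_module tensor_right_module tensor_bimodule; simp)+
  have 1: "r_counit ?A ?B ?N ?M eps_op ?N (elem_tensor ?A S' ?N (swap B M N s) n) = ns n s"
    if s: "s \<in> carrier S" and n: "n \<in> carrier N" for s n
  proof (rule S_eqI[OF ahom_comp[OF swapS_rules(1) ahom_comp[OF elem_tensor_ahom_left rc]] ns_ahom_right _ s])
    fix p q assume pq: "p \<in> carrier M" "q \<in> carrier N"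
    then show "r_counit ?A ?B ?N ?M eps_op ?N (elem_tensor ?A S' ?N (swap B M N (mn p q)) n) = ns n (mn p q)"
      using r_counit_elem[of ?B ?N ?A ?M ?N eps_op q p n] e n by (simp add: swap_mn eps_op_elem)
  qed (use n S'm in simp_all)
  have 2: "l_counit ?A ?B ?N ?M eps_op ?M (elem_tensor ?A ?M S' m (swap B M N s)) = sm s m"
    if s: "s \<in> carrier S" and m: "m \<in> carrier M" for s m
  proof (rule S_eqI[OF ahom_comp[OF swapS_rules(1) ahom_comp[OF elem_tensor_ahom_right lc]] sm_ahom_left _ s])
    fix p q assume pq: "p \<in> carrier M" "q \<in> carrier N"
    then show "l_counit ?A ?B ?N ?M eps_op ?M (elem_tensor ?A ?M S' m (swap B M N (mn p q))) = sm (mn p q) m"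
      using l_counit_elem[of ?B ?M ?A ?M ?N eps_op p m q] e m by (simp add: swap_mn eps_op_elem)
  qed (use m S'm in simp_all)
  have li: "lact_inv ?A ?N \<in> ahom N (tensor ?A (regular ?A) ?N)"
    using left_hom_ahom[OF lact_inv_left_hom[of ?A ?N]] by simp
  have ri: "ract_inv ?A ?M \<in> ahom M (tensor ?A ?M (regular ?A))"
    using right_hom_ahom[OF ract_inv_right_hom[of ?A ?M]] by simp
  have t1: "r_counit ?A ?B ?N ?M eps_op ?N (tensor_map ?A (regular ?A) ?N S' ?N eta_op (ident ?N) (lact_inv ?A ?N n)) = n"
    if n: "n \<in> carrier N" for n
  proof (rule firm_right_eqI[of A N _ N, OF _ _ ahom_comp[OF li ahom_comp[OF tensor_map_ahom rc]] ahom_ident _ n])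
    fix n a assume na: "n \<in> carrier N" "a \<in> carrier A"
    then show "r_counit ?A ?B ?N ?M eps_op ?N (tensor_map ?A (regular ?A) ?N S' ?N eta_op (ident ?N)
        (lact_inv ?A ?N (n \<triangleleft>\<^bsub>N\<^esub> a))) = n \<triangleleft>\<^bsub>N\<^esub> a"
      using lact_inv_smult[of ?A ?N a n] bimod_hom_right[OF h] S'm 1[of "\<eta> a" n]
      by (simp add: eta_op_def)
  qed (use bimod_hom_right[OF h] S'm in simp_all)
  have t2: "l_counit ?A ?B ?N ?M eps_op ?M (tensor_map ?A ?M (regular ?A) ?M S' (ident ?M) eta_op (ract_inv ?A ?M m)) = m"
    if m: "m \<in> carrier M" for m
  proof (rule firm_left_eqI[of A M _ M, OF _ _ ahom_comp[OF ri ahom_comp[OF tensor_map_ahom lc]] ahom_ident _ m])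
    fix a m assume na: "m \<in> carrier M" "a \<in> carrier A"
    then show "l_counit ?A ?B ?N ?M eps_op ?M (tensor_map ?A ?M (regular ?A) ?M S' (ident ?M) eta_op
        (ract_inv ?A ?M (a \<odot>\<^bsub>M\<^esub> m))) = a \<odot>\<^bsub>M\<^esub> m"
      using ract_inv_rsmult[of ?A ?M a m] bimod_hom_left[OF h] S'm 2[of "\<eta> a" m]
      by (simp add: eta_op_def)
  qed (use bimod_hom_left[OF h] S'm in simp_all)
  have "right_adjoint ?A ?B ?N ?M eta_op eps_op"
    unfolding right_adjoint_def using fM h e t1 t2 by simp
  then show ?thesis using fA fB fN by (simp add: firm_adjunction_def)
qed

end

lemma hom_inv_opp [simp]: "hom_inv (opp_mod M) N f = hom_inv M N f" "hom_inv M (opp_mod N) f = hom_inv M N f"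
  by (simp_all add: hom_inv_def)

context firm_adjunction
begin

interpretation op: firm_adjunction Ao Bo No Mo eta_op eps_op
  by (rule opp_adjunction)

abbreviation Lobj where "Lobj Z \<equiv> tensor A N (tensor B M Z)"
abbreviation Lmap where "Lmap \<equiv> l_comonad_map A B M N"
abbreviation Lcoact where "Lcoact Y \<equiv> l_coaction A B M N \<eta> Y"
abbreviation LF where "LF X Y u \<equiv> tensor_map A N X N Y (ident N) u"
abbreviation FX_op where "FX_op X \<equiv> tensor Ao X No"

text \<open>\<open>N \<otimes>\<^sub>A (M \<otimes>\<^sub>B Z) \<cong> (Z \<otimes> M) \<otimes> N\<close> over the opposite rings, comparing the two comonads.\<close>

definition TT where
  "TT Z = (\<lambda>t\<in>carrier (Lobj Z). op.FF (opp_mod (tensor B M Z)) (tensor Bo (opp_mod Z) Mo)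
     (swap B M Z) (swap A N (tensor B M Z) t))"

context
  fixes Z :: "('b, 'c, 'z) bimod"
  assumes Z: "left_module B Z"
begin

lemma swap_MZ: "swap B M Z \<in> right_hom Ao (opp_mod (tensor B M Z)) (tensor Bo (opp_mod Z) Mo)"
proof -
  have "swap B M Z \<in> left_hom A (tensor B M Z) (opp_mod (tensor Bo (opp_mod Z) Mo))"
    using Z by (intro swap_left_hom) simp_all
  then show ?thesis
    using hom_opp(4)[of A "tensor B M Z" "opp_mod (tensor Bo (opp_mod Z) Mo)"] by simp
qed

lemma UZ_modules: "right_module Ao (tensor Bo (opp_mod Z) Mo)"
  "left_module A (tensor B M Z)" "right_module Bo (op.Gobj (opp_mod Z))" "left_module B (Lobj Z)"
  using Z tensor_right_module[of Bo "opp_mod Z" Ao Mo]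
    tensor_right_module[of Ao "tensor Bo (opp_mod Z) Mo" Bo No]
  by simp_all

lemma TT_elem: "n \<in> carrier N \<Longrightarrow> m \<in> carrier M \<Longrightarrow> z \<in> carrier Z \<Longrightarrow>
    TT Z (elem_tensor A N (tensor B M Z) n (elem_tensor B M Z m z))
     = elem_tensor Ao (tensor Bo (opp_mod Z) Mo) No
         (elem_tensor Bo (opp_mod Z) Mo z m) n"
  using swap_MZ UZ_modules Z by (simp add: TT_def swap_elem)

lemma TT_ahom: "TT Z \<in> ahom (Lobj Z) (op.Gobj (opp_mod Z))"
  unfolding TT_def
  by (intro restrict_ahom ahom_comp[OF swap_ahom tensor_map_ahom]) (use swap_MZ UZ_modules Z in simp_all)

lemma TT_bij: "bij_betw (TT Z) (carrier (Lobj Z)) (carrier (op.Gobj (opp_mod Z)))"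
proof -
  have b: "bij_betw (swap A N (tensor B M Z)) (carrier (Lobj Z))
     (carrier (tensor Ao (opp_mod (tensor B M Z)) No))"
    by (rule swap_bij) (use UZ_modules in simp_all)
  have w: "bij_betw (swap B M Z) (carrier (tensor B M Z)) (carrier (tensor Bo (opp_mod Z) Mo))"
    by (rule swap_bij) (use Z in simp_all)
  have "bij_betw (op.FF (opp_mod (tensor B M Z)) (tensor Bo (opp_mod Z) Mo) (swap B M Z))
     (carrier (tensor Ao (opp_mod (tensor B M Z)) No)) (carrier (op.Gobj (opp_mod Z)))"
    by (rule tensor_map_bij) (use UZ_modules swap_MZ w in \<open>simp_all add: bij_betw_id[unfolded id_def]\<close>)
  from bij_betw_trans[OF b this] show ?thesis
    by (rule iffD1[OF bij_betw_cong, rotated]) (simp add: TT_def)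
qed

lemma TT_left_hom: "TT Z \<in> left_hom B (Lobj Z) (opp_mod (op.Gobj (opp_mod Z)))"
  unfolding left_hom_iff
proof (intro conjI ballI)
  note m = UZ_modules
  show "TT Z \<in> ahom (Lobj Z) (opp_mod (op.Gobj (opp_mod Z)))" using TT_ahom by simp
  fix b t assume b: "b \<in> carrier B" and t: "t \<in> carrier (Lobj Z)"
  have r: "(\<lambda>t. t \<triangleleft>\<^bsub>op.Gobj (opp_mod Z)\<^esub> b) \<in> ahom (op.Gobj (opp_mod Z)) (op.Gobj (opp_mod Z))"
    by (rule tensor_rsmult_ahom[where B = Bo]) (use m b in simp_all)
  have "TT Z (b \<odot>\<^bsub>Lobj Z\<^esub> t) = TT Z t \<triangleleft>\<^bsub>op.Gobj (opp_mod Z)\<^esub> b"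
    by (rule tensor3_eqI_right[OF _ _ _ _ ahom_comp[OF tensor_smult_ahom[where A = B] TT_ahom] ahom_comp[OF TT_ahom r] _ t])
       (use m b Z in \<open>simp_all add: TT_elem tensor_rsmult_elem[where B = Bo]\<close>)
  then show "TT Z (b \<odot>\<^bsub>Lobj Z\<^esub> t) = b \<odot>\<^bsub>opp_mod (op.Gobj (opp_mod Z))\<^esub> TT Z t" by simp
qed (simp add: TT_def)

lemma TT_right_hom: "TT Z \<in> right_hom Bo (opp_mod (Lobj Z)) (op.Gobj (opp_mod Z))"
  using TT_left_hom hom_opp(4)[of B "Lobj Z" "opp_mod (op.Gobj (opp_mod Z))"] by simp

lemma TT_closed: "t \<in> carrier (Lobj Z) \<Longrightarrow> TT Z t \<in> carrier (op.Gobj (opp_mod Z))"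
  by (rule ahom_closed[OF TT_ahom])

lemma TT_inj: "s \<in> carrier (Lobj Z) \<Longrightarrow> t \<in> carrier (Lobj Z) \<Longrightarrow> TT Z s = TT Z t \<Longrightarrow> s = t"
  using inj_onD[OF bij_betw_imp_inj_on[OF TT_bij]] by blast

end

lemma Lmap_ahom:
  assumes "left_module B Z" "left_module B Z'" "h \<in> left_hom B Z Z'"
  shows "Lmap Z Z' h \<in> ahom (Lobj Z) (Lobj Z')"
  using assms by (simp add: l_comonad_map_def)

lemma TT_natural:
  assumes "left_module B Z" "left_module B Z'" "h \<in> left_hom B Z Z'" "t \<in> carrier (Lobj Z)"
  shows "TT Z' (Lmap Z Z' h t) = op.Gmap (opp_mod Z) (opp_mod Z') h (TT Z t)"
proof (rule tensor3_eqI_right[OF _ _ _ _ ahom_comp[OF Lmap_ahom[OF assms(1-3)] TT_ahom[OF assms(2)]]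
      ahom_comp[OF TT_ahom[OF assms(1)] op.Gmap_ahom] _ assms(4)])
  fix n m z assume *: "n \<in> carrier N" "m \<in> carrier M" "z \<in> carrier Z"
  have "Lmap Z Z' h (elem_tensor A N (tensor B M Z) n (elem_tensor B M Z m z))
      = elem_tensor A N (tensor B M Z') n (elem_tensor B M Z' m (h z))"
    using * assms by (simp add: l_comonad_map_def)
  then show "TT Z' (Lmap Z Z' h (elem_tensor A N (tensor B M Z) n (elem_tensor B M Z m z)))
      = op.Gmap (opp_mod Z) (opp_mod Z') h (TT Z (elem_tensor A N (tensor B M Z) n (elem_tensor B M Z m z)))"
    using * assms left_hom_closed[OF assms(3)] op.Gmap_elem[of "opp_mod Z" "opp_mod Z'" h z m n]
    by (simp add: TT_elem)
qed (use assms in simp_all)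

lemma l_coalgebra_hom_opp:
  assumes Z: "left_module B Z" "left_module B Z'"
    and \<rho>: "\<And>z. z \<in> carrier Z \<Longrightarrow> \<rho> z \<in> carrier (Lobj Z)"
      "\<And>z. z \<in> carrier Z' \<Longrightarrow> \<rho>' z \<in> carrier (Lobj Z')"
  shows "l_coalgebra_hom A B M N Z \<rho> Z' \<rho>' =
    r_coalgebra_hom Ao Bo No Mo
      (opp_mod Z) (\<lambda>z. TT Z (\<rho> z)) (opp_mod Z') (\<lambda>z. TT Z' (\<rho>' z))"
proof -
  have "\<rho>' (h z) = Lmap Z Z' h (\<rho> z) \<longleftrightarrow> TT Z' (\<rho>' (h z)) = op.Gmap (opp_mod Z) (opp_mod Z') h (TT Z (\<rho> z))"
    if h: "h \<in> left_hom B Z Z'" and z: "z \<in> carrier Z" for h z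
    unfolding TT_natural[OF Z h \<rho>(1)[OF z], symmetric]
    using TT_inj[OF Z(2) \<rho>(2)[OF left_hom_closed[OF h z]] ahom_closed[OF Lmap_ahom[OF Z h] \<rho>(1)[OF z]]] by auto
  then show ?thesis
    by (auto simp: l_coalgebra_hom_def r_coalgebra_hom_def)
qed

context
  fixes Y :: "('a, 'c, 'x) bimod"
  assumes Y: "firm_left A Y"
begin

lemma Y_rules: "left_module A Y" "right_module Ao (opp_mod Y)" "firm_right Ao (opp_mod Y)"
  "left_module B (tensor A N Y)" "right_module Bo (FX_op (opp_mod Y))"
  using firm_left_module[OF Y] firm_right_opp[OF Y]
    tensor_right_module[of Ao "opp_mod Y" Bo No] by simp_all

lemma swapY: "swap A N Y \<in> right_hom Bo (opp_mod (tensor A N Y)) (FX_op (opp_mod Y))"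
  "bij_betw (swap A N Y) (carrier (tensor A N Y)) (carrier (FX_op (opp_mod Y)))"
proof -
  have "swap A N Y \<in> left_hom B (tensor A N Y) (opp_mod (FX_op (opp_mod Y)))"
    using Y_rules by (intro swap_left_hom) simp_all
  then show "swap A N Y \<in> right_hom Bo (opp_mod (tensor A N Y)) (FX_op (opp_mod Y))"
    using hom_opp(4)[of B "tensor A N Y" "opp_mod (FX_op (opp_mod Y))"] by simp
  show "bij_betw (swap A N Y) (carrier (tensor A N Y)) (carrier (FX_op (opp_mod Y)))"
    by (rule swap_bij) (use Y_rules in simp_all)
qed

lemma Lcoact_ahom: "Lcoact Y \<in> ahom (tensor A N Y) (Lobj (tensor A N Y))"
  unfolding l_coaction_def using Y_rules l_unit_left_hom[OF Y] by simp

lemma swap_coact: assumes t: "t \<in> carrier (tensor A N Y)"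
  shows "op.coact (opp_mod Y) (swap A N Y t)
    = op.Gmap (opp_mod (tensor A N Y)) (FX_op (opp_mod Y)) (swap A N Y) (TT (tensor A N Y) (Lcoact Y t))"
proof -
  let ?Z = "tensor A N Y" and ?X = "opp_mod Y"
  let ?G = "op.Gmap (opp_mod ?Z) (FX_op ?X) (swap A N Y)"
  note Ym = Y_rules
  have G: "?G \<in> ahom (op.Gobj (opp_mod ?Z)) (op.Gobj (FX_op ?X))"
    by (rule op.Gmap_ahom) (use Ym swapY in simp_all)
  have co: "op.coact ?X \<in> ahom (FX_op ?X) (op.Gobj (FX_op ?X))"
    by (rule right_hom_ahom[OF op.coact_right_hom[OF Ym(3)]])
  have sw: "swap A N Y \<in> ahom ?Z (FX_op ?X)" using right_hom_ahom[OF swapY(1)] by simp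
  note TTa = TT_ahom[OF Ym(4)]
  show ?thesis
  proof (rule tensor_eqI[OF _ _ ahom_comp[OF sw co] ahom_comp[OF Lcoact_ahom ahom_comp[OF TTa G]] _ t])
    fix n y assume n: "n \<in> carrier N" and y: "y \<in> carrier Y"
    show "op.coact ?X (swap A N Y (elem_tensor A N Y n y)) = ?G (TT ?Z (Lcoact Y (elem_tensor A N Y n y)))"
    proof (rule firm_left_eqI[of A Y _ "op.Gobj (FX_op ?X)", OF _ _ ahom_comp[OF elem_tensor_ahom_right ahom_comp[OF sw co]]
          ahom_comp[OF elem_tensor_ahom_right ahom_comp[OF Lcoact_ahom ahom_comp[OF TTa G]]] _ y])
      fix a y assume ay: "a \<in> carrier A" "y \<in> carrier Y"
      have ayc: "a \<odot>\<^bsub>Y\<^esub> y \<in> carrier Y" using ay Ym by simp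
      have UF: "right_module Ao (tensor Bo (FX_op ?X) Mo)"
        by (rule tensor_right_module) (use Ym in simp_all)
      have as: "assoc_inv Ao Bo ?X No Mo
          \<in> ahom (tensor Ao ?X S') (tensor Bo (FX_op ?X) Mo)"
        by (rule assoc_inv_ahom) (use Ym in simp_all)
      have key: "elem_tensor Ao (tensor Bo (FX_op ?X) Mo) No
          (assoc_inv Ao Bo ?X No Mo
             (elem_tensor Ao ?X S' y (swap B M N s))) n
        = ?G (TT ?Z (elem_tensor A N (tensor B M ?Z) n (assoc B A M N Y (elem_tensor A S Y s y))))"
        if s: "s \<in> carrier S" for s
      proof (rule S_eqI[OF ahom_comp[OF swapS_rules(1) ahom_comp[OF elem_tensor_ahom_right ahom_comp[OF as elem_tensor_ahom_left]]]
            ahom_comp[OF elem_tensor_ahom_left ahom_comp[OF assoc_ahom ahom_comp[OF elem_tensor_ahom_right ahom_comp[OF TTa G]]]] _ s])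
        fix p q assume pq: "p \<in> carrier M" "q \<in> carrier N"
        have 1: "assoc_inv Ao Bo ?X No Mo
             (elem_tensor Ao ?X S' y (swap B M N (mn p q)))
           = elem_tensor Bo (FX_op ?X) Mo (elem_tensor Ao ?X No y q) p"
          unfolding swap_mn[OF pq] by (rule assoc_inv_elem) (use pq ay Ym in simp_all)
        have 2: "assoc B A M N Y (elem_tensor A S Y (mn p q) y) = elem_tensor B M ?Z p (elem_tensor A N Y q y)"
          unfolding mn_def by (rule assoc_elem) (use pq ay Ym in simp_all)
        have 3: "TT ?Z (elem_tensor A N (tensor B M ?Z) n (elem_tensor B M ?Z p (elem_tensor A N Y q y)))
            = elem_tensor Ao (tensor Bo (opp_mod ?Z) Mo) No
              (elem_tensor Bo (opp_mod ?Z) Mo (elem_tensor A N Y q y) p) n"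
          by (rule TT_elem) (use pq ay Ym n in simp_all)
        have 4: "?G (elem_tensor Ao (tensor Bo (opp_mod ?Z) Mo) No
              (elem_tensor Bo (opp_mod ?Z) Mo (elem_tensor A N Y q y) p) n)
            = elem_tensor Ao (tensor Bo (FX_op ?X) Mo) No
              (elem_tensor Bo (FX_op ?X) Mo (swap A N Y (elem_tensor A N Y q y)) p) n"
          by (rule op.Gmap_elem) (use pq ay Ym n swapY in simp_all)
        have 5: "swap A N Y (elem_tensor A N Y q y) = elem_tensor Ao ?X No y q"
          by (rule swap_elem) (use pq ay Ym in simp_all)
        show "elem_tensor Ao (tensor Bo (FX_op ?X) Mo) No
          (assoc_inv Ao Bo ?X No Mo
             (elem_tensor Ao ?X S' y (swap B M N (mn p q)))) n
          = ?G (TT ?Z (elem_tensor A N (tensor B M ?Z) n (assoc B A M N Y (elem_tensor A S Y (mn p q) y))))"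
          unfolding 1 2 3 4 5 ..
      qed (use n ay Ym UF in simp_all)
      have 6: "swap A N Y (elem_tensor A N Y n (a \<odot>\<^bsub>Y\<^esub> y)) = elem_tensor Ao ?X No (a \<odot>\<^bsub>Y\<^esub> y) n"
        by (rule swap_elem) (use n ayc Ym in simp_all)
      have 7: "op.coact ?X (elem_tensor Ao ?X No (a \<odot>\<^bsub>Y\<^esub> y) n)
          = elem_tensor Ao (tensor Bo (FX_op ?X) Mo) No
            (r_unit Ao Bo No Mo eta_op ?X (a \<odot>\<^bsub>Y\<^esub> y)) n"
        by (rule op.coact_elem[OF Ym(3)]) (use n ayc in simp_all)
      have 8: "r_unit Ao Bo No Mo eta_op ?X (a \<odot>\<^bsub>Y\<^esub> y)
          = assoc_inv Ao Bo ?X No Mo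
             (elem_tensor Ao ?X S' y (swap B M N (\<eta> a)))"
        using op.r_unit_elem[OF Ym(3), of a y] ay by (simp add: eta_op_def)
      have 9: "Lcoact Y (elem_tensor A N Y n (a \<odot>\<^bsub>Y\<^esub> y))
          = elem_tensor A N (tensor B M ?Z) n (assoc B A M N Y (elem_tensor A S Y (\<eta> a) y))"
        using n ay ayc Ym l_unit_left_hom[OF Y] by (simp add: l_coaction_def l_unit_elem[OF Y])
      show "op.coact ?X (swap A N Y (elem_tensor A N Y n (a \<odot>\<^bsub>Y\<^esub> y)))
          = ?G (TT ?Z (Lcoact Y (elem_tensor A N Y n (a \<odot>\<^bsub>Y\<^esub> y))))"
        unfolding 6 7 8 9 by (rule key) (use ay in simp)
    qed (use n Ym Y in simp_all)
  qed (use Ym in simp_all)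
qed

lemma swapY_coalgebra_hom:
  "swap A N Y \<in> r_coalgebra_hom Ao Bo No Mo
     (opp_mod (tensor A N Y)) (\<lambda>z. TT (tensor A N Y) (Lcoact Y z)) (FX_op (opp_mod Y)) (op.coact (opp_mod Y))"
  using swapY(1) swap_coact by (simp add: r_coalgebra_hom_def)

end

end

context firm_adjunction
begin

interpretation op: firm_adjunction Ao Bo No Mo eta_op eps_op
  by (rule opp_adjunction)

lemma LF_swap:
  assumes X: "left_module A X" and Y: "left_module A Y" and u: "u \<in> left_hom A X Y" and t: "t \<in> carrier (tensor A N X)"
  shows "swap A N Y (LF X Y u t) = op.FF (opp_mod X) (opp_mod Y) u (swap A N X t)"
proof (rule tensor_eqI[OF _ X ahom_comp[OF tensor_map_ahom swap_ahom] ahom_comp[OF swap_ahom tensor_map_ahom] _ t])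
  fix n x assume *: "n \<in> carrier N" "x \<in> carrier X"
  then show "swap A N Y (LF X Y u (elem_tensor A N X n x)) = op.FF (opp_mod X) (opp_mod Y) u (swap A N X (elem_tensor A N X n x))"
    using assms left_hom_closed[OF u] by (simp add: swap_elem)
qed (use assms in simp_all)

context
  fixes U :: "'u set"
  assumes comonadic: "l_comonadic U A B M N \<eta> \<epsilon>"
begin

lemma l_comparison_bij:
  fixes X Y :: "(unit, 'a, 'u) bimod"
  assumes X: "firm_right Ao X" "carrier X \<subseteq> U" and Y: "firm_right Ao Y" "carrier Y \<subseteq> U"
  shows "bij_betw (op.FF X Y) (right_hom Ao X Y)
    (r_coalgebra_hom Ao Bo No Mo (FX_op X) (op.coact X) (FX_op Y) (op.coact Y))"
proof -
  let ?X = "opp_mod X" and ?Y = "opp_mod Y"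
  have fX: "firm_left A ?X" and fY: "firm_left A ?Y"
    using firm_left_opp[OF X(1)] firm_left_opp[OF Y(1)] by simp_all
  note rX = Y_rules[OF fX] and rY = Y_rules[OF fY] and sX = swapY[OF fX] and sY = swapY[OF fY]
  let ?ZX = "tensor A N ?X" and ?ZY = "tensor A N ?Y"
  let ?rX = "\<lambda>z. TT ?ZX (Lcoact ?X z)" and ?rY = "\<lambda>z. TT ?ZY (Lcoact ?Y z)"
  let ?R = "r_coalgebra_hom Ao Bo No Mo"
  have rXc: "?rX z \<in> carrier (op.Gobj (opp_mod ?ZX))" if "z \<in> carrier ?ZX" for z
    by (rule TT_closed[OF rX(4) ahom_closed[OF Lcoact_ahom[OF fX] that]])
  have rYc: "?rY z \<in> carrier (op.Gobj (opp_mod ?ZY))" if "z \<in> carrier ?ZY" for z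
    by (rule TT_closed[OF rY(4) ahom_closed[OF Lcoact_ahom[OF fY] that]])
  have hom_eq: "left_hom A ?X ?Y = right_hom Ao X Y"
    using hom_opp(4)[of A ?X ?Y] by simp
  have "l_coalgebra_hom A B M N ?ZX (Lcoact ?X) ?ZY (Lcoact ?Y) = ?R (opp_mod ?ZX) ?rX (opp_mod ?ZY) ?rY"
    by (rule l_coalgebra_hom_opp[OF rX(4) rY(4) ahom_closed[OF Lcoact_ahom[OF fX]] ahom_closed[OF Lcoact_ahom[OF fY]]])
  then have L: "bij_betw (LF ?X ?Y) (right_hom Ao X Y) (?R (opp_mod ?ZX) ?rX (opp_mod ?ZY) ?rY)"
    using conjunct1[OF comonadic[unfolded l_comonadic_def], rule_format, of ?X ?Y] fX fY X(2) Y(2)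
    by (simp add: hom_eq)
  have nat: "swap A N ?Y (LF ?X ?Y u t) = op.FF X Y u (swap A N ?X t)"
    if "u \<in> right_hom Ao X Y" "t \<in> carrier ?ZX" for u t
    using LF_swap[OF rX(1) rY(1), of u t] that by (simp only: hom_eq opp_mod_simps(6))
  have LFc: "LF ?X ?Y u t \<in> carrier ?ZY" if u: "u \<in> right_hom Ao X Y" and t: "t \<in> carrier ?ZX" for u t
    by (rule tensor_map_closed) (use rX rY u t hom_eq in simp_all)
  have LFe: "LF ?X ?Y u \<in> extensional (carrier ?ZX)" for u by simp
  have sXs: "z \<in> swap A N ?X ` carrier ?ZX" if "z \<in> carrier (FX_op X)" for z
    using bij_betw_imp_surj_on[OF sX(2)] that by simp
  show ?thesis
    unfolding bij_betw_def
  proof (intro conjI subset_antisym)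
    show "inj_on (op.FF X Y) (right_hom Ao X Y)"
    proof (rule inj_onI)
      fix u v assume u: "u \<in> right_hom Ao X Y" and v: "v \<in> right_hom Ao X Y"
        and eq: "op.FF X Y u = op.FF X Y v"
      have "LF ?X ?Y u t = LF ?X ?Y v t" if t: "t \<in> carrier ?ZX" for t
        by (rule inj_onD[OF bij_betw_imp_inj_on[OF sY(2)] _ LFc[OF u t] LFc[OF v t]])
           (simp only: nat[OF u t] nat[OF v t] eq)
      then have "LF ?X ?Y u = LF ?X ?Y v" by (rule extensionalityI[OF LFe LFe])
      then show "u = v" by (rule inj_onD[OF bij_betw_imp_inj_on[OF L] _ u v])
    qed
    show "op.FF X Y ` right_hom Ao X Y \<subseteq> ?R (FX_op X) (op.coact X) (FX_op Y) (op.coact Y)"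
      using op.FF_coalgebra_hom[OF X(1) Y(1)] by auto
    show "?R (FX_op X) (op.coact X) (FX_op Y) (op.coact Y) \<subseteq> op.FF X Y ` right_hom Ao X Y"
    proof
      fix g assume g: "g \<in> ?R (FX_op X) (op.coact X) (FX_op Y) (op.coact Y)"
      note hX = swapY_coalgebra_hom[OF fX, unfolded opp_mod_simps(6)]
        and hY = swapY_coalgebra_hom[OF fY, unfolded opp_mod_simps(6)]
      note mX = rX(5)[unfolded opp_mod_simps(6)] and mY = rY(5)[unfolded opp_mod_simps(6)]
      have zX: "right_module Bo (opp_mod ?ZX)" and zY: "right_module Bo (opp_mod ?ZY)"
        using rX(4) rY(4) by (simp_all only: module_opp)
      note bY = sY(2)[unfolded opp_mod_simps(6)]
      have iY: "hom_inv (opp_mod ?ZY) (FX_op Y) (swap A N ?Y) \<in> ?R (FX_op Y) (op.coact Y) (opp_mod ?ZY) ?rY"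
        by (rule op.r_coalgebra_hom_inv[OF zY mY _ hY]) (use rYc bY in simp_all)
      have k1: "(\<lambda>z\<in>carrier (opp_mod ?ZX). g (swap A N ?X z)) \<in> ?R (opp_mod ?ZX) ?rX (FX_op Y) (op.coact Y)"
        by (rule op.r_coalgebra_hom_comp[OF zX mX mY _ hX g]) (use rXc in simp)
      have k2: "(\<lambda>z\<in>carrier (opp_mod ?ZX). hom_inv (opp_mod ?ZY) (FX_op Y) (swap A N ?Y)
          ((\<lambda>z\<in>carrier (opp_mod ?ZX). g (swap A N ?X z)) z)) \<in> ?R (opp_mod ?ZX) ?rX (opp_mod ?ZY) ?rY" (is "?k \<in> _")
        by (rule op.r_coalgebra_hom_comp[OF zX mY zY _ k1 iY]) (use rXc in simp)
      then have "?k \<in> LF ?X ?Y ` right_hom Ao X Y"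
        unfolding bij_betw_imp_surj_on[OF L] .
      then obtain u where u: "u \<in> right_hom Ao X Y" "?k = LF ?X ?Y u" by (elim imageE)
      have gr: "g \<in> right_hom Bo (FX_op X) (FX_op Y)" by (rule op.r_coalgebra_homD(1)[OF g])
      have "op.FF X Y u z = g z" if z: "z \<in> carrier (FX_op X)" for z
      proof -
        obtain t where t: "t \<in> carrier ?ZX" "z = swap A N ?X t" using sXs[OF z] by (elim imageE)
        have "op.FF X Y u z = swap A N ?Y (?k t)"
          unfolding t(2) nat[OF u(1) t(1), symmetric] u(2) ..
        also have "?k t = hom_inv ?ZY (FX_op Y) (swap A N ?Y) (g z)"
          using t by simp
        also have "swap A N ?Y (hom_inv ?ZY (FX_op Y) (swap A N ?Y) (g z)) = g z"
          by (rule hom_inv_right[OF bY right_hom_closed[OF gr z]])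
        finally show ?thesis .
      qed
      then have "op.FF X Y u = g"
        using gr by (intro extensionalityI[OF tensor_map_extensional]) (simp_all only: right_hom_iff)
      then show "g \<in> op.FF X Y ` right_hom Ao X Y" using u(1) by (intro image_eqI[OF sym])
    qed
  qed
qed

lemma l_comparison_surj:
  fixes Z :: "(unit, 'b, 'u) bimod"
  assumes coalg: "r_coalgebra Ao Bo No Mo eta_op eps_op Z \<rho>" and ZU: "carrier Z \<subseteq> U"
  shows "\<exists>(X :: (unit, 'a, 'u) bimod) h. firm_right Ao X \<and> carrier X \<subseteq> U
    \<and> h \<in> r_coalgebra_hom Ao Bo No Mo (FX_op X) (op.coact X) Z \<rho>
    \<and> bij_betw h (carrier (FX_op X)) (carrier Z)"
proof -
  let ?Z = "opp_mod Z" and ?B = Bo and ?A = Ao and ?M = Mo and ?N = No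
  let ?R = "r_coalgebra_hom ?A ?B ?N ?M"
  let ?UZ = "tensor B M ?Z" and ?UZ' = "tensor ?B Z ?M"
  have Zf: "firm_right ?B Z" and \<rho>: "\<rho> \<in> right_hom ?B Z (op.Gobj Z)"
    and cu: "\<And>z. z \<in> carrier Z \<Longrightarrow> r_counit ?A ?B ?N ?M eps_op Z (\<rho> z) = z"
    and ca: "\<And>z. z \<in> carrier Z \<Longrightarrow> op.Gmap Z (op.Gobj Z) \<rho> (\<rho> z) = op.coact ?UZ' (\<rho> z)"
    using coalg by (auto simp: r_coalgebra_def Let_def r_coaction_def)
  have Zl: "firm_left B ?Z" using firm_left_opp[OF Zf] by simp
  note Zm = firm_left_module[OF Zl] firm_right_module[OF Zf]
  have fU: "firm_left A ?UZ" by (rule firm_left_tensor) (use Zm in simp_all)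
  have fU': "firm_right ?A ?UZ'" by (rule firm_right_tensor) (use Zm in simp_all)
  note Ur = Y_rules[OF fU]
  have TTb: "bij_betw (TT ?Z) (carrier (Lobj ?Z)) (carrier (op.Gobj Z))"
    using TT_bij[OF Zm(1)] by (simp only: opp_mod_simps(6))
  have TTr: "TT ?Z \<in> right_hom ?B (opp_mod (Lobj ?Z)) (op.Gobj Z)"
    using TT_right_hom[OF Zm(1)] by (simp only: opp_mod_simps(6))
  have Lm: "left_module B (Lobj ?Z)" "right_module ?B (opp_mod (Lobj ?Z))" "right_module ?B (op.Gobj Z)"
    using UZ_modules[OF Zm(1)] by simp_all
  define \<sigma> where "\<sigma> = (\<lambda>z\<in>carrier Z. hom_inv (Lobj ?Z) (op.Gobj Z) (TT ?Z) (\<rho> z))"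
  have T\<sigma>: "TT ?Z (\<sigma> z) = \<rho> z" if "z \<in> carrier Z" for z
    using that TTb right_hom_closed[OF \<rho>] by (simp add: \<sigma>_def)
  have \<sigma>r: "\<sigma> \<in> right_hom ?B Z (opp_mod (Lobj ?Z))"
    using right_hom_comp[OF \<rho> hom_inv_right_hom[OF TTr _ Lm(2)] Zm(2)] TTb by (simp add: \<sigma>_def)
  have \<sigma>l: "\<sigma> \<in> left_hom B ?Z (Lobj ?Z)"
    using \<sigma>r hom_opp(4)[of B ?Z "Lobj ?Z"] by simp
  have \<sigma>c: "\<sigma> z \<in> carrier (Lobj ?Z)" if "z \<in> carrier Z" for z
    using left_hom_closed[OF \<sigma>l] that by simp
  have lc: "l_counit A B M N \<epsilon> ?Z \<in> ahom (Lobj ?Z) Z"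
    using left_hom_ahom[OF l_counit_left_hom[of B ?Z A N M \<epsilon>]] Zm Zl by simp
  have TTa: "TT ?Z \<in> ahom (Lobj ?Z) (op.Gobj Z)"
    using TT_ahom[OF Zm(1)] by (simp only: opp_mod_simps(6))
  have rc: "r_counit ?A ?B ?N ?M eps_op Z \<in> ahom (op.Gobj Z) Z"
    using right_hom_ahom[OF r_counit_right_hom[of ?B Z ?A ?M ?N eps_op]] Zm Zf eps_op_bimod_hom by simp
  have counit: "l_counit A B M N \<epsilon> ?Z t = r_counit ?A ?B ?N ?M eps_op Z (TT ?Z t)" if t: "t \<in> carrier (Lobj ?Z)" for t
  proof (rule tensor3_eqI_right[OF _ _ _ _ lc ahom_comp[OF TTa rc] _ t])
    fix n m z assume *: "n \<in> carrier N" "m \<in> carrier M" "z \<in> carrier ?Z"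
    have "TT ?Z (elem_tensor A N ?UZ n (elem_tensor B M ?Z m z))
        = elem_tensor ?A ?UZ' ?N (elem_tensor ?B Z ?M z m) n"
      using TT_elem[OF Zm(1) *] by (simp only: opp_mod_simps(6))
    moreover have "r_counit ?A ?B ?N ?M eps_op Z (elem_tensor ?A ?UZ' ?N (elem_tensor ?B Z ?M z m) n) = \<epsilon> (nm n m) \<odot>\<^bsub>?Z\<^esub> z"
      using r_counit_elem[of ?B Z ?A ?M ?N eps_op z m n] * Zm by (simp add: eps_op_elem)
    ultimately show "l_counit A B M N \<epsilon> ?Z (elem_tensor A N ?UZ n (elem_tensor B M ?Z m z))
        = r_counit ?A ?B ?N ?M eps_op Z (TT ?Z (elem_tensor A N ?UZ n (elem_tensor B M ?Z m z)))"
      using l_counit_elem[of B ?Z A N M \<epsilon> z n m] * Zm by (simp add: nm_def)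
  qed (use Zm in simp_all)
  let ?Y = "Lobj ?Z"
  have w: "swap B M ?Z \<in> right_hom ?A (opp_mod ?UZ) ?UZ'"
    using swap_MZ[OF Zm(1)] by (simp only: opp_mod_simps(6))
  have TT_split: "TT ?Z t = op.FF (opp_mod ?UZ) ?UZ' (swap B M ?Z) (swap A N ?UZ t)" if "t \<in> carrier ?Y" for t
    using that unfolding TT_def by (simp only: restrict_apply' opp_mod_simps(6))
  have big: "op.coact ?UZ' (TT ?Z t) = op.Gmap (opp_mod ?Y) (op.Gobj Z) (TT ?Z) (TT ?Y (Lcoact ?UZ t))"
    if t: "t \<in> carrier ?Y" for t
  proof -
    note s = swapY[OF fU]
    have st: "swap A N ?UZ t \<in> carrier (FX_op (opp_mod ?UZ))"
      using bij_betwE[OF s(2)] t by blast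
    have c: "TT ?Y (Lcoact ?UZ t) \<in> carrier (op.Gobj (opp_mod ?Y))"
      by (rule TT_closed[OF Lm(1) ahom_closed[OF Lcoact_ahom[OF fU] t]])
    have "op.coact ?UZ' (TT ?Z t) = op.coact ?UZ' (op.FF (opp_mod ?UZ) ?UZ' (swap B M ?Z) (swap A N ?UZ t))"
      by (simp only: TT_split[OF t])
    also have "\<dots> = op.Gmap (FX_op (opp_mod ?UZ)) (op.Gobj Z) (op.FF (opp_mod ?UZ) ?UZ' (swap B M ?Z))
        (op.coact (opp_mod ?UZ) (swap A N ?UZ t))"
      by (rule op.r_coalgebra_homD(2)[OF op.FF_coalgebra_hom[OF Ur(3) fU' w] st])
    also have "op.coact (opp_mod ?UZ) (swap A N ?UZ t)
        = op.Gmap (opp_mod ?Y) (FX_op (opp_mod ?UZ)) (swap A N ?UZ) (TT ?Y (Lcoact ?UZ t))"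
      by (rule swap_coact[OF fU t])
    also have "op.Gmap (FX_op (opp_mod ?UZ)) (op.Gobj Z) (op.FF (opp_mod ?UZ) ?UZ' (swap B M ?Z))
          (op.Gmap (opp_mod ?Y) (FX_op (opp_mod ?UZ)) (swap A N ?UZ) (TT ?Y (Lcoact ?UZ t)))
        = op.Gmap (opp_mod ?Y) (op.Gobj Z) (TT ?Z) (TT ?Y (Lcoact ?UZ t))"
      by (rule op.Gmap_comp[OF Lm(2) Ur(5) Lm(3) s(1) op.r_coalgebra_homD(1)[OF op.FF_coalgebra_hom[OF Ur(3) fU' w]] TTr _ c])
         (use TT_split in simp)
    finally show ?thesis .
  qed
  have GTinj: "x = y" if x: "x \<in> carrier (op.Gobj (opp_mod ?Y))" and y: "y \<in> carrier (op.Gobj (opp_mod ?Y))"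
    and eq: "op.Gmap (opp_mod ?Y) (op.Gobj Z) (TT ?Z) x = op.Gmap (opp_mod ?Y) (op.Gobj Z) (TT ?Z) y" for x y
  proof -
    let ?i = "hom_inv (opp_mod ?Y) (op.Gobj Z) (TT ?Z)"
    have TTb': "bij_betw (TT ?Z) (carrier (opp_mod ?Y)) (carrier (op.Gobj Z))" using TTb by simp
    have i: "?i \<in> right_hom ?B (op.Gobj Z) (opp_mod ?Y)" by (rule hom_inv_right_hom[OF TTr TTb' Lm(2)])
    have id: "op.Gmap (op.Gobj Z) (opp_mod ?Y) ?i (op.Gmap (opp_mod ?Y) (op.Gobj Z) (TT ?Z) x) = x"
      if x: "x \<in> carrier (op.Gobj (opp_mod ?Y))" for x
    proof -
      have id: "ident (opp_mod ?Y) \<in> right_hom ?B (opp_mod ?Y) (opp_mod ?Y)" by (rule ident_right_hom[OF Lm(2)])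
      have "op.Gmap (op.Gobj Z) (opp_mod ?Y) ?i (op.Gmap (opp_mod ?Y) (op.Gobj Z) (TT ?Z) x)
          = op.Gmap (opp_mod ?Y) (opp_mod ?Y) (ident (opp_mod ?Y)) x"
        by (rule op.Gmap_comp[OF Lm(2,3,2) TTr i id _ x]) (use hom_inv_left[OF TTb'] in simp)
      also have "\<dots> = x" by (rule op.Gmap_ident[OF Lm(2) id _ x]) simp
      finally show ?thesis .
    qed
    show ?thesis using id[OF x] id[OF y] eq by simp
  qed
  have l_coalg: "l_coalgebra A B M N \<eta> \<epsilon> ?Z \<sigma>"
    unfolding l_coalgebra_def Let_def
  proof (intro conjI ballI Zl \<sigma>l)
    fix z assume "z \<in> carrier ?Z"
    then have z: "z \<in> carrier Z" by simp
    show "l_counit A B M N \<epsilon> ?Z (\<sigma> z) = z"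
      unfolding counit[OF \<sigma>c[OF z]] T\<sigma>[OF z] by (rule cu[OF z])
    have Lc: "Lmap ?Z ?Y \<sigma> (\<sigma> z) \<in> carrier (Lobj ?Y)"
      by (rule ahom_closed[OF Lmap_ahom[OF Zm(1) Lm(1) \<sigma>l] \<sigma>c[OF z]])
    have Rc: "Lcoact ?UZ (\<sigma> z) \<in> carrier (Lobj ?Y)"
      by (rule ahom_closed[OF Lcoact_ahom[OF fU] \<sigma>c[OF z]])
    have "op.Gmap (opp_mod ?Y) (op.Gobj Z) (TT ?Z) (TT ?Y (Lmap ?Z ?Y \<sigma> (\<sigma> z)))
        = op.Gmap (opp_mod ?Y) (op.Gobj Z) (TT ?Z) (op.Gmap Z (opp_mod ?Y) \<sigma> (\<rho> z))"
      unfolding TT_natural[OF Zm(1) Lm(1) \<sigma>l \<sigma>c[OF z]] T\<sigma>[OF z] opp_mod_simps(6) ..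
    also have "\<dots> = op.Gmap Z (op.Gobj Z) \<rho> (\<rho> z)"
      by (rule op.Gmap_comp[OF Zm(2) Lm(2,3) \<sigma>r TTr \<rho> _ right_hom_closed[OF \<rho> z]]) (simp add: T\<sigma>)
    also have "\<dots> = op.Gmap (opp_mod ?Y) (op.Gobj Z) (TT ?Z) (TT ?Y (Lcoact ?UZ (\<sigma> z)))"
      unfolding ca[OF z] big[OF \<sigma>c[OF z], symmetric] T\<sigma>[OF z] ..
    finally have "TT ?Y (Lmap ?Z ?Y \<sigma> (\<sigma> z)) = TT ?Y (Lcoact ?UZ (\<sigma> z))"
      by (rule GTinj[OF TT_closed[OF Lm(1) Lc] TT_closed[OF Lm(1) Rc]])
    then have "Lmap ?Z ?Y \<sigma> (\<sigma> z) = Lcoact ?UZ (\<sigma> z)" by (rule TT_inj[OF Lm(1) Lc Rc])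
    then show "Lmap ?Z ?Y \<sigma> (\<sigma> z) = tensor_map A N ?UZ N (tensor B M ?Y) (ident N) (l_unit A B M N \<eta> ?UZ) (\<sigma> z)"
      by (simp only: l_coaction_def)
  qed
  obtain X :: "('a, unit, 'u) bimod" and h where X: "firm_left A X" "carrier X \<subseteq> U"
    and h: "h \<in> l_coalgebra_hom A B M N (tensor A N X) (Lcoact X) ?Z \<sigma>" "bij_betw h (carrier (tensor A N X)) (carrier ?Z)"
    using conjunct2[OF comonadic[unfolded l_comonadic_def], rule_format, of ?Z \<sigma>] l_coalg ZU by auto
  note Xr = Y_rules[OF X(1)] and sX = swapY[OF X(1)]
  let ?ZX = "tensor A N X" and ?X = "opp_mod X"
  have zX: "right_module ?B (opp_mod ?ZX)" using Xr(4) by simp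
  have rXc: "TT ?ZX (Lcoact X z) \<in> carrier (op.Gobj (opp_mod ?ZX))" if "z \<in> carrier ?ZX" for z
    by (rule TT_closed[OF Xr(4) ahom_closed[OF Lcoact_ahom[OF X(1)] that]])
  have "h \<in> ?R (opp_mod ?ZX) (\<lambda>z. TT ?ZX (Lcoact X z)) (opp_mod ?Z) (\<lambda>z. TT ?Z (\<sigma> z))"
    using h(1) l_coalgebra_hom_opp[where \<rho>' = \<sigma>, OF Xr(4) Zm(1) ahom_closed[OF Lcoact_ahom[OF X(1)]]] \<sigma>c by simp
  then have h': "h \<in> ?R (opp_mod ?ZX) (\<lambda>z. TT ?ZX (Lcoact X z)) Z \<rho>"
    using T\<sigma> by (auto simp: r_coalgebra_hom_def right_hom_closed)
  have i: "hom_inv (opp_mod ?ZX) (FX_op ?X) (swap A N X)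
      \<in> ?R (FX_op ?X) (op.coact ?X) (opp_mod ?ZX) (\<lambda>z. TT ?ZX (Lcoact X z))"
    by (rule op.r_coalgebra_hom_inv[OF zX Xr(5) _ swapY_coalgebra_hom[OF X(1)]]) (use rXc sX in simp_all)
  have "(\<lambda>z\<in>carrier (FX_op ?X). h (hom_inv (opp_mod ?ZX) (FX_op ?X) (swap A N X) z))
      \<in> ?R (FX_op ?X) (op.coact ?X) Z \<rho>"
    by (rule op.r_coalgebra_hom_comp[OF Xr(5) zX Zm(2) op.coact_closed[OF Xr(3)] i h'])
  moreover have "bij_betw (\<lambda>z\<in>carrier (FX_op ?X). h (hom_inv (opp_mod ?ZX) (FX_op ?X) (swap A N X) z))
      (carrier (FX_op ?X)) (carrier Z)"
  proof (rule iffD1[OF bij_betw_cong])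
    show "bij_betw (h \<circ> hom_inv ?ZX (FX_op ?X) (swap A N X)) (carrier (FX_op ?X)) (carrier Z)"
      using bij_betw_trans[OF hom_inv_bij[OF sX(2)] h(2)] by simp
  qed simp
  ultimately show ?thesis
    using X Xr(3) by (intro exI[of _ ?X] exI[of _ "\<lambda>z\<in>carrier (FX_op ?X). h (hom_inv (opp_mod ?ZX) (FX_op ?X) (swap A N X) z)"] conjI) (assumption | simp)+
qed

theorem l_comonadic_opp:
  "r_comonadic U Ao Bo No Mo eta_op eps_op"
  unfolding r_comonadic_def using l_comparison_bij l_comparison_surj by blast

end

end

section \<open>The map \<open>\<Gamma>\<close> on the left\<close>

context firm_adjunction
begin

lemma endos_iff: "f \<in> carrier endos \<longleftrightarrow> f \<in> bimod_hom B B C C \<and> (\<forall>c\<in>carrier C. \<epsilon> (f c) = \<epsilon> c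
    \<and> C_comult A B M N \<eta> (f c) = tensor_map B C C C C f f (C_comult A B M N \<eta> c))"
  unfolding coring_endo_def Let_def by (simp only: partial_object.select_convs mem_Collect_eq)

interpretation op: firm_adjunction Ao Bo No Mo eta_op eps_op
  by (rule opp_adjunction)

abbreviation swap_C' where "swap_C' \<equiv> swap Ao Mo No"

lemma swap_mn_op: "m \<in> carrier M \<Longrightarrow> n \<in> carrier N \<Longrightarrow> swap B M N (mn m n) = op.mn n m"
  by (simp add: swap_mn op.mn_def)

lemma swap_nm_op: "m \<in> carrier M \<Longrightarrow> n \<in> carrier N \<Longrightarrow> swap A N M (nm n m) = op.nm m n"
  by (simp add: swap_nm op.nm_def)

lemma swap_swap_C: "c \<in> carrier C \<Longrightarrow> swap_C' (swap A N M c) = c"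
  by (rule swap_swap) simp_all

lemma swap_swap_C': "c \<in> carrier C' \<Longrightarrow> swap A N M (swap_C' c) = c"
  using swap_swap[of Ao Mo No c] by simp

lemma op_sm: assumes "s \<in> carrier S" "n \<in> carrier N" shows "op.sm (swap B M N s) n = ns n s"
proof (rule S_eqI[OF ahom_comp[OF swapS_rules(1) op.sm_ahom_left[unfolded hom_opp(2)]] ns_ahom_right _ assms(1)])
  fix p q assume "p \<in> carrier M" "q \<in> carrier N"
  then show "op.sm (swap B M N (mn p q)) n = ns n (mn p q)"
    using op.sm_mn[of q p n] assms by (simp add: swap_mn_op eps_op_elem op.nm_def)
qed (use assms in simp_all)

lemma op_ns: assumes "s \<in> carrier S" "m \<in> carrier M" shows "op.ns m (swap B M N s) = sm s m"
proof (rule S_eqI[OF ahom_comp[OF swapS_rules(1) op.ns_ahom_right[unfolded hom_opp(2)]] sm_ahom_left _ assms(1)])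
  fix p q assume "p \<in> carrier M" "q \<in> carrier N"
  then show "op.ns m (swap B M N (mn p q)) = sm (mn p q) m"
    using op.ns_mn[of q p m] assms by (simp add: swap_mn_op eps_op_elem op.nm_def)
qed (use assms in simp_all)

lemma op_ss: assumes s: "s \<in> carrier S" and s': "s' \<in> carrier S"
  shows "op.ss (swap B M N s) (swap B M N s') = swap B M N (ss s' s)"
proof (rule S_eqI[OF ahom_comp[OF swapS_rules(1) op.ss_ahom_left] ahom_comp[OF ss_ahom_right swapS_rules(1)] _ s])
  fix p q assume "p \<in> carrier M" "q \<in> carrier N"
  then show "op.ss (swap B M N (mn p q)) (swap B M N s') = swap B M N (ss s' (mn p q))"
    using op.ss_mn_left[of q p "swap B M N s'"] swapS_rules(2)[OF s'] s'
    by (simp add: swap_mn_op op_ns ss_mn_right)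
qed (use s' swapS_rules(2) in simp_all)

definition conj_endo :: "(('n, 'm) tens \<Rightarrow> ('n, 'm) tens) \<Rightarrow> ('m, 'n) tens \<Rightarrow> ('m, 'n) tens" where
  "conj_endo f = (\<lambda>c\<in>carrier C'. swap A N M (f (swap_C' c)))"

lemma conj_endo_swap: "c \<in> carrier C \<Longrightarrow> conj_endo f (swap A N M c) = swap A N M (f c)"
  using swapC_rules(2) by (simp add: conj_endo_def swap_swap_C)

lemma swapC_bimod_hom: "swap A N M \<in> bimod_hom Bo Bo (opp_mod C) C'"
  using swapC_rules(4) bimod_hom_opp[of B B C "opp_mod C'"] by simp

lemma opp_C_rules: "bimodule Bo Bo C'" "bimodule Bo Bo (opp_mod C)"
  "bimodule B B (opp_mod C')"
proof -
  show 1: "bimodule Bo Bo C'" by (rule tensor_bimodule) simp_all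
  then show "bimodule B B (opp_mod C')" using bimodule_opp[of B B "opp_mod C'"] by simp
qed simp

lemma conj_endo_bimod_hom:
  assumes "f \<in> bimod_hom B B C C" shows "conj_endo f \<in> bimod_hom Bo Bo C' C'"
proof -
  have "f \<in> bimod_hom Bo Bo (opp_mod C) (opp_mod C)" using assms by simp
  from bimod_hom_comp[OF swapC'_rules(4) bimod_hom_comp[OF this swapC_bimod_hom opp_C_rules(2)] opp_C_rules(1)]
  have "(\<lambda>c\<in>carrier C'. (\<lambda>c\<in>carrier (opp_mod C). swap A N M (f c)) (swap_C' c)) \<in> bimod_hom Bo Bo C' C'" .
  also have "(\<lambda>c\<in>carrier C'. (\<lambda>c\<in>carrier (opp_mod C). swap A N M (f c)) (swap_C' c)) = conj_endo f"
    unfolding conj_endo_def by (rule restrict_ext) (simp add: swapC'_rules(2))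
  finally show ?thesis .
qed

definition swap2 where
  "swap2 t = tensor_map Bo (opp_mod C) (opp_mod C) C' C' (swap A N M) (swap A N M) (swap B C C t)"

lemma swap2_rules: "swap A N M \<in> right_hom Bo (opp_mod C) C'" "swap A N M \<in> left_hom Bo (opp_mod C) C'"
  "right_module Bo (opp_mod C)" "left_module Bo (opp_mod C)"
  "right_module Bo C'" "left_module Bo C'"
  using swapC_bimod_hom bimodule_left[OF opp_C_rules(1)] bimodule_right[OF opp_C_rules(1)] by (simp_all add: bimod_hom_iff)

lemma swap2_elem: assumes c: "c \<in> carrier C" "c' \<in> carrier C"
  shows "swap2 (elem_tensor B C C c c') = elem_tensor Bo C' C' (swap A N M c') (swap A N M c)"
proof -
  have "swap B C C (elem_tensor B C C c c') = elem_tensor Bo (opp_mod C) (opp_mod C) c' c"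
    by (rule swap_elem) (use c in simp_all)
  moreover have "tensor_map Bo (opp_mod C) (opp_mod C) C' C' (swap A N M) (swap A N M)
      (elem_tensor Bo (opp_mod C) (opp_mod C) c' c)
    = elem_tensor Bo C' C' (swap A N M c') (swap A N M c)"
    by (rule tensor_map_elem[OF swap2_rules(3-6,1,2)]) (simp_all only: opp_mod_simps(1) c)
  ultimately show ?thesis by (simp only: swap2_def)
qed

lemma swap2_ahom: "swap2 \<in> ahom (tensor B C C) (tensor Bo C' C')"
  unfolding swap2_def[abs_def] by (rule ahom_comp[OF swap_ahom tensor_map_ahom]) (use swap2_rules in simp_all)

lemma swap2_inj: "inj_on swap2 (carrier (tensor B C C))"
proof -
  have "bij_betw (tensor_map Bo (opp_mod C) (opp_mod C) C' C' (swap A N M) (swap A N M) \<circ> swap B C C)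
      (carrier (tensor B C C)) (carrier (tensor Bo C' C'))"
    by (rule bij_betw_trans[OF swap_bij tensor_map_bij]) (use swap2_rules swapC_rules in simp_all)
  then show ?thesis
    unfolding swap2_def[abs_def] comp_def by (rule bij_betw_imp_inj_on)
qed

lemma swap2_delta:
  assumes s: "s \<in> carrier S" and m: "m \<in> carrier M" and n: "n \<in> carrier N"
  shows "swap2 (delta n s m) = op.delta m (swap B M N s) n"
proof (rule S_eqI[OF ahom_comp[OF delta_ahom swap2_ahom] ahom_comp[OF swapS_rules(1) op.delta_ahom] _ s])
  fix p q assume "p \<in> carrier M" "q \<in> carrier N"
  then show "swap2 (delta n (mn p q) m) = op.delta m (swap B M N (mn p q)) n"
    using op.delta_mn[of q p n m] m n by (simp add: swap2_elem swap_nm_op swap_mn_op)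
qed (use m n in simp_all)

lemma swap2_comult:
  assumes c: "c \<in> carrier C"
  shows "swap2 (C_comult A B M N \<eta> c) = C_comult Ao Bo No Mo eta_op (swap A N M c)"
proof (rule C_eqI[OF ahom_comp[OF C_comult_ahom swap2_ahom] ahom_comp[OF swapC_rules(1) op.C_comult_ahom] _ c])
  fix m n assume m: "m \<in> carrier M" and n: "n \<in> carrier N"
  show "swap2 (C_comult A B M N \<eta> (nm n m))
      = C_comult Ao Bo No Mo eta_op (swap A N M (nm n m))"
  proof (rule firm_left_eqI[of A M _ "tensor Bo C' C'", OF _ _
        ahom_comp[OF nm_ahom_right ahom_comp[OF C_comult_ahom swap2_ahom]]
        ahom_comp[OF nm_ahom_right ahom_comp[OF swapC_rules(1) op.C_comult_ahom]] _ m])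
    fix a m assume am: "a \<in> carrier A" "m \<in> carrier M"
    have "swap A N M (nm n (a \<odot>\<^bsub>M\<^esub> m)) = op.nm m (a \<odot>\<^bsub>opp_mod N\<^esub> n)"
      using am n swap_nm_op[of m "n \<triangleleft>\<^bsub>N\<^esub> a"] by simp
    then show "swap2 (C_comult A B M N \<eta> (nm n (a \<odot>\<^bsub>M\<^esub> m)))
      = C_comult Ao Bo No Mo eta_op (swap A N M (nm n (a \<odot>\<^bsub>M\<^esub> m)))"
      using op.C_comult_nm[of m n a] am n by (simp only: C_comult_nm swap2_delta eta_closed) (simp add: eta_op_def)
  qed (use n in simp_all)
qed

lemma conj_endo_endos:
  assumes f: "f \<in> bimod_hom B B C C"
  shows "conj_endo f \<in> carrier op.endos \<longleftrightarrow> f \<in> carrier endos"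
proof -
  let ?D = "C_comult A B M N \<eta>" and ?D' = "C_comult Ao Bo No Mo eta_op"
  let ?g = "conj_endo f"
  let ?ff = "tensor_map B C C C C f f" and ?gg = "tensor_map Bo C' C' C' C' ?g ?g"
  note g = conj_endo_bimod_hom[OF f]
  have fc: "f c \<in> carrier C" if "c \<in> carrier C" for c using bimod_hom_closed[OF f that] .
  have eps: "eps_op (?g (swap A N M c)) = \<epsilon> (f c)" "eps_op (swap A N M c) = \<epsilon> c" if "c \<in> carrier C" for c
    using that fc swapC_rules(2) by (simp_all add: conj_endo_swap eps_op_def swap_swap_C)
  have ffa: "?ff \<in> ahom (tensor B C C) (tensor B C C)"
    by (rule tensor_map_ahom[OF _ _ _ _ bimod_hom_right[OF f] bimod_hom_left[OF f]]) simp_all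
  have gga: "?gg \<in> ahom (tensor Bo C' C') (tensor Bo C' C')"
    by (rule tensor_map_ahom[OF swap2_rules(5,6,5,6) bimod_hom_right[OF g] bimod_hom_left[OF g]])
  have gg: "?gg (swap2 t) = swap2 (?ff t)" if t: "t \<in> carrier (tensor B C C)" for t
  proof (rule tensor_eqI[OF _ _ ahom_comp[OF swap2_ahom gga] ahom_comp[OF ffa swap2_ahom] _ t])
    fix c c' assume c: "c \<in> carrier C" "c' \<in> carrier C"
    have "?gg (elem_tensor Bo C' C' (swap A N M c') (swap A N M c))
        = elem_tensor Bo C' C' (?g (swap A N M c')) (?g (swap A N M c))"
      by (rule tensor_map_elem[OF swap2_rules(5,6,5,6) bimod_hom_right[OF g] bimod_hom_left[OF g] swapC_rules(2)[OF c(2)] swapC_rules(2)[OF c(1)]])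
    moreover have "?ff (elem_tensor B C C c c') = elem_tensor B C C (f c) (f c')"
      by (rule tensor_map_elem[OF _ _ _ _ bimod_hom_right[OF f] bimod_hom_left[OF f] c]) simp_all
    ultimately show "?gg (swap2 (elem_tensor B C C c c')) = swap2 (?ff (elem_tensor B C C c c'))"
      by (simp only: swap2_elem[OF c] swap2_elem[OF fc[OF c(1)] fc[OF c(2)]] conj_endo_swap[OF c(1)] conj_endo_swap[OF c(2)])
  qed simp_all
  have Dc: "?D c \<in> carrier (tensor B C C)" if "c \<in> carrier C" for c
    by (rule ahom_closed[OF C_comult_ahom that])
  have D: "?D' (?g (swap A N M c)) = ?gg (?D' (swap A N M c)) \<longleftrightarrow> ?D (f c) = ?ff (?D c)" if c: "c \<in> carrier C" for c
  proof -
    have 1: "?D' (?g (swap A N M c)) = swap2 (?D (f c))"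
      unfolding conj_endo_swap[OF c] swap2_comult[OF fc[OF c]] ..
    have 2: "?gg (?D' (swap A N M c)) = swap2 (?ff (?D c))"
      unfolding swap2_comult[OF c, symmetric] gg[OF Dc[OF c]] ..
    show ?thesis
      unfolding 1 2 by (rule inj_on_eq_iff[OF swap2_inj Dc[OF fc[OF c]] ahom_closed[OF ffa Dc[OF c]]])
  qed
  have "f \<in> carrier endos \<longleftrightarrow> (\<forall>c\<in>carrier C. \<epsilon> (f c) = \<epsilon> c \<and> ?D (f c) = ?ff (?D c))"
    by (simp only: endos_iff f simp_thms)
  also have "\<dots> \<longleftrightarrow> (\<forall>c\<in>carrier C. eps_op (?g (swap A N M c)) = eps_op (swap A N M c)
      \<and> ?D' (?g (swap A N M c)) = ?gg (?D' (swap A N M c)))"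
    by (rule ball_cong[OF refl]) (simp only: eps D)
  also have "\<dots> \<longleftrightarrow> (\<forall>c\<in>swap A N M ` carrier C. eps_op (?g c) = eps_op c \<and> ?D' (?g c) = ?gg (?D' c))"
    by (simp only: ball_simps(9))
  also have "\<dots> \<longleftrightarrow> ?g \<in> carrier op.endos"
    unfolding bij_betw_imp_surj_on[OF swapC_rules(3)] by (simp only: op.endos_iff g simp_thms)
  finally show ?thesis by (rule sym)
qed

lemma conj_endo_bij: "bij_betw conj_endo (carrier endos) (carrier op.endos)"
  unfolding bij_betw_def
proof (intro conjI subset_antisym subsetI)
  show "inj_on conj_endo (carrier endos)"
  proof (rule inj_onI)
    fix f g assume fg: "f \<in> carrier endos" "g \<in> carrier endos" and eq: "conj_endo f = conj_endo g"
    note f = f_hom[OF fg(1)] and g = f_hom[OF fg(2)]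
    show "f = g"
    proof (rule left_hom_eqI[OF bimod_hom_left[OF f] bimod_hom_left[OF g]])
      fix c assume c: "c \<in> carrier C"
      then have "swap A N M (f c) = swap A N M (g c)" by (simp only: eq flip: conj_endo_swap)
      then show "f c = g c"
        by (rule inj_onD[OF bij_betw_imp_inj_on[OF swapC_rules(3)]])
           (use c bimod_hom_closed[OF f] bimod_hom_closed[OF g] in auto)
    qed
  qed
next
  fix g assume "g \<in> conj_endo ` carrier endos"
  then show "g \<in> carrier op.endos" using conj_endo_endos f_hom by blast
next
  fix g assume g: "g \<in> carrier op.endos"
  let ?f = "\<lambda>c\<in>carrier C. swap_C' (g (swap A N M c))"
  note gh = op.f_hom[OF g]
  have "g \<in> bimod_hom B B (opp_mod C') (opp_mod C')" using gh bimod_hom_opp[of B B "opp_mod C'" "opp_mod C'"] by simp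
  moreover have "swap_C' \<in> bimod_hom B B (opp_mod C') C"
    using swapC'_rules(4) bimod_hom_opp[of B B "opp_mod C'" C] by simp
  ultimately have "(\<lambda>c\<in>carrier C. (\<lambda>c\<in>carrier (opp_mod C'). swap_C' (g c)) (swap A N M c)) \<in> bimod_hom B B C C"
    by (intro bimod_hom_comp[OF swapC_rules(4) bimod_hom_comp] opp_C_rules(3)) simp_all
  also have "(\<lambda>c\<in>carrier C. (\<lambda>c\<in>carrier (opp_mod C'). swap_C' (g c)) (swap A N M c)) = ?f"
    by (rule restrict_ext) (simp add: swapC_rules(2))
  finally have f: "?f \<in> bimod_hom B B C C" .
  have "conj_endo ?f = g"
  proof (rule left_hom_eqI[OF bimod_hom_left[OF conj_endo_bimod_hom[OF f]] bimod_hom_left[OF gh]])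
    fix c assume "c \<in> carrier C'"
    then show "conj_endo ?f c = g c"
      using bimod_hom_closed[OF gh] swapC'_rules(2) by (simp add: conj_endo_def swap_swap_C')
  qed
  then show "g \<in> conj_endo ` carrier endos"
    using conj_endo_endos[OF f] g by (intro image_eqI[of _ _ ?f]) simp_all
qed

lemma conj_endo_compose:
  assumes f: "f \<in> bimod_hom B B C C" and g: "g \<in> bimod_hom B B C C"
  shows "conj_endo (compose (carrier C) f g) = compose (carrier C') (conj_endo f) (conj_endo g)"
  unfolding compose_def conj_endo_def
  by (rule restrict_ext) (simp add: swapC'_rules(2) swapC_rules(2) swap_swap_C bimod_hom_closed[OF f] bimod_hom_closed[OF g])

end

lemma firm_mono_opp:
  fixes U :: "'u set"
  assumes "nonunital_ring A" "firm_mono U A I i" shows "firm_mono U (opp_ring A) (opp_mod I) i"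
  unfolding firm_mono_def
proof (intro allI impI, elim conjE)
  fix T :: "('a, 'a, 'u) bimod" and f g
  assume T: "firm_bimodule (opp_ring A) (opp_ring A) T" "carrier T \<subseteq> U"
    and fg: "f \<in> bimod_hom (opp_ring A) (opp_ring A) T (opp_mod I)" "g \<in> bimod_hom (opp_ring A) (opp_ring A) T (opp_mod I)"
    and eq: "\<forall>t\<in>carrier T. i (f t) = i (g t)"
  have "firm_bimodule A A (opp_mod T)"
    using firm_bimodule_opp[OF T(1)] assms(1) by simp
  moreover have "f \<in> bimod_hom A A (opp_mod T) I" "g \<in> bimod_hom A A (opp_mod T) I"
    using fg bimod_hom_opp[of A A "opp_mod T" I] by simp_all
  ultimately show "f = g"
    using assms(2)[unfolded firm_mono_def, rule_format, of "opp_mod T" f g] T(2) eq by simp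
qed

lemma firm_mono_comp:
  fixes U :: "'u set" and A :: "'a ring"
  assumes "inj_on h (i ` carrier I)"
  shows "firm_mono U A I (\<lambda>x\<in>carrier I. h (i x)) \<longleftrightarrow> firm_mono U A I i"
proof -
  have "(\<lambda>x\<in>carrier I. h (i x)) (f t) = (\<lambda>x\<in>carrier I. h (i x)) (g t) \<longleftrightarrow> i (f t) = i (g t)"
    if "f \<in> bimod_hom A A T I" "g \<in> bimod_hom A A T I" "t \<in> carrier T" for T :: "('a, 'a, 'u) bimod" and f g t
    using inj_on_eq_iff[OF assms, of "i (f t)" "i (g t)"] bimod_hom_closed[OF that(1,3)] bimod_hom_closed[OF that(2,3)]
    by simp
  then show ?thesis unfolding firm_mono_def by (auto cong: conj_cong)
qed

context firm_adjunction
begin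

abbreviation opi where "opi I i \<equiv> (\<lambda>x\<in>carrier I. swap B M N (i x))"
abbreviation xil where "xil I i \<equiv> xi_l A B M N \<epsilon> I i"

definition mul :: "('a, 'a, 'u) bimod \<Rightarrow> ('u \<Rightarrow> ('m, 'n) tens) \<Rightarrow> (('m, 'n) tens, 'u) tens \<Rightarrow> ('m, 'n) tens" where
  "mul I i = tensor_lift S (\<lambda>s x. ss s (i x))"

lemma S_bimod_hom: "swap B M N \<in> bimod_hom Ao Ao (opp_mod S) S'"
  using swapS_rules(4) bimod_hom_opp[of A A S "opp_mod S'"] by simp

lemma S'_rules: "left_module Ao S'" "right_module Ao S'" "bimodule Ao Ao S'"
  "left_module Ao (opp_mod S)" "right_module Ao (opp_mod S)"
  by (rule tensor_left_module tensor_right_module tensor_bimodule | simp)+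

interpretation op: firm_adjunction Ao Bo No Mo eta_op eps_op
  by (rule opp_adjunction)

context
  fixes I :: "('a, 'a, 'u) bimod" and i
  assumes I: "firm_bimodule A A I" and i: "i \<in> bimod_hom A A I S"
begin

lemmas Il_rules [simp] = I_rules[OF I i]

lemma opi_rules: "firm_bimodule Ao Ao (opp_mod I)"
  "opi I i \<in> bimod_hom Ao Ao (opp_mod I) S'"
proof -
  show "firm_bimodule Ao Ao (opp_mod I)" by (rule firm_bimodule_opp[OF I]) simp_all
  have "opi I i \<in> bimod_hom A A I (opp_mod S')" by (rule bimod_hom_comp[OF i swapS_rules(4)]) simp
  then show "opi I i \<in> bimod_hom Ao Ao (opp_mod I) S'"
    using bimod_hom_opp[of A A I "opp_mod S'"] by simp
qed

lemma mul_balanced: "balanced A S I S (\<lambda>s x. ss s (i x))"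
  by (intro balancedI ahom_comp[OF bimod_hom_ahom[OF i] ss_ahom_right] ss_ahom_left) (simp_all add: ss_balanced)

lemma mul_elem: "s \<in> carrier S \<Longrightarrow> x \<in> carrier I \<Longrightarrow> mul I i (elem_tensor A S I s x) = ss s (i x)"
  unfolding mul_def by (rule tensor_lift_elem[OF _ _ _ mul_balanced]) simp_all

lemma mul_ahom: "mul I i \<in> ahom (tensor A S I) S"
  unfolding mul_def by (rule tensor_lift_ahom[OF _ _ _ mul_balanced]) simp_all

definition swap_SI where
  "swap_SI t = tensor_map Ao (opp_mod I) (opp_mod S) (opp_mod I) S' (ident I) (swap B M N) (swap A S I t)"

lemma swap_SI_hyps: "right_module Ao (opp_mod I)" "left_module Ao (opp_mod S)"
  "right_module Ao (opp_mod I)" "left_module Ao S'"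
  "ident I \<in> right_hom Ao (opp_mod I) (opp_mod I)" "swap B M N \<in> left_hom Ao (opp_mod S) S'"
proof -
  show m: "right_module Ao (opp_mod I)" by simp
  then show "right_module Ao (opp_mod I)" .
  show "ident I \<in> right_hom Ao (opp_mod I) (opp_mod I)"
    using ident_right_hom[OF m] by (simp only: opp_mod_simps(1))
qed (rule S'_rules bimod_hom_left[OF S_bimod_hom])+

lemma swap_SI_ahom: "swap_SI \<in> ahom (tensor A S I) (tensor Ao (opp_mod I) S')"
  unfolding swap_SI_def[abs_def]
  by (rule ahom_comp[OF swap_ahom tensor_map_ahom[OF swap_SI_hyps]]) simp_all

lemma swap_SI_elem: assumes "s \<in> carrier S" "x \<in> carrier I"
  shows "swap_SI (elem_tensor A S I s x) = elem_tensor Ao (opp_mod I) S' x (swap B M N s)"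
proof -
  have "swap A S I (elem_tensor A S I s x) = elem_tensor Ao (opp_mod I) (opp_mod S) x s"
    by (rule swap_elem) (use assms in simp_all)
  moreover have "tensor_map Ao (opp_mod I) (opp_mod S) (opp_mod I) S' (ident I) (swap B M N)
      (elem_tensor Ao (opp_mod I) (opp_mod S) x s)
    = elem_tensor Ao (opp_mod I) S' (ident I x) (swap B M N s)"
    by (rule tensor_map_elem[OF swap_SI_hyps]) (simp_all only: opp_mod_simps(1) assms)
  ultimately show ?thesis using assms(2) by (simp only: swap_SI_def restrict_apply')
qed

lemma swap_SI_bij: "bij_betw swap_SI (carrier (tensor A S I)) (carrier (tensor Ao (opp_mod I) S'))"
proof -
  have "bij_betw (tensor_map Ao (opp_mod I) (opp_mod S) (opp_mod I) S' (ident I) (swap B M N) \<circ> swap A S I)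
      (carrier (tensor A S I)) (carrier (tensor Ao (opp_mod I) S'))"
    by (rule bij_betw_trans[OF swap_bij tensor_map_bij[OF swap_SI_hyps]])
       (simp_all add: swapS_rules(3) bij_betw_id[unfolded id_def])
  then show ?thesis unfolding swap_SI_def[abs_def] comp_def .
qed

lemma mul_op: assumes t: "t \<in> carrier (tensor A S I)"
  shows "op.mu (opp_mod I) (opi I i) (swap_SI t) = swap B M N (mul I i t)"
proof (rule tensor_eqI[OF _ _ ahom_comp[OF swap_SI_ahom op.mu_ahom[OF opi_rules]] ahom_comp[OF mul_ahom swapS_rules(1)] _ t])
  fix s x assume *: "s \<in> carrier S" "x \<in> carrier I"
  have "op.mu (opp_mod I) (opi I i) (elem_tensor Ao (opp_mod I) S' x (swap B M N s))
      = op.ss (opi I i x) (swap B M N s)"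
    by (rule op.mu_elem[OF opi_rules]) (use * swapS_rules(2) in simp_all)
  also have "\<dots> = swap B M N (ss s (i x))"
    using * by (simp add: op_ss)
  finally show "op.mu (opp_mod I) (opi I i) (swap_SI (elem_tensor A S I s x)) = swap B M N (mul I i (elem_tensor A S I s x))"
    by (simp only: swap_SI_elem[OF *] mul_elem[OF *])
qed simp_all

lemma mul_bij_iff:
  "bij_betw (mul I i) (carrier (tensor A S I)) (carrier S)
   \<longleftrightarrow> bij_betw (op.mu (opp_mod I) (opi I i)) (carrier (tensor Ao (opp_mod I) S')) (carrier S')"
proof -
  have "bij_betw (mul I i) (carrier (tensor A S I)) (carrier S)
      \<longleftrightarrow> bij_betw (swap B M N \<circ> mul I i) (carrier (tensor A S I)) (carrier S')"
    by (rule bij_betw_comp_iff2[OF swapS_rules(3)]) (use ahom_closed[OF mul_ahom] in blast)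
  also have "\<dots> \<longleftrightarrow> bij_betw (op.mu (opp_mod I) (opi I i) \<circ> swap_SI) (carrier (tensor A S I)) (carrier S')"
    by (rule bij_betw_cong) (simp only: comp_apply mul_op)
  also have "\<dots> \<longleftrightarrow> bij_betw (op.mu (opp_mod I) (opi I i)) (carrier (tensor Ao (opp_mod I) S')) (carrier S')"
    by (rule bij_betw_comp_iff[OF swap_SI_bij, symmetric])
  finally show ?thesis .
qed

lemma xil_elem: "n \<in> carrier N \<Longrightarrow> x \<in> carrier I \<Longrightarrow> xil I i (elem_tensor A N I n x) = ns n (i x)"
  by (simp add: xi_l_def ns_def)

lemma xil_ahom: "xil I i \<in> ahom (tensor A N I) N"
  unfolding xi_l_def
  by (intro restrict_ahom ahom_comp[OF tensor_map_ahom left_hom_ahom[OF l_counit_N_left_hom]]) simp_all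

lemma xil_right_hom: "xil I i \<in> right_hom A (tensor A N I) N"
  unfolding right_hom_iff
proof (intro conjI ballI)
  fix a t assume a: "a \<in> carrier A" and t: "t \<in> carrier (tensor A N I)"
  show "xil I i (t \<triangleleft>\<^bsub>tensor A N I\<^esub> a) = xil I i t \<triangleleft>\<^bsub>N\<^esub> a"
    by (rule tensor_eqI[OF _ _ ahom_comp[OF tensor_rsmult_ahom xil_ahom] ahom_comp[OF xil_ahom rsmult_ahom] _ t])
       (use a in \<open>simp_all add: xil_elem ns_rsmult\<close>)
qed (simp_all add: xil_ahom, simp_all add: xi_l_def)

lemma xil_op: assumes t: "t \<in> carrier (tensor A N I)"
  shows "op.xi (opp_mod I) (opi I i) (swap A N I t) = xil I i t"
proof (rule tensor_eqI[OF _ _ ahom_comp[OF swap_ahom op.xi_ahom[OF opi_rules, unfolded hom_opp(2)]] xil_ahom _ t])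
  fix n x assume *: "n \<in> carrier N" "x \<in> carrier I"
  have "op.xi (opp_mod I) (opi I i) (elem_tensor Ao (opp_mod I) No x n) = op.sm (opi I i x) n"
    by (rule op.xi_elem[OF opi_rules]) (use * in simp_all)
  moreover have "swap A N I (elem_tensor A N I n x) = elem_tensor Ao (opp_mod I) No x n"
    by (rule swap_elem) (use * in simp_all)
  ultimately show "op.xi (opp_mod I) (opi I i) (swap A N I (elem_tensor A N I n x)) = xil I i (elem_tensor A N I n x)"
    using * by (simp add: op_sm xil_elem)
qed simp_all

lemma xil_bij:
  assumes "bij_betw (op.xi (opp_mod I) (opi I i)) (carrier (tensor Ao (opp_mod I) No)) (carrier N)"
  shows "bij_betw (xil I i) (carrier (tensor A N I)) (carrier N)"
proof -
  have "bij_betw (op.xi (opp_mod I) (opi I i) \<circ> swap A N I) (carrier (tensor A N I)) (carrier N)"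
    by (rule bij_betw_trans[OF swap_bij assms]) simp_all
  then show ?thesis
    by (rule iffD1[OF bij_betw_cong, rotated]) (simp only: comp_apply xil_op)
qed

context
  assumes bij: "bij_betw (xil I i) (carrier (tensor A N I)) (carrier N)"
begin

lemma hom_inv_xil: "hom_inv (tensor A N I) N (xil I i) \<in> right_hom A N (tensor A N I)"
  by (rule hom_inv_right_hom[OF xil_right_hom bij]) simp

lemma gamma_l_rules:
  "tensor_map A N I N S (ident N) i \<in> right_hom A (tensor A N I) (tensor A N S)"
  "assoc_inv A B N M N \<in> right_hom A (tensor A N S) (tensor B C N)"
  "r_counit A B M N \<epsilon> C \<in> right_hom B (tensor A (tensor B C N) M) C"
  "hom_inv (tensor A N I) N (xil I i) = (\<lambda>n\<in>carrier N. inv_into (carrier (tensor A N I)) (xil I i) n)"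
  by (simp_all add: assoc_inv_right_hom r_counit_right_hom hom_inv_def)

lemma gamma_l_ahom: "gamma_l A B M N \<epsilon> I i \<in> ahom C C"
  unfolding gamma_l_def Let_def gamma_l_rules(4)[symmetric]
  by (intro restrict_ahom ahom_comp[OF tensor_map_ahom ahom_comp[OF tensor_map_ahom
        ahom_comp[OF tensor_map_ahom right_hom_ahom[OF gamma_l_rules(3)]]]])
     (simp_all add: hom_inv_xil gamma_l_rules(1,2))

lemma gamma_l_represents:
  assumes x: "x \<in> carrier I" and n: "n \<in> carrier N" and m: "m \<in> carrier M"
  shows "gamma_l A B M N \<epsilon> I i (nm (ns n (i x)) m) = nm n (sm (i x) m)"
proof -
  let ?NS = "tensor A N S"
  let ?f = "\<lambda>t. r_counit A B M N \<epsilon> C (tensor_map A ?NS M (tensor B C N) M (assoc_inv A B N M N) (ident M) t)"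
  have f: "?f \<in> ahom (tensor A ?NS M) C"
    by (intro ahom_comp[OF tensor_map_ahom right_hom_ahom[OF gamma_l_rules(3)]]) (simp_all add: gamma_l_rules)
  have key: "?f (elem_tensor A ?NS M (elem_tensor A N S n s) m) = nm n (sm s m)" if s: "s \<in> carrier S" for s
  proof (rule S_eqI[OF ahom_comp[OF elem_tensor_ahom_right ahom_comp[OF elem_tensor_ahom_left f]]
        ahom_comp[OF sm_ahom_left nm_ahom_right] _ s])
    fix p q assume pq: "p \<in> carrier M" "q \<in> carrier N"
    have "assoc_inv A B N M N (elem_tensor A N S n (mn p q)) = elem_tensor B C N (nm n p) q"
      using pq n by (simp add: mn_def nm_def)
    moreover have "r_counit A B M N \<epsilon> C (elem_tensor A (tensor B C N) M (elem_tensor B C N (nm n p) q) m)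
        = nm n p \<triangleleft>\<^bsub>C\<^esub> \<epsilon> (nm q m)"
      unfolding nm_def by (rule r_counit_elem) (use pq n m in simp_all)
    ultimately show "?f (elem_tensor A ?NS M (elem_tensor A N S n (mn p q)) m) = nm n (sm (mn p q) m)"
      using pq n m by (simp add: gamma_l_rules)
  qed (use n m in simp_all)
  have "hom_inv (tensor A N I) N (xil I i) (ns n (i x)) = elem_tensor A N I n x"
    using hom_inv_left[OF bij, of "elem_tensor A N I n x"] x n by (simp add: xil_elem)
  then have "gamma_l A B M N \<epsilon> I i (nm (ns n (i x)) m) = ?f (elem_tensor A ?NS M (elem_tensor A N S n (i x)) m)"
    using x n m hom_inv_xil gamma_l_rules(1) unfolding gamma_l_def Let_def gamma_l_rules(4)[symmetric]
    by (simp add: nm_def)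
  with key[of "i x"] x show ?thesis by simp
qed

lemma conj_gamma_l:
  "op.represents (conj_endo (gamma_l A B M N \<epsilon> I i)) (opp_mod I) (opi I i)"
  unfolding op.represents_def
proof (intro ballI)
  fix x m n assume "x \<in> carrier (opp_mod I)" "m \<in> carrier Mo" "n \<in> carrier No"
  then have *: "x \<in> carrier I" "m \<in> carrier M" "n \<in> carrier N" by simp_all
  then have "op.nm m (op.sm (opi I i x) n) = swap A N M (nm (ns n (i x)) m)"
    "op.nm (op.ns m (opi I i x)) n = swap A N M (nm n (sm (i x) m))"
    by (simp_all add: op_sm op_ns swap_nm_op)
  then show "conj_endo (gamma_l A B M N \<epsilon> I i) (op.nm m (op.sm (opi I i x) n)) = op.nm (op.ns m (opi I i x)) n"
    using * by (simp only: conj_endo_swap nm_closed ns_closed Il_rules gamma_l_represents)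
qed

end

end

end

lemma monoid_iso_pullback:
  assumes iso: "monoid_iso G' H' h'"
    and s: "bij_betw s (carrier G) (carrier G')" and e: "bij_betw e (carrier H) (carrier H')"
    and G: "\<And>x y. x \<in> carrier G \<Longrightarrow> y \<in> carrier G \<Longrightarrow> x \<otimes>\<^bsub>G\<^esub> y \<in> carrier G \<and> s (x \<otimes>\<^bsub>G\<^esub> y) = s x \<otimes>\<^bsub>G'\<^esub> s y"
      "\<one>\<^bsub>G\<^esub> \<in> carrier G" "s \<one>\<^bsub>G\<^esub> = \<one>\<^bsub>G'\<^esub>"
    and H: "\<And>x y. x \<in> carrier H \<Longrightarrow> y \<in> carrier H \<Longrightarrow> x \<otimes>\<^bsub>H\<^esub> y \<in> carrier H \<and> e (x \<otimes>\<^bsub>H\<^esub> y) = e x \<otimes>\<^bsub>H'\<^esub> e y"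
      "\<one>\<^bsub>H\<^esub> \<in> carrier H" "e \<one>\<^bsub>H\<^esub> = \<one>\<^bsub>H'\<^esub>"
    and h: "\<And>x. x \<in> carrier G \<Longrightarrow> h x \<in> carrier H \<and> e (h x) = h' (s x)"
  shows "monoid_iso G H h"
proof -
  have mon: "monoid K"
    if K': "monoid K'" and t: "bij_betw t (carrier K) (carrier K')"
    and K: "\<And>x y. x \<in> carrier K \<Longrightarrow> y \<in> carrier K \<Longrightarrow> x \<otimes>\<^bsub>K\<^esub> y \<in> carrier K \<and> t (x \<otimes>\<^bsub>K\<^esub> y) = t x \<otimes>\<^bsub>K'\<^esub> t y"
      "\<one>\<^bsub>K\<^esub> \<in> carrier K" "t \<one>\<^bsub>K\<^esub> = \<one>\<^bsub>K'\<^esub>"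
    for K :: "'x monoid" and K' :: "'y monoid" and t
  proof (rule monoidI)
    interpret K': monoid K' by (rule K')
    note inj = inj_onD[OF bij_betw_imp_inj_on[OF t]]
    have c: "t x \<in> carrier K'" if "x \<in> carrier K" for x using bij_betwE[OF t] that by blast
    fix x y z assume x: "x \<in> carrier K"
    show "\<one>\<^bsub>K\<^esub> \<otimes>\<^bsub>K\<^esub> x = x" "x \<otimes>\<^bsub>K\<^esub> \<one>\<^bsub>K\<^esub> = x" by (rule inj; use x K c in simp)+
    assume y: "y \<in> carrier K"
    show "x \<otimes>\<^bsub>K\<^esub> y \<in> carrier K" using K(1)[OF x y] by simp
    assume z: "z \<in> carrier K"
    show "x \<otimes>\<^bsub>K\<^esub> y \<otimes>\<^bsub>K\<^esub> z = x \<otimes>\<^bsub>K\<^esub> (y \<otimes>\<^bsub>K\<^esub> z)"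
      by (rule inj) (use x y z K(1) c K'.m_assoc in simp_all)
  qed (rule K(2))
  have mG': "monoid G'" and mH': "monoid H'" and hom': "h' \<in> hom G' H'" "bij_betw h' (carrier G') (carrier H')"
    and one': "h' \<one>\<^bsub>G'\<^esub> = \<one>\<^bsub>H'\<^esub>"
    using iso by (auto simp: monoid_iso_def iso_def)
  note inj = inj_onD[OF bij_betw_imp_inj_on[OF e]]
  have sc: "s x \<in> carrier G'" if "x \<in> carrier G" for x using bij_betwE[OF s] that by blast
  have mult: "h (x \<otimes>\<^bsub>G\<^esub> y) = h x \<otimes>\<^bsub>H\<^esub> h y" if "x \<in> carrier G" "y \<in> carrier G" for x y
    by (rule inj) (use that G(1) H(1) h sc hom_mult[OF hom'(1)] in simp_all)
  have one: "h \<one>\<^bsub>G\<^esub> = \<one>\<^bsub>H\<^esub>"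
    by (rule inj) (use G H h one' in simp_all)
  have "bij_betw (h' \<circ> s) (carrier G) (carrier H')" by (rule bij_betw_trans[OF s hom'(2)])
  then have "bij_betw (e \<circ> h) (carrier G) (carrier H')"
    by (rule iffD1[OF bij_betw_cong, rotated]) (use h in simp)
  moreover have "h ` carrier G \<subseteq> carrier H" using h by blast
  ultimately have "bij_betw h (carrier G) (carrier H)"
    using bij_betw_comp_iff2[OF e] by blast
  then show ?thesis
    using mon[OF mG' s G] mon[OF mH' e H] mult one h by (simp add: monoid_iso_def iso_def hom_def)
qed

context firm_adjunction
begin

interpretation op: firm_adjunction Ao Bo No Mo eta_op eps_op
  by (rule opp_adjunction)

abbreviation SR' where "SR' \<equiv> S_ring Ao Bo No Mo eps_op"

lemma SR_tensor: "tensor A SR I = tensor A S I"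
  by (simp add: S_ring_def Let_def)

lemma swapS_inj: "J \<subseteq> carrier S \<Longrightarrow> inj_on (swap B M N) J"
  using inj_on_subset[OF bij_betw_imp_inj_on[OF swapS_rules(3)]] .

lemma l_inv_sub_op:
  fixes I :: "('a, 'a, 'u) bimod" and U :: "'u set"
  assumes I: "firm_bimodule A A I" and i: "i \<in> bimod_hom A A I S" and J: "J \<subseteq> carrier S"
  shows "l_inv_sub U A SR J I i \<longleftrightarrow> r_inv_sub U Ao SR' (swap B M N ` J) (opp_mod I) (opi I i)"
proof -
  note o = opi_rules[OF I i]
  have sub: "i ` carrier I \<subseteq> carrier S" using bimod_hom_closed[OF i] by blast
  have "firm_mono U Ao (opp_mod I) (opi I i) \<longleftrightarrow> firm_mono U A I (opi I i)"
    using firm_mono_opp[of A U I] firm_mono_opp[of Ao U "opp_mod I"] by auto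
  also have "\<dots> \<longleftrightarrow> firm_mono U A I i" by (rule firm_mono_comp[OF swapS_inj[OF sub]])
  finally have mono: "firm_mono U Ao (opp_mod I) (opi I i) \<longleftrightarrow> firm_mono U A I i" .
  have "opi I i ` carrier I = swap B M N ` (i ` carrier I)" by (simp add: image_image)
  then have img: "opi I i ` carrier I = swap B M N ` J \<longleftrightarrow> i ` carrier I = J"
    using inj_on_image_eq_iff[OF swapS_inj[OF subset_refl] sub J] by simp
  have l: "l_inv_sub U A SR J I i \<longleftrightarrow> carrier I \<subseteq> U \<and> firm_mono U A I i \<and> i ` carrier I = J
      \<and> bij_betw (mul I i) (carrier (tensor A S I)) (carrier S)"
    unfolding l_inv_sub_def firm_sub_def S_ring_simps SR_tensor mul_def by (simp only: I i simp_thms conj_assoc)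
  have r: "r_inv_sub U Ao SR' (swap B M N ` J) (opp_mod I) (opi I i)
      \<longleftrightarrow> carrier I \<subseteq> U \<and> firm_mono U Ao (opp_mod I) (opi I i) \<and> opi I i ` carrier I = swap B M N ` J
      \<and> bij_betw (op.mu (opp_mod I) (opi I i)) (carrier (tensor Ao (opp_mod I) S')) (carrier S')"
    unfolding r_inv_sub_def firm_sub_def op.S_ring_simps op.mu_def opp_mod_simps(1) by (simp only: o simp_thms conj_assoc)
  show ?thesis unfolding l r mono img mul_bij_iff[OF I i] ..
qed

lemma ideal_prod_closed: assumes "J \<subseteq> carrier S" "J' \<subseteq> carrier S" shows "ideal_prod SR J J' \<subseteq> carrier S"
proof
  fix s assume "s \<in> ideal_prod SR J J'"
  then show "s \<in> carrier S"
  proof induct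
    case (prod s s')
    then have "s \<in> carrier S" "s' \<in> carrier S" using assms by blast+
    then show ?case by simp
  qed (use abelian_groupE(1)[OF tensor_abelian_group[of B M N]] in simp)
qed

lemma swap_ideal_prod: assumes J: "J \<subseteq> carrier S" "J' \<subseteq> carrier S"
  shows "swap B M N ` ideal_prod SR J J' = ideal_prod SR' (swap B M N ` J') (swap B M N ` J)"
proof (intro subset_antisym subsetI)
  note closed = subsetD[OF ideal_prod_closed[OF J]]
  fix t assume "t \<in> swap B M N ` ideal_prod SR J J'"
  then obtain s where s: "s \<in> ideal_prod SR J J'" "t = swap B M N s" by (elim imageE)
  from s(1) have "swap B M N s \<in> ideal_prod SR' (swap B M N ` J') (swap B M N ` J)"
  proof induct
    case (prod s s')
    then show ?case
      using ideal_prod.prod[of "swap B M N s'" "swap B M N ` J'" "swap B M N s" "swap B M N ` J" SR'] J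
      by (simp add: op_ss subset_iff)
  next
    case (sum s s')
    then show ?case
      using ideal_prod.sum[of "swap B M N s" SR' _ _ "swap B M N s'"] closed
      by (simp add: ahom_add[OF swapS_rules(1)])
  qed
  then show "t \<in> ideal_prod SR' (swap B M N ` J') (swap B M N ` J)" using s(2) by simp
next
  note closed = subsetD[OF ideal_prod_closed[OF J]]
  fix t assume "t \<in> ideal_prod SR' (swap B M N ` J') (swap B M N ` J)"
  then show "t \<in> swap B M N ` ideal_prod SR J J'"
  proof induct
    case (prod t t')
    then obtain s s' where s: "s \<in> J" "s' \<in> J'" "t = swap B M N s'" "t' = swap B M N s" by (elim imageE)
    then have "ss s s' \<in> ideal_prod SR J J'" using ideal_prod.prod[of s J s' J' SR] by simp
    moreover have "s \<in> carrier S" "s' \<in> carrier S" using s J by blast+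
    ultimately show ?case using s(3,4) by (intro image_eqI[of _ _ "ss s s'"]) (simp_all only: op_ss op.S_ring_simps)
  next
    case (sum t t')
    then obtain s s' where s: "s \<in> ideal_prod SR J J'" "s' \<in> ideal_prod SR J J'" "t = swap B M N s" "t' = swap B M N s'"
      by (elim imageE)
    then have "s \<oplus>\<^bsub>S\<^esub> s' \<in> ideal_prod SR J J'" using ideal_prod.sum[of s SR J J' s'] by simp
    then show ?case
      using s closed by (intro image_eqI[of _ _ "s \<oplus>\<^bsub>S\<^esub> s'"]) (simp_all add: ahom_add[OF swapS_rules(1)])
  qed
qed

context
  fixes U :: "'u set"
begin

abbreviation Il where "Il \<equiv> I_l U A B M N \<eta> \<epsilon>"
abbreviation Gl where "Gl \<equiv> Gamma_l U A B M N \<epsilon>"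
abbreviation Ir_op where "Ir_op \<equiv> I_r U Ao Bo No Mo eta_op eps_op"
abbreviation G_op where "G_op \<equiv> Gamma_r U Ao Bo No Mo eps_op"

lemma Il_l_inv_sub: "J \<in> carrier Il \<longleftrightarrow> (\<exists>I i. l_inv_sub U A SR J I i)"
  by (simp add: I_l_def Let_def)

lemma Ir_op_r_inv_sub: "J \<in> carrier Ir_op \<longleftrightarrow> (\<exists>I i. r_inv_sub U Ao SR' J I i)"
  by (simp add: I_r_def Let_def)

lemma l_inv_subD:
  assumes "l_inv_sub U A SR J I i"
  shows "firm_bimodule A A I" "i \<in> bimod_hom A A I S" "J \<subseteq> carrier S" "i ` carrier I = J"
proof -
  show *: "firm_bimodule A A I" "i \<in> bimod_hom A A I S" "i ` carrier I = J"
    using assms unfolding l_inv_sub_def firm_sub_def S_ring_simps by simp_all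
  show "J \<subseteq> carrier S" using bimod_hom_closed[OF *(2)] *(3) by blast
qed

lemma l_inv_sub_inv_pair:
  assumes "l_inv_sub U A SR J I i" shows "op.inv_pair (opp_mod I) (opi I i)"
  using l_inv_sub_op[OF l_inv_subD(1-3)[OF assms]] assms op.r_inv_sub_iff by blast

lemma Il_iff: "J \<in> carrier Il \<longleftrightarrow> J \<subseteq> carrier S \<and> swap B M N ` J \<in> carrier Ir_op"
proof
  assume "J \<in> carrier Il"
  then obtain I i where l: "l_inv_sub U A SR J I i" unfolding Il_l_inv_sub by blast
  then show "J \<subseteq> carrier S \<and> swap B M N ` J \<in> carrier Ir_op"
    using l_inv_sub_op[OF l_inv_subD(1-3)[OF l]] l_inv_subD(3)[OF l] unfolding Ir_op_r_inv_sub by blast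
next
  assume J: "J \<subseteq> carrier S \<and> swap B M N ` J \<in> carrier Ir_op"
  then obtain I' :: "('a, 'a, 'u) bimod" and i' where r: "r_inv_sub U Ao SR' (swap B M N ` J) I' i'"
    unfolding Ir_op_r_inv_sub by blast
  then have fI: "firm_bimodule Ao Ao I'" and hi: "i' \<in> bimod_hom Ao Ao I' S'"
    unfolding r_inv_sub_def firm_sub_def op.S_ring_simps by simp_all
  let ?I = "opp_mod I'" and ?w = "hom_inv S S' (swap B M N)"
  let ?i = "\<lambda>x\<in>carrier ?I. ?w (i' x)"
  have I: "firm_bimodule A A ?I" using firm_bimodule_opp[OF fI] by simp
  have "i' \<in> bimod_hom A A ?I (opp_mod S')" using hi bimod_hom_opp[of A A ?I "opp_mod S'"] by simp
  moreover have "?w \<in> bimod_hom A A (opp_mod S') S"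
    using hom_inv_bimod_hom[OF swapS_rules(4)] swapS_rules(3) by simp
  ultimately have i: "?i \<in> bimod_hom A A ?I S"
    by (rule bimod_hom_comp) (use firm_bimoduleD(1)[OF I] in simp)
  have "opi ?I ?i x = i' x" for x
  proof (cases "x \<in> carrier I'")
    case True
    then show ?thesis using hom_inv_right[OF swapS_rules(3) bimod_hom_closed[OF hi True]] by simp
  next
    case False
    have "i' \<in> extensional (carrier I')" using hi by (simp add: bimod_hom_iff left_hom_iff)
    with False show ?thesis by (simp add: extensional_def)
  qed
  then have "opi ?I ?i = i'" ..
  then show "J \<in> carrier Il"
    using l_inv_sub_op[OF I i conjunct1[OF J]] r unfolding Il_l_inv_sub by auto
qed

lemma Gl_spec:
  assumes J: "J \<in> carrier Il"
  obtains I :: "('a, 'a, 'u) bimod" and i where "l_inv_sub U A SR J I i" "Gl J = gamma_l A B M N \<epsilon> I i"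
proof -
  let ?p = "SOME (I :: ('a, 'a, 'u) bimod, i). l_inv_sub U A SR J I i"
  have "\<exists>p. case p of (I :: ('a, 'a, 'u) bimod, i) \<Rightarrow> l_inv_sub U A SR J I i"
    using J by (auto simp: Il_l_inv_sub)
  then have "case ?p of (I, i) \<Rightarrow> l_inv_sub U A SR J I i" by (rule someI_ex)
  moreover obtain I i where p: "?p = (I, i)" by (cases ?p)
  ultimately have "l_inv_sub U A SR J I i" by simp
  moreover have "Gl J = gamma_l A B M N \<epsilon> I i" unfolding Gamma_l_def p by simp
  ultimately show ?thesis by (rule that)
qed

context
  assumes inf: "infinite U" and AU: "carrier A \<lesssim> U" and rec: "op.reconstructs U"
begin

lemma AU': "carrier Ao \<lesssim> U" using AU by simp

lemma conj_Gl:
  assumes J: "J \<in> carrier Il"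
  shows "Gl J \<in> carrier endos" "conj_endo (Gl J) = G_op (swap B M N ` J)"
proof -
  obtain I :: "('a, 'a, 'u) bimod" and i where l: "l_inv_sub U A SR J I i" and Gl: "Gl J = gamma_l A B M N \<epsilon> I i"
    using Gl_spec[OF J] .
  note I = l_inv_subD[OF l]
  note ip = op.inv_pairD[OF l_inv_sub_inv_pair[OF l], unfolded opp_mod_simps(1)]
  let ?g = "gamma_l A B M N \<epsilon> I i"
  note bij = xil_bij[OF I(1,2) ip(3)]
  note ga = gamma_l_ahom[OF I(1,2) bij] and rep = conj_gamma_l[OF I(1,2) bij]
  have gx: "?g \<in> extensional (carrier C)" by (simp add: gamma_l_def Let_def)
  have ca: "conj_endo ?g \<in> ahom C' C'"
    unfolding conj_endo_def
    by (rule restrict_ahom[OF left_module_abelian[OF bimodule_left[OF opp_C_rules(1)]]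
          ahom_comp[OF swapC'_rules(1) ahom_comp[OF ga swapC_rules(1)]]])
  have cb: "conj_endo ?g \<in> bimod_hom Bo Bo C' C'"
  proof (rule op.represents_bimod_hom[OF ip(1,2) _ ca _ rep])
    show "bij_betw (op.xi (opp_mod I) (opi I i)) (carrier (tensor Ao (opp_mod I) No)) (carrier No)"
      unfolding opp_mod_simps(1) by (rule ip(3))
    show "conj_endo ?g \<in> extensional (carrier C')" unfolding conj_endo_def by (rule restrict_extensional)
  qed
  have J': "swap B M N ` J \<in> carrier Ir_op" using J Il_iff by blast
  have "op.rep_set (conj_endo ?g) (opi I i ` carrier (opp_mod I))"
    using rep unfolding op.represents_iff_rep_set .
  also have "opi I i ` carrier (opp_mod I) = swap B M N ` J"
    unfolding I(4)[symmetric] image_image opp_mod_simps(1) by (rule image_cong[OF refl]) (simp only: restrict_apply')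
  finally have G: "G_op (swap B M N ` J) = conj_endo ?g"
    by (rule op.G_unique[OF inf AU' rec J' cb])
  then show 2: "conj_endo (Gl J) = G_op (swap B M N ` J)" unfolding Gl by (rule sym)
  obtain f where f: "f \<in> carrier endos" "conj_endo f = conj_endo ?g"
    using op.G_spec(1)[OF inf AU' rec J', unfolded G, folded bij_betw_imp_surj_on[OF conj_endo_bij]] by (elim imageE) simp
  have "f = ?g"
  proof (rule extensionalityI)
    show "f \<in> extensional (carrier C)" using f_hom[OF f(1)] by (simp add: bimod_hom_iff left_hom_iff)
    fix c assume c: "c \<in> carrier C"
    then have "swap A N M (f c) = swap A N M (?g c)" by (simp only: f(2) flip: conj_endo_swap)
    then show "f c = ?g c"
      by (rule inj_onD[OF bij_betw_imp_inj_on[OF swapC_rules(3)] _ bimod_hom_closed[OF f_hom[OF f(1)] c] ahom_closed[OF ga c]])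
  qed (rule gx)
  then show "Gl J \<in> carrier endos" using f(1) unfolding Gl by (simp only:)
qed

lemma swap_Il_bij: "bij_betw ((`) (swap B M N)) (carrier Il) (carrier Ir_op)"
  unfolding bij_betw_def
proof (intro conjI subset_antisym subsetI)
  show "inj_on ((`) (swap B M N)) (carrier Il)"
  proof (rule inj_onI)
    fix J J' assume "J \<in> carrier Il" "J' \<in> carrier Il" and eq: "swap B M N ` J = swap B M N ` J'"
    then have "J \<subseteq> carrier S" "J' \<subseteq> carrier S" unfolding Il_iff by simp_all
    then show "J = J'" using eq inj_on_image_eq_iff[OF swapS_inj[OF subset_refl]] by simp
  qed
next
  fix J' assume "J' \<in> (`) (swap B M N) ` carrier Il"
  then obtain J where "J \<in> carrier Il" "J' = swap B M N ` J" by (elim imageE)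
  then show "J' \<in> carrier Ir_op" unfolding Il_iff by simp
next
  fix J' assume J': "J' \<in> carrier Ir_op"
  then obtain I' i' where r: "r_inv_sub U Ao SR' J' I' i'" unfolding Ir_op_r_inv_sub by blast
  then have hi: "i' \<in> bimod_hom Ao Ao I' S'" "i' ` carrier I' = J'"
    unfolding r_inv_sub_def firm_sub_def op.S_ring_simps by simp_all
  have "i' ` carrier I' \<subseteq> carrier S'" by (rule image_subsetI) (rule bimod_hom_closed[OF hi(1)])
  then have "J' \<subseteq> swap B M N ` carrier S"
    unfolding bij_betw_imp_surj_on[OF swapS_rules(3)] hi(2) .
  then obtain J where "J \<subseteq> carrier S" "J' = swap B M N ` J" by (elim subset_imageE)
  then show "J' \<in> (`) (swap B M N) ` carrier Il" using J' by (intro image_eqI[of _ _ J]) (simp_all only: Il_iff simp_thms)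
qed

theorem Gamma_l_iso: "monoid_iso Il endos Gl"
proof (rule monoid_iso_pullback[OF op.Gamma_r_iso[OF inf AU' rec], where s = "(`) (swap B M N)" and e = conj_endo])
  have ops: "mult Il = ideal_prod SR" "one Il = \<eta> ` carrier A"
    unfolding I_l_def Let_def by (simp_all only: monoid.select_convs)
  have ops': "carrier (op_monoid Ir_op) = carrier Ir_op" "x \<otimes>\<^bsub>op_monoid Ir_op\<^esub> y = ideal_prod SR' y x"
    "\<one>\<^bsub>op_monoid Ir_op\<^esub> = eta_op ` carrier A" for x y
    unfolding op_monoid_def I_r_def Let_def by (simp_all only: monoid.select_convs partial_object.select_convs opp_ring_simps(1))
  have eops: "mult endos = compose (carrier C)" "one endos = ident C"
    "mult op.endos = compose (carrier C')" "one op.endos = ident C'"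
    unfolding coring_endo_def Let_def by (simp_all only: monoid.select_convs)
  interpret E: monoid op.endos by (rule op.endos_monoid[OF inf AU' rec])
  show "bij_betw ((`) (swap B M N)) (carrier Il) (carrier (op_monoid Ir_op))"
    unfolding ops' by (rule swap_Il_bij)
  show "bij_betw conj_endo (carrier endos) (carrier op.endos)" by (rule conj_endo_bij)
  have one: "swap B M N ` \<eta> ` carrier A = eta_op ` carrier A"
    unfolding eta_op_def image_image by (rule image_cong[OF refl]) (simp only: restrict_apply')
  then show "swap B M N ` \<one>\<^bsub>Il\<^esub> = \<one>\<^bsub>op_monoid Ir_op\<^esub>" unfolding ops ops' .
  have "\<eta> ` carrier A \<subseteq> carrier S" by (rule image_subsetI) simp
  then show "\<one>\<^bsub>Il\<^esub> \<in> carrier Il"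
    using op.G_one(1)[OF inf AU' rec] unfolding ops Il_iff one opp_ring_simps(1) by (rule conjI)
  show "x \<otimes>\<^bsub>Il\<^esub> y \<in> carrier Il \<and> swap B M N ` (x \<otimes>\<^bsub>Il\<^esub> y) = swap B M N ` x \<otimes>\<^bsub>op_monoid Ir_op\<^esub> swap B M N ` y"
    if "x \<in> carrier Il" "y \<in> carrier Il" for x y
  proof -
    from that have xy: "x \<subseteq> carrier S" "y \<subseteq> carrier S" "swap B M N ` x \<in> carrier Ir_op" "swap B M N ` y \<in> carrier Ir_op"
      unfolding Il_iff by blast+
    show ?thesis
      unfolding ops ops' Il_iff swap_ideal_prod[OF xy(1,2)]
      by (intro conjI refl ideal_prod_closed[OF xy(1,2)] op.G_prod(1)[OF inf AU' rec xy(4,3)])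
  qed
  show one_e: "conj_endo \<one>\<^bsub>endos\<^esub> = \<one>\<^bsub>op.endos\<^esub>"
    unfolding eops conj_endo_def by (rule restrict_ext) (simp add: swapC'_rules(2) swap_swap_C')
  have endoI: "f \<in> carrier endos" if "f \<in> bimod_hom B B C C" "conj_endo f \<in> carrier op.endos" for f
    by (rule iffD1[OF conj_endo_endos[OF that(1)] that(2)])
  have "ident C \<in> bimod_hom B B C C" by simp
  then show "\<one>\<^bsub>endos\<^esub> \<in> carrier endos"
    using one_e E.one_closed unfolding eops(2) by (intro endoI) (simp_all only:)
  show "x \<otimes>\<^bsub>endos\<^esub> y \<in> carrier endos \<and> conj_endo (x \<otimes>\<^bsub>endos\<^esub> y) = conj_endo x \<otimes>\<^bsub>op.endos\<^esub> conj_endo y"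
    if x: "x \<in> carrier endos" and y: "y \<in> carrier endos" for x y
  proof -
    have 1: "conj_endo (x \<otimes>\<^bsub>endos\<^esub> y) = conj_endo x \<otimes>\<^bsub>op.endos\<^esub> conj_endo y"
      unfolding eops by (rule conj_endo_compose[OF f_hom[OF x] f_hom[OF y]])
    have 2: "conj_endo x \<in> carrier op.endos" "conj_endo y \<in> carrier op.endos"
      using bij_betwE[OF conj_endo_bij] x y by blast+
    have "x \<otimes>\<^bsub>endos\<^esub> y \<in> bimod_hom B B C C"
      unfolding eops compose_def by (rule bimod_hom_comp[OF f_hom[OF y] f_hom[OF x]]) simp
    then have "x \<otimes>\<^bsub>endos\<^esub> y \<in> carrier endos"
      by (rule endoI) (unfold 1, rule E.m_closed[OF 2])
    then show ?thesis using 1 by (rule conjI)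
  qed
  show "Gl x \<in> carrier endos \<and> conj_endo (Gl x) = G_op (swap B M N ` x)" if "x \<in> carrier Il" for x
    by (rule conjI[OF conj_Gl[OF that]])
qed

end

end

end

section \<open>The dual bimodule\<close>

lemma dual_module_simps [simp]:
  "carrier (dual_module A B M) = right_hom B M (regular B)"
  "\<zero>\<^bsub>dual_module A B M\<^esub> = (\<lambda>m\<in>carrier M. \<zero>\<^bsub>B\<^esub>)"
  "f \<oplus>\<^bsub>dual_module A B M\<^esub> g = (\<lambda>m\<in>carrier M. f m \<oplus>\<^bsub>B\<^esub> g m)"
  "b \<odot>\<^bsub>dual_module A B M\<^esub> f = (\<lambda>m\<in>carrier M. b \<otimes>\<^bsub>B\<^esub> f m)"
  "f \<triangleleft>\<^bsub>dual_module A B M\<^esub> a = (\<lambda>m\<in>carrier M. f (a \<odot>\<^bsub>M\<^esub> m))"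
  by (simp_all add: dual_module_def)

lemma dual_module_bimodule:
  assumes M: "bimodule A B M" and B: "nonunital_ring B"
  shows "bimodule B A (dual_module A B M)"
proof -
  note Ml = bimodule_left[OF M] and Mr = bimodule_right[OF M]
  interpret B: abelian_group B using B by (simp add: nonunital_ring_def)
  interpret M: abelian_group M using Ml by (rule left_module_abelian)
  note [simp] = smult_closed[OF Ml] rsmult_closed[OF Mr] nonunital_ring_mult_closed[OF B]
  have ring: "(x \<otimes>\<^bsub>B\<^esub> y) \<otimes>\<^bsub>B\<^esub> z = x \<otimes>\<^bsub>B\<^esub> (y \<otimes>\<^bsub>B\<^esub> z)" "(x \<oplus>\<^bsub>B\<^esub> y) \<otimes>\<^bsub>B\<^esub> z = x \<otimes>\<^bsub>B\<^esub> z \<oplus>\<^bsub>B\<^esub> y \<otimes>\<^bsub>B\<^esub> z"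
    "z \<otimes>\<^bsub>B\<^esub> (x \<oplus>\<^bsub>B\<^esub> y) = z \<otimes>\<^bsub>B\<^esub> x \<oplus>\<^bsub>B\<^esub> z \<otimes>\<^bsub>B\<^esub> y"
    if "x \<in> carrier B" "y \<in> carrier B" "z \<in> carrier B" for x y z
    using B that by (auto simp: nonunital_ring_def)
  have ra: "(\<lambda>x. x \<otimes>\<^bsub>B\<^esub> b) \<in> ahom B B" if "b \<in> carrier B" for b
    by (rule ahomI) (use that in \<open>simp_all add: ring\<close>)
  have z: "\<zero>\<^bsub>B\<^esub> \<otimes>\<^bsub>B\<^esub> b = \<zero>\<^bsub>B\<^esub>" if "b \<in> carrier B" for b
    using ahom_zero[OF B.abelian_group_axioms B.abelian_group_axioms ra[OF that]] .
  have neg: "(\<ominus>\<^bsub>B\<^esub> x) \<otimes>\<^bsub>B\<^esub> b = \<ominus>\<^bsub>B\<^esub> (x \<otimes>\<^bsub>B\<^esub> b)" if "x \<in> carrier B" "b \<in> carrier B" for x b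
    using ahom_neg[OF B.abelian_group_axioms B.abelian_group_axioms ra[OF that(2)] that(1)] .
  have sM: "a \<odot>\<^bsub>M\<^esub> (m \<oplus>\<^bsub>M\<^esub> m') = a \<odot>\<^bsub>M\<^esub> m \<oplus>\<^bsub>M\<^esub> a \<odot>\<^bsub>M\<^esub> m'" "(a \<oplus>\<^bsub>A\<^esub> a') \<odot>\<^bsub>M\<^esub> m = a \<odot>\<^bsub>M\<^esub> m \<oplus>\<^bsub>M\<^esub> a' \<odot>\<^bsub>M\<^esub> m"
    if "a \<in> carrier A" "a' \<in> carrier A" "m \<in> carrier M" "m' \<in> carrier M" for a a' m m'
    using Ml that by (auto simp: left_module_def)
  have iff: "f \<in> right_hom B M (regular B) \<longleftrightarrow> f \<in> extensional (carrier M) \<and> (\<forall>m\<in>carrier M. f m \<in> carrier B)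
      \<and> (\<forall>m\<in>carrier M. \<forall>m'\<in>carrier M. f (m \<oplus>\<^bsub>M\<^esub> m') = f m \<oplus>\<^bsub>B\<^esub> f m')
      \<and> (\<forall>b\<in>carrier B. \<forall>m\<in>carrier M. f (m \<triangleleft>\<^bsub>M\<^esub> b) = f m \<otimes>\<^bsub>B\<^esub> b)" for f
    by (auto simp: right_hom_iff ahom_def)
  let ?H = "dual_module A B M"
  have ag: "abelian_group ?H"
  proof (rule abelian_groupI)
    fix f g assume f: "f \<in> carrier ?H"
    show "\<zero>\<^bsub>?H\<^esub> \<oplus>\<^bsub>?H\<^esub> f = f"
      by (rule extensionalityI[of _ "carrier M"]) (use f in \<open>simp_all add: iff\<close>)
    show "\<exists>g\<in>carrier ?H. g \<oplus>\<^bsub>?H\<^esub> f = \<zero>\<^bsub>?H\<^esub>"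
      by (rule bexI[of _ "\<lambda>m\<in>carrier M. \<ominus>\<^bsub>B\<^esub> f m"])
         (use f in \<open>auto simp: iff neg B.minus_add B.l_neg intro!: restrict_ext\<close>)
    assume g: "g \<in> carrier ?H"
    show "f \<oplus>\<^bsub>?H\<^esub> g \<in> carrier ?H" using f g by (simp add: iff ring B.a_ac)
    show "f \<oplus>\<^bsub>?H\<^esub> g = g \<oplus>\<^bsub>?H\<^esub> f" using f g by (auto simp: iff B.a_comm intro!: restrict_ext)
    fix h assume "h \<in> carrier ?H"
    then show "f \<oplus>\<^bsub>?H\<^esub> g \<oplus>\<^bsub>?H\<^esub> h = f \<oplus>\<^bsub>?H\<^esub> (g \<oplus>\<^bsub>?H\<^esub> h)"
      using f g by (auto simp: iff B.a_assoc intro!: restrict_ext)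
  qed (simp add: iff z)
  have "left_module B ?H"
  proof (rule left_moduleI[OF ag])
    fix b assume b: "b \<in> carrier B"
    show "(\<lambda>f. b \<odot>\<^bsub>?H\<^esub> f) \<in> ahom ?H ?H"
      by (rule ahomI) (use b in \<open>auto simp: iff ring intro!: restrict_ext\<close>)
  qed (auto simp: iff ring intro!: restrict_ext)
  moreover have "right_module A ?H"
  proof (rule right_moduleI[OF ag])
    fix a assume a: "a \<in> carrier A"
    show "(\<lambda>f. f \<triangleleft>\<^bsub>?H\<^esub> a) \<in> ahom ?H ?H"
      by (rule ahomI) (use a sM in \<open>auto simp: iff bimodule_commute[OF M, symmetric] intro!: restrict_ext\<close>)
  qed (auto simp: iff sM smult_smult[OF Ml] intro!: restrict_ext)
  ultimately show ?thesis by (auto simp: bimodule_def intro!: restrict_ext)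
qed

section \<open>The right adjoint is \<open>M\<^sup>\<dagger>\<close>\<close>

context firm_adjunction
begin

lemma right_adjoint_transport:
  fixes D :: "('b, 'a, 'd) bimod"
  assumes D: "firm_bimodule B A D" and phi: "\<phi> \<in> bimod_hom B A D N"
    and bij: "bij_betw \<phi> (carrier D) (carrier N)"
  shows "\<exists>\<eta>' \<epsilon>'. right_adjoint A B M D \<eta>' \<epsilon>'"
proof -
  note [simp] = firm_bimoduleD[OF D] phi bimod_hom_left[OF phi] bimod_hom_right[OF phi] bimod_hom_closed[OF phi]
  let ?k = "hom_inv D N \<phi>"
  have k: "?k \<in> bimod_hom B A N D" by (rule hom_inv_bimod_hom[OF phi bij]) simp
  note [simp] = k bimod_hom_left[OF k] bimod_hom_right[OF k] bimod_hom_closed[OF k] hom_inv_left[OF bij] hom_inv_right[OF bij]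
  let ?S = "tensor B M D" and ?C = "tensor A D M"
  let ?u = "tensor_map B M N M D (ident M) ?k" and ?v = "tensor_map A D M N M \<phi> (ident M)"
  define \<eta>' where "\<eta>' = (\<lambda>a\<in>carrier (regular A). ?u (\<eta> a))"
  define \<epsilon>' where "\<epsilon>' = (\<lambda>c\<in>carrier ?C. \<epsilon> (?v c))"
  have eta': "\<eta>' \<in> bimod_hom A A (regular A) ?S"
    unfolding \<eta>'_def by (rule bimod_hom_comp[OF eta_bimod_hom tensor_map_bimod_hom]) simp_all
  have eps': "\<epsilon>' \<in> bimod_hom B B ?C (regular B)"
    unfolding \<epsilon>'_def by (rule bimod_hom_comp[OF tensor_map_bimod_hom eps_bimod_hom]) simp_all
  have eps'_elem: "\<epsilon>' (elem_tensor A D M d m) = \<epsilon> (nm (\<phi> d) m)" if "d \<in> carrier D" "m \<in> carrier M" for d m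
    using that by (simp add: \<epsilon>'_def nm_def)
  have rc: "r_counit A B M D \<epsilon>' M \<in> ahom (tensor A ?S M) M"
    by (rule right_hom_ahom[OF r_counit_right_hom]) (simp_all add: eps')
  have lc: "l_counit A B M D \<epsilon>' D \<in> ahom (tensor A D ?S) D"
    by (rule left_hom_ahom[OF l_counit_left_hom]) (simp_all add: eps')
  have ua: "?u \<in> ahom S ?S" by simp
  have 1: "r_counit A B M D \<epsilon>' M (elem_tensor A ?S M (?u s) m) = sm s m"
    if s: "s \<in> carrier S" and m: "m \<in> carrier M" for s m
  proof (rule S_eqI[OF ahom_comp[OF ua ahom_comp[OF elem_tensor_ahom_left rc]] sm_ahom_left _ s])
    fix p q assume pq: "p \<in> carrier M" "q \<in> carrier N"
    have "r_counit A B M D \<epsilon>' M (elem_tensor A ?S M (elem_tensor B M D p (?k q)) m)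
        = p \<triangleleft>\<^bsub>M\<^esub> \<epsilon>' (elem_tensor A D M (?k q) m)"
      by (rule r_counit_elem) (use pq m eps' in simp_all)
    then show "r_counit A B M D \<epsilon>' M (elem_tensor A ?S M (?u (mn p q)) m) = sm (mn p q) m"
      using pq m by (simp add: eps'_elem, simp add: mn_def)
  qed (use m in simp_all)
  have 2: "l_counit A B M D \<epsilon>' D (elem_tensor A D ?S d (?u s)) = ?k (ns (\<phi> d) s)"
    if s: "s \<in> carrier S" and d: "d \<in> carrier D" for s d
  proof (rule S_eqI[OF ahom_comp[OF ua ahom_comp[OF elem_tensor_ahom_right lc]] ahom_comp[OF ns_ahom_right bimod_hom_ahom[OF k]] _ s])
    fix p q assume pq: "p \<in> carrier M" "q \<in> carrier N"
    have "l_counit A B M D \<epsilon>' D (elem_tensor A D ?S d (elem_tensor B M D p (?k q)))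
        = \<epsilon>' (elem_tensor A D M d p) \<odot>\<^bsub>D\<^esub> ?k q"
      by (rule l_counit_elem) (use pq d eps' in simp_all)
    then show "l_counit A B M D \<epsilon>' D (elem_tensor A D ?S d (?u (mn p q))) = ?k (ns (\<phi> d) (mn p q))"
      using pq d left_hom_smult[OF bimod_hom_left[OF k], of "\<epsilon> (nm (\<phi> d) p)" q]
      by (simp add: eps'_elem, simp add: mn_def)
  qed (use d in simp_all)
  have t1: "r_counit A B M D \<epsilon>' M (tensor_map A (regular A) M ?S M \<eta>' (ident M) (lact_inv A M m)) = m"
    if m: "m \<in> carrier M" for m
  proof (rule firm_left_eqI[of A M _ M, OF _ _ ahom_comp[OF left_hom_ahom[OF lact_inv_left_hom] ahom_comp[OF tensor_map_ahom rc]] ahom_ident _ m])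
    fix a m assume am: "a \<in> carrier A" "m \<in> carrier M"
    then have "tensor_map A (regular A) M ?S M \<eta>' (ident M) (lact_inv A M (a \<odot>\<^bsub>M\<^esub> m)) = elem_tensor A ?S M (?u (\<eta> a)) m"
      using bimod_hom_right[OF eta'] by (simp add: lact_inv_smult) (simp add: \<eta>'_def)
    then show "r_counit A B M D \<epsilon>' M (tensor_map A (regular A) M ?S M \<eta>' (ident M) (lact_inv A M (a \<odot>\<^bsub>M\<^esub> m))) = a \<odot>\<^bsub>M\<^esub> m"
      using 1[of "\<eta> a" m] am by simp
  qed (use bimod_hom_right[OF eta'] in simp_all)
  have t2: "l_counit A B M D \<epsilon>' D (tensor_map A D (regular A) D ?S (ident D) \<eta>' (ract_inv A D d)) = d"
    if d: "d \<in> carrier D" for d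
  proof (rule firm_right_eqI[of A D _ D, OF _ _ ahom_comp[OF right_hom_ahom[OF ract_inv_right_hom] ahom_comp[OF tensor_map_ahom lc]] ahom_ident _ d])
    fix d a assume ad: "d \<in> carrier D" "a \<in> carrier A"
    then have "tensor_map A D (regular A) D ?S (ident D) \<eta>' (ract_inv A D (d \<triangleleft>\<^bsub>D\<^esub> a)) = elem_tensor A D ?S d (?u (\<eta> a))"
      using bimod_hom_left[OF eta'] by (simp add: ract_inv_rsmult) (simp add: \<eta>'_def)
    moreover have "?k (\<phi> d \<triangleleft>\<^bsub>N\<^esub> a) = d \<triangleleft>\<^bsub>D\<^esub> a"
      using right_hom_rsmult[OF bimod_hom_right[OF k], of a "\<phi> d"] ad by simp
    ultimately show "l_counit A B M D \<epsilon>' D (tensor_map A D (regular A) D ?S (ident D) \<eta>' (ract_inv A D (d \<triangleleft>\<^bsub>D\<^esub> a))) = d \<triangleleft>\<^bsub>D\<^esub> a"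
      using 2[of "\<eta> a" d] ad by simp
  qed (use bimod_hom_left[OF eta'] in simp_all)
  have "right_adjoint A B M D \<eta>' \<epsilon>'"
    unfolding right_adjoint_def using D eta' eps' t1 t2 by simp
  then show ?thesis by blast
qed

abbreviation H where "H \<equiv> dual_module A B M"
abbreviation BH where "BH \<equiv> tensor B (regular B) H"
abbreviation MD where "MD \<equiv> tensor A BH (regular A)"

lemma H_rules [simp]: "bimodule B A H" "left_module B H" "right_module A H"
  using dual_module_bimodule[OF firm_bimoduleD(1)[OF firm_M] firm_ring_nonunital[OF firm_B]]
  by (auto intro: bimodule_left bimodule_right)

lemma regular_rules [simp]: "bimodule A A (regular A)" "bimodule B B (regular B)"
  "right_module A (regular A)" "left_module A (regular A)" "right_module B (regular B)" "left_module B (regular B)"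
  using firm_bimoduleD(1-3)[OF firm_ring_bimodule[OF firm_A]] firm_bimoduleD(1-3)[OF firm_ring_bimodule[OF firm_B]] by auto

lemma BH_rules [simp]: "bimodule B A BH" "left_module B BH" "right_module A BH"
  by (rule tensor_bimodule tensor_left_module tensor_right_module; simp)+

lemma MD_bimodule: "bimodule B A MD"
  by (rule tensor_bimodule) simp_all

text \<open>\<open>(f \<otimes> N)(s)\<close> for \<open>s \<in> M \<otimes>\<^sub>B N\<close>, under \<open>B \<otimes>\<^sub>B N \<cong> N\<close>.\<close>

definition ev where "ev f s = lact B N (tensor_map B M N (regular B) N f (ident N) s)"

lemma ev_mn: "f \<in> right_hom B M (regular B) \<Longrightarrow> p \<in> carrier M \<Longrightarrow> q \<in> carrier N \<Longrightarrow> ev f (mn p q) = f p \<odot>\<^bsub>N\<^esub> q"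
  using right_hom_closed[of f B M "regular B" p] by (simp add: ev_def mn_def)

lemma ev_ahom_right: "f \<in> right_hom B M (regular B) \<Longrightarrow> (\<lambda>s. ev f s) \<in> ahom S N"
  unfolding ev_def by (rule ahom_comp[OF tensor_map_ahom lact_ahom]) simp_all

lemma ev_closed: "f \<in> right_hom B M (regular B) \<Longrightarrow> s \<in> carrier S \<Longrightarrow> ev f s \<in> carrier N"
  by (rule ahom_closed[OF ev_ahom_right])

lemma H_closed: "f \<in> right_hom B M (regular B) \<Longrightarrow> m \<in> carrier M \<Longrightarrow> f m \<in> carrier B"
  using right_hom_closed[of f B M "regular B" m] by simp

lemma H_ops:
  "f \<in> right_hom B M (regular B) \<Longrightarrow> g \<in> right_hom B M (regular B) \<Longrightarrow> (\<lambda>m\<in>carrier M. f m \<oplus>\<^bsub>B\<^esub> g m) \<in> right_hom B M (regular B)"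
  "b \<in> carrier B \<Longrightarrow> f \<in> right_hom B M (regular B) \<Longrightarrow> (\<lambda>m\<in>carrier M. b \<otimes>\<^bsub>B\<^esub> f m) \<in> right_hom B M (regular B)"
  "a \<in> carrier A \<Longrightarrow> f \<in> right_hom B M (regular B) \<Longrightarrow> (\<lambda>m\<in>carrier M. f (a \<odot>\<^bsub>M\<^esub> m)) \<in> right_hom B M (regular B)"
  using abelian_groupE(1)[OF left_module_abelian[OF H_rules(2)], of f g] smult_closed[OF H_rules(2), of b f]
    rsmult_closed[OF H_rules(3), of f a] by simp_all

lemma ev_ahom_left: assumes s: "s \<in> carrier S" shows "(\<lambda>f. ev f s) \<in> ahom H N"
proof (rule ahomI; (unfold dual_module_simps)?)
  fix f g assume f: "f \<in> right_hom B M (regular B)"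
  show "ev f s \<in> carrier N" by (rule ev_closed[OF f s])
  assume g: "g \<in> right_hom B M (regular B)"
  note h = H_ops(1)[OF f g]
  show "ev (\<lambda>m\<in>carrier M. f m \<oplus>\<^bsub>B\<^esub> g m) s = ev f s \<oplus>\<^bsub>N\<^esub> ev g s"
  proof (rule S_eqI[OF ev_ahom_right[OF h] ahom_plus[OF _ ev_ahom_right[OF f] ev_ahom_right[OF g]] _ s])
    fix p q assume pq: "p \<in> carrier M" "q \<in> carrier N"
    have "(f p \<oplus>\<^bsub>B\<^esub> g p) \<odot>\<^bsub>N\<^esub> q = f p \<odot>\<^bsub>N\<^esub> q \<oplus>\<^bsub>N\<^esub> g p \<odot>\<^bsub>N\<^esub> q"
      using firm_bimoduleD(2)[OF firm_N] H_closed[OF f pq(1)] H_closed[OF g pq(1)] pq(2)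
      unfolding left_module_def by blast
    then show "ev (\<lambda>m\<in>carrier M. f m \<oplus>\<^bsub>B\<^esub> g m) (mn p q) = ev f (mn p q) \<oplus>\<^bsub>N\<^esub> ev g (mn p q)"
      by (simp only: ev_mn[OF f pq] ev_mn[OF g pq] ev_mn[OF h pq] restrict_apply' pq(1))
  qed (rule left_module_abelian[of B], simp)
qed

lemma ev_smult: assumes b: "b \<in> carrier B" and f: "f \<in> right_hom B M (regular B)" and s: "s \<in> carrier S"
  shows "ev (b \<odot>\<^bsub>H\<^esub> f) s = b \<odot>\<^bsub>N\<^esub> ev f s"
  unfolding dual_module_simps
proof (rule S_eqI[OF ev_ahom_right[OF H_ops(2)[OF b f]] ahom_comp[OF ev_ahom_right[OF f] smult_ahom] _ s])
  fix p q assume "p \<in> carrier M" "q \<in> carrier N"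
  then show "ev (\<lambda>m\<in>carrier M. b \<otimes>\<^bsub>B\<^esub> f m) (mn p q) = b \<odot>\<^bsub>N\<^esub> ev f (mn p q)"
    using H_closed[OF f] b by (simp add: ev_mn f H_ops(2)[OF b f] smult_smult[OF firm_bimoduleD(2)[OF firm_N]])
qed (use b in simp_all)

lemma ev_balanced: assumes a: "a \<in> carrier A" and f: "f \<in> right_hom B M (regular B)" and s: "s \<in> carrier S"
  shows "ev (f \<triangleleft>\<^bsub>H\<^esub> a) s = ev f (a \<odot>\<^bsub>S\<^esub> s)"
  unfolding dual_module_simps
proof (rule S_eqI[OF ev_ahom_right[OF H_ops(3)[OF a f]] ahom_comp[OF smult_ahom ev_ahom_right[OF f]] _ s])
  fix p q assume "p \<in> carrier M" "q \<in> carrier N"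
  then show "ev (\<lambda>m\<in>carrier M. f (a \<odot>\<^bsub>M\<^esub> m)) (mn p q) = ev f (a \<odot>\<^bsub>S\<^esub> mn p q)"
    using a by (simp add: ev_mn f H_ops(3)[OF a f])
qed (use a in simp_all)

lemma ev_rsmult: assumes a: "a \<in> carrier A" and f: "f \<in> right_hom B M (regular B)" and s: "s \<in> carrier S"
  shows "ev f (s \<triangleleft>\<^bsub>S\<^esub> a) = ev f s \<triangleleft>\<^bsub>N\<^esub> a"
proof (rule S_eqI[OF ahom_comp[OF rsmult_ahom ev_ahom_right[OF f]] ahom_comp[OF ev_ahom_right[OF f] rsmult_ahom] _ s])
  fix p q assume "p \<in> carrier M" "q \<in> carrier N"
  then show "ev f (mn p q \<triangleleft>\<^bsub>S\<^esub> a) = ev f (mn p q) \<triangleleft>\<^bsub>N\<^esub> a"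
    using a H_closed[OF f] by (simp add: ev_mn f)
qed (use a in simp_all)

lemma eps_ev: assumes f: "f \<in> right_hom B M (regular B)" and s: "s \<in> carrier S" and m: "m \<in> carrier M"
  shows "\<epsilon> (nm (ev f s) m) = f (sm s m)"
proof (rule S_eqI[OF ahom_comp[OF ev_ahom_right[OF f] ahom_comp[OF nm_ahom_left eps_ahom]] ahom_comp[OF sm_ahom_left right_hom_ahom[OF f]] _ s])
  fix p q assume pq: "p \<in> carrier M" "q \<in> carrier N"
  have "\<epsilon> (f p \<odot>\<^bsub>C\<^esub> nm q m) = f p \<otimes>\<^bsub>B\<^esub> \<epsilon> (nm q m)"
    by (rule eps_smult(1)) (use pq m H_closed[OF f] in simp_all)
  moreover have "f (p \<triangleleft>\<^bsub>M\<^esub> \<epsilon> (nm q m)) = f p \<otimes>\<^bsub>B\<^esub> \<epsilon> (nm q m)"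
    using right_hom_rsmult[OF f, of "\<epsilon> (nm q m)" p] pq m by simp
  ultimately show "\<epsilon> (nm (ev f (mn p q)) m) = f (sm (mn p q) m)"
    using pq m H_closed[OF f] by (simp add: ev_mn f)
qed (use m in simp_all)

definition to_dual where "to_dual = (\<lambda>n\<in>carrier N. \<lambda>m\<in>carrier M. \<epsilon> (nm n m))"

lemma to_dual_closed: "n \<in> carrier N \<Longrightarrow> to_dual n \<in> right_hom B M (regular B)"
  unfolding right_hom_iff to_dual_def
  by (auto intro!: restrict_ahom ahom_comp[OF nm_ahom_right eps_ahom] simp flip: nm_smult(2))

lemma to_dual_bimod_hom: "to_dual \<in> bimod_hom B A N H"
proof -
  have "to_dual \<in> ahom N H"
  proof (rule ahomI; (unfold dual_module_simps)?)
    fix n n' assume n: "n \<in> carrier N" "n' \<in> carrier N"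
    then have "n \<oplus>\<^bsub>N\<^esub> n' \<in> carrier N"
      using abelian_groupE(1)[OF left_module_abelian[of B N]] by simp
    then show "to_dual (n \<oplus>\<^bsub>N\<^esub> n') = (\<lambda>m\<in>carrier M. to_dual n m \<oplus>\<^bsub>B\<^esub> to_dual n' m)"
      using n by (auto simp: to_dual_def ahom_add[OF nm_ahom_left] ahom_add[OF eps_ahom] intro!: restrict_ext)
  qed (rule to_dual_closed)
  moreover have "to_dual (b \<odot>\<^bsub>N\<^esub> n) = b \<odot>\<^bsub>H\<^esub> to_dual n" if "b \<in> carrier B" "n \<in> carrier N" for b n
    unfolding dual_module_simps using that by (auto simp: to_dual_def intro!: restrict_ext simp flip: nm_smult(1))
  moreover have "to_dual (n \<triangleleft>\<^bsub>N\<^esub> a) = to_dual n \<triangleleft>\<^bsub>H\<^esub> a" if "a \<in> carrier A" "n \<in> carrier N" for a n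
    unfolding dual_module_simps using that by (auto simp: to_dual_def intro!: restrict_ext)
  ultimately show ?thesis
    by (simp only: bimod_hom_iff left_hom_iff right_hom_iff) (simp add: to_dual_def)
qed

lemma ev_to_dual: assumes n: "n \<in> carrier N" and s: "s \<in> carrier S" shows "ev (to_dual n) s = ns n s"
proof (rule S_eqI[OF ev_ahom_right[OF to_dual_closed[OF n]] ns_ahom_right[OF n] _ s])
  fix p q assume "p \<in> carrier M" "q \<in> carrier N"
  then show "ev (to_dual n) (mn p q) = ns n (mn p q)"
    using n by (simp add: ev_mn[OF to_dual_closed[OF n]]) (simp add: to_dual_def)
qed

lemma to_dual_ev: assumes f: "f \<in> right_hom B M (regular B)" and a: "a \<in> carrier A"
  shows "to_dual (ev f (\<eta> a)) = f \<triangleleft>\<^bsub>H\<^esub> a"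
  unfolding dual_module_simps
  using ev_closed[OF f eta_closed[OF a]] eps_ev[OF f eta_closed[OF a]] a
  by (auto simp: to_dual_def intro!: restrict_ext)

definition from_dagger where
  "from_dagger = (\<lambda>t\<in>carrier MD. tensor_lift N (\<lambda>u a. ev (lact B H u) (\<eta> a)) t)"

lemma lact_H: "u \<in> carrier BH \<Longrightarrow> lact B H u \<in> right_hom B M (regular B)"
  using ahom_closed[OF lact_ahom[of B H]] by simp

lemma from_dagger_balanced: "balanced A BH (regular A) N (\<lambda>u a. ev (lact B H u) (\<eta> a))"
proof (rule balancedI)
  fix a assume "a \<in> carrier (regular A)"
  then show "(\<lambda>u. ev (lact B H u) (\<eta> a)) \<in> ahom BH N"
    by (intro ahom_comp[OF lact_ahom ev_ahom_left]) simp_all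
next
  fix u assume "u \<in> carrier BH"
  then have "(\<lambda>a. ev (lact B H u) (\<eta> a)) \<in> ahom A N"
    by (intro ahom_comp[OF eta_ahom ev_ahom_right] lact_H)
  then show "(\<lambda>a. ev (lact B H u) (\<eta> a)) \<in> ahom (regular A) N" by (simp add: ahom_def)
next
  fix u c a assume u: "u \<in> carrier BH" and c: "c \<in> carrier A" and "a \<in> carrier (regular A)"
  then have a: "a \<in> carrier A" by simp
  have "lact B H (u \<triangleleft>\<^bsub>BH\<^esub> c) = lact B H u \<triangleleft>\<^bsub>H\<^esub> c"
    by (rule right_hom_rsmult[OF lact_right_hom _ u]) (use c in simp_all)
  then show "ev (lact B H (u \<triangleleft>\<^bsub>BH\<^esub> c)) (\<eta> a) = ev (lact B H u) (\<eta> (c \<odot>\<^bsub>regular A\<^esub> a))"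
    using a c by (simp only: ev_balanced[OF c lact_H[OF u] eta_closed[OF a]] regular_simps eta_mult(1))
qed

lemma from_dagger_elem: "u \<in> carrier BH \<Longrightarrow> a \<in> carrier A \<Longrightarrow>
    from_dagger (elem_tensor A BH (regular A) u a) = ev (lact B H u) (\<eta> a)"
  by (simp add: from_dagger_def tensor_lift_elem[OF _ _ _ from_dagger_balanced] left_module_abelian[of B])

lemma from_dagger_ahom: "from_dagger \<in> ahom MD N"
  unfolding from_dagger_def
  by (intro restrict_ahom tensor_lift_ahom[OF _ _ _ from_dagger_balanced]) (simp_all add: left_module_abelian[of B])

lemma from_dagger_bimod_hom: "from_dagger \<in> bimod_hom B A MD N"
  unfolding bimod_hom_iff left_hom_iff right_hom_iff
proof (intro conjI ballI from_dagger_ahom)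
  fix b t assume b: "b \<in> carrier B" and t: "t \<in> carrier MD"
  show "from_dagger (b \<odot>\<^bsub>MD\<^esub> t) = b \<odot>\<^bsub>N\<^esub> from_dagger t"
  proof (rule tensor_eqI[OF _ _ ahom_comp[OF smult_ahom[OF bimodule_left[OF MD_bimodule] b] from_dagger_ahom]
        ahom_comp[OF from_dagger_ahom smult_ahom] _ t])
    fix u a assume u: "u \<in> carrier BH" and "a \<in> carrier (regular A)"
    then have a: "a \<in> carrier A" by simp
    have "b \<odot>\<^bsub>MD\<^esub> elem_tensor A BH (regular A) u a = elem_tensor A BH (regular A) (b \<odot>\<^bsub>BH\<^esub> u) a"
      by (rule tensor_smult_elem) (use b u a in simp_all)
    moreover have "lact B H (b \<odot>\<^bsub>BH\<^esub> u) = b \<odot>\<^bsub>H\<^esub> lact B H u"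
      by (rule left_hom_smult[OF lact_left_hom _ u]) (use b in simp_all)
    ultimately show "from_dagger (b \<odot>\<^bsub>MD\<^esub> elem_tensor A BH (regular A) u a) = b \<odot>\<^bsub>N\<^esub> from_dagger (elem_tensor A BH (regular A) u a)"
      using smult_closed[OF BH_rules(2) b u]
      by (simp only: from_dagger_elem[OF _ a] u ev_smult[OF b lact_H[OF u] eta_closed[OF a]])
  qed (use b in simp_all)
next
  fix c t assume c: "c \<in> carrier A" and t: "t \<in> carrier MD"
  show "from_dagger (t \<triangleleft>\<^bsub>MD\<^esub> c) = from_dagger t \<triangleleft>\<^bsub>N\<^esub> c"
  proof (rule tensor_eqI[OF _ _ ahom_comp[OF rsmult_ahom[OF bimodule_right[OF MD_bimodule] c] from_dagger_ahom]
        ahom_comp[OF from_dagger_ahom rsmult_ahom] _ t])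
    fix u a assume u: "u \<in> carrier BH" and "a \<in> carrier (regular A)"
    then have a: "a \<in> carrier A" by simp
    have "elem_tensor A BH (regular A) u a \<triangleleft>\<^bsub>MD\<^esub> c = elem_tensor A BH (regular A) u (a \<otimes>\<^bsub>A\<^esub> c)"
      by (subst tensor_rsmult_elem) (use c u a in simp_all)
    moreover have ac: "a \<otimes>\<^bsub>A\<^esub> c \<in> carrier A" using a c by simp
    ultimately show "from_dagger (elem_tensor A BH (regular A) u a \<triangleleft>\<^bsub>MD\<^esub> c) = from_dagger (elem_tensor A BH (regular A) u a) \<triangleleft>\<^bsub>N\<^esub> c"
      by (simp only: from_dagger_elem[OF u a] from_dagger_elem[OF u ac] eta_mult(2)[OF a c] ev_rsmult[OF c lact_H[OF u] eta_closed[OF a]])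
  qed (use c in simp_all)
qed (simp_all add: from_dagger_def)

definition to_dagger where
  "to_dagger n = tensor_map A (tensor B (regular B) N) (regular A) BH (regular A)
      (tensor_map B (regular B) N (regular B) H (ident (regular B)) to_dual) (ident (regular A))
      (tensor_map A N (regular A) (tensor B (regular B) N) (regular A) (lact_inv B N) (ident (regular A)) (ract_inv A N n))"

lemma to_dagger_homs [simp]: "to_dual \<in> bimod_hom B A N H" "to_dual \<in> left_hom B N H" "to_dual \<in> right_hom A N H"
  "lact_inv B N \<in> right_hom A N (tensor B (regular B) N)" "ract_inv A N \<in> right_hom A N (tensor A N (regular A))"
  using to_dual_bimod_hom bimod_hom_left[OF to_dual_bimod_hom] bimod_hom_right[OF to_dual_bimod_hom]
    lact_inv_right_hom[of B N A] ract_inv_right_hom[of A N] by auto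

lemma to_dagger_ahom: "to_dagger \<in> ahom N MD"
  unfolding to_dagger_def[abs_def]
  by (rule ahom_comp[OF right_hom_ahom[OF to_dagger_homs(5)] ahom_comp[OF tensor_map_ahom tensor_map_ahom]]) simp_all

lemma to_dagger_elem:
  assumes b: "b \<in> carrier B" and n: "n \<in> carrier N" and a: "a \<in> carrier A"
  shows "to_dagger ((b \<odot>\<^bsub>N\<^esub> n) \<triangleleft>\<^bsub>N\<^esub> a) = elem_tensor A BH (regular A) (elem_tensor B (regular B) H b (to_dual n)) a"
proof -
  have bn: "b \<odot>\<^bsub>N\<^esub> n \<in> carrier N" using b n by simp
  have "ract_inv A N ((b \<odot>\<^bsub>N\<^esub> n) \<triangleleft>\<^bsub>N\<^esub> a) = elem_tensor A N (regular A) (b \<odot>\<^bsub>N\<^esub> n) a"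
    by (rule ract_inv_rsmult) (use bn a in simp_all)
  moreover have "lact_inv B N (b \<odot>\<^bsub>N\<^esub> n) = elem_tensor B (regular B) N b n"
    by (rule lact_inv_smult) (use b n in simp_all)
  ultimately show ?thesis
    using bn b n a by (simp add: to_dagger_def del: rsmult_closed)
qed

lemma from_to_dagger: assumes n: "n \<in> carrier N" shows "from_dagger (to_dagger n) = n"
proof (rule firm_right_eqI[of A N _ N, OF _ _ ahom_comp[OF to_dagger_ahom from_dagger_ahom] ahom_ident _ n])
  fix n a assume n: "n \<in> carrier N" and a: "a \<in> carrier A"
  show "from_dagger (to_dagger (n \<triangleleft>\<^bsub>N\<^esub> a)) = n \<triangleleft>\<^bsub>N\<^esub> a"
  proof (rule firm_left_eqI[of B N _ N, OF _ _ ahom_comp[OF rsmult_ahom ahom_comp[OF to_dagger_ahom from_dagger_ahom]] rsmult_ahom _ n])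
    fix b n assume b: "b \<in> carrier B" and n: "n \<in> carrier N"
    note f = to_dual_closed[OF n]
    have l: "lact B H (elem_tensor B (regular B) H b (to_dual n)) = b \<odot>\<^bsub>H\<^esub> to_dual n"
      by (rule lact_elem) (use b f in simp_all)
    have u: "elem_tensor B (regular B) H b (to_dual n) \<in> carrier BH" using b f by simp
    show "from_dagger (to_dagger ((b \<odot>\<^bsub>N\<^esub> n) \<triangleleft>\<^bsub>N\<^esub> a)) = (b \<odot>\<^bsub>N\<^esub> n) \<triangleleft>\<^bsub>N\<^esub> a"
      unfolding to_dagger_elem[OF b n a] from_dagger_elem[OF u a] l ev_smult[OF b f eta_closed[OF a]]
        ev_to_dual[OF n eta_closed[OF a]] using a b n by simp
  qed (use a in simp_all)
qed simp_all

lemma to_from_dagger: assumes t: "t \<in> carrier MD" shows "to_dagger (from_dagger t) = t"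
proof -
  note tf = ahom_comp[OF from_dagger_ahom to_dagger_ahom]
  show ?thesis
  proof (rule tensor_eqI[OF _ _ tf ahom_ident _ t])
    fix u a assume u: "u \<in> carrier BH" and a: "a \<in> carrier (regular A)"
    show "to_dagger (from_dagger (elem_tensor A BH (regular A) u a)) = elem_tensor A BH (regular A) u a"
    proof (rule firm_right_eqI[of A "regular A", OF _ _ ahom_comp[OF elem_tensor_ahom_right tf] elem_tensor_ahom_right _ a])
      fix x y assume "x \<in> carrier (regular A)" and y: "y \<in> carrier A"
      then have x: "x \<in> carrier A" by simp
      then have xy: "x \<otimes>\<^bsub>A\<^esub> y \<in> carrier A" using y by simp
      show "to_dagger (from_dagger (elem_tensor A BH (regular A) u (x \<triangleleft>\<^bsub>regular A\<^esub> y))) = elem_tensor A BH (regular A) u (x \<triangleleft>\<^bsub>regular A\<^esub> y)"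
      proof (rule tensor_eqI[OF _ _ ahom_comp[OF elem_tensor_ahom_left tf] elem_tensor_ahom_left _ u])
        fix b f assume "b \<in> carrier (regular B)" and "f \<in> carrier H"
        then have b: "b \<in> carrier B" and f: "f \<in> right_hom B M (regular B)" by simp_all
        have v: "elem_tensor B (regular B) H b f \<in> carrier BH" using b f by simp
        have e: "ev f (\<eta> x) \<in> carrier N" by (rule ev_closed[OF f eta_closed[OF x]])
        have l: "lact B H (elem_tensor B (regular B) H b f) = b \<odot>\<^bsub>H\<^esub> f" by (rule lact_elem) (use b f in simp_all)
        have r: "elem_tensor B (regular B) H b (f \<triangleleft>\<^bsub>H\<^esub> x) = elem_tensor B (regular B) H b f \<triangleleft>\<^bsub>BH\<^esub> x"
          by (rule tensor_rsmult_elem[symmetric]) (use b f x in simp_all)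
        have "from_dagger (elem_tensor A BH (regular A) (elem_tensor B (regular B) H b f) (x \<otimes>\<^bsub>A\<^esub> y))
            = (b \<odot>\<^bsub>N\<^esub> ev f (\<eta> x)) \<triangleleft>\<^bsub>N\<^esub> y"
          unfolding from_dagger_elem[OF v xy] l ev_smult[OF b f eta_closed[OF xy]]
          unfolding eta_mult(2)[OF x y]
            ev_rsmult[OF y f eta_closed[OF x]] using b e y by simp
        then have "to_dagger (from_dagger (elem_tensor A BH (regular A) (elem_tensor B (regular B) H b f) (x \<otimes>\<^bsub>A\<^esub> y)))
            = elem_tensor A BH (regular A) (elem_tensor B (regular B) H b f \<triangleleft>\<^bsub>BH\<^esub> x) y"
          by (simp only: to_dagger_elem[OF b e y] to_dual_ev[OF f x] r)
        also have "\<dots> = elem_tensor A BH (regular A) (elem_tensor B (regular B) H b f) (x \<odot>\<^bsub>regular A\<^esub> y)"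
          by (rule elem_tensor_balanced) (use v x y in simp_all)
        finally show "to_dagger (from_dagger (elem_tensor A BH (regular A) (elem_tensor B (regular B) H b f) (x \<triangleleft>\<^bsub>regular A\<^esub> y)))
            = elem_tensor A BH (regular A) (elem_tensor B (regular B) H b f) (x \<triangleleft>\<^bsub>regular A\<^esub> y)"
          by (simp only: regular_simps)
      qed (use x y in simp_all)
    qed (use u firm_ring_right[OF firm_A] in simp_all)
  qed simp_all
qed

theorem dagger_right_adjoint: "\<exists>\<eta>' \<epsilon>'. right_adjoint A B M (dagger A B M) \<eta>' \<epsilon>'"
proof -
  have bij: "bij_betw from_dagger (carrier MD) (carrier N)"
    by (rule bij_betw_byWitness[where f' = to_dagger])
       (intro ballI to_from_dagger from_to_dagger image_subsetI ahom_closed[OF from_dagger_ahom] ahom_closed[OF to_dagger_ahom]; assumption)+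
  have "firm_bimodule B A MD"
    by (rule firm_bimodule_iso[OF firm_N MD_bimodule _ _ hom_inv_bimod_hom[OF from_dagger_bimod_hom bij MD_bimodule]
          hom_inv_bij[OF bij]]) simp_all
  then show ?thesis unfolding dagger_def by (rule right_adjoint_transport[OF _ from_dagger_bimod_hom bij])
qed

end

context firm_adjunction
begin

interpretation op: firm_adjunction Ao Bo No Mo eta_op eps_op
  by (rule opp_adjunction)

context
  fixes U :: "'u set"
  assumes inf: "infinite U" and AU: "carrier A \<lesssim> U" and MU: "carrier M \<lesssim> U" and NU: "carrier N \<lesssim> U"
begin

lemma Gamma_r_comonadic:
  "r_comonadic U A B M N \<eta> \<epsilon> \<Longrightarrow>
     monoid_iso (op_monoid (I_r U A B M N \<eta> \<epsilon>)) (coring_endo A B M N \<eta> \<epsilon>) (Gamma_r U A B M N \<epsilon>)"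
  by (rule Gamma_r_iso[OF inf AU comonadic_reconstructs[OF inf AU MU]])

lemma Gamma_l_comonadic:
  assumes "l_comonadic U A B M N \<eta> \<epsilon>"
  shows "monoid_iso (I_l U A B M N \<eta> \<epsilon>) (coring_endo A B M N \<eta> \<epsilon>) (Gamma_l U A B M N \<epsilon>)"
proof (rule Gamma_l_iso[OF inf AU op.comonadic_reconstructs[OF inf _ _ l_comonadic_opp[OF assms]]])
qed (use AU NU in simp_all)

lemma Gamma_separable:
  assumes pi: "\<pi> \<in> bimod_hom A A S (regular A)" and eta: "\<And>a. a \<in> carrier A \<Longrightarrow> \<pi> (\<eta> a) = a"
  shows "monoid_iso (op_monoid (I_r U A B M N \<eta> \<epsilon>)) (coring_endo A B M N \<eta> \<epsilon>) (Gamma_r U A B M N \<epsilon>)"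
    "monoid_iso (I_l U A B M N \<eta> \<epsilon>) (coring_endo A B M N \<eta> \<epsilon>) (Gamma_l U A B M N \<epsilon>)"
    "J \<in> carrier (I_r U A B M N \<eta> \<epsilon>) \<union> carrier (I_l U A B M N \<eta> \<epsilon>) \<Longrightarrow> firm_bimodule A A (S\<lparr>carrier := J\<rparr>)"
proof -
  have rec: "reconstructs U" by (rule separable_reconstructs[OF pi eta inf MU NU])
  show "monoid_iso (op_monoid (I_r U A B M N \<eta> \<epsilon>)) (coring_endo A B M N \<eta> \<epsilon>) (Gamma_r U A B M N \<epsilon>)"
    by (rule Gamma_r_iso[OF inf AU rec])
  let ?w = "hom_inv S S' (swap B M N)"
  define pi' where "pi' = (\<lambda>s\<in>carrier (opp_mod S'). \<pi> (?w s))"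
  have "?w \<in> bimod_hom A A (opp_mod S') S"
    using hom_inv_bimod_hom[OF swapS_rules(4)] swapS_rules(3) by simp
  then have "pi' \<in> bimod_hom A A (opp_mod S') (regular A)"
    unfolding pi'_def by (rule bimod_hom_comp[OF _ pi]) (use bimodule_opp[of A A "opp_mod S'"] S'_rules(3) in simp)
  then have op_pi: "pi' \<in> bimod_hom Ao Ao S' (regular Ao)"
    using bimod_hom_opp[of A A "opp_mod S'" "regular A"] by simp
  have op_eta: "pi' (eta_op a) = a" if "a \<in> carrier Ao" for a
    using that eta swapS_rules(2)[of "\<eta> a"] hom_inv_left[OF swapS_rules(3), of "\<eta> a"] by (simp add: pi'_def eta_op_def)
  have op_rec: "op.reconstructs U"
    by (rule op.separable_reconstructs[OF op_pi op_eta inf]) (use MU NU in simp_all)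
  show "monoid_iso (I_l U A B M N \<eta> \<epsilon>) (coring_endo A B M N \<eta> \<epsilon>) (Gamma_l U A B M N \<epsilon>)"
    by (rule Gamma_l_iso[OF inf AU op_rec])
  assume "J \<in> carrier (I_r U A B M N \<eta> \<epsilon>) \<union> carrier (I_l U A B M N \<eta> \<epsilon>)"
  then show "firm_bimodule A A (S\<lparr>carrier := J\<rparr>)"
  proof
    assume "J \<in> carrier (I_r U A B M N \<eta> \<epsilon>)"
    then obtain I :: "('a, 'a, 'u) bimod" and i where "inv_pair I i" "i ` carrier I = J"
      unfolding Ir_iff[OF inf AU rec] by (elim exE conjE)
    then show ?thesis using inv_pair_image_firm[OF pi eta, of I i] by simp
  next
    assume "J \<in> carrier (I_l U A B M N \<eta> \<epsilon>)"
    then obtain I :: "('a, 'a, 'u) bimod" and i where l: "l_inv_sub U A SR J I i"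
      unfolding Il_l_inv_sub by (elim exE)
    note I = l_inv_subD[OF l]
    have op_inj: "inj_on (opi I i) (carrier (opp_mod I))"
      by (rule op.inv_pair_inj[OF op_pi op_eta l_inv_sub_inv_pair[OF l]])
    have "inj_on i (carrier I)"
    proof (rule inj_onI)
      fix x y assume "x \<in> carrier I" "y \<in> carrier I" "i x = i y"
      then show "x = y"
        by (intro inj_onD[OF op_inj]) (simp_all only: opp_mod_simps(1) restrict_apply')
    qed
    then have bij: "bij_betw i (carrier I) (carrier (S\<lparr>carrier := J\<rparr>))"
      using I(4) by (simp add: bij_betw_def)
    have bim: "bimodule A A (S\<lparr>carrier := J\<rparr>)"
      using image_bimodule[OF firm_bimoduleD(1)[OF I(1)] _ I(2)] by (simp add: I(4))
    show ?thesis
      by (rule firm_bimodule_iso[OF I(1) bim _ _ bimod_hom_image[OF I(2), unfolded I(4)] bij]) simp_all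
  qed
qed

end

end

theorem theorem4p15:
  fixes A :: "'a ring" and B :: "'b ring" and M :: "('a, 'b, 'm) bimod" and U :: "'u set"
  assumes "firm_ring A" and "firm_ring B" and "firm_bimodule A B M"
    and "\<exists>(N :: ('b, 'a, 'n) bimod) \<eta> \<epsilon>. right_adjoint A B M N \<eta> \<epsilon>"
    and "infinite U" and "carrier A \<lesssim> U" and "carrier B \<lesssim> U" and "carrier M \<lesssim> U"
    and "carrier (dagger A B M) \<lesssim> U"
  shows "(\<exists>\<eta> \<epsilon>. right_adjoint A B M (dagger A B M) \<eta> \<epsilon>)
    \<and> (\<forall>\<eta> \<epsilon>. right_adjoint A B M (dagger A B M) \<eta> \<epsilon> \<longrightarrow>
         (let N = dagger A B M;
              Ir = I_r U A B M N \<eta> \<epsilon>;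
              Il = I_l U A B M N \<eta> \<epsilon>;
              E = coring_endo A B M N \<eta> \<epsilon>
          in (r_comonadic U A B M N \<eta> \<epsilon> \<longrightarrow>
                monoid_iso (op_monoid Ir) E (Gamma_r U A B M N \<epsilon>))
           \<and> (l_comonadic U A B M N \<eta> \<epsilon> \<longrightarrow>
                monoid_iso Il E (Gamma_l U A B M N \<epsilon>))
           \<and> (separable A B M N \<eta> \<longrightarrow>
                monoid_iso (op_monoid Ir) E (Gamma_r U A B M N \<epsilon>)
              \<and> monoid_iso Il E (Gamma_l U A B M N \<epsilon>)
              \<and> (\<forall>J \<in> carrier Ir \<union> carrier Il.
                   firm_bimodule A A ((tensor B M N)\<lparr>carrier := J\<rparr>)))))"
  unfolding Let_def
proof (intro conjI allI impI)
  obtain N :: "('b, 'a, 'n) bimod" and \<eta> \<epsilon> where adj: "right_adjoint A B M N \<eta> \<epsilon>"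
    using assms(4) by (elim exE)
  have "firm_adjunction A B M N \<eta> \<epsilon>" using assms(1-3) adj by (rule firm_adjunction.intro)
  then show "\<exists>\<eta> \<epsilon>. right_adjoint A B M (dagger A B M) \<eta> \<epsilon>"
    by (rule firm_adjunction.dagger_right_adjoint)
next
  fix \<eta> \<epsilon> assume adj: "right_adjoint A B M (dagger A B M) \<eta> \<epsilon>"
  interpret firm_adjunction A B M "dagger A B M" \<eta> \<epsilon> using assms(1-3) adj by (rule firm_adjunction.intro)
  note U = assms(5,6,8,9)
  show "monoid_iso (op_monoid (I_r U A B M (dagger A B M) \<eta> \<epsilon>)) (coring_endo A B M (dagger A B M) \<eta> \<epsilon>)
      (Gamma_r U A B M (dagger A B M) \<epsilon>)" if "r_comonadic U A B M (dagger A B M) \<eta> \<epsilon>"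
    by (rule Gamma_r_comonadic[OF U that])
  show "monoid_iso (I_l U A B M (dagger A B M) \<eta> \<epsilon>) (coring_endo A B M (dagger A B M) \<eta> \<epsilon>)
      (Gamma_l U A B M (dagger A B M) \<epsilon>)" if "l_comonadic U A B M (dagger A B M) \<eta> \<epsilon>"
    by (rule Gamma_l_comonadic[OF U that])
  assume "separable A B M (dagger A B M) \<eta>"
  then obtain \<pi> where pi: "\<pi> \<in> bimod_hom A A S (regular A)" "\<forall>a\<in>carrier A. \<pi> (\<eta> a) = a"
    unfolding separable_def by (elim bexE)
  note sep = Gamma_separable[OF U pi(1) bspec[OF pi(2)]]
  show "monoid_iso (op_monoid (I_r U A B M (dagger A B M) \<eta> \<epsilon>)) (coring_endo A B M (dagger A B M) \<eta> \<epsilon>)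
      (Gamma_r U A B M (dagger A B M) \<epsilon>)"
    by (rule sep(1))
  show "monoid_iso (I_l U A B M (dagger A B M) \<eta> \<epsilon>) (coring_endo A B M (dagger A B M) \<eta> \<epsilon>)
      (Gamma_l U A B M (dagger A B M) \<epsilon>)"
    by (rule sep(2))
  show "\<forall>J\<in>carrier (I_r U A B M (dagger A B M) \<eta> \<epsilon>) \<union> carrier (I_l U A B M (dagger A B M) \<eta> \<epsilon>).
      firm_bimodule A A (S\<lparr>carrier := J\<rparr>)"
    using sep(3) by (rule ballI)
qed

end
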